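(* Let $0<r<1/2$, $s=\frac{2r}{1-2r}$, $k_n=[n^{(1-2r)/2}]$, $\phi_j(t)=\sqrt2\cos(\pi jt)$, and consider Cramer–von Mises tests as described in the context. Let $f_n=\sum_{j=1}^\infty\theta_{nj}\phi_j$ be a sequence of alternatives ($1+f_n$ densities) with $cn^{-r}\le\|f_n\|\le Cn^{-r}$, $0<c<C<\infty$, satisfying condition G1: for any $\varepsilon>0$ there are $c_\varepsilon>0$ and $n_0(\varepsilon,c_\varepsilon)$ such that $n\sum_{j<c_\varepsilon k_n}\theta_{nj}^2j^{-2}<\varepsilon$ for all $n>n_0(\varepsilon,c_\varepsilon)$. Then: (a) $f_n$ is consistent if and only if there are $c_1>0,c_2>0,n_0$ such that $\sum_{j<c_2k_n}\theta_{nj}^2>c_1n^{-2r}$ for all $n>n_0$. (b) $f_n$ is inconsistent if and only if for any $c_2>0$ one has $\sum_{j<c_2k_n}\theta_{nj}^2=o(n^{-2r})$ as $n\to\infty$. (c) $f_n$ is consistent if and only if there are $P_0>0$, $0<c_1<C_1$ and $f_{1n}\in\bar{\mathbb{B}}^s_{2\infty}(P_0)$ with $c_1n^{-r}\le\|f_{1n}\|\le C_1n^{-r}$ such that $\|f_n\|^2=\|f_{1n}\|^2+\|f_n-f_{1n}\|^2$. Therefore, if $f_n=f_{1n}+f_{2n}$ with $f_{1n}\in\bar{\mathbb{B}}^s_{2\infty}(P_0)$, $f_{2n}$ orthogonal to $f_{1n}$ and $c_1n^{-r}\le\|f_{1n}\|,\|f_{2n}\|\le C_1n^{-r}$, then $f_n$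 is consistent. (d) If $f_n$ is consistent and satisfies condition B, then for any $\varepsilon>0$ there are $P_0>0$, $0<c_1<C_1$ and $f_{1n}\in\bar{\mathbb{B}}^s_{2\infty}(P_0)$ with $c_1n^{-r}\le\|f_{1n}\|\le C_1n^{-r}$ such that $f_{1n}$ is orthogonal to $f_n-f_{1n}$ and, for any $\alpha\in(0,1)$, for Cramer–von Mises tests $K_n$ with $\alpha(K_n)=\alpha(1+o(1))$, there is $n_\varepsilon$ such that $|\beta(K_n,f_n)-\beta(K_n,f_{1n})|\le\varepsilon$ and $\beta(K_n,f_n-f_{1n})\ge1-\alpha-\varepsilon$ for all $n>n_\varepsilon$. If moreover $f_n$ satisfies condition B: (e) $f_n$ is purely $n^{-r}$-consistent if and only if for any $\varepsilon>0$ there are $C_1(\varepsilon)$ and $n_0(\varepsilon)$ such that $\sum_{j>C_1(\varepsilon)k_n}\theta_{nj}^2\le\varepsilon n^{-2r}$ for all $n>n_0(\varepsilon)$. (f) $f_n$ is purely $n^{-r}$-consistent if and only if for any inconsistent subsequence of alternatives $f_{1n_i}$ with $cn_i^{-r}<\|f_{1n_i}\|<Cn_i^{-r}$, $n_i\to\infty$, one has $\|f_{n_i}+f_{1n_i}\|^2=\|f_{n_i}\|^2+\|f_{1n_i}\|^2+o(n_i^{-2r})$.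
   Context: Setting. $X_1,\ldots,X_n$ are i.i.d. on $(0,1)$ with c.d.f. $F$ having density $1+f$, $f\in L_2(0,1)$. The hypothesis is $f=0$, i.e. $F=F_0$, $F_0(x)=x$; an alternative is a sequence $f_n$ such that $1+f_n$ is a density. With $\hat F_n$ the empirical c.d.f., the Cramer–von Mises statistic is $T^2(\hat F_n-F_0)=\int_0^1(\hat F_n(x)-F_0(x))^2\,dF_0(x)$; tests $K_n$ generated by it reject the hypothesis when it exceeds a threshold. $\alpha(K_n)$, $\beta(K_n,f)$ are the type I error probability and the type II error probability at $f$; $\|\cdot\|$ is the $L_2(0,1)$ norm; $[\cdot]$ is the integer part. For $P_0>0$, $\bar{\mathbb{B}}^s_{2\infty}(P_0)=\{f=\sum_{j=1}^\infty\theta_j\phi_j:\ \theta_j\in\mathbb{R},\ \sup_{\lambda>0}\lambda^{2s}\sum_{j>\lambda}\theta_j^2\le P_0\}$. A sequence $f_n$ is consistent if for any $\alpha\in(0,1)$, for Cramer–von Mises tests $K_n$ with $\alpha(K_n)=\alpha(1+o(1))$, one has $\limsup_n\beta(K_n,f_n)<1-\alpha$. It is inconsistent if $\liminf_n(\alpha(K_n)+\beta(K_n,f_n))\ge1$ for each sequence of Cramer–von Mises tests $K_n$. For alternatives given only along $n_i\to\infty$ the limits are taken along $n_i$. Condition B: there is $c_0$ such that, for all $c>c_0$, the functions $1+\sum_{j>ck_n}\theta_{nj}\phi_j$ and $1+\sum_{j<ck_n}\theta_{nj}\phi_j$ are densities. A consistent sequence $f_n$ with $cn^{-r}\le\|f_n\|\le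 Cn^{-r}$ satisfying B is purely $n^{-r}$-consistent if there is no subsequence $f_{n_i}=f_{1n_i}+f_{2n_i}$ with $f_{2n_i}$ orthogonal to $f_{1n_i}$, $\|f_{2n_i}\|>c_1n_i^{-r}$ for some $c_1>0$, and $f_{2n_i}$ an inconsistent sequence of alternatives. *)

theory Defs
  imports "HOL-Probability.Probability" "HOL-Library.Landau_Symbols"
begin

text \<open>Elements of $L_2(0,1)$ are represented by functions \<open>real \<Rightarrow> real\<close>, of which only the
  values on $(0,1)$ matter, and these only up to null sets.\<close>

definition L2 :: "(real \<Rightarrow> real) set" where
  "L2 = {f. set_borel_measurable lborel {0<..<1} f \<and>
            set_integrable lborel {0<..<1} (\<lambda>x. (f x)\<^sup>2)}"

definition l2inner :: "(real \<Rightarrow> real) \<Rightarrow> (real \<Rightarrow> real) \<Rightarrow> real" where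
  "l2inner f g = (LINT x:{0<..<1}|lborel. f x * g x)"

definition l2norm :: "(real \<Rightarrow> real) \<Rightarrow> real" where
  "l2norm f = sqrt (l2inner f f)"

definition l2eq :: "(real \<Rightarrow> real) \<Rightarrow> (real \<Rightarrow> real) \<Rightarrow> bool" where
  "l2eq f g \<longleftrightarrow> (AE x in lborel. x \<in> {0<..<1} \<longrightarrow> f x = g x)"

definition \<phi> :: "nat \<Rightarrow> real \<Rightarrow> real" where
  "\<phi> j t = sqrt 2 * cos (pi * real j * t)"

text \<open>\<open>cos_expansion \<theta> f\<close> says $f = \sum_{j \ge 1} \theta_j \phi_j$, the series converging in
  $L_2(0,1)$; the value \<open>\<theta> 0\<close> is never used. As the system is orthonormal, it entails
  $\sum_{j\ge 1} \theta_j^2 < \infty$.\<close>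

definition cos_expansion :: "(nat \<Rightarrow> real) \<Rightarrow> (real \<Rightarrow> real) \<Rightarrow> bool" where
  "cos_expansion \<theta> f \<longleftrightarrow> f \<in> L2 \<and>
     (\<lambda>N. l2norm (\<lambda>x. f x - (\<Sum>j=1..N. \<theta> j * \<phi> j x))) \<longlonglongrightarrow> 0"

definition besov_ball :: "real \<Rightarrow> real \<Rightarrow> (real \<Rightarrow> real) set" where
  "besov_ball s P0 = {f. \<exists>\<theta>. cos_expansion \<theta> f \<and>
     (\<forall>l>0. l powr (2 * s) * (\<Sum>\<^sub>\<infinity>j\<in>{j. real j > l}. (\<theta> j)\<^sup>2) \<le> P0)}"

definition alternative :: "(real \<Rightarrow> real) \<Rightarrow> bool" where
  "alternative f \<longleftrightarrow> f \<in> L2 \<and>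
     (AE x in lborel. x \<in> {0<..<1} \<longrightarrow> 0 \<le> 1 + f x) \<and>
     (LINT x:{0<..<1}|lborel. 1 + f x) = 1"

definition law :: "(real \<Rightarrow> real) \<Rightarrow> real measure" where
  "law f = density lborel (\<lambda>x. ennreal (indicator {0<..<1} x * (1 + f x)))"

definition sample_law :: "nat \<Rightarrow> (real \<Rightarrow> real) \<Rightarrow> (nat \<Rightarrow> real) measure" where
  "sample_law n f = PiM {..<n} (\<lambda>_. law f)"

definition ecdf :: "nat \<Rightarrow> (nat \<Rightarrow> real) \<Rightarrow> real \<Rightarrow> real" where
  "ecdf n X x = real (card {i\<in>{..<n}. X i \<le> x}) / real n"

text \<open>$T^2(\hat F_n - F_0)$; here $F_0(x) = x$, so $dF_0(x) = dx$ on $(0,1)$.\<close>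

definition cvm_stat :: "nat \<Rightarrow> (nat \<Rightarrow> real) \<Rightarrow> real" where
  "cvm_stat n X = (LINT x:{0<..<1}|lborel. (ecdf n X x - x)\<^sup>2)"

text \<open>A test is the predicate ``reject the hypothesis''.\<close>

definition cvm_test :: "nat \<Rightarrow> real \<Rightarrow> (nat \<Rightarrow> real) \<Rightarrow> bool" where
  "cvm_test n t X \<longleftrightarrow> cvm_stat n X > t"

definition type_I :: "nat \<Rightarrow> ((nat \<Rightarrow> real) \<Rightarrow> bool) \<Rightarrow> real" where
  "type_I n K = measure (sample_law n (\<lambda>_. 0)) {X \<in> space (sample_law n (\<lambda>_. 0)). K X}"

definition type_II :: "nat \<Rightarrow> ((nat \<Rightarrow> real) \<Rightarrow> bool) \<Rightarrow> (real \<Rightarrow> real) \<Rightarrow> real" where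
  "type_II n K f = measure (sample_law n f) {X \<in> space (sample_law n f). \<not> K X}"

text \<open>In the next two definitions \<open>f i\<close> is the alternative for sample size \<open>\<nu> i\<close>; a full sequence
  of alternatives is the case \<open>\<nu> = (\<lambda>n. n)\<close>. A sequence of tests is given by its sequence \<open>t\<close> of
  thresholds.\<close>

definition cvm_consistent :: "(nat \<Rightarrow> nat) \<Rightarrow> (nat \<Rightarrow> real \<Rightarrow> real) \<Rightarrow> bool" where
  "cvm_consistent \<nu> f \<longleftrightarrow> (\<forall>\<alpha>\<in>{0<..<1}. \<forall>t::nat \<Rightarrow> real.
     (\<lambda>i. type_I (\<nu> i) (cvm_test (\<nu> i) (t i))) \<longlonglongrightarrow> \<alpha> \<longrightarrow>
     limsup (\<lambda>i. ereal (type_II (\<nu> i) (cvm_test (\<nu> i) (t i)) (f i))) < ereal (1 - \<alpha>))"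

definition cvm_inconsistent :: "(nat \<Rightarrow> nat) \<Rightarrow> (nat \<Rightarrow> real \<Rightarrow> real) \<Rightarrow> bool" where
  "cvm_inconsistent \<nu> f \<longleftrightarrow> (\<forall>t::nat \<Rightarrow> real.
     liminf (\<lambda>i. ereal (type_I (\<nu> i) (cvm_test (\<nu> i) (t i)) +
                        type_II (\<nu> i) (cvm_test (\<nu> i) (t i)) (f i))) \<ge> 1)"

text \<open>Sample sizes are positive, so index sequences avoid 0.\<close>

definition sample_sizes :: "(nat \<Rightarrow> nat) \<Rightarrow> bool" where
  "sample_sizes \<nu> \<longleftrightarrow> strict_mono \<nu> \<and> (\<forall>i. \<nu> i \<ge> 1)"

definition kn :: "real \<Rightarrow> nat \<Rightarrow> nat" where
  "kn r n = nat \<lfloor>real n powr ((1 - 2 * r) / 2)\<rfloor>"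

definition condition_G1 :: "real \<Rightarrow> (nat \<Rightarrow> nat \<Rightarrow> real) \<Rightarrow> bool" where
  "condition_G1 r \<theta> \<longleftrightarrow> (\<forall>\<epsilon>>0. \<exists>c>0. \<exists>n0. \<forall>n>n0.
     real n * (\<Sum>j | 1 \<le> j \<and> real j < c * real (kn r n). (\<theta> n j)\<^sup>2 / (real j)\<^sup>2) < \<epsilon>)"

definition series_density :: "(nat \<Rightarrow> real) \<Rightarrow> bool" where
  "series_density \<theta> \<longleftrightarrow> (\<exists>g. cos_expansion \<theta> g \<and> alternative g)"

definition condition_B :: "real \<Rightarrow> (nat \<Rightarrow> nat \<Rightarrow> real) \<Rightarrow> bool" where
  "condition_B r \<theta> \<longleftrightarrow> (\<exists>c0. \<forall>c>c0. \<forall>n\<ge>1.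
     series_density (\<lambda>j. if real j > c * real (kn r n) then \<theta> n j else 0) \<and>
     series_density (\<lambda>j. if real j < c * real (kn r n) then \<theta> n j else 0))"

text \<open>For a sequence \<open>f n\<close> with \<open>cos_expansion (\<theta> n) (f n)\<close>; the coefficients enter only through
  condition B.\<close>

definition purely_consistent :: "real \<Rightarrow> (nat \<Rightarrow> nat \<Rightarrow> real) \<Rightarrow> (nat \<Rightarrow> real \<Rightarrow> real) \<Rightarrow> bool" where
  "purely_consistent r \<theta> f \<longleftrightarrow>
     cvm_consistent (\<lambda>n. n) f \<and>
     (\<exists>c C. 0 < c \<and> c < C \<and> (\<forall>n\<ge>1. c * real n powr (-r) \<le> l2norm (f n) \<and>
                                     l2norm (f n) \<le> C * real n powr (-r))) \<and>
     condition_B r \<theta> \<and>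
     \<not> (\<exists>\<nu> f1 f2. sample_sizes \<nu> \<and>
          (\<forall>i. f1 i \<in> L2 \<and> alternative (f2 i) \<and>
               l2eq (f (\<nu> i)) (\<lambda>x. f1 i x + f2 i x) \<and> l2inner (f2 i) (f1 i) = 0) \<and>
          (\<exists>c1>0. \<forall>i. l2norm (f2 i) > c1 * real (\<nu> i) powr (-r)) \<and>
          cvm_inconsistent \<nu> f2)"

end

theory Submission
  imports Defs
begin

text \<open>Let \<open>F\<close> be the distribution function of an alternative \<open>f\<close>. The empirical process of the sample is a
uniform empirical process, and it is shifted by \<open>h = sqrt n * (F - F_0)\<close>; so \<open>n\<close> times the Cramer--von
Mises statistic is about the squared norm of \<open>Y + h\<close>, where \<open>Y\<close> is the uniform empirical process. The
squared norm of \<open>h\<close> is called the drift. Since integration divides the \<open>j\<close>-th cosine coefficient by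
\<open>pi * j\<close>, the drift is \<open>n * (\<Sum>j. \<theta>\<^sub>j\<^sup>2 / (pi * j)\<^sup>2)\<close>.

By condition G1 the frequencies below a small multiple of \<open>k n\<close> contribute little to the drift. The
norm of \<open>h\<close> stays bounded while each fixed coefficient of \<open>h\<close> tends to 0, so \<open>h\<close> tends to 0 weakly and the cross term
between \<open>Y\<close> and \<open>h\<close> disappears: the statistic is its null version plus the deterministic drift
(\<open>stat_approx\<close>). The null version has a limit law with a continuous distribution function that
strictly increases where it is positive (\<open>null_cdf_tendsto\<close>, \<open>limit_cdf_isCont\<close>, \<open>limit_cdf_strict\<close>).
Hence the type II error at threshold \<open>t\<close> is asymptotically the limit distribution function at
\<open>n * t\<close> minus the drift (\<open>type_II_asymptotic\<close>), and the sequence is consistent iff the drift stays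
away from 0 (\<open>consistent_iff_drift\<close>).

That a vanishing drift implies inconsistency is a special case. The converse is needed for arbitrary
inconsistent alternatives, for which \<open>h\<close> need not tend to 0 weakly. Here the mean of the statistic
decides: it exceeds the null mean 1/6 by about the drift, and fourth moments turn the difference of
means into a difference of rejection probabilities at some threshold (\<open>detection\<close>).

What remains concerns coefficients only. As \<open>n * n powr (-2 * r) / (k n)\<^sup>2\<close> is bounded from above and
below, frequencies beyond a large multiple of \<open>k n\<close> contribute little to the drift, those below a
small multiple are excluded by G1, and on the frequencies between them the drift is comparable to
the energy \<open>\<Sum>j. \<theta>\<^sub>j\<^sup>2\<close> divided by \<open>n powr (-2 * r)\<close> (\<open>drift_split\<close>, \<open>low_le_drift\<close>). This yields
(a) and (b). For (c) and (d) the smooth component is the truncation of \<open>f\<close> at a multiple of \<open>k n\<close>.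
For (e) and (f), a tail of high frequencies that carries a fixed share of the energy is itself an
inconsistent alternative, correlated with \<open>f\<close>; and if no such tail exists, \<open>f\<close> is asymptotically
orthogonal to every inconsistent sequence (\<open>tight_cross_term\<close>).\<close>

section \<open>Square-integrable functions on the unit interval\<close>

lemma integrable_mult_of_squares:
  fixes f g :: "'a \<Rightarrow> real"
  assumes [measurable]: "f \<in> borel_measurable M" "g \<in> borel_measurable M"
    and "integrable M (\<lambda>x. (f x)\<^sup>2)" "integrable M (\<lambda>x. (g x)\<^sup>2)"
  shows "integrable M (\<lambda>x. f x * g x)"
proof (rule Bochner_Integration.integrable_bound)
  show "integrable M (\<lambda>x. (f x)\<^sup>2 + (g x)\<^sup>2)"
    using assms by simp
  show "AE x in M. norm (f x * g x) \<le> norm ((f x)\<^sup>2 + (g x)\<^sup>2)"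
  proof (rule AE_I2)
    fix x
    have "0 \<le> (\<bar>f x\<bar> - \<bar>g x\<bar>)\<^sup>2" by simp
    then have "2 * \<bar>f x * g x\<bar> \<le> (f x)\<^sup>2 + (g x)\<^sup>2"
      by (simp add: power2_diff abs_mult)
    then show "norm (f x * g x) \<le> norm ((f x)\<^sup>2 + (g x)\<^sup>2)" by simp
  qed
qed simp

lemma integrable_add_of_squares:
  fixes f g :: "'a \<Rightarrow> real"
  assumes "f \<in> borel_measurable M" "g \<in> borel_measurable M"
    and "integrable M (\<lambda>x. (f x)\<^sup>2)" "integrable M (\<lambda>x. (g x)\<^sup>2)"
  shows "integrable M (\<lambda>x. (f x + g x)\<^sup>2)"
  using integrable_mult_of_squares[OF assms] assms(3,4)
  by (simp add: power2_sum mult.assoc)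

lemma integral_Cauchy_Schwarz:
  fixes f g :: "'a \<Rightarrow> real"
  assumes "f \<in> borel_measurable M" "g \<in> borel_measurable M"
    and f: "integrable M (\<lambda>x. (f x)\<^sup>2)" and g: "integrable M (\<lambda>x. (g x)\<^sup>2)"
  shows "(LINT x|M. f x * g x)\<^sup>2 \<le> (LINT x|M. (f x)\<^sup>2) * (LINT x|M. (g x)\<^sup>2)"
proof -
  note fg = integrable_mult_of_squares[OF assms]
  define A B D where "A = (LINT x|M. (f x)\<^sup>2)" and "B = (LINT x|M. f x * g x)" and "D = (LINT x|M. (g x)\<^sup>2)"
  have quad: "0 \<le> A * s\<^sup>2 + 2 * B * (s * t) + D * t\<^sup>2" for s t
  proof -
    have "0 \<le> (LINT x|M. (s * f x + t * g x)\<^sup>2)" by simp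
    also have "\<dots> = (LINT x|M. s\<^sup>2 * (f x)\<^sup>2 + 2 * (s * t) * (f x * g x) + t\<^sup>2 * (g x)\<^sup>2)"
      by (intro Bochner_Integration.integral_cong) (auto simp: power2_eq_square algebra_simps)
    also have "\<dots> = s\<^sup>2 * A + 2 * (s * t) * B + t\<^sup>2 * D"
      unfolding A_def B_def D_def using f g fg by simp
    finally show ?thesis by (simp add: algebra_simps)
  qed
  have A0: "A \<ge> 0" and D0: "D \<ge> 0" by (auto simp: A_def D_def)
  show ?thesis
  proof (cases "D = 0")
    case False
    from quad[of D "- B"] have "0 \<le> D * (A * D - B\<^sup>2)"
      by (simp add: power2_eq_square algebra_simps)
    then have "B\<^sup>2 \<le> A * D" using False D0 by (simp add: zero_le_mult_iff)
    then show ?thesis by (simp add: A_def B_def D_def)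
  next
    case True
    have "B = 0"
    proof (rule ccontr)
      assume "B \<noteq> 0"
      from quad[of 1 "- (A + 1) / (2 * B)"] True \<open>B \<noteq> 0\<close> have "0 \<le> A - (A + 1)"
        by (simp add: field_simps)
      then show False by simp
    qed
    then show ?thesis using True by (simp add: A_def B_def D_def)
  qed
qed

lemma (in prob_space) integrable_of_square:
  fixes f :: "'a \<Rightarrow> real"
  assumes "f \<in> borel_measurable M" "integrable M (\<lambda>x. (f x)\<^sup>2)"
  shows "integrable M f"
  using integrable_mult_of_squares[OF assms(1) _ assms(2), of "\<lambda>_. 1"] by simp

lemma (in prob_space) square_integral_le:
  fixes f :: "'a \<Rightarrow> real"
  assumes "f \<in> borel_measurable M" "integrable M (\<lambda>x. (f x)\<^sup>2)"
  shows "(LINT x|M. \<bar>f x\<bar>)\<^sup>2 \<le> (LINT x|M. (f x)\<^sup>2)"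
  using integral_Cauchy_Schwarz[of "\<lambda>x. \<bar>f x\<bar>" M "\<lambda>_. 1"] assms by (simp add: prob_space)

text \<open>The uniform distribution. It lives on the open interval, as quantile functions are well behaved
  only there.\<close>

definition U01 :: "real measure" where
  "U01 = restrict_space lborel {0<..<1}"

lemma space_U01 [simp]: "space U01 = {0<..<1}"
  by (simp add: U01_def space_restrict_space)

lemma prob_space_U01: "prob_space U01"
  by (auto simp: U01_def emeasure_restrict_space space_restrict_space intro!: prob_spaceI)

interpretation U01: prob_space U01 by (rule prob_space_U01)

lemma measurable_U01_ident [measurable]: "(\<lambda>x. x) \<in> borel_measurable U01"
  by (simp add: U01_def measurable_restrict_space1)

lemma measurable_U01I: "f \<in> measurable borel N \<Longrightarrow> f \<in> measurable U01 N"
  by (simp add: U01_def measurable_restrict_space1)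

lemma AE_U01_iff: "(AE x in U01. P x) \<longleftrightarrow> (AE x in lborel. x \<in> {0<..<1} \<longrightarrow> P x)"
  unfolding U01_def by (subst AE_restrict_space_iff) auto

lemma set_integral_U01: "(LINT x:{0<..<1}|lborel. f x) = (LINT x|U01. (f x::real))"
  by (simp add: U01_def set_lebesgue_integral_def integral_restrict_space)

lemma L2_iff: "f \<in> L2 \<longleftrightarrow> f \<in> borel_measurable U01 \<and> integrable U01 (\<lambda>x. (f x)\<^sup>2)"
  by (simp add: L2_def U01_def set_borel_measurable_def set_integrable_def
      borel_measurable_restrict_space_iff integrable_restrict_space mult.commute)

lemma L2_measurable [measurable_dest]: "f \<in> L2 \<Longrightarrow> f \<in> borel_measurable U01"
  and L2_square_integrable: "f \<in> L2 \<Longrightarrow> integrable U01 (\<lambda>x. (f x)\<^sup>2)"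
  by (auto simp: L2_iff)

lemma L2_mult_integrable: "f \<in> L2 \<Longrightarrow> g \<in> L2 \<Longrightarrow> integrable U01 (\<lambda>x. f x * g x)"
  by (auto simp: L2_iff intro: integrable_mult_of_squares)

lemma L2_integrable: "f \<in> L2 \<Longrightarrow> integrable U01 f"
  by (auto simp: L2_iff intro: U01.integrable_of_square)

lemma L2_bounded:
  assumes "f \<in> borel_measurable U01" "\<And>x. x \<in> {0<..<1} \<Longrightarrow> \<bar>f x\<bar> \<le> B"
  shows "f \<in> L2"
proof -
  have "integrable U01 (\<lambda>x. (f x)\<^sup>2)"
  proof (rule U01.integrable_const_bound[where B="B\<^sup>2"])
    show "AE x in U01. norm ((f x)\<^sup>2) \<le> B\<^sup>2"
      using assms(2) by (intro AE_I2) (auto intro!: abs_le_square_iff[THEN iffD1] order_trans[OF _ abs_ge_self])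
  qed (use assms(1) in measurable)
  with assms show ?thesis by (simp add: L2_iff)
qed

lemma L2_const [simp]: "(\<lambda>_. a) \<in> L2"
  by (rule L2_bounded[of _ "\<bar>a\<bar>"]) auto

lemma L2_add: "f \<in> L2 \<Longrightarrow> g \<in> L2 \<Longrightarrow> (\<lambda>x. f x + g x) \<in> L2"
  by (auto simp: L2_iff intro: integrable_add_of_squares)

lemma L2_scale: "f \<in> L2 \<Longrightarrow> (\<lambda>x. a * f x) \<in> L2"
  by (auto simp: L2_iff power_mult_distrib)

lemma L2_diff: "f \<in> L2 \<Longrightarrow> g \<in> L2 \<Longrightarrow> (\<lambda>x. f x - g x) \<in> L2"
  using L2_add[of f "\<lambda>x. (-1) * g x"] L2_scale[of g "-1"] by simp

lemma L2_sum: "(\<And>i. i \<in> A \<Longrightarrow> f i \<in> L2) \<Longrightarrow> (\<lambda>x. \<Sum>i\<in>A. f i x) \<in> L2"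
  by (induction A rule: infinite_finite_induct) (auto intro: L2_add)

lemma l2inner_eq: "l2inner f g = (LINT x|U01. f x * g x)"
  by (simp add: l2inner_def set_integral_U01)

lemma l2inner_commute: "l2inner f g = l2inner g f"
  by (simp add: l2inner_eq mult.commute)

lemma l2inner_add_left: "f \<in> L2 \<Longrightarrow> g \<in> L2 \<Longrightarrow> h \<in> L2 \<Longrightarrow>
    l2inner (\<lambda>x. f x + g x) h = l2inner f h + l2inner g h"
  by (simp add: l2inner_eq distrib_right L2_mult_integrable)

lemma l2inner_diff_left: "f \<in> L2 \<Longrightarrow> g \<in> L2 \<Longrightarrow> h \<in> L2 \<Longrightarrow>
    l2inner (\<lambda>x. f x - g x) h = l2inner f h - l2inner g h"
  by (simp add: l2inner_eq left_diff_distrib L2_mult_integrable)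

lemma l2inner_scale_left: "l2inner (\<lambda>x. a * f x) h = a * l2inner f h"
  by (simp add: l2inner_eq mult.assoc)

lemma l2inner_sum_left: "(\<And>i. i \<in> A \<Longrightarrow> f i \<in> L2) \<Longrightarrow> h \<in> L2 \<Longrightarrow>
    l2inner (\<lambda>x. \<Sum>i\<in>A. f i x) h = (\<Sum>i\<in>A. l2inner (f i) h)"
  by (simp add: l2inner_eq sum_distrib_right L2_mult_integrable)

lemma l2inner_add_right: "f \<in> L2 \<Longrightarrow> g \<in> L2 \<Longrightarrow> h \<in> L2 \<Longrightarrow>
    l2inner h (\<lambda>x. f x + g x) = l2inner h f + l2inner h g"
  by (simp add: l2inner_commute[of h] l2inner_add_left)

lemma l2inner_diff_right: "f \<in> L2 \<Longrightarrow> g \<in> L2 \<Longrightarrow> h \<in> L2 \<Longrightarrow>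
    l2inner h (\<lambda>x. f x - g x) = l2inner h f - l2inner h g"
  by (simp add: l2inner_commute[of h] l2inner_diff_left)

lemma l2inner_scale_right: "l2inner h (\<lambda>x. a * f x) = a * l2inner h f"
  by (simp add: l2inner_commute[of h] l2inner_scale_left)

lemma l2inner_sum_right: "(\<And>i. i \<in> A \<Longrightarrow> f i \<in> L2) \<Longrightarrow> h \<in> L2 \<Longrightarrow>
    l2inner h (\<lambda>x. \<Sum>i\<in>A. f i x) = (\<Sum>i\<in>A. l2inner h (f i))"
  by (simp add: l2inner_commute[of h] l2inner_sum_left)

lemma l2inner_self: "l2inner f f = (LINT x|U01. (f x)\<^sup>2)"
  by (simp add: l2inner_eq power2_eq_square)

lemma l2inner_self_nonneg [simp]: "0 \<le> l2inner f f"
  by (simp add: l2inner_self)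

lemma l2norm_square: "(l2norm f)\<^sup>2 = l2inner f f"
  by (simp add: l2norm_def)

lemma l2norm_nonneg [simp]: "0 \<le> l2norm f"
  by (simp add: l2norm_def)

lemma l2inner_le:
  assumes "f \<in> L2" "g \<in> L2"
  shows "\<bar>l2inner f g\<bar> \<le> l2norm f * l2norm g"
proof (rule power2_le_imp_le)
  show "\<bar>l2inner f g\<bar>\<^sup>2 \<le> (l2norm f * l2norm g)\<^sup>2"
    unfolding power_mult_distrib power2_abs l2norm_square l2inner_self
    using integral_Cauchy_Schwarz[of f U01 g] assms by (simp add: l2inner_eq L2_iff)
qed simp

lemma l2norm_add_square: "f \<in> L2 \<Longrightarrow> g \<in> L2 \<Longrightarrow>
    (l2norm (\<lambda>x. f x + g x))\<^sup>2 = (l2norm f)\<^sup>2 + 2 * l2inner f g + (l2norm g)\<^sup>2"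
  by (simp add: l2norm_square l2inner_add_left l2inner_add_right L2_add l2inner_commute)

lemma l2norm_diff_square: "f \<in> L2 \<Longrightarrow> g \<in> L2 \<Longrightarrow>
    (l2norm (\<lambda>x. f x - g x))\<^sup>2 = (l2norm f)\<^sup>2 - 2 * l2inner f g + (l2norm g)\<^sup>2"
  by (simp add: l2norm_square l2inner_diff_left l2inner_diff_right L2_diff l2inner_commute)

lemma l2norm_scale: "l2norm (\<lambda>x. a * f x) = \<bar>a\<bar> * l2norm f"
  by (simp add: l2norm_def l2inner_scale_left l2inner_scale_right real_sqrt_mult flip: mult.assoc)

lemma l2norm_triangle:
  assumes "f \<in> L2" "g \<in> L2"
  shows "l2norm (\<lambda>x. f x + g x) \<le> l2norm f + l2norm g"
proof (rule power2_le_imp_le)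
  show "(l2norm (\<lambda>x. f x + g x))\<^sup>2 \<le> (l2norm f + l2norm g)\<^sup>2"
    using l2inner_le[OF assms] by (simp add: l2norm_add_square assms power2_sum)
qed simp

lemma l2inner_cong_AE:
  assumes "AE x in U01. f x = f' x" "AE x in U01. g x = g' x"
    and [measurable]: "f \<in> borel_measurable U01" "g \<in> borel_measurable U01"
       "f' \<in> borel_measurable U01" "g' \<in> borel_measurable U01"
  shows "l2inner f g = l2inner f' g'"
  unfolding l2inner_eq by (rule integral_cong_AE) (use assms(1,2) in \<open>auto elim: eventually_elim2\<close>)

lemma l2eq_iff: "l2eq f g \<longleftrightarrow> (AE x in U01. f x = g x)"
  by (simp add: l2eq_def AE_U01_iff)

lemma l2norm_cong: "(\<And>x. x \<in> {0<..<1} \<Longrightarrow> f x = g x) \<Longrightarrow> l2norm f = l2norm g"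
  unfolding l2norm_def l2inner_eq by (intro arg_cong[of _ _ sqrt] Bochner_Integration.integral_cong) auto

lemma l2norm_eq_0: 
  assumes "f \<in> L2" "l2norm f = 0"
  shows "AE x in U01. f x = 0"
proof -
  have "(LINT x|U01. (f x)\<^sup>2) = 0"
    using assms(2) by (simp add: l2norm_def l2inner_self)
  then show ?thesis
    using integral_nonneg_eq_0_iff_AE[OF L2_square_integrable[OF assms(1)]] by auto
qed

lemma l2norm_le_bound:
  assumes "f \<in> borel_measurable U01" "\<And>x. x \<in> {0<..<1} \<Longrightarrow> \<bar>f x\<bar> \<le> B"
  shows "l2norm f \<le> B"
proof (rule power2_le_imp_le)
  have B: "0 \<le> B" using assms(2)[of "1/2"] by force
  have "(LINT x|U01. (f x)\<^sup>2) \<le> (LINT x|U01. B\<^sup>2)"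
    using L2_bounded[OF assms] assms(2) B
    by (intro integral_mono) (auto simp: L2_iff intro!: abs_le_square_iff[THEN iffD1])
  then show "(l2norm f)\<^sup>2 \<le> B\<^sup>2" "0 \<le> B"
    using B by (auto simp: l2norm_square l2inner_self U01.prob_space[simplified])
qed

lemma integral_abs_le_l2norm:
  assumes "f \<in> L2"
  shows "(LINT x|U01. \<bar>f x\<bar>) \<le> l2norm f"
proof (rule power2_le_imp_le)
  show "(LINT x|U01. \<bar>f x\<bar>)\<^sup>2 \<le> (l2norm f)\<^sup>2"
    using U01.square_integral_le[of f] assms unfolding l2norm_square l2inner_self L2_iff by blast
qed simp

subsection \<open>Orthonormal systems\<close>

definition orthonormal :: "'i set \<Rightarrow> ('i \<Rightarrow> real \<Rightarrow> real) \<Rightarrow> bool" where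
  "orthonormal J e \<longleftrightarrow> (\<forall>j\<in>J. e j \<in> L2) \<and> (\<forall>j\<in>J. \<forall>k\<in>J. l2inner (e j) (e k) = (if j = k then 1 else 0))"

text \<open>Expanding the square leaves the coefficients only, because the residual is orthogonal to the span.\<close>

lemma orthonormal_residual:
  assumes "orthonormal J e" "finite J" "g \<in> L2"
  shows "(l2norm (\<lambda>x. g x - (\<Sum>j\<in>J. l2inner g (e j) * e j x)))\<^sup>2 = (l2norm g)\<^sup>2 - (\<Sum>j\<in>J. (l2inner g (e j))\<^sup>2)"
proof -
  have e: "\<And>j. j \<in> J \<Longrightarrow> e j \<in> L2" and on: "\<And>j k. j \<in> J \<Longrightarrow> k \<in> J \<Longrightarrow> l2inner (e j) (e k) = (if j = k then 1 else 0)"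
    using assms(1) by (auto simp: orthonormal_def)
  define p where "p = (\<lambda>x. \<Sum>j\<in>J. l2inner g (e j) * e j x)"
  have p: "p \<in> L2" unfolding p_def by (intro L2_sum L2_scale e)
  have pe: "l2inner p (e k) = l2inner g (e k)" if "k \<in> J" for k
  proof -
    have "l2inner p (e k) = (\<Sum>j\<in>J. l2inner g (e j) * l2inner (e j) (e k))"
      unfolding p_def using e that by (simp add: l2inner_sum_left L2_scale l2inner_scale_left)
    also have "\<dots> = (\<Sum>j\<in>J. if j = k then l2inner g (e j) else 0)"
      by (intro sum.cong) (simp_all add: on that del: l2inner_self_nonneg)
    finally show ?thesis using that assms(2) by simp
  qed
  have "l2inner q p = (\<Sum>j\<in>J. l2inner g (e j) * l2inner q (e j))" if "q \<in> L2" for q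
    unfolding p_def using e that by (simp add: l2inner_sum_right L2_scale l2inner_scale_right)
  from this[OF p] this[OF assms(3)] have "l2inner p p = (\<Sum>j\<in>J. (l2inner g (e j))\<^sup>2)"
      "l2inner g p = (\<Sum>j\<in>J. (l2inner g (e j))\<^sup>2)"
    by (simp_all add: pe power2_eq_square)
  then show ?thesis
    using l2norm_diff_square[OF assms(3) p] by (simp add: l2norm_square p_def)
qed

lemma Bessel:
  assumes "orthonormal J e" "finite J" "g \<in> L2"
  shows "(\<Sum>j\<in>J. (l2inner g (e j))\<^sup>2) \<le> (l2norm g)\<^sup>2"
proof -
  have "0 \<le> (l2norm g)\<^sup>2 - (\<Sum>j\<in>J. (l2inner g (e j))\<^sup>2)"
    unfolding orthonormal_residual[OF assms, symmetric] by (rule zero_le_power2)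
  then show ?thesis by simp
qed

text \<open>Both trigonometric systems and the antiderivatives of their members are integrated through this
  form of the fundamental theorem.\<close>

lemma U01_tail_integral:
  assumes "\<And>x. (F has_real_derivative g x) (at x)" "\<And>x. isCont g x" "0 \<le> u" "u \<le> 1"
  shows "(LINT x|U01. indicator {u..} x * g x) = F 1 - F u"
proof -
  have "(LINT x|U01. indicator {u..} x * g x) = (LINT x|lborel. indicator {0<..<1} x * (indicator {u..} x * g x))"
    by (simp add: U01_def integral_restrict_space)
  also have "\<dots> = (LINT x|lborel. g x * indicator {u..1} x)"
  proof (rule integral_cong_AE)
    have "continuous_on UNIV g" using assms(2) by (simp add: continuous_at_imp_continuous_on)
    then have g: "g \<in> borel_measurable borel" by (rule borel_measurable_continuous_onI)
    show "(\<lambda>x. indicat_real {0<..<1} x * (indicat_real {u..} x * g x)) \<in> borel_measurable lborel"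
      using g by simp
    show "(\<lambda>x. g x * indicator {u..1} x) \<in> borel_measurable lborel"
      using g by simp
    show "AE x in lborel. indicat_real {0<..<1} x * (indicat_real {u..} x * g x) = g x * indicator {u..1} x"
      using AE_lborel_singleton[of "0"] AE_lborel_singleton[of "1"]
      by eventually_elim (use assms(3,4) in \<open>auto split: split_indicator\<close>)
  qed
  also have "\<dots> = F 1 - F u"
    using assms by (intro integral_FTC_Icc_real) auto
  finally show ?thesis .
qed

lemma U01_integral:
  assumes "\<And>x. (F has_real_derivative g x) (at x)" "\<And>x. isCont g x"
  shows "(LINT x|U01. g x) = F 1 - F 0"
proof -
  have "(LINT x|U01. g x) = (LINT x|U01. indicator {0..} x * g x)"
    by (intro Bochner_Integration.integral_cong) auto
  then show ?thesis using U01_tail_integral[OF assms, of 0] by simp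
qed

definition sine :: "nat \<Rightarrow> real \<Rightarrow> real" where
  "sine j t = sqrt 2 * sin (pi * real j * t)"

lemma measurable_phi [measurable]: "\<phi> j \<in> borel_measurable borel"
  unfolding \<phi>_def by measurable
lemma measurable_sine [measurable]: "sine j \<in> borel_measurable borel"
  unfolding sine_def by measurable

lemma abs_phi_le: "\<bar>\<phi> j t\<bar> \<le> sqrt 2" and abs_sine_le: "\<bar>sine j t\<bar> \<le> sqrt 2"
  by (simp_all add: \<phi>_def sine_def abs_mult mult_left_le)

lemma L2_phi [simp]: "\<phi> j \<in> L2" and L2_sine [simp]: "sine j \<in> L2"
  by (rule L2_bounded[OF measurable_U01I abs_phi_le], measurable)
     (rule L2_bounded[OF measurable_U01I abs_sine_le], measurable)

lemma integral_cos_pi: "k \<noteq> 0 \<Longrightarrow> (LINT x|U01. cos (pi * of_int k * x)) = 0"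
proof -
  assume k: "k \<noteq> 0"
  have "(LINT x|U01. cos (pi * of_int k * x)) = sin (pi * of_int k * 1) / (pi * of_int k) - sin (pi * of_int k * 0) / (pi * of_int k)"
    by (rule U01_integral) (use k in \<open>auto intro!: derivative_eq_intros continuous_intros\<close>)
  also have "sin (pi * of_int k * 1) = 0" by (simp add: sin_npi_int)
  finally show ?thesis by simp
qed

lemma integral_phi [simp]: "j \<ge> 1 \<Longrightarrow> (LINT x|U01. \<phi> j x) = 0"
  using integral_cos_pi[of "int j"] by (simp add: \<phi>_def)

lemma U01_integrable_continuous:
  assumes "continuous_on UNIV (g :: real \<Rightarrow> real)"
  shows "integrable U01 g"
proof -
  have "compact (g ` {0..1})" using assms by (intro compact_continuous_image) (auto intro: continuous_on_subset)
  from compact_imp_bounded[OF this] obtain B where "\<forall>x\<in>{0..1}. \<bar>g x\<bar> \<le> B"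
    by (auto simp: bounded_iff)
  then show ?thesis
    by (intro U01.integrable_const_bound[where B=B] AE_I2 measurable_U01I borel_measurable_continuous_onI assms) auto
qed

lemma l2inner_trig:
  assumes "j \<ge> 1" "k \<ge> 1"
  shows "l2inner (\<phi> j) (\<phi> k) = (if j = k then 1 else 0)"
    and "l2inner (sine j) (sine k) = (if j = k then 1 else 0)"
proof -
  define A B where "A = (LINT x|U01. cos (pi * of_int (int j - int k) * x))"
    and "B = (LINT x|U01. cos (pi * of_int (int j + int k) * x))"
  have I: "integrable U01 (\<lambda>x. cos (pi * real_of_int i * x))" for i
    by (intro U01_integrable_continuous continuous_intros)
  have A: "A = (if j = k then 1 else 0)" and B: "B = 0"
    using integral_cos_pi[of "int j - int k"] integral_cos_pi[of "int j + int k"] assms U01.prob_space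
    by (auto simp: A_def B_def)
  have "l2inner (\<phi> j) (\<phi> k) = (LINT x|U01. cos (pi * of_int (int j - int k) * x) + cos (pi * of_int (int j + int k) * x))"
    unfolding l2inner_eq
  proof (intro Bochner_Integration.integral_cong refl)
    fix x show "\<phi> j x * \<phi> k x = cos (pi * of_int (int j - int k) * x) + cos (pi * of_int (int j + int k) * x)"
      by (simp add: \<phi>_def cos_add cos_diff algebra_simps)
  qed
  also have "\<dots> = A + B"
    unfolding A_def B_def by (intro Bochner_Integration.integral_add I)
  finally show "l2inner (\<phi> j) (\<phi> k) = (if j = k then 1 else 0)"
    using A B by simp
  have "l2inner (sine j) (sine k) = (LINT x|U01. cos (pi * of_int (int j - int k) * x) - cos (pi * of_int (int j + int k) * x))"
    unfolding l2inner_eq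
  proof (intro Bochner_Integration.integral_cong refl)
    fix x show "sine j x * sine k x = cos (pi * of_int (int j - int k) * x) - cos (pi * of_int (int j + int k) * x)"
      by (simp add: sine_def cos_add cos_diff algebra_simps)
  qed
  also have "\<dots> = A - B"
    unfolding A_def B_def by (intro Bochner_Integration.integral_diff I)
  finally show "l2inner (sine j) (sine k) = (if j = k then 1 else 0)"
    using A B by simp
qed

lemma orthonormal_phi: "J \<subseteq> {1..} \<Longrightarrow> orthonormal J \<phi>" and orthonormal_sine: "J \<subseteq> {1..} \<Longrightarrow> orthonormal J sine"
  unfolding orthonormal_def by (auto simp: subset_eq l2inner_trig)

lemma sine_tail_integral:
  assumes "j \<ge> 1" "0 \<le> u" "u \<le> 1"
  shows "(LINT x|U01. indicator {u..} x * sine j x) = (\<phi> j u - \<phi> j 1) / (pi * real j)"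
proof -
  have "(LINT x|U01. indicator {u..} x * sine j x) = - \<phi> j 1 / (pi * real j) - (- \<phi> j u / (pi * real j))"
    by (rule U01_tail_integral) (use assms in \<open>auto simp: \<phi>_def sine_def intro!: derivative_eq_intros continuous_intros\<close>)
  then show ?thesis by (simp add: diff_divide_distrib)
qed

section \<open>Antiderivatives and cosine expansions\<close>

interpretation UU: pair_prob_space U01 U01 ..

lemma AE_U01_neq: "AE u in U01. u \<noteq> x"
  unfolding AE_U01_iff using AE_lborel_singleton[of x] by eventually_elim auto

lemma L2_indicator: "A \<in> sets borel \<Longrightarrow> (\<lambda>x. indicator A x) \<in> L2"
  by (rule L2_bounded[of _ 1]) (auto intro!: measurable_U01I borel_measurable_indicator split: split_indicator)

text \<open>The antiderivative that vanishes at 0. For an alternative \<open>f\<close> with distribution function \<open>F\<close> it is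
  \<open>F - F_0\<close> on the unit interval.\<close>

definition prim :: "(real \<Rightarrow> real) \<Rightarrow> real \<Rightarrow> real" where
  "prim f x = (LINT u|U01. indicator {..x} u * f u)"

lemma prim_integrable: "f \<in> L2 \<Longrightarrow> integrable U01 (\<lambda>u. indicator {..x} u * f u)"
  by (intro L2_mult_integrable L2_indicator) auto

lemma measurable_prim [measurable]:
  assumes "f \<in> L2"
  shows "prim f \<in> borel_measurable borel"
proof -
  have [measurable]: "f \<in> borel_measurable U01" using assms by (rule L2_measurable)
  have "(\<lambda>x. LINT u|U01. (if u \<le> x then f u else 0)) \<in> borel_measurable borel"
    by (rule U01.borel_measurable_lebesgue_integral) measurable
  also have "(\<lambda>x. LINT u|U01. (if u \<le> x then f u else 0)) = prim f"
    unfolding prim_def by (intro ext Bochner_Integration.integral_cong) auto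
  finally show ?thesis .
qed

lemma abs_prim_le:
  assumes "f \<in> L2"
  shows "\<bar>prim f x\<bar> \<le> l2norm f"
proof -
  have "\<bar>prim f x\<bar> \<le> (LINT u|U01. \<bar>indicator {..x} u * f u\<bar>)"
    unfolding prim_def by (rule integral_abs_bound)
  also have "\<dots> \<le> (LINT u|U01. \<bar>f u\<bar>)"
    using prim_integrable[OF assms] L2_integrable[OF assms]
    by (intro integral_mono integrable_abs) (auto split: split_indicator)
  also have "\<dots> \<le> l2norm f" by (rule integral_abs_le_l2norm[OF assms])
  finally show ?thesis .
qed

lemma L2_prim: "f \<in> L2 \<Longrightarrow> prim f \<in> L2"
  by (rule L2_bounded[OF _ abs_prim_le]) (auto intro: measurable_U01I measurable_prim)

lemma l2norm_prim_le: "f \<in> L2 \<Longrightarrow> l2norm (prim f) \<le> l2norm f"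
  by (rule l2norm_le_bound[OF _ abs_prim_le]) (auto intro: measurable_U01I measurable_prim)

lemma prim_add: "f \<in> L2 \<Longrightarrow> g \<in> L2 \<Longrightarrow> prim (\<lambda>x. f x + g x) x = prim f x + prim g x"
  by (simp add: prim_def distrib_left prim_integrable)

lemma prim_diff: "f \<in> L2 \<Longrightarrow> g \<in> L2 \<Longrightarrow> prim (\<lambda>x. f x - g x) x = prim f x - prim g x"
  by (simp add: prim_def right_diff_distrib prim_integrable)

lemma prim_scale: "prim (\<lambda>x. a * f x) x = a * prim f x"
  by (simp add: prim_def mult.left_commute)

lemma prim_sum: "(\<And>i. i \<in> A \<Longrightarrow> f i \<in> L2) \<Longrightarrow> prim (\<lambda>x. \<Sum>i\<in>A. f i x) x = (\<Sum>i\<in>A. prim (f i) x)"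
  by (simp add: prim_def sum_distrib_left prim_integrable)

lemma prim_phi:
  assumes "j \<ge> 1" "x \<in> {0<..<1}"
  shows "prim (\<phi> j) x = sine j x / (pi * real j)"
proof -
  let ?F = "\<lambda>t. sine j t / (pi * real j)"
  have d: "(?F has_real_derivative \<phi> j t) (at t)" for t
    using assms(1) by (auto simp: sine_def \<phi>_def intro!: derivative_eq_intros)
  have c: "isCont (\<phi> j) t" for t unfolding \<phi>_def by (intro continuous_intros)
  have "(LINT t|U01. \<phi> j t) = (LINT t|U01. indicator {..x} t * \<phi> j t + indicator {x..} t * \<phi> j t)"
  proof (rule integral_cong_AE)
    show "AE t in U01. \<phi> j t = indicator {..x} t * \<phi> j t + indicator {x..} t * \<phi> j t"
      using AE_U01_neq[of x] by eventually_elim (auto split: split_indicator)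
  qed (auto intro!: measurable_U01I)
  also have "\<dots> = prim (\<phi> j) x + (LINT t|U01. indicator {x..} t * \<phi> j t)"
    unfolding prim_def by (intro Bochner_Integration.integral_add L2_mult_integrable L2_indicator L2_phi) auto
  finally show ?thesis
    using U01_tail_integral[OF d c, of x] U01_integral[OF d c] assms by (simp add: sine_def)
qed

text \<open>Fubini's theorem on the triangle \<open>u \<le> x\<close>.\<close>

lemma prim_adjoint:
  assumes "f \<in> L2" "g \<in> L2"
  shows "l2inner (prim f) g = (LINT u|U01. f u * (LINT x|U01. indicator {u..} x * g x))"
proof -
  note [measurable] = assms[THEN L2_measurable]
  define H where "H = (\<lambda>(x, u). (if u \<le> x then f u * g x else 0))"
  have [measurable]: "H \<in> borel_measurable (U01 \<Otimes>\<^sub>M U01)" unfolding H_def by measurable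
  have inner: "integrable U01 (\<lambda>u. H (x, u))" for x
  proof -
    have "integrable U01 (\<lambda>u. (indicator {..x} u * f u) * g x)"
      using prim_integrable[OF assms(1)] by simp
    also have "(\<lambda>u. (indicator {..x} u * f u) * g x) = (\<lambda>u. H (x, u))"
      by (auto simp: H_def fun_eq_iff split: split_indicator)
    finally show ?thesis .
  qed
  have "integrable (U01 \<Otimes>\<^sub>M U01) H"
  proof (rule UU.Fubini_integrable)
    show "integrable U01 (\<lambda>x. LINT y|U01. norm (H (x, y)))"
    proof (rule Bochner_Integration.integrable_bound)
      show "integrable U01 (\<lambda>x. l2norm f * \<bar>g x\<bar>)"
        using L2_integrable[OF assms(2)] by simp
      show "AE x in U01. norm (LINT y|U01. norm (H (x, y))) \<le> norm (l2norm f * \<bar>g x\<bar>)"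
      proof (rule AE_I2)
        fix x
        have "(LINT y|U01. norm (H (x, y))) \<le> (LINT y|U01. \<bar>f y\<bar> * \<bar>g x\<bar>)"
          using inner[of x] L2_integrable[OF assms(1)]
          by (intro integral_mono integrable_norm) (auto simp: H_def abs_mult)
        also have "\<dots> \<le> l2norm f * \<bar>g x\<bar>"
          using integral_abs_le_l2norm[OF assms(1)] by (simp add: mult_right_mono)
        finally show "norm (LINT y|U01. norm (H (x, y))) \<le> norm (l2norm f * \<bar>g x\<bar>)" by simp
      qed
    qed measurable
    show "AE x in U01. integrable U01 (\<lambda>u. H (x, u))" using inner by simp
  qed measurable
  from UU.Fubini_integral[of "\<lambda>x u. H (x, u)"] this
  have "(LINT u|U01. LINT x|U01. H (x, u)) = (LINT x|U01. LINT u|U01. H (x, u))" by simp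
  also have "\<dots> = l2inner (prim f) g"
    unfolding l2inner_eq prim_def integral_mult_left_zero[symmetric]
    by (intro Bochner_Integration.integral_cong) (auto simp: H_def)
  also have "(LINT u|U01. LINT x|U01. H (x, u)) = (LINT u|U01. f u * (LINT x|U01. indicator {u..} x * g x))"
    unfolding integral_mult_right_zero[symmetric]
    by (intro Bochner_Integration.integral_cong) (auto simp: H_def split: split_indicator)
  finally show ?thesis by simp
qed

text \<open>The antiderivative of \<open>f\<close> has sine coefficients which are the cosine coefficients of \<open>f\<close> damped by
  \<open>pi * j\<close>: this is where the weights $j^{-2}$ come from. The boundary term at 1 drops out because
  \<open>f\<close> has mean 0.\<close>

lemma prim_coefficient:
  assumes "f \<in> L2" "(LINT u|U01. f u) = 0" "j \<ge> 1"
  shows "l2inner (prim f) (sine j) = l2inner f (\<phi> j) / (pi * real j)"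
proof -
  have "l2inner (prim f) (sine j) = (LINT u|U01. f u * (LINT x|U01. indicator {u..} x * sine j x))"
    by (rule prim_adjoint) (simp_all add: assms)
  also have "\<dots> = (LINT u|U01. (f u * \<phi> j u - \<phi> j 1 * f u) / (pi * real j))"
    by (intro Bochner_Integration.integral_cong refl, subst sine_tail_integral)
       (use assms(3) in \<open>auto simp: algebra_simps\<close>)
  also have "\<dots> = (l2inner f (\<phi> j) - \<phi> j 1 * (LINT u|U01. f u)) / (pi * real j)"
    using assms(1) by (simp add: l2inner_eq L2_mult_integrable L2_integrable)
  finally show ?thesis using assms(2) by simp
qed

text \<open>Bessel's inequality for the sine system, applied to the antiderivative.\<close>

lemma prim_norm_ge:
  assumes "f \<in> L2" "(LINT u|U01. f u) = 0" "finite J" "J \<subseteq> {1..}"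
  shows "(\<Sum>j\<in>J. (l2inner f (\<phi> j))\<^sup>2 / (pi * real j)\<^sup>2) \<le> (l2norm (prim f))\<^sup>2"
proof -
  have "(\<Sum>j\<in>J. (l2inner f (\<phi> j))\<^sup>2 / (pi * real j)\<^sup>2) = (\<Sum>j\<in>J. (l2inner (prim f) (sine j))\<^sup>2)"
    using assms by (intro sum.cong) (auto simp: prim_coefficient power_divide subset_eq)
  also have "\<dots> \<le> (l2norm (prim f))\<^sup>2"
    by (intro Bessel orthonormal_sine L2_prim assms)
  finally show ?thesis .
qed

subsection \<open>Cosine expansions\<close>

abbreviation psum :: "(nat \<Rightarrow> real) \<Rightarrow> nat set \<Rightarrow> real \<Rightarrow> real" where
  "psum \<theta> J \<equiv> \<lambda>x. \<Sum>j\<in>J. \<theta> j * \<phi> j x"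

lemma L2_psum [simp]: "psum \<theta> J \<in> L2"
  by (intro L2_sum L2_scale) simp

lemma cos_expansion_L2: "cos_expansion \<theta> f \<Longrightarrow> f \<in> L2"
  by (simp add: cos_expansion_def)

lemma l2inner_psum: "g \<in> L2 \<Longrightarrow> l2inner (psum \<theta> J) g = (\<Sum>j\<in>J. \<theta> j * l2inner (\<phi> j) g)"
  by (simp add: l2inner_sum_left L2_scale l2inner_scale_left)

lemma l2inner_psum_phi:
  assumes "finite J" "J \<subseteq> {1..}" "k \<ge> 1"
  shows "l2inner (psum \<theta> J) (\<phi> k) = (if k \<in> J then \<theta> k else 0)"
proof -
  have "l2inner (psum \<theta> J) (\<phi> k) = (\<Sum>j\<in>J. if j = k then \<theta> j else 0)"
    unfolding l2inner_psum[OF L2_phi] using assms by (intro sum.cong) (auto simp: l2inner_trig subset_eq)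
  then show ?thesis using assms by simp
qed

lemma cos_expansion_inner:
  assumes "cos_expansion \<theta> f" "g \<in> L2"
  shows "(\<lambda>N. \<Sum>j=1..N. \<theta> j * l2inner (\<phi> j) g) \<longlonglongrightarrow> l2inner f g"
proof -
  note f = cos_expansion_L2[OF assms(1)]
  have "(\<lambda>N. l2inner f g - (\<Sum>j=1..N. \<theta> j * l2inner (\<phi> j) g)) \<longlonglongrightarrow> 0"
  proof (rule Lim_null_comparison)
    show "\<forall>\<^sub>F N in sequentially. norm (l2inner f g - (\<Sum>j=1..N. \<theta> j * l2inner (\<phi> j) g)) \<le> l2norm (\<lambda>x. f x - psum \<theta> {1..N} x) * l2norm g"
      using l2inner_le[OF L2_diff[OF f L2_psum] assms(2)]
      by (intro always_eventually) (auto simp: l2inner_diff_left f assms(2) l2inner_psum)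
    show "(\<lambda>N. l2norm (\<lambda>x. f x - psum \<theta> {1..N} x) * l2norm g) \<longlonglongrightarrow> 0"
      using assms(1) unfolding cos_expansion_def by (intro tendsto_mult_left_zero) auto
  qed
  from tendsto_diff[OF tendsto_const[of "l2inner f g"] this] show ?thesis by simp
qed

lemma cos_expansion_coeff:
  assumes "cos_expansion \<theta> f" "k \<ge> 1"
  shows "l2inner f (\<phi> k) = \<theta> k"
proof (rule LIMSEQ_unique[OF cos_expansion_inner[OF assms(1) L2_phi]])
  have "(\<Sum>j=1..N. \<theta> j * l2inner (\<phi> j) (\<phi> k)) = \<theta> k" if "N \<ge> k" for N
    using l2inner_psum_phi[of "{1..N}" k \<theta>] that assms(2) by (simp add: l2inner_psum)
  then show "(\<lambda>N. \<Sum>j=1..N. \<theta> j * l2inner (\<phi> j) (\<phi> k)) \<longlonglongrightarrow> \<theta> k"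
    by (intro tendsto_eventually eventually_sequentiallyI)
qed

lemma cos_expansion_inner_coeffs:
  assumes "cos_expansion \<theta> f" "g \<in> L2"
  shows "(\<lambda>N. \<Sum>j=1..N. \<theta> j * l2inner g (\<phi> j)) \<longlonglongrightarrow> l2inner f g"
  using cos_expansion_inner[OF assms] by (simp add: l2inner_commute)

lemma cos_expansion_norm:
  assumes "cos_expansion \<theta> f"
  shows "(\<lambda>N. \<Sum>j=1..N. (\<theta> j)\<^sup>2) \<longlonglongrightarrow> (l2norm f)\<^sup>2"
proof -
  have "(\<Sum>j=1..N. (\<theta> j)\<^sup>2) = (\<Sum>j=1..N. \<theta> j * l2inner f (\<phi> j))" for N
    by (intro sum.cong) (auto simp: cos_expansion_coeff[OF assms] power2_eq_square)
  then show ?thesis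
    using cos_expansion_inner_coeffs[OF assms cos_expansion_L2[OF assms]] by (simp add: l2norm_square)
qed

lemma cos_expansion_residual:
  assumes "cos_expansion \<theta> f" "finite J" "J \<subseteq> {1..}"
  shows "(l2norm (\<lambda>x. f x - psum \<theta> J x))\<^sup>2 = (l2norm f)\<^sup>2 - (\<Sum>j\<in>J. (\<theta> j)\<^sup>2)"
proof -
  have "psum \<theta> J x = psum (\<lambda>j. l2inner f (\<phi> j)) J x" "(\<Sum>j\<in>J. (\<theta> j)\<^sup>2) = (\<Sum>j\<in>J. (l2inner f (\<phi> j))\<^sup>2)" for x
    using assms(3) by (auto intro!: sum.cong simp: cos_expansion_coeff[OF assms(1)] subset_eq)
  then show ?thesis
    using orthonormal_residual[OF orthonormal_phi assms(2) cos_expansion_L2[OF assms(1)]] assms(3) by simp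
qed

lemma cos_expansion_has_sum:
  assumes "cos_expansion \<theta> f"
  shows "((\<lambda>j. (\<theta> j)\<^sup>2) has_sum (l2norm f)\<^sup>2) {1..}"
proof -
  let ?t = "\<lambda>j. if j \<ge> 1 then (\<theta> j)\<^sup>2 else 0"
  have "(\<lambda>N. \<Sum>j\<le>N. ?t j) \<longlonglongrightarrow> (l2norm f)\<^sup>2"
  proof -
    have "(\<Sum>j\<le>N. ?t j) = (\<Sum>j=1..N. (\<theta> j)\<^sup>2)" for N
      by (intro sum.mono_neutral_cong_right) auto
    then show ?thesis using cos_expansion_norm[OF assms] by simp
  qed
  then have "?t sums (l2norm f)\<^sup>2" by (simp add: sums_def_le)
  then have "(?t has_sum (l2norm f)\<^sup>2) UNIV" by (intro sums_nonneg_imp_has_sum) auto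
  then show ?thesis
    by (rule has_sum_cong_neutral[THEN iffD1, rotated -1]) auto
qed

lemma cos_expansion_tail:
  assumes "cos_expansion \<theta> f" "finite J" "J \<subseteq> {1..}" "K = {1..} - J"
  shows "(\<Sum>\<^sub>\<infinity>j\<in>K. (\<theta> j)\<^sup>2) = (l2norm f)\<^sup>2 - (\<Sum>j\<in>J. (\<theta> j)\<^sup>2)"
  unfolding assms(4)
  by (intro infsumI has_sum_Diff cos_expansion_has_sum assms(1) has_sum_finite assms(2,3))

lemma cos_expansion_sum_le:
  assumes "cos_expansion \<theta> f" "finite J" "J \<subseteq> {1..}"
  shows "(\<Sum>j\<in>J. (\<theta> j)\<^sup>2) \<le> (l2norm f)\<^sup>2"
proof -
  have "0 \<le> (l2norm f)\<^sup>2 - (\<Sum>j\<in>J. (\<theta> j)\<^sup>2)"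
    unfolding cos_expansion_residual[OF assms, symmetric] by simp
  then show ?thesis by simp
qed

lemma cos_expansion_diff:
  assumes "cos_expansion \<theta> f" "cos_expansion \<eta> g"
  shows "cos_expansion (\<lambda>j. \<theta> j - \<eta> j) (\<lambda>x. f x - g x)"
  unfolding cos_expansion_def
proof
  note L = assms[THEN cos_expansion_L2]
  show "(\<lambda>x. f x - g x) \<in> L2" by (intro L2_diff L)
  show "(\<lambda>N. l2norm (\<lambda>x. f x - g x - (\<Sum>j=1..N. (\<theta> j - \<eta> j) * \<phi> j x))) \<longlonglongrightarrow> 0"
  proof (rule Lim_null_comparison)
    show "\<forall>\<^sub>F N in sequentially. norm (l2norm (\<lambda>x. f x - g x - (\<Sum>j=1..N. (\<theta> j - \<eta> j) * \<phi> j x)))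
        \<le> l2norm (\<lambda>x. f x - psum \<theta> {1..N} x) + l2norm (\<lambda>x. g x - psum \<eta> {1..N} x)"
    proof (intro always_eventually allI)
      fix N
      have "l2norm (\<lambda>x. (f x - psum \<theta> {1..N} x) + (-1) * (g x - psum \<eta> {1..N} x))
         \<le> l2norm (\<lambda>x. f x - psum \<theta> {1..N} x) + l2norm (\<lambda>x. (-1) * (g x - psum \<eta> {1..N} x))"
        by (intro l2norm_triangle L2_scale L2_diff L L2_psum)
      also have "(\<lambda>x. (f x - psum \<theta> {1..N} x) + (-1) * (g x - psum \<eta> {1..N} x))
         = (\<lambda>x. f x - g x - (\<Sum>j=1..N. (\<theta> j - \<eta> j) * \<phi> j x))"
        by (simp add: fun_eq_iff left_diff_distrib sum_subtractf)
      also have "l2norm (\<lambda>x. (-1) * (g x - psum \<eta> {1..N} x)) = l2norm (\<lambda>x. g x - psum \<eta> {1..N} x)"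
        by (subst l2norm_scale) simp
      finally show "norm (l2norm (\<lambda>x. f x - g x - (\<Sum>j=1..N. (\<theta> j - \<eta> j) * \<phi> j x)))
        \<le> l2norm (\<lambda>x. f x - psum \<theta> {1..N} x) + l2norm (\<lambda>x. g x - psum \<eta> {1..N} x)" by simp
    qed
    show "(\<lambda>N. l2norm (\<lambda>x. f x - psum \<theta> {1..N} x) + l2norm (\<lambda>x. g x - psum \<eta> {1..N} x)) \<longlonglongrightarrow> 0"
      using assms unfolding cos_expansion_def by (intro tendsto_add_zero) auto
  qed
qed

lemma cos_expansion_psum:
  assumes "finite J" "J \<subseteq> {1..}" "\<And>j. j \<ge> 1 \<Longrightarrow> \<eta> j = (if j \<in> J then \<theta> j else 0)"
  shows "cos_expansion \<eta> (psum \<theta> J)"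
  unfolding cos_expansion_def
proof
  obtain M where M: "\<And>j. j \<in> J \<Longrightarrow> j \<le> M" using assms(1) by (meson finite_nat_set_iff_bounded_le)
  have "l2norm (\<lambda>x. psum \<theta> J x - (\<Sum>j=1..N. \<eta> j * \<phi> j x)) = 0" if "N \<ge> M" for N
  proof -
    have "(\<Sum>j=1..N. \<eta> j * \<phi> j x) = psum \<theta> J x" for x
      using assms M that by (intro sum.mono_neutral_cong_right) (auto simp: subset_eq, force)
    then show ?thesis by (simp add: l2norm_def l2inner_eq)
  qed
  then show "(\<lambda>N. l2norm (\<lambda>x. psum \<theta> J x - (\<Sum>j=1..N. \<eta> j * \<phi> j x))) \<longlonglongrightarrow> 0"
    by (intro tendsto_eventually eventually_sequentiallyI)
qed simp

text \<open>The difference has all coefficients 0, and an expansion preserves the norm.\<close>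

lemma cos_expansion_unique:
  assumes "cos_expansion \<theta> f" "cos_expansion \<eta> g" "\<And>j. j \<ge> 1 \<Longrightarrow> \<theta> j = \<eta> j"
  shows "AE x in U01. f x = g x"
proof -
  note d = cos_expansion_diff[OF assms(1,2)]
  have "(\<lambda>N. \<Sum>j=1..N. (\<theta> j - \<eta> j)\<^sup>2) = (\<lambda>N. 0)" using assms(3) by (intro ext sum.neutral) auto
  then have "(l2norm (\<lambda>x. f x - g x))\<^sup>2 = 0"
    using cos_expansion_norm[OF d] by (simp add: LIMSEQ_const_iff)
  then have "AE x in U01. f x - g x = 0"
    by (intro l2norm_eq_0 cos_expansion_L2[OF d]) simp
  then show ?thesis by eventually_elim simp
qed

text \<open>Partial sums of the cosine expansion are integrated term by term, and \<open>prim\<close> is a contraction, so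
  the bound survives the limit. The cutoff \<open>l\<close> is free: above it every weight $(\pi j)^{-2}$ is at
  most $(\pi l)^{-2}$.\<close>

lemma prim_norm_le:
  assumes "cos_expansion \<theta> f" "l > 0"
  shows "(l2norm (prim f))\<^sup>2 \<le> (\<Sum>j | 1 \<le> j \<and> real j < l. (\<theta> j)\<^sup>2 / (pi * real j)\<^sup>2) + (l2norm f)\<^sup>2 / (pi * l)\<^sup>2"
    (is "_ \<le> ?K")
proof -
  note f = cos_expansion_L2[OF assms(1)]
  have fin: "finite {j. 1 \<le> j \<and> real j < l}"
    by (rule finite_subset[of _ "{..nat \<lceil>l\<rceil>}"]) (auto simp: le_nat_iff ceiling_le_iff le_ceiling_iff)
  have K0: "0 \<le> ?K" by (intro add_nonneg_nonneg sum_nonneg) auto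
  have part: "(l2norm (prim (psum \<theta> {1..N})))\<^sup>2 \<le> ?K" for N
  proof -
    define a where "a = (\<lambda>j. \<theta> j / (pi * real j))"
    have p: "prim (psum \<theta> {1..N}) x = (\<Sum>j=1..N. a j * sine j x)" if "x \<in> {0<..<1}" for x
      using that by (simp add: prim_sum L2_scale prim_scale) (intro sum.cong, auto simp: prim_phi a_def)
    have "(l2norm (prim (psum \<theta> {1..N})))\<^sup>2 = (l2norm (\<lambda>x. \<Sum>j=1..N. a j * sine j x))\<^sup>2"
      using l2norm_cong[OF p] by simp
    also have "\<dots> = (\<Sum>j=1..N. \<Sum>k=1..N. a j * (a k * l2inner (sine j) (sine k)))"
      unfolding l2norm_square
      by (simp add: l2inner_sum_left l2inner_sum_right L2_scale L2_sum l2inner_scale_left l2inner_scale_right sum_distrib_left)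
    also have "\<dots> = (\<Sum>j=1..N. \<Sum>k=1..N. if k = j then (a j)\<^sup>2 else 0)"
      by (intro sum.cong refl) (auto simp: l2inner_trig power2_eq_square)
    also have "\<dots> = (\<Sum>j=1..N. (a j)\<^sup>2)" by (intro sum.cong refl) (subst sum.delta, auto)
    also have "\<dots> = (\<Sum>j=1..N. (\<theta> j)\<^sup>2 / (pi * real j)\<^sup>2)"
      by (simp add: a_def power_divide)
    also have "\<dots> = (\<Sum>j | j \<in> {1..N} \<and> real j < l. (\<theta> j)\<^sup>2 / (pi * real j)\<^sup>2) + (\<Sum>j | j \<in> {1..N} \<and> \<not> real j < l. (\<theta> j)\<^sup>2 / (pi * real j)\<^sup>2)"
      by (subst sum.union_disjoint[symmetric]) (auto intro: sum.cong)
    also have "(\<Sum>j | j \<in> {1..N} \<and> real j < l. (\<theta> j)\<^sup>2 / (pi * real j)\<^sup>2) \<le> (\<Sum>j | 1 \<le> j \<and> real j < l. (\<theta> j)\<^sup>2 / (pi * real j)\<^sup>2)"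
      by (intro sum_mono2 fin) auto
    also have "(\<Sum>j | j \<in> {1..N} \<and> \<not> real j < l. (\<theta> j)\<^sup>2 / (pi * real j)\<^sup>2) \<le> (\<Sum>j | j \<in> {1..N} \<and> \<not> real j < l. (\<theta> j)\<^sup>2 / (pi * l)\<^sup>2)"
      using assms(2) by (intro sum_mono divide_left_mono power_mono) auto
    also have "\<dots> = (\<Sum>j | j \<in> {1..N} \<and> \<not> real j < l. (\<theta> j)\<^sup>2) / (pi * l)\<^sup>2"
      by (simp add: sum_divide_distrib)
    also have "\<dots> \<le> (l2norm f)\<^sup>2 / (pi * l)\<^sup>2"
      by (intro divide_right_mono cos_expansion_sum_le[OF assms(1)]) auto
    finally show ?thesis by simp
  qed
  have "l2norm (prim f) \<le> sqrt ?K + l2norm (\<lambda>x. f x - psum \<theta> {1..N} x)" for N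
  proof -
    have "l2norm (prim f) = l2norm (\<lambda>x. prim (psum \<theta> {1..N}) x + prim (\<lambda>x. f x - psum \<theta> {1..N} x) x)"
      by (intro l2norm_cong) (simp add: prim_diff f)
    also have "\<dots> \<le> l2norm (prim (psum \<theta> {1..N})) + l2norm (prim (\<lambda>x. f x - psum \<theta> {1..N} x))"
      by (intro l2norm_triangle L2_prim L2_diff L2_psum f)
    also have "\<dots> \<le> sqrt ?K + l2norm (\<lambda>x. f x - psum \<theta> {1..N} x)"
      by (intro add_mono real_le_rsqrt part l2norm_prim_le L2_diff L2_psum f)
    finally show ?thesis .
  qed
  moreover have "(\<lambda>N. sqrt ?K + l2norm (\<lambda>x. f x - psum \<theta> {1..N} x)) \<longlonglongrightarrow> sqrt ?K + 0"
    using assms(1) unfolding cos_expansion_def by (intro tendsto_add tendsto_const) auto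
  ultimately have "l2norm (prim f) \<le> sqrt ?K"
    using LIMSEQ_le_const by fastforce
  then have "(l2norm (prim f))\<^sup>2 \<le> (sqrt ?K)\<^sup>2" by (intro power_mono) auto
  then show ?thesis using K0 by simp
qed

lemma alternative_L2: "alternative f \<Longrightarrow> f \<in> L2"
  by (simp add: alternative_def)

lemma integral_one_plus: "f \<in> L2 \<Longrightarrow> (LINT x|U01. 1 + f x) = 1 + (LINT x|U01. f x)"
  using U01.prob_space by (subst Bochner_Integration.integral_add) (auto simp: L2_integrable)

lemma alternative_iff: "alternative f \<longleftrightarrow> f \<in> L2 \<and> (AE x in U01. 0 \<le> 1 + f x) \<and> (LINT x|U01. f x) = 0"
  by (auto simp: alternative_def set_integral_U01 integral_one_plus AE_U01_iff)

lemma alternative_mean: "alternative f \<Longrightarrow> (LINT x|U01. f x) = 0"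
  by (simp add: alternative_iff)

lemma alternative_cong_AE:
  assumes "alternative g" "f \<in> L2" "AE x in U01. f x = g x"
  shows "alternative f"
proof -
  have "AE x in U01. 0 \<le> 1 + f x"
    using assms(1,3) unfolding alternative_iff by (auto elim: eventually_elim2)
  moreover have "(LINT x|U01. f x) = (LINT x|U01. g x)"
    using assms by (intro integral_cong_AE) (auto intro: L2_measurable alternative_L2)
  ultimately show ?thesis using assms by (simp add: alternative_iff)
qed

section \<open>The quantile coupling\<close>

text \<open>Integrals against \<open>law f\<close> become integrals on the unit interval.\<close>

lemma emeasure_law:
  assumes "alternative f" and [measurable]: "A \<in> sets borel"
  shows "emeasure (law f) A = ennreal (LINT x|U01. indicator A x * (1 + f x))"
proof -
  note f = alternative_L2[OF assms(1)]
  define w where "w = (\<lambda>x. indicator {0<..<1} x * (1 + f x))"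
  have [measurable]: "w \<in> borel_measurable borel"
    unfolding w_def using L2_measurable[OF L2_add[OF L2_const f, of 1]]
    by (simp add: U01_def borel_measurable_restrict_space_iff)
  have int: "integrable lborel (\<lambda>x. indicator A x * w x)"
  proof -
    have "integrable U01 (\<lambda>x. indicator A x * (1 + f x))"
      by (intro L2_mult_integrable L2_indicator L2_add L2_const f) simp
    then show ?thesis by (simp add: U01_def integrable_restrict_space w_def mult_ac)
  qed
  have nn: "AE x in lborel. 0 \<le> indicator A x * w x"
    using assms(1) unfolding alternative_def w_def by (auto split: split_indicator)
  have law: "law f = density lborel (\<lambda>x. ennreal (w x))" by (simp add: law_def w_def)
  have "emeasure (law f) A = (\<integral>\<^sup>+x. ennreal (w x) * indicator A x \<partial>lborel)"
    unfolding law by (rule emeasure_density) auto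
  also have "\<dots> = (\<integral>\<^sup>+x. ennreal (indicator A x * w x) \<partial>lborel)"
    by (intro nn_integral_cong) (auto split: split_indicator)
  also have "\<dots> = ennreal (LINT x|lborel. indicator A x * w x)"
    by (rule nn_integral_eq_integral[OF int nn])
  also have "(LINT x|lborel. indicator A x * w x) = (LINT x|U01. indicator A x * (1 + f x))"
    by (simp add: U01_def integral_restrict_space w_def mult_ac)
  finally show ?thesis .
qed

lemma real_distribution_law:
  assumes "alternative f"
  shows "real_distribution (law f)"
proof -
  have "emeasure (law f) UNIV = 1"
    using emeasure_law[OF assms, of UNIV] alternative_L2[OF assms] alternative_mean[OF assms]
    by (simp add: integral_one_plus)
  then have "prob_space (law f)" by (intro prob_spaceI) (simp add: law_def)
  then show ?thesis
    by (simp add: real_distribution_def real_distribution_axioms_def law_def)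
qed

lemma prim_one:
  assumes x: "x \<in> {0<..<1}"
  shows "(LINT u|U01. indicator {..x} u) = x"
proof -
  have "(LINT u|U01. indicator {..x} u) = (LINT u|U01. 1 - indicat_real {x..} u)"
  proof (rule integral_cong_AE)
    show "AE u in U01. indicator {..x} u = (1 - indicator {x..} u :: real)"
      using AE_U01_neq[of x] by eventually_elim (auto split: split_indicator)
  qed (auto intro!: measurable_U01I)
  also have "\<dots> = 1 - (LINT u|U01. indicator {x..} u)"
    using U01.prob_space L2_integrable[OF L2_indicator[of "{x..}"]]
    by (subst Bochner_Integration.integral_diff) auto
  also have "(LINT u|U01. indicator {x..} u) = 1 - x"
    using U01_tail_integral[of "\<lambda>x. x" "\<lambda>_. 1" x] x by (auto intro: derivative_eq_intros)
  finally show ?thesis by simp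
qed

lemma cdf_law:
  assumes "alternative f" "x \<in> {0<..<1}"
  shows "cdf (law f) x = x + prim f x"
proof -
  note f = alternative_L2[OF assms(1)]
  interpret real_distribution "law f" by (rule real_distribution_law[OF assms(1)])
  have "cdf (law f) x = measure (law f) {..x}" by (simp add: cdf_def)
  also have "\<dots> = (LINT u|U01. indicator {..x} u * (1 + f u))"
  proof (rule measure_eq_emeasure_eq_ennreal)
    show "0 \<le> (LINT u|U01. indicator {..x} u * (1 + f u))"
      using assms(1) unfolding alternative_iff
      by (intro integral_nonneg_AE) (auto elim!: eventually_mono)
  qed (rule emeasure_law[OF assms(1)], simp)
  also have "\<dots> = (LINT u|U01. indicator {..x} u) + prim f x"
    using L2_integrable[OF L2_indicator[of "{..x}"]] prim_integrable[OF f]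
    by (simp add: distrib_left prim_def)
  finally show ?thesis using prim_one[OF assms(2)] by simp
qed

text \<open>A sample from \<open>law f\<close> is the image of a uniform sample under the quantile function. The quantile
  function is adjoint to the distribution function \<open>x + prim f x\<close>, so counting the transformed
  observations below \<open>x\<close> means counting the uniform ones below \<open>x + prim f x\<close>. In this way all error
  probabilities, under the hypothesis and under every alternative, become probabilities on the one
  space of uniform samples.\<close>

lemma quantile_exists:
  assumes "alternative f"
  obtains Q where "Q \<in> borel_measurable U01" "distr U01 borel Q = law f"
    "\<And>u x. u \<in> {0<..<1} \<Longrightarrow> x \<in> {0<..<1} \<Longrightarrow> Q u \<le> x \<longleftrightarrow> u \<le> x + prim f x"
proof -
  interpret cdf_distribution "law f"
    unfolding cdf_distribution_def by (rule real_distribution_law[OF assms])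
  show ?thesis
  proof
    have "I \<in> borel_measurable (restrict_space borel {0<..<1})" by (rule measurable_CI)
    then show "I \<in> borel_measurable U01"
      by (simp add: U01_def cong: measurable_cong_sets)
    show "distr U01 borel I = law f" unfolding U01_def by (rule distr_I_eq_M)
    show "I u \<le> x \<longleftrightarrow> u \<le> x + prim f x" if "u \<in> {0<..<1}" "x \<in> {0<..<1}" for u x
      using pseudoinverse[of u x] cdf_law[OF assms that(2)] that(1) by simp
  qed
qed

abbreviation U01n :: "nat \<Rightarrow> (nat \<Rightarrow> real) measure" where
  "U01n n \<equiv> PiM {..<n} (\<lambda>_. U01)"

lemma prob_space_U01n: "prob_space (U01n n)"
  by (intro prob_space_PiM prob_space_U01)

interpretation Un: prob_space "U01n n" for n by (rule prob_space_U01n)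

lemma U01n_component: "\<omega> \<in> space (U01n n) \<Longrightarrow> i < n \<Longrightarrow> \<omega> i \<in> {0<..<1}"
  by (auto simp: space_PiM PiE_def Pi_def)

lemma sample_law_coupling:
  assumes "alternative f" "Q \<in> borel_measurable U01" "distr U01 borel Q = law f"
  shows "sample_law n f = distr (U01n n) (PiM {..<n} (\<lambda>_. borel)) (compose {..<n} Q)"
proof -
  interpret real_distribution "law f" by (rule real_distribution_law[OF assms(1)])
  have Q: "Q \<in> measurable U01 (law f)" using assms(2) by simp
  have "distr U01 (law f) Q = law f"
    unfolding assms(3)[symmetric] by (intro distr_cong) (simp_all add: assms(3))
  then have "sample_law n f = distr (U01n n) (PiM {..<n} (\<lambda>_. law f)) (compose {..<n} Q)"
    unfolding sample_law_def
    by (subst distr_PiM_finite_prob_space') (auto simp: Q prob_space_U01 prob_space_axioms)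
  also have "\<dots> = distr (U01n n) (PiM {..<n} (\<lambda>_. borel)) (compose {..<n} Q)"
    by (intro distr_cong sets_PiM_cong) auto
  finally show ?thesis .
qed

text \<open>The uniform empirical process.\<close>

definition emp :: "nat \<Rightarrow> (nat \<Rightarrow> real) \<Rightarrow> real \<Rightarrow> real" where
  "emp n \<omega> y = (\<Sum>i<n. indicator {\<omega> i..} y - y) / sqrt (real n)"

text \<open>The value of \<open>n\<close> times the Cramer--von Mises statistic at the sample from \<open>law f\<close> that is coupled to
  the uniform sample \<open>\<omega>\<close>.\<close>

definition stat :: "nat \<Rightarrow> (real \<Rightarrow> real) \<Rightarrow> (nat \<Rightarrow> real) \<Rightarrow> real" where
  "stat n f \<omega> = (LINT x|U01. (emp n \<omega> (x + prim f x) + sqrt n * prim f x)\<^sup>2)"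

lemma ecdf_eq: "ecdf n X x = (\<Sum>i<n. indicator {X i..} x) / real n"
proof -
  have "real (card {i\<in>{..<n}. X i \<le> x}) = (\<Sum>i\<in>{i\<in>{..<n}. X i \<le> x}. 1)"
    by simp
  also have "\<dots> = (\<Sum>i<n. if X i \<le> x then 1 else 0)" by (rule sum.inter_filter) simp
  also have "\<dots> = (\<Sum>i<n. indicator {X i..} x)" by (intro sum.cong) auto
  finally show ?thesis unfolding ecdf_def by simp
qed

lemma cvm_stat_coupling:
  assumes "n \<ge> 1" "\<omega> \<in> space (U01n n)"
    and Q: "\<And>u x. u \<in> {0<..<1} \<Longrightarrow> x \<in> {0<..<1} \<Longrightarrow> Q u \<le> x \<longleftrightarrow> u \<le> x + prim f x"
  shows "real n * cvm_stat n (compose {..<n} Q \<omega>) = stat n f \<omega>"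
proof -
  have "real n * (ecdf n (compose {..<n} Q \<omega>) x - x)\<^sup>2 = (emp n \<omega> (x + prim f x) + sqrt n * prim f x)\<^sup>2"
    if x: "x \<in> {0<..<1}" for x
  proof -
    let ?A = "\<Sum>i<n. indicator {\<omega> i..} (x + prim f x) :: real"
    have n: "real n > 0" using assms(1) by simp
    have "ecdf n (compose {..<n} Q \<omega>) x = ?A / real n"
      unfolding ecdf_eq using Q[OF U01n_component[OF assms(2)] x]
      by (intro arg_cong2[of _ _ _ _ "(/)"] sum.cong) (auto simp: compose_def indicator_def)
    moreover have "emp n \<omega> (x + prim f x) + sqrt n * prim f x = sqrt n * (?A / real n - x)"
    proof -
      define q where "q = sqrt (real n)"
      have q: "q > 0" "real n = q * q" using n by (simp_all add: q_def)
      show ?thesis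
        unfolding emp_def sum_subtractf q_def[symmetric] using q(1) by (simp add: q(2) field_simps)
    qed
    ultimately show ?thesis using n by (simp add: power_mult_distrib)
  qed
  then show ?thesis
    unfolding cvm_stat_def stat_def set_integral_U01 integral_mult_right_zero[symmetric]
    by (intro Bochner_Integration.integral_cong) auto
qed

lemma measurable_cvm_stat [measurable]: "cvm_stat n \<in> borel_measurable (PiM {..<n} (\<lambda>_. borel))"
proof -
  have "(\<lambda>X. LINT x|U01. ((\<Sum>i<n. if X i \<le> x then 1 else 0) / real n - x)\<^sup>2) \<in> borel_measurable (PiM {..<n} (\<lambda>_. borel))"
    by (rule U01.borel_measurable_lebesgue_integral) measurable
  also have "(\<lambda>X. LINT x|U01. ((\<Sum>i<n. if X i \<le> x then 1 else 0) / real n - x)\<^sup>2) = cvm_stat n"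
    unfolding cvm_stat_def set_integral_U01 ecdf_eq indicator_def by (simp add: of_bool_def)
  finally show ?thesis .
qed

lemma measurable_emp_pair:
  "(\<lambda>(\<omega>, y). emp n \<omega> y) \<in> borel_measurable (U01n n \<Otimes>\<^sub>M borel)"
proof -
  have "(\<lambda>(\<omega>, y). (\<Sum>i<n. (if \<omega> i \<le> y then 1 else 0) - y) / sqrt (real n)) \<in> borel_measurable (U01n n \<Otimes>\<^sub>M borel)"
    by measurable
  then show ?thesis unfolding emp_def indicator_def by (simp add: of_bool_def)
qed

lemma measurable_emp [measurable (raw)]:
  assumes "g \<in> measurable M (U01n n)" "h \<in> borel_measurable M"
  shows "(\<lambda>x. emp n (g x) (h x)) \<in> borel_measurable M"
  using measurable_compose[OF measurable_Pair[OF assms] measurable_emp_pair] by simp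

lemma measurable_prim' [measurable (raw)]:
  assumes "f \<in> L2" "h \<in> borel_measurable M"
  shows "(\<lambda>x. prim f (h x)) \<in> borel_measurable M"
  using measurable_compose[OF assms(2) measurable_prim[OF assms(1)]] .

lemma measurable_stat:
  assumes [measurable]: "f \<in> L2"
  shows "stat n f \<in> borel_measurable (U01n n)"
  unfolding stat_def by (rule U01.borel_measurable_lebesgue_integral) measurable

lemma measure_sample_law:
  assumes "alternative f" "n \<ge> 1"
  shows "measure (sample_law n f) {X \<in> space (sample_law n f). P (cvm_stat n X > t)} =
     measure (U01n n) {\<omega> \<in> space (U01n n). P (stat n f \<omega> > real n * t)}"
proof -
  obtain Q where Q: "Q \<in> borel_measurable U01" "distr U01 borel Q = law f"
    "\<And>u x. u \<in> {0<..<1} \<Longrightarrow> x \<in> {0<..<1} \<Longrightarrow> Q u \<le> x \<longleftrightarrow> u \<le> x + prim f x"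
    using quantile_exists[OF assms(1)] by blast
  note [measurable] = Q(1)
  have c: "compose {..<n} Q \<in> measurable (U01n n) (PiM {..<n} (\<lambda>_. borel))"
    unfolding compose_def by measurable
  have eq: "cvm_stat n (compose {..<n} Q \<omega>) > t \<longleftrightarrow> stat n f \<omega> > real n * t" if "\<omega> \<in> space (U01n n)" for \<omega>
    using cvm_stat_coupling[OF assms(2) that Q(3)] assms(2)
    by (simp flip: mult_less_cancel_left_pos[of "real n" t "cvm_stat n (compose {..<n} Q \<omega>)"])
  have m: "{X \<in> space (PiM {..<n} (\<lambda>_. borel)). P (cvm_stat n X > t)} \<in> sets (PiM {..<n} (\<lambda>_. borel))"
    by measurable
  show ?thesis
    unfolding sample_law_coupling[OF assms(1) Q(1,2)] space_distr measure_distr[OF c m]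
    using eq measurable_space[OF c] by (intro arg_cong[of _ _ "measure _"]) auto
qed

lemma alternative_zero [simp]: "alternative (\<lambda>_. 0)"
  by (simp add: alternative_iff)

lemma type_I_eq: "n \<ge> 1 \<Longrightarrow> type_I n (cvm_test n t) =
    measure (U01n n) {\<omega> \<in> space (U01n n). stat n (\<lambda>_. 0) \<omega> > real n * t}"
  using measure_sample_law[of "\<lambda>_. 0" n "\<lambda>b. b" t] by (simp add: type_I_def cvm_test_def)

lemma type_II_eq: "n \<ge> 1 \<Longrightarrow> alternative f \<Longrightarrow> type_II n (cvm_test n t) f =
    measure (U01n n) {\<omega> \<in> space (U01n n). stat n f \<omega> \<le> real n * t}"
  using measure_sample_law[of f n "\<lambda>b. \<not> b" t] by (simp add: type_II_def cvm_test_def not_less)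

section \<open>Moments of the uniform empirical process\<close>

interpretation Up: product_prob_space "\<lambda>_::nat. U01" UNIV
  by (intro product_prob_spaceI prob_space_U01)

lemma Un_component:
  assumes "i < n"
  shows "distr (U01n n) U01 (\<lambda>\<omega>. \<omega> i) = U01"
  using assms by (intro distr_PiM_component) (auto simp: prob_space_U01)

lemma integrable_Un_component: "i < n \<Longrightarrow> integrable U01 (g :: real \<Rightarrow> real) \<Longrightarrow> integrable (U01n n) (\<lambda>\<omega>. g (\<omega> i))"
  using integrable_distr_eq[of "\<lambda>\<omega>. \<omega> i" "U01n n" U01 g] Un_component[of i n]
  by (simp add: borel_measurable_integrable)

lemma integral_Un_component: "i < n \<Longrightarrow> g \<in> borel_measurable U01 \<Longrightarrow> (LINT \<omega>|U01n n. g (\<omega> i)) = (LINT u|U01. (g u :: real))"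
  using integral_distr[of "\<lambda>\<omega>. \<omega> i" "U01n n" U01 g] Un_component[of i n] by simp

text \<open>A product over all coordinates in which all but two factors are 1.\<close>

lemma integral_Un_mult:
  assumes "i < n" "j < n" "i \<noteq> j" "integrable U01 g" "integrable U01 h"
  shows "integrable (U01n n) (\<lambda>\<omega>. g (\<omega> i) * h (\<omega> j :: real) :: real)"
    and "(LINT \<omega>|U01n n. g (\<omega> i) * h (\<omega> j)) = (LINT u|U01. g u) * (LINT u|U01. h u)"
proof -
  define F where "F = (\<lambda>k. if k = i then g else if k = j then h else (\<lambda>_. 1))"
  have F: "integrable U01 (F k)" for k using assms(4,5) by (simp add: F_def)
  have prod: "(\<Prod>k<n. H k) = H i * H j" if "\<And>k. k \<noteq> i \<Longrightarrow> k \<noteq> j \<Longrightarrow> H k = 1" for H :: "nat \<Rightarrow> real"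
  proof -
    have "(\<Prod>k<n. H k) = (\<Prod>k\<in>{i, j}. H k)"
      using assms(1,2) that by (intro prod.mono_neutral_right) auto
    then show ?thesis using assms(3) by simp
  qed
  have P: "(\<Prod>k<n. F k (\<omega> k)) = g (\<omega> i) * h (\<omega> j)" for \<omega>
    using assms(3) by (subst prod) (auto simp: F_def)
  have I: "(\<Prod>k<n. LINT u|U01. F k u) = (LINT u|U01. g u) * (LINT u|U01. h u)"
    using assms(3) U01.prob_space by (subst prod) (auto simp: F_def)
  show "integrable (U01n n) (\<lambda>\<omega>. g (\<omega> i) * h (\<omega> j))"
    using Up.product_integrable_prod[of "{..<n}" F] F by (simp add: P)
  show "(LINT \<omega>|U01n n. g (\<omega> i) * h (\<omega> j)) = (LINT u|U01. g u) * (LINT u|U01. h u)"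
    using Up.product_integral_prod[of "{..<n}" F] F by (simp add: P I)
qed

text \<open>The mixed terms vanish by independence.\<close>

lemma iid_sum_moments:
  assumes "g \<in> L2" "(LINT u|U01. g u) = 0"
  shows "integrable (U01n n) (\<lambda>\<omega>. \<Sum>i<n. g (\<omega> i))"
    and "(LINT \<omega>|U01n n. (\<Sum>i<n. g (\<omega> i))) = 0"
    and "integrable (U01n n) (\<lambda>\<omega>. (\<Sum>i<n. g (\<omega> i))\<^sup>2)"
    and "(LINT \<omega>|U01n n. (\<Sum>i<n. g (\<omega> i))\<^sup>2) = real n * l2inner g g"
proof -
  note g = L2_integrable[OF assms(1)] L2_measurable[OF assms(1)]
  show "integrable (U01n n) (\<lambda>\<omega>. \<Sum>i<n. g (\<omega> i))"
    by (auto intro!: integrable_Un_component g)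
  show "(LINT \<omega>|U01n n. (\<Sum>i<n. g (\<omega> i))) = 0"
    using assms by (simp add: integrable_Un_component integral_Un_component g)
  have sq: "(\<Sum>i<n. g (\<omega> i))\<^sup>2 = (\<Sum>i<n. \<Sum>j<n. g (\<omega> i) * g (\<omega> j))" for \<omega>
    by (simp add: power2_eq_square sum_product)
  have int: "integrable (U01n n) (\<lambda>\<omega>. g (\<omega> i) * g (\<omega> j))" if "i < n" "j < n" for i j
    using that integral_Un_mult(1)[OF that _ g(1) g(1)] integrable_Un_component[OF that(1), of "\<lambda>u. g u * g u"] L2_mult_integrable[OF assms(1,1)]
    by (cases "i = j") auto
  have val: "(LINT \<omega>|U01n n. g (\<omega> i) * g (\<omega> j)) = (if j = i then l2inner g g else 0)" if "i < n" "j < n" for i j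
    using that integral_Un_mult(2)[OF that _ g(1) g(1)] integral_Un_component[OF that(1), of "\<lambda>u. g u * g u"] g assms(2)
    by (auto simp: l2inner_eq)
  show "integrable (U01n n) (\<lambda>\<omega>. (\<Sum>i<n. g (\<omega> i))\<^sup>2)"
    unfolding sq by (intro Bochner_Integration.integrable_sum) (auto intro: int)
  show "(LINT \<omega>|U01n n. (\<Sum>i<n. g (\<omega> i))\<^sup>2) = real n * l2inner g g"
  proof -
    have "(LINT \<omega>|U01n n. (\<Sum>i<n. g (\<omega> i))\<^sup>2) = (\<Sum>i<n. LINT \<omega>|U01n n. (\<Sum>j<n. g (\<omega> i) * g (\<omega> j)))"
      unfolding sq by (rule Bochner_Integration.integral_sum) (auto intro!: Bochner_Integration.integrable_sum intro: int)
    also have "\<dots> = (\<Sum>i<n. \<Sum>j<n. LINT \<omega>|U01n n. g (\<omega> i) * g (\<omega> j))"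
      by (intro sum.cong refl Bochner_Integration.integral_sum) (auto intro: int)
    also have "\<dots> = (\<Sum>i<n. \<Sum>j<n. if j = i then l2inner g g else 0)"
      by (intro sum.cong refl) (simp add: val)
    finally show ?thesis by simp
  qed
qed

lemma Un_Fubini_bounded:
  assumes [measurable]: "k \<in> borel_measurable (U01n n \<Otimes>\<^sub>M U01)"
    and bound: "\<And>\<omega> x. \<omega> \<in> space (U01n n) \<Longrightarrow> x \<in> {0<..<1} \<Longrightarrow> \<bar>k (\<omega>, x)\<bar> \<le> (B::real)"
  shows "integrable (U01n n) (\<lambda>\<omega>. LINT x|U01. k (\<omega>, x))"
    and "(LINT \<omega>|U01n n. LINT x|U01. k (\<omega>, x)) = (LINT x|U01. LINT \<omega>|U01n n. k (\<omega>, x))"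
    and "integrable U01 (\<lambda>x. LINT \<omega>|U01n n. k (\<omega>, x))"
proof -
  interpret pair_prob_space "U01n n" U01 ..
  have "integrable (U01n n \<Otimes>\<^sub>M U01) k"
    by (rule integrable_const_bound[where B=B]) (auto intro!: AE_I2 bound simp: space_pair_measure)
  then show "integrable (U01n n) (\<lambda>\<omega>. LINT x|U01. k (\<omega>, x))" "integrable U01 (\<lambda>x. LINT \<omega>|U01n n. k (\<omega>, x))"
     "(LINT \<omega>|U01n n. LINT x|U01. k (\<omega>, x)) = (LINT x|U01. LINT \<omega>|U01n n. k (\<omega>, x))"
    using integrable_fst'[of k] integrable_snd[of "\<lambda>\<omega> x. k (\<omega>, x)"] Fubini_integral[of "\<lambda>\<omega> x. k (\<omega>, x)"] by auto
qed

subsection \<open>Pointwise moments\<close>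

text \<open>The contribution of one observation \<open>u\<close> to the empirical process at \<open>y\<close>.\<close>

definition centered_step :: "real \<Rightarrow> real \<Rightarrow> real" where
  "centered_step y u = indicator {..y} u - y"

lemma emp_eq: "emp n \<omega> y = (\<Sum>i<n. centered_step y (\<omega> i)) / sqrt n"
  by (simp add: emp_def centered_step_def indicator_def)

lemma measurable_centered_step [measurable]: "centered_step y \<in> borel_measurable borel"
  unfolding centered_step_def by measurable

lemma abs_centered_step_le: "y \<in> {0..1} \<Longrightarrow> \<bar>centered_step y u\<bar> \<le> 1"
  by (auto simp: centered_step_def split: split_indicator)

lemma L2_centered_step: "centered_step y \<in> L2"
  unfolding centered_step_def by (intro L2_diff L2_indicator L2_const) simp

lemma integral_indicator_le:
  assumes "y \<in> {0..1}"
  shows "(LINT u|U01. indicator {..y} u) = y"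
proof (cases "y = 0 \<or> y = 1")
  case True
  have "(LINT u|U01. indicator {..y} u) = (LINT u|U01. y)"
    using True by (intro Bochner_Integration.integral_cong) auto
  then show ?thesis using U01.prob_space by simp
next
  case False
  with assms have "y \<in> {0<..<1}" by auto
  then show ?thesis by (rule prim_one)
qed

lemma prob_U01_le [simp]: "0 \<le> y \<Longrightarrow> y \<le> 1 \<Longrightarrow> U01.prob ({..y} \<inter> {0<..<1}) = y"
  using integral_indicator_le[of y] by simp

lemma integral_centered_step: "y \<in> {0..1} \<Longrightarrow> (LINT u|U01. centered_step y u) = 0"
  unfolding centered_step_def using U01.prob_space L2_integrable[OF L2_indicator[of "{..y}"]]
  by (subst Bochner_Integration.integral_diff) (auto simp: integral_indicator_le)

lemma l2inner_centered_step:
  assumes "x \<in> {0..1}" "y \<in> {0..1}"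
  shows "l2inner (centered_step x) (centered_step y) = min x y - x * y"
proof -
  note I = L2_indicator[of "{..x}", simplified] L2_indicator[of "{..y}", simplified]
  have "l2inner (centered_step x) (centered_step y) = l2inner (\<lambda>u. indicator {..x} u) (\<lambda>u. indicator {..y} u)
      - l2inner (\<lambda>u. indicator {..x} u) (\<lambda>_. y) - (l2inner (\<lambda>_. x) (\<lambda>u. indicator {..y} u) - l2inner (\<lambda>_. x) (\<lambda>_. y))"
    unfolding centered_step_def by (simp add: l2inner_diff_left l2inner_diff_right I L2_diff)
  also have "l2inner (\<lambda>u. indicator {..x} u) (\<lambda>u. indicator {..y} u) = (LINT u|U01. indicator {..min x y} u)"
    unfolding l2inner_eq by (intro Bochner_Integration.integral_cong) (auto split: split_indicator)
  also have "\<dots> = min x y" using assms by (intro integral_indicator_le) auto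
  also have "l2inner (\<lambda>u. indicator {..x} u) (\<lambda>_. y) = x * y"
    using assms by (simp add: l2inner_eq integral_indicator_le)
  also have "l2inner (\<lambda>_. x) (\<lambda>u. indicator {..y} u) = x * y"
    using assms by (simp add: l2inner_eq integral_indicator_le)
  also have "l2inner (\<lambda>_. x) (\<lambda>_. y) = x * y"
    using U01.prob_space by (simp add: l2inner_eq)
  finally show ?thesis by simp
qed

lemma emp_moments:
  assumes "y \<in> {0..1}" "n \<ge> 1"
  shows "integrable (U01n n) (\<lambda>\<omega>. emp n \<omega> y)" "(LINT \<omega>|U01n n. emp n \<omega> y) = 0"
    and "(LINT \<omega>|U01n n. (emp n \<omega> y)\<^sup>2) = y * (1 - y)"
proof -
  note M = iid_sum_moments[OF L2_centered_step integral_centered_step[OF assms(1)], of n]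
  show "integrable (U01n n) (\<lambda>\<omega>. emp n \<omega> y)" "(LINT \<omega>|U01n n. emp n \<omega> y) = 0"
    using M(1,2) by (simp_all add: emp_eq)
  have "(LINT \<omega>|U01n n. (\<Sum>i<n. centered_step y (\<omega> i))\<^sup>2) = real n * (y * (1 - y))"
    unfolding M(4) using assms(1) by (simp add: l2inner_centered_step algebra_simps)
  then show "(LINT \<omega>|U01n n. (emp n \<omega> y)\<^sup>2) = y * (1 - y)"
    using assms(2) by (simp add: emp_eq power_divide)
qed

text \<open>The increment is a normalized sum of centered indicators of the interval between \<open>x\<close> and \<open>y\<close>.
  It is applied to the points \<open>x\<close> and \<open>F x\<close>: the coupled process differs little from the uniform one.\<close>

lemma emp_increment:
  assumes "x \<in> {0..1}" "y \<in> {0..1}" "n \<ge> 1"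
  shows "(LINT \<omega>|U01n n. (emp n \<omega> y - emp n \<omega> x)\<^sup>2) \<le> \<bar>y - x\<bar>"
proof -
  have L: "(\<lambda>u. centered_step y u - centered_step x u) \<in> L2" by (intro L2_diff L2_centered_step)
  have "(LINT u|U01. centered_step y u - centered_step x u) = 0"
    using assms by (simp add: L2_integrable L2_centered_step integral_centered_step)
  from iid_sum_moments(4)[OF L this, of n]
  have "(LINT \<omega>|U01n n. (emp n \<omega> y - emp n \<omega> x)\<^sup>2) = l2inner (\<lambda>u. centered_step y u - centered_step x u) (\<lambda>u. centered_step y u - centered_step x u)"
    using assms(3) by (simp add: emp_eq power_divide sum_subtractf flip: diff_divide_distrib)
  also have "\<dots> = \<bar>y - x\<bar> - (y - x)\<^sup>2"
    using assms
    by (simp add: l2inner_diff_left l2inner_diff_right L2_centered_step L2_diff l2inner_centered_step power2_eq_square algebra_simps abs_if min_def)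
  finally show ?thesis by simp
qed

lemma exp_le_quadratic:
  assumes "\<bar>u\<bar> \<le> 1"
  shows "exp u \<le> 1 + u + (u::real)\<^sup>2"
proof (cases "u \<ge> 0")
  case True then show ?thesis using assms exp_bound[of u] by simp
next
  case False
  define v where "v = - u"
  have v: "0 < v" "v \<le> 1" using False assms by (auto simp: v_def)
  have "exp u = 1 / exp v" by (simp add: v_def exp_minus field_simps)
  also have "\<dots> \<le> 1 / (1 + v)" using v by (intro divide_left_mono) (auto intro!: mult_pos_pos)
  also have "\<dots> \<le> 1 - v + v\<^sup>2"
  proof -
    have "(1 - v + v\<^sup>2) * (1 + v) = 1 + v ^ 3" by (simp add: power2_eq_square power3_eq_cube algebra_simps)
    then have "1 \<le> (1 - v + v\<^sup>2) * (1 + v)" using v by simp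
    then show ?thesis using v by (simp add: pos_divide_le_eq)
  qed
  finally show ?thesis by (simp add: v_def)
qed

lemma power4_le_exp: "(x::real) ^ 4 \<le> 256 * (exp x + exp (- x))"
proof -
  have "(\<bar>x\<bar> / 4) ^ 4 \<le> (1 + \<bar>x\<bar> / real 4) ^ 4" by (intro power_mono) auto
  also have "\<dots> \<le> exp \<bar>x\<bar>" by (rule exp_ge_one_plus_x_over_n_power_n) auto
  also have "\<dots> \<le> exp x + exp (- x)" by (auto simp: abs_if)
  finally show ?thesis by (simp add: power_divide)
qed

text \<open>By independence the exponential moment is the \<open>n\<close>-th power of the one of a single summand, which is
  at most \<open>1 + 1 / n\<close> because the summand is centered and bounded by \<open>1 / sqrt n\<close>.\<close>

lemma emp_exp_moment:
  assumes y: "y \<in> {0..1}" and n: "n \<ge> 1" and s: "\<bar>s\<bar> = 1"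
  shows "integrable (U01n n) (\<lambda>\<omega>. exp (s * emp n \<omega> y))"
    and "(LINT \<omega>|U01n n. exp (s * emp n \<omega> y)) \<le> exp 1"
proof -
  define q where "q = sqrt (real n)"
  have q: "q \<ge> 1" "q\<^sup>2 = real n" using n by (auto simp: q_def)
  define H where "H = (\<lambda>u. exp (s * centered_step y u / q))"
  have bd: "\<bar>s * centered_step y u / q\<bar> \<le> 1" for u
    using abs_centered_step_le[OF y, of u] q s by (simp add: abs_mult divide_le_eq)
  have intH: "integrable U01 H"
  proof (rule U01.integrable_const_bound[where B="exp 1"])
    show "AE u in U01. norm (H u) \<le> exp 1"
      unfolding H_def by (intro AE_I2) (simp add: abs_le_D1[OF bd])
    show "H \<in> borel_measurable U01" unfolding H_def by (intro measurable_U01I) measurable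
  qed
  have eq: "exp (s * emp n \<omega> y) = (\<Prod>i<n. H (\<omega> i))" for \<omega>
    by (simp add: H_def emp_eq q_def exp_sum[symmetric] sum_distrib_left sum_divide_distrib)
  show "integrable (U01n n) (\<lambda>\<omega>. exp (s * emp n \<omega> y))"
    unfolding eq by (rule Up.product_integrable_prod) (auto simp: intH)
  have "(LINT u|U01. H u) \<le> (LINT u|U01. 1 + (s / q) * centered_step y u + 1 / real n)"
  proof (rule integral_mono)
    show "integrable U01 (\<lambda>u. 1 + s / q * centered_step y u + 1 / real n)"
      using L2_integrable[OF L2_centered_step] by simp
    fix u
    have "(s * centered_step y u / q)\<^sup>2 = (centered_step y u)\<^sup>2 / real n"
      using q s by (simp add: power_mult_distrib power_divide abs_square_eq_1)
    also have "\<dots> \<le> 1 / real n"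
      using abs_centered_step_le[OF y, of u] n by (intro divide_right_mono) (auto simp: abs_square_le_1)
    finally show "H u \<le> 1 + s / q * centered_step y u + 1 / real n"
      using exp_le_quadratic[OF bd[of u]] by (simp add: H_def)
  qed (rule intH)
  also have "\<dots> = 1 + 1 / real n"
    using L2_integrable[OF L2_centered_step] U01.prob_space by (simp add: integral_centered_step[OF y])
  finally have H1: "(LINT u|U01. H u) \<le> 1 + 1 / real n" .
  have "(LINT \<omega>|U01n n. exp (s * emp n \<omega> y)) = (LINT u|U01. H u) ^ n"
    unfolding eq by (subst Up.product_integral_prod) (auto simp: intH)
  also have "\<dots> \<le> (1 + 1 / real n) ^ n"
    using H1 by (intro power_mono integral_nonneg_AE) (auto simp: H_def)
  also have "\<dots> \<le> exp 1" using n by (intro exp_ge_one_plus_x_over_n_power_n) auto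
  finally show "(LINT \<omega>|U01n n. exp (s * emp n \<omega> y)) \<le> exp 1" .
qed

text \<open>What matters is that the bound is uniform in \<open>n\<close> and \<open>y\<close>; exponential moments give it without
  expanding a fourth power.\<close>

lemma emp_moment4:
  assumes y: "y \<in> {0..1}" and n: "n \<ge> 1"
  shows "(LINT \<omega>|U01n n. (emp n \<omega> y) ^ 4) \<le> 1536"
proof -
  note E = emp_exp_moment[OF y n, of 1] emp_exp_moment[OF y n, of "-1"]
  have "(LINT \<omega>|U01n n. (emp n \<omega> y) ^ 4) \<le> (LINT \<omega>|U01n n. 256 * (exp (emp n \<omega> y) + exp (- emp n \<omega> y)))"
    using E by (intro integral_mono' power4_le_exp) auto
  also have "\<dots> \<le> 256 * (exp 1 + exp 1)" using E by simp
  also have "\<dots> \<le> 1536" using exp_le by simp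
  finally show ?thesis .
qed

lemma abs_emp_le:
  assumes "y \<in> {0..1}" "\<omega> \<in> space (U01n n)"
  shows "\<bar>emp n \<omega> y\<bar> \<le> sqrt (real n)"
proof -
  have "\<bar>\<Sum>i<n. centered_step y (\<omega> i)\<bar> \<le> (\<Sum>i<n. 1)"
    by (rule order_trans[OF sum_abs sum_mono]) (use abs_centered_step_le[OF assms(1)] in auto)
  then have "\<bar>emp n \<omega> y\<bar> \<le> real n / sqrt (real n)"
    by (simp add: emp_eq divide_right_mono)
  then show ?thesis by (simp add: real_div_sqrt)
qed

subsection \<open>The null statistic\<close>

lemma L2_emp_comp:
  assumes "\<omega> \<in> space (U01n n)" "g \<in> borel_measurable U01" "\<And>x. x \<in> {0<..<1} \<Longrightarrow> g x \<in> {0..1}"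
  shows "(\<lambda>x. emp n \<omega> (g x)) \<in> L2"
proof (rule L2_bounded)
  show "(\<lambda>x. emp n \<omega> (g x)) \<in> borel_measurable U01"
    using assms(2) unfolding emp_def indicator_def of_bool_def by measurable
  show "\<bar>emp n \<omega> (g x)\<bar> \<le> sqrt (real n)" if "x \<in> {0<..<1}" for x
    using abs_emp_le[OF assms(3)[OF that] assms(1)] .
qed

lemma L2_emp: "\<omega> \<in> space (U01n n) \<Longrightarrow> emp n \<omega> \<in> L2"
  using L2_emp_comp[of \<omega> n "\<lambda>x. x"] by auto

definition null_stat :: "nat \<Rightarrow> (nat \<Rightarrow> real) \<Rightarrow> real" where
  "null_stat n \<omega> = (l2norm (emp n \<omega>))\<^sup>2"

lemma null_stat_eq: "null_stat n \<omega> = (LINT x|U01. (emp n \<omega> x)\<^sup>2)"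
  by (simp add: null_stat_def l2norm_square l2inner_self)

lemma stat_zero: "stat n (\<lambda>_. 0) = null_stat n"
  by (simp add: fun_eq_iff stat_def null_stat_eq prim_def)

lemma measurable_null_stat [measurable]: "null_stat n \<in> borel_measurable (U01n n)"
  using measurable_stat[of "\<lambda>_. 0" n] by (simp add: stat_zero)

lemma null_stat_nonneg: "0 \<le> null_stat n \<omega>" by (simp add: null_stat_def)

lemma abs_emp_square_le: "y \<in> {0..1} \<Longrightarrow> \<omega> \<in> space (U01n n) \<Longrightarrow> (emp n \<omega> y)\<^sup>2 \<le> real n"
  using abs_le_square_iff[of "emp n \<omega> y" "sqrt (real n)"] abs_emp_le[of y \<omega> n] by simp

lemma expectation_null_stat:
  assumes "n \<ge> 1"
  shows "integrable (U01n n) (null_stat n)" "(LINT \<omega>|U01n n. null_stat n \<omega>) = 1 / 6"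
proof -
  have m: "(\<lambda>(\<omega>, x). (emp n \<omega> x)\<^sup>2) \<in> borel_measurable (U01n n \<Otimes>\<^sub>M U01)" by measurable
  have b: "\<bar>(\<lambda>(\<omega>, x). (emp n \<omega> x)\<^sup>2) (\<omega>, x)\<bar> \<le> real n" if "\<omega> \<in> space (U01n n)" "x \<in> {0<..<1}" for \<omega> x
    using abs_emp_square_le[of x \<omega> n] that by auto
  show "integrable (U01n n) (null_stat n)"
    using Un_Fubini_bounded(1)[OF m b] by (simp add: null_stat_eq[abs_def])
  have "(LINT \<omega>|U01n n. null_stat n \<omega>) = (LINT x|U01. LINT \<omega>|U01n n. (emp n \<omega> x)\<^sup>2)"
    using Un_Fubini_bounded(2)[OF m b] by (simp add: null_stat_eq)
  also have "\<dots> = (LINT x|U01. x * (1 - x))"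
    using assms by (intro Bochner_Integration.integral_cong refl) (auto simp: emp_moments)
  also have "\<dots> = (1\<^sup>2 / 2 - 1 ^ 3 / 3) - (0\<^sup>2 / 2 - 0 ^ 3 / 3)"
    by (rule U01_integral) (auto intro!: derivative_eq_intros continuous_intros simp: power2_eq_square algebra_simps)
  finally show "(LINT \<omega>|U01n n. null_stat n \<omega>) = 1 / 6" by simp
qed

text \<open>The sine coefficients of the empirical process, see \<open>emp_coefficient\<close>.\<close>

definition emp_coef :: "nat \<Rightarrow> nat \<Rightarrow> (nat \<Rightarrow> real) \<Rightarrow> real" where
  "emp_coef n j \<omega> = (\<Sum>i<n. \<phi> j (\<omega> i)) / (pi * real j * sqrt (real n))"

lemma measurable_emp_coef [measurable]: "emp_coef n j \<in> borel_measurable (U01n n)"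
  unfolding emp_coef_def by (intro borel_measurable_divide borel_measurable_sum borel_measurable_const)
    (auto intro!: measurable_compose[OF measurable_component_singleton] measurable_U01I)

lemma integral_x_sine: "j \<ge> 1 \<Longrightarrow> (LINT x|U01. x * sine j x) = - \<phi> j 1 / (pi * real j)"
proof -
  assume j: "j \<ge> 1"
  have "(LINT x|U01. x * sine j x) = (sine j 1 / (pi * real j)\<^sup>2 - 1 * \<phi> j 1 / (pi * real j))
      - (sine j 0 / (pi * real j)\<^sup>2 - 0 * \<phi> j 0 / (pi * real j))"
  proof (rule U01_integral)
    fix x :: real
    have d: "(sine j has_real_derivative (pi * real j) * \<phi> j x) (at x)" "(\<phi> j has_real_derivative - (pi * real j) * sine j x) (at x)"
      unfolding sine_def \<phi>_def by (auto intro!: derivative_eq_intros)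
    show "((\<lambda>x. sine j x / (pi * real j)\<^sup>2 - x * \<phi> j x / (pi * real j)) has_real_derivative x * sine j x) (at x)"
      using j by (auto intro!: derivative_eq_intros d simp: field_simps power2_eq_square)
    show "isCont (\<lambda>x. x * sine j x) x" unfolding sine_def by (intro continuous_intros)
  qed
  then show "(LINT x|U01. x * sine j x) = - \<phi> j 1 / (pi * real j)" by (simp add: sine_def)
qed

text \<open>Each observation contributes the integral of the \<open>j\<close>-th sine beyond it, a cosine; the contribution
  of the centering cancels the constant.\<close>

lemma emp_coefficient:
  assumes "\<omega> \<in> space (U01n n)" "j \<ge> 1"
  shows "l2inner (emp n \<omega>) (sine j) = emp_coef n j \<omega>"
proof -
  have I: "integrable U01 (\<lambda>x. indicator {\<omega> i..} x * sine j x)" for i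
    by (intro L2_mult_integrable L2_indicator L2_sine) simp
  have X: "integrable U01 (\<lambda>x. x * sine j x)"
    by (intro L2_mult_integrable L2_sine L2_bounded[of _ 1]) auto
  have "l2inner (emp n \<omega>) (sine j) = (LINT x|U01. (\<Sum>i<n. indicator {\<omega> i..} x * sine j x - x * sine j x) / sqrt (real n))"
    unfolding l2inner_eq emp_def
    by (intro Bochner_Integration.integral_cong refl) (simp add: sum_distrib_right left_diff_distrib)
  also have "\<dots> = (\<Sum>i<n. (LINT x|U01. indicator {\<omega> i..} x * sine j x) - (LINT x|U01. x * sine j x)) / sqrt (real n)"
    using I X by simp
  also have "(\<Sum>i<n. (LINT x|U01. indicator {\<omega> i..} x * sine j x) - (LINT x|U01. x * sine j x)) = (\<Sum>i<n. \<phi> j (\<omega> i) / (pi * real j))"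
  proof (intro sum.cong refl)
    fix i assume "i \<in> {..<n}"
    then have "\<omega> i \<in> {0<..<1}" using U01n_component[OF assms(1)] by simp
    then show "(LINT x|U01. indicator {\<omega> i..} x * sine j x) - (LINT x|U01. x * sine j x) = \<phi> j (\<omega> i) / (pi * real j)"
      using sine_tail_integral[OF assms(2), of "\<omega> i"] integral_x_sine[OF assms(2)]
      by (simp add: diff_divide_distrib)
  qed
  also have "\<dots> / sqrt (real n) = emp_coef n j \<omega>" by (simp add: emp_coef_def flip: sum_divide_distrib)
  finally show ?thesis .
qed

lemma emp_coef_moment:
  assumes "n \<ge> 1" "j \<ge> 1"
  shows "integrable (U01n n) (\<lambda>\<omega>. (emp_coef n j \<omega>)\<^sup>2)" "(LINT \<omega>|U01n n. (emp_coef n j \<omega>)\<^sup>2) = 1 / (pi * real j)\<^sup>2"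
  using iid_sum_moments(3,4)[OF L2_phi integral_phi[OF assms(2)], of n] assms
  by (simp_all add: emp_coef_def power_divide l2inner_trig power_mult_distrib)

text \<open>The part of the null statistic that is not explained by the first \<open>m\<close> coefficients.\<close>

definition tail_energy :: "nat \<Rightarrow> nat \<Rightarrow> (nat \<Rightarrow> real) \<Rightarrow> real" where
  "tail_energy m n \<omega> = null_stat n \<omega> - (\<Sum>j=1..m. (emp_coef n j \<omega>)\<^sup>2)"

text \<open>The covariance kernel \<open>min x y - x * y\<close> of the empirical process has trace 1/6 and eigenvalues
  $(\pi j)^{-2}$; this is what the first \<open>m\<close> eigenvalues leave of the trace.\<close>

definition trace_tail :: "nat \<Rightarrow> real" where
  "trace_tail m = 1 / 6 - (\<Sum>j=1..m. 1 / (pi * real j)\<^sup>2)"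

lemma measurable_tail_energy [measurable]: "tail_energy m n \<in> borel_measurable (U01n n)"
  unfolding tail_energy_def by measurable

lemma tail_energy_residual:
  assumes "\<omega> \<in> space (U01n n)"
  shows "tail_energy m n \<omega> = (l2norm (\<lambda>x. emp n \<omega> x - (\<Sum>j=1..m. emp_coef n j \<omega> * sine j x)))\<^sup>2"
  using orthonormal_residual[OF orthonormal_sine _ L2_emp[OF assms], of "{1..m}"]
  by (simp add: emp_coefficient[OF assms] tail_energy_def null_stat_def)

lemma expectation_tail_energy:
  assumes "n \<ge> 1"
  shows "integrable (U01n n) (tail_energy m n)" "(LINT \<omega>|U01n n. tail_energy m n \<omega>) = trace_tail m"
proof -
  have E: "integrable (U01n n) (\<lambda>\<omega>. \<Sum>j=1..m. (emp_coef n j \<omega>)\<^sup>2)"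
    "(LINT \<omega>|U01n n. (\<Sum>j=1..m. (emp_coef n j \<omega>)\<^sup>2)) = (\<Sum>j=1..m. 1 / (pi * real j)\<^sup>2)"
    by (auto intro!: Bochner_Integration.integrable_sum emp_coef_moment[OF assms]
        simp: Bochner_Integration.integral_sum emp_coef_moment[OF assms] simp del: One_nat_def)
  show "integrable (U01n n) (tail_energy m n)" "(LINT \<omega>|U01n n. tail_energy m n \<omega>) = trace_tail m"
    unfolding tail_energy_def[abs_def] trace_tail_def using E expectation_null_stat[OF assms] by (simp_all del: One_nat_def)
qed

lemma trace_tail_nonneg: "0 \<le> trace_tail m"
proof -
  have "0 \<le> (LINT \<omega>|U01n 1. tail_energy m 1 \<omega>)"
    by (intro Bochner_Integration.integral_nonneg) (simp add: tail_energy_residual)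
  then show ?thesis using expectation_tail_energy(2)[of 1 m] by simp
qed

text \<open>The Basel problem says that the eigenvalues exhaust the trace.\<close>

lemma trace_tail_tendsto: "trace_tail \<longlonglongrightarrow> 0"
proof -
  have "(\<lambda>n. 1 / (pi * real (n + 1))\<^sup>2) sums (1 / 6)"
    using sums_divide[OF inverse_squares_sums, of "pi\<^sup>2"] by (simp add: power_mult_distrib mult.commute)
  then have "(\<lambda>m. \<Sum>j<m. 1 / (pi * real (j + 1))\<^sup>2) \<longlonglongrightarrow> 1 / 6" by (simp add: sums_def)
  moreover have "(\<Sum>j<m. 1 / (pi * real (j + 1))\<^sup>2) = (\<Sum>j=1..m. 1 / (pi * real j)\<^sup>2)" for m
    by (rule sum.reindex_bij_witness[of _ "\<lambda>j. j - 1" Suc]) auto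
  ultimately have "(\<lambda>m. 1/6 - (\<Sum>j=1..m. 1 / (pi * real j)\<^sup>2)) \<longlonglongrightarrow> 1 / 6 - 1 / 6"
    by (intro tendsto_diff tendsto_const) simp
  then show ?thesis by (simp add: trace_tail_def[abs_def])
qed

section \<open>The statistic under an alternative\<close>

text \<open>The squared norm of the shift \<open>sqrt n * (F - F_0)\<close>.\<close>

definition drift :: "nat \<Rightarrow> (real \<Rightarrow> real) \<Rightarrow> real" where
  "drift n f = real n * (l2norm (prim f))\<^sup>2"

lemma drift_nonneg [simp]: "0 \<le> drift n f" by (simp add: drift_def)

text \<open>The value is that of a distribution function.\<close>

lemma shifted_range:
  assumes "alternative f" "x \<in> {0<..<1}"
  shows "x + prim f x \<in> {0..1}"
proof -
  interpret real_distribution "law f" by (rule real_distribution_law[OF assms(1)])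
  show ?thesis
    using cdf_law[OF assms] cdf_nonneg[of x] cdf_bounded_prob[of x] by simp
qed

lemma measurable_shifted: "f \<in> L2 \<Longrightarrow> (\<lambda>x. x + prim f x) \<in> borel_measurable U01"
  by (intro borel_measurable_add measurable_U01_ident measurable_U01I measurable_prim)

lemma L2_emp_shifted: "alternative f \<Longrightarrow> \<omega> \<in> space (U01n n) \<Longrightarrow> (\<lambda>x. emp n \<omega> (x + prim f x)) \<in> L2"
  by (intro L2_emp_comp measurable_shifted alternative_L2 shifted_range)

lemma stat_eq_norm: "stat n f \<omega> = (l2norm (\<lambda>x. emp n \<omega> (x + prim f x) + sqrt n * prim f x))\<^sup>2"
  by (simp add: stat_def l2norm_square l2inner_self)

lemma stat_nonneg: "0 \<le> stat n f \<omega>" by (simp add: stat_eq_norm)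

lemma l2norm_shift: "l2norm (\<lambda>x. sqrt (real n) * prim f x) = sqrt (drift n f)"
  by (simp add: l2norm_scale drift_def real_sqrt_mult)

text \<open>The squared distance between the coupled and the uniform empirical process.\<close>

definition shift_error :: "nat \<Rightarrow> (real \<Rightarrow> real) \<Rightarrow> (nat \<Rightarrow> real) \<Rightarrow> real" where
  "shift_error n f \<omega> = (LINT x|U01. (emp n \<omega> (x + prim f x) - emp n \<omega> x)\<^sup>2)"

lemma expectation_shift_error:
  assumes "alternative f" "n \<ge> 1"
  shows "integrable (U01n n) (shift_error n f)" "(LINT \<omega>|U01n n. shift_error n f \<omega>) \<le> l2norm f"
proof -
  note f[measurable] = alternative_L2[OF assms(1)]
  have m: "(\<lambda>(\<omega>, x). (emp n \<omega> (x + prim f x) - emp n \<omega> x)\<^sup>2) \<in> borel_measurable (U01n n \<Otimes>\<^sub>M U01)" by measurable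
  have b: "\<bar>(\<lambda>(\<omega>, x). (emp n \<omega> (x + prim f x) - emp n \<omega> x)\<^sup>2) (\<omega>, x)\<bar> \<le> (2 * sqrt n)\<^sup>2"
    if "\<omega> \<in> space (U01n n)" "x \<in> {0<..<1}" for \<omega> x
  proof -
    have "\<bar>emp n \<omega> (x + prim f x) - emp n \<omega> x\<bar> \<le> 2 * sqrt n"
      using abs_emp_le[OF shifted_range[OF assms(1) that(2)] that(1)] abs_emp_le[of x \<omega> n] that by auto
    then have "\<bar>emp n \<omega> (x + prim f x) - emp n \<omega> x\<bar>\<^sup>2 \<le> (2 * sqrt n)\<^sup>2"
      by (intro power_mono) auto
    then show ?thesis by simp
  qed
  show "integrable (U01n n) (shift_error n f)"
    using Un_Fubini_bounded(1)[OF m b] by (simp add: shift_error_def[abs_def])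
  have "(LINT \<omega>|U01n n. shift_error n f \<omega>) = (LINT x|U01. LINT \<omega>|U01n n. (emp n \<omega> (x + prim f x) - emp n \<omega> x)\<^sup>2)"
    using Un_Fubini_bounded(2)[OF m b] by (simp add: shift_error_def)
  also have "\<dots> \<le> (LINT x|U01. \<bar>prim f x\<bar>)"
  proof (rule integral_mono)
    show "integrable U01 (\<lambda>x. LINT \<omega>|U01n n. (emp n \<omega> (x + prim f x) - emp n \<omega> x)\<^sup>2)"
      using Un_Fubini_bounded(3)[OF m b] by simp
    show "integrable U01 (\<lambda>x. \<bar>prim f x\<bar>)" by (intro integrable_abs L2_integrable L2_prim f)
    show "(LINT \<omega>|U01n n. (emp n \<omega> (x + prim f x) - emp n \<omega> x)\<^sup>2) \<le> \<bar>prim f x\<bar>" if "x \<in> space U01" for x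
      using emp_increment[of x "x + prim f x" n] shifted_range[OF assms(1)] that assms(2) by auto
  qed
  also have "\<dots> \<le> l2norm (prim f)" by (intro integral_abs_le_l2norm L2_prim f)
  also have "\<dots> \<le> l2norm f" by (rule l2norm_prim_le[OF f])
  finally show "(LINT \<omega>|U01n n. shift_error n f \<omega>) \<le> l2norm f" .
qed

lemma shift_error_nonneg: "0 \<le> shift_error n f \<omega>" by (simp add: shift_error_def)

text \<open>The statistic is the squared norm of \<open>Y + h + R\<close>, where \<open>Y\<close> is the empirical process, \<open>h\<close> the shift
  and \<open>R\<close> the coupling error. Of the mixed terms only the one of \<open>Y\<close> and \<open>h\<close> needs care. It is split
  at the frequency \<open>m\<close>: below, the coefficients of \<open>h\<close> are small; above, \<open>Y\<close> has little energy.\<close>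

lemma stat_expansion:
  assumes "alternative f" "\<omega> \<in> space (U01n n)"
  shows "\<bar>stat n f \<omega> - null_stat n \<omega> - drift n f\<bar> \<le>
     2 * (sqrt (\<Sum>j=1..m. real n * (l2inner f (\<phi> j))\<^sup>2 / (pi * real j)\<^sup>2) * sqrt (null_stat n \<omega>))
     + 2 * (sqrt (drift n f) * sqrt (tail_energy m n \<omega>)) + 2 * (sqrt (null_stat n \<omega>) * sqrt (shift_error n f \<omega>))
     + 2 * (sqrt (drift n f) * sqrt (shift_error n f \<omega>)) + shift_error n f \<omega>"
proof -
  note f = alternative_L2[OF assms(1)]
  define Y where "Y = emp n \<omega>"
  define R where "R = (\<lambda>x. emp n \<omega> (x + prim f x) - emp n \<omega> x)"
  define h where "h = (\<lambda>x. sqrt n * prim f x)"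
  define g where "g = (\<lambda>x. \<Sum>j=1..m. l2inner h (sine j) * sine j x)"
  define p where "p = (\<lambda>x. \<Sum>j=1..m. emp_coef n j \<omega> * sine j x)"
  have Y: "Y \<in> L2" unfolding Y_def by (rule L2_emp[OF assms(2)])
  have R: "R \<in> L2" unfolding R_def by (intro L2_diff L2_emp_shifted assms L2_emp)
  have h: "h \<in> L2" unfolding h_def by (intro L2_scale L2_prim f)
  have p: "p \<in> L2" unfolding p_def by (intro L2_sum L2_scale L2_sine)
  have g: "g \<in> L2" unfolding g_def by (intro L2_sum L2_scale L2_sine)
  have nR: "l2norm R = sqrt (shift_error n f \<omega>)"
    by (simp add: l2norm_def l2inner_self R_def shift_error_def)
  have nY: "l2norm Y = sqrt (null_stat n \<omega>)" by (simp add: null_stat_def Y_def)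
  have nh: "l2norm h = sqrt (drift n f)" unfolding h_def by (rule l2norm_shift)
  have ng: "l2norm g = sqrt (\<Sum>j=1..m. real n * (l2inner f (\<phi> j))\<^sup>2 / (pi * real j)\<^sup>2)"
  proof -
    have c: "l2inner h (sine j) = sqrt n * (l2inner f (\<phi> j) / (pi * real j))" if "j \<in> {1..m}" for j
      using that unfolding h_def l2inner_scale_left
      by (simp add: prim_coefficient f alternative_mean assms(1))
    have on: "orthonormal {1..m} sine" by (rule orthonormal_sine) simp
    have "l2inner g (sine j) = l2inner h (sine j)" if "j \<in> {1..m}" for j
    proof -
      have "l2inner g (sine j) = (\<Sum>k=1..m. l2inner h (sine k) * l2inner (sine k) (sine j))"
        unfolding g_def by (simp add: l2inner_sum_left L2_scale l2inner_scale_left)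
      also have "\<dots> = (\<Sum>k=1..m. if k = j then l2inner h (sine k) else 0)"
        using that by (intro sum.cong) (auto simp: l2inner_trig)
      finally show ?thesis using that by simp
    qed
    then have "l2inner g g = (\<Sum>j=1..m. l2inner h (sine j) * l2inner h (sine j))"
      by (subst (2) g_def) (simp add: l2inner_sum_right L2_scale l2inner_scale_right g)
    also have "\<dots> = (\<Sum>j=1..m. real n * (l2inner f (\<phi> j))\<^sup>2 / (pi * real j)\<^sup>2)"
      by (intro sum.cong refl) (simp only: c, simp add: power2_eq_square)
    finally show ?thesis by (simp add: l2norm_def)
  qed
  have Yh: "\<bar>l2inner Y h\<bar> \<le> l2norm g * l2norm Y + l2norm h * sqrt (tail_energy m n \<omega>)"
  proof -
    have ph: "l2inner p h = l2inner g Y"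
      unfolding p_def g_def using h Y
      by (simp add: l2inner_sum_left L2_scale l2inner_scale_left)
         (intro sum.cong refl, simp add: emp_coefficient[OF assms(2), symmetric] Y_def[symmetric] l2inner_commute)
    have "l2inner Y h = l2inner p h + l2inner (\<lambda>x. Y x - p x) h"
      by (simp add: l2inner_diff_left Y p h)
    then have "\<bar>l2inner Y h\<bar> \<le> \<bar>l2inner g Y\<bar> + \<bar>l2inner (\<lambda>x. Y x - p x) h\<bar>" using ph by simp
    also have "\<dots> \<le> l2norm g * l2norm Y + l2norm (\<lambda>x. Y x - p x) * l2norm h"
      by (intro add_mono l2inner_le g Y h L2_diff p)
    also have "l2norm (\<lambda>x. Y x - p x) = sqrt (tail_energy m n \<omega>)"
      unfolding tail_energy_residual[OF assms(2)] by (simp add: Y_def p_def)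
    finally show ?thesis by (simp add: mult.commute)
  qed
  have "stat n f \<omega> = (l2norm (\<lambda>x. (Y x + h x) + R x))\<^sup>2"
    unfolding stat_eq_norm by (simp add: Y_def R_def h_def algebra_simps)
  also have "\<dots> = (l2norm Y)\<^sup>2 + 2 * l2inner Y h + (l2norm h)\<^sup>2 + 2 * (l2inner Y R + l2inner h R) + (l2norm R)\<^sup>2"
    by (simp add: l2norm_add_square Y h R L2_add l2inner_add_left)
  finally have "stat n f \<omega> - null_stat n \<omega> - drift n f = 2 * l2inner Y h + 2 * l2inner Y R + 2 * l2inner h R + shift_error n f \<omega>"
    by (simp add: nY nh nR null_stat_nonneg shift_error_nonneg)
  then have "\<bar>stat n f \<omega> - null_stat n \<omega> - drift n f\<bar> \<le> 2 * \<bar>l2inner Y h\<bar> + 2 * \<bar>l2inner Y R\<bar> + 2 * \<bar>l2inner h R\<bar> + shift_error n f \<omega>"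
    using shift_error_nonneg[of n f \<omega>] by linarith
  then show ?thesis
    using Yh l2inner_le[OF Y R] l2inner_le[OF h R] unfolding nR nY nh ng by linarith
qed

lemma (in prob_space) expectation_sqrt_mult:
  fixes A B :: "'a \<Rightarrow> real"
  assumes "integrable M A" "integrable M B" "\<And>x. x \<in> space M \<Longrightarrow> 0 \<le> A x" "\<And>x. x \<in> space M \<Longrightarrow> 0 \<le> B x"
  shows "integrable M (\<lambda>x. sqrt (A x) * sqrt (B x))"
    and "expectation (\<lambda>x. sqrt (A x) * sqrt (B x)) \<le> sqrt (expectation A) * sqrt (expectation B)"
proof -
  note [measurable] = assms(1,2)[THEN borel_measurable_integrable]
  have eq: "integrable M (\<lambda>x. (sqrt (A x))\<^sup>2) \<longleftrightarrow> integrable M A" "expectation (\<lambda>x. (sqrt (A x))\<^sup>2) = expectation A"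
     "integrable M (\<lambda>x. (sqrt (B x))\<^sup>2) \<longleftrightarrow> integrable M B" "expectation (\<lambda>x. (sqrt (B x))\<^sup>2) = expectation B"
    using assms(3,4) by (auto intro!: Bochner_Integration.integrable_cong Bochner_Integration.integral_cong)
  show "integrable M (\<lambda>x. sqrt (A x) * sqrt (B x))"
    by (intro integrable_mult_of_squares) (simp_all add: eq assms(1,2))
  have "(expectation (\<lambda>x. sqrt (A x) * sqrt (B x)))\<^sup>2 \<le> expectation A * expectation B"
    using integral_Cauchy_Schwarz[of "\<lambda>x. sqrt (A x)" M "\<lambda>x. sqrt (B x)"] assms(1,2) by (simp add: eq)
  then show "expectation (\<lambda>x. sqrt (A x) * sqrt (B x)) \<le> sqrt (expectation A) * sqrt (expectation B)"
    by (metis real_le_rsqrt real_sqrt_mult)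
qed

lemma (in prob_space) expectation_sqrt:
  fixes A :: "'a \<Rightarrow> real"
  assumes "integrable M A" "\<And>x. x \<in> space M \<Longrightarrow> 0 \<le> A x"
  shows "integrable M (\<lambda>x. sqrt (A x))" "expectation (\<lambda>x. sqrt (A x)) \<le> sqrt (expectation A)"
  using expectation_sqrt_mult[of A "\<lambda>_. 1"] assms by (simp_all add: prob_space)

definition approx_error :: "nat \<Rightarrow> nat \<Rightarrow> (real \<Rightarrow> real) \<Rightarrow> real" where
  "approx_error m n f = 2 * sqrt (\<Sum>j=1..m. real n * (l2inner f (\<phi> j))\<^sup>2 / (pi * real j)\<^sup>2)
     + 2 * (sqrt (drift n f) * sqrt (trace_tail m)) + 2 * sqrt (l2norm f)
     + 2 * (sqrt (drift n f) * sqrt (l2norm f)) + l2norm f"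

lemma stat_approx:
  assumes "alternative f" "n \<ge> 1"
  shows "integrable (U01n n) (\<lambda>\<omega>. \<bar>stat n f \<omega> - null_stat n \<omega> - drift n f\<bar>)"
    and "(LINT \<omega>|U01n n. \<bar>stat n f \<omega> - null_stat n \<omega> - drift n f\<bar>) \<le> approx_error m n f"
proof -
  note f = alternative_L2[OF assms(1)]
  note [measurable] = measurable_stat[OF f]
  define q where "q m = sqrt (\<Sum>j=1..m. real n * (l2inner f (\<phi> j))\<^sup>2 / (pi * real j)\<^sup>2)" for m
  have q: "q m \<ge> 0" for m unfolding q_def by (intro real_sqrt_ge_zero sum_nonneg) auto
  note S = expectation_null_stat[OF assms(2)] and D = expectation_tail_energy[OF assms(2)] and R = expectation_shift_error[OF assms]
  have Dnn: "0 \<le> tail_energy m n \<omega>" if "\<omega> \<in> space (U01n n)" for \<omega> m using tail_energy_residual[OF that] by simp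
  note sS = Un.expectation_sqrt[OF S(1) null_stat_nonneg] and sD = Un.expectation_sqrt[OF D(1) Dnn]
    and sR = Un.expectation_sqrt[OF R(1) shift_error_nonneg]
    and sSR = Un.expectation_sqrt_mult[OF S(1) R(1) null_stat_nonneg shift_error_nonneg]
  define B where "B m \<omega> = 2 * (q m * sqrt (null_stat n \<omega>))
     + 2 * (sqrt (drift n f) * sqrt (tail_energy m n \<omega>)) + 2 * (sqrt (null_stat n \<omega>) * sqrt (shift_error n f \<omega>))
     + 2 * (sqrt (drift n f) * sqrt (shift_error n f \<omega>)) + shift_error n f \<omega>" for m \<omega>
  have B: "integrable (U01n n) (B m)" for m
    unfolding B_def using sS(1) sD(1) sR(1) sSR(1) R(1) by simp
  have le: "\<bar>stat n f \<omega> - null_stat n \<omega> - drift n f\<bar> \<le> B m \<omega>" if "\<omega> \<in> space (U01n n)" for m \<omega>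
    unfolding B_def q_def by (rule stat_expansion[OF assms(1) that])
  show int: "integrable (U01n n) (\<lambda>\<omega>. \<bar>stat n f \<omega> - null_stat n \<omega> - drift n f\<bar>)"
  proof (rule Bochner_Integration.integrable_bound[OF B[of 0]])
    show "AE \<omega> in U01n n. norm \<bar>stat n f \<omega> - null_stat n \<omega> - drift n f\<bar> \<le> norm (B 0 \<omega>)"
      using le[of _ 0] by (intro AE_I2) force
  qed measurable
  have "(LINT \<omega>|U01n n. \<bar>stat n f \<omega> - null_stat n \<omega> - drift n f\<bar>) \<le> (LINT \<omega>|U01n n. B m \<omega>)"
    by (intro integral_mono int B le)
  also have "\<dots> = 2 * (q m * (LINT \<omega>|U01n n. sqrt (null_stat n \<omega>))) + 2 * (sqrt (drift n f) * (LINT \<omega>|U01n n. sqrt (tail_energy m n \<omega>)))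
     + 2 * (LINT \<omega>|U01n n. sqrt (null_stat n \<omega>) * sqrt (shift_error n f \<omega>)) + 2 * (sqrt (drift n f) * (LINT \<omega>|U01n n. sqrt (shift_error n f \<omega>)))
     + (LINT \<omega>|U01n n. shift_error n f \<omega>)"
    unfolding B_def using sS(1) sD(1) sR(1) sSR(1) R(1) by simp
  also have "\<dots> \<le> 2 * (q m * 1) + 2 * (sqrt (drift n f) * sqrt (trace_tail m)) + 2 * (1 * sqrt (l2norm f))
     + 2 * (sqrt (drift n f) * sqrt (l2norm f)) + l2norm f"
  proof -
    have "sqrt (LINT \<omega>|U01n n. null_stat n \<omega>) \<le> 1" using S(2) by simp
    then have "(LINT \<omega>|U01n n. sqrt (null_stat n \<omega>)) \<le> 1" by (rule order_trans[OF sS(2)])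
    moreover have "(LINT \<omega>|U01n n. sqrt (tail_energy m n \<omega>)) \<le> sqrt (trace_tail m)" using sD(2)[of m] D(2)[of m] by simp
    moreover have sr: "sqrt (LINT \<omega>|U01n n. shift_error n f \<omega>) \<le> sqrt (l2norm f)" using R(2) by simp
    moreover have "(LINT \<omega>|U01n n. sqrt (shift_error n f \<omega>)) \<le> sqrt (l2norm f)" using sR(2) sr by (rule order_trans)
    moreover have "(LINT \<omega>|U01n n. sqrt (null_stat n \<omega>) * sqrt (shift_error n f \<omega>)) \<le> 1 * sqrt (l2norm f)"
    proof (rule order_trans[OF sSR(2)], rule mult_mono)
      show "sqrt (LINT \<omega>|U01n n. null_stat n \<omega>) \<le> 1" using S(2) by simp
      show "0 \<le> sqrt (LINT \<omega>|U01n n. shift_error n f \<omega>)"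
        by (intro real_sqrt_ge_zero Bochner_Integration.integral_nonneg shift_error_nonneg)
    qed (use sr in auto)
    ultimately show ?thesis using R(2) q[of m] by (intro add_mono mult_left_mono) auto
  qed
  finally show "(LINT \<omega>|U01n n. \<bar>stat n f \<omega> - null_stat n \<omega> - drift n f\<bar>) \<le> approx_error m n f"
    by (simp add: approx_error_def q_def)
qed

text \<open>First \<open>m\<close> is chosen by the trace tail, uniformly in the sample size; then finitely many
  coefficients of the shift have to become small.\<close>

lemma approx_error_eventually_small:
  assumes "(\<lambda>i. l2norm (f i)) \<longlonglongrightarrow> 0" "\<forall>\<^sub>F i in sequentially. drift (\<nu> i) (f i) \<le> A"
    and weak: "\<And>j. j \<ge> 1 \<Longrightarrow> (\<lambda>i. real (\<nu> i) * (l2inner (f i) (\<phi> j))\<^sup>2) \<longlonglongrightarrow> 0"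
    and "\<delta> > 0"
  obtains m where "\<forall>\<^sub>F i in sequentially. approx_error m (\<nu> i) (f i) < \<delta>"
proof -
  define A' where "A' = max A 0"
  have "(\<lambda>m. 2 * (sqrt A' * sqrt (trace_tail m))) \<longlonglongrightarrow> 2 * (sqrt A' * sqrt 0)"
    by (intro tendsto_intros trace_tail_tendsto)
  from order_tendstoD(2)[OF this, of "\<delta> / 2"]
  have "\<forall>\<^sub>F m in sequentially. 2 * (sqrt A' * sqrt (trace_tail m)) < \<delta> / 2"
    using \<open>\<delta> > 0\<close> by simp
  then obtain m where m: "2 * (sqrt A' * sqrt (trace_tail m)) < \<delta> / 2"
    using eventually_happens[of _ sequentially] by auto
  let ?u = "\<lambda>i. 2 * sqrt (\<Sum>j=1..m. real (\<nu> i) * (l2inner (f i) (\<phi> j))\<^sup>2 / (pi * real j)\<^sup>2)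
     + 2 * sqrt (l2norm (f i)) + 2 * (sqrt A' * sqrt (l2norm (f i))) + l2norm (f i)"
  have "?u \<longlonglongrightarrow> 2 * sqrt (\<Sum>j=1..m. 0 / (pi * real j)\<^sup>2) + 2 * sqrt 0 + 2 * (sqrt A' * sqrt 0) + 0"
    by (intro tendsto_intros assms(1) weak) auto
  from order_tendstoD(2)[OF this, of "\<delta> / 2"] have "\<forall>\<^sub>F i in sequentially. ?u i < \<delta> / 2"
    using \<open>\<delta> > 0\<close> by simp
  with assms(2) have "\<forall>\<^sub>F i in sequentially. approx_error m (\<nu> i) (f i) < \<delta>"
  proof eventually_elim
    case (elim i)
    have "sqrt (drift (\<nu> i) (f i)) \<le> sqrt A'" using elim(1) by (simp add: A'_def)
    then have "2 * (sqrt (drift (\<nu> i) (f i)) * sqrt (trace_tail m)) \<le> 2 * (sqrt A' * sqrt (trace_tail m))"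
      "2 * (sqrt (drift (\<nu> i) (f i)) * sqrt (l2norm (f i))) \<le> 2 * (sqrt A' * sqrt (l2norm (f i)))"
      using trace_tail_nonneg by (auto intro!: mult_right_mono)
    then show ?case using elim(2) m unfolding approx_error_def by linarith
  qed
  then show ?thesis by (rule that)
qed

subsection \<open>Alternatives that stay away from the hypothesis are detected\<close>

lemma Un_markov:
  assumes "integrable (U01n n) (X :: (nat \<Rightarrow> real) \<Rightarrow> real)" "\<And>\<omega>. \<omega> \<in> space (U01n n) \<Longrightarrow> 0 \<le> X \<omega>" "c > 0"
  shows "measure (U01n n) {\<omega> \<in> space (U01n n). X \<omega> \<ge> c} \<le> (LINT \<omega>|U01n n. X \<omega>) / c"
  using integral_Markov_inequality_measure[OF assms(1), of "space (U01n n)" c] assms(2,3) by auto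

text \<open>A sum of indicators approximates the minimum of \<open>s\<close> and a constant. It expresses truncated means
  by finitely many tail probabilities.\<close>

lemma staircase_bounds:
  assumes "0 \<le> (s::real)" "0 \<le> d"
  shows "min s (real K * d) \<le> d * (\<Sum>k<K. of_bool (s > real k * d))"
    and "d * (\<Sum>k<K. of_bool (s > real k * d)) \<le> min (s + d) (real K * d)"
  using assms by (induction K) (auto simp: min_def algebra_simps split: if_splits)

text \<open>Fubini's theorem reduces the moments to those of the empirical process at the point \<open>x + prim f x\<close>.
  The shift is deterministic and the process centered, so the mean of the statistic splits.\<close>

lemma shifted_emp_moments:
  assumes "alternative f" "n \<ge> 1"
  defines "Y \<equiv> \<lambda>\<omega>. (LINT x|U01. (emp n \<omega> (x + prim f x))\<^sup>2)"
  shows "integrable (U01n n) Y" "(LINT \<omega>|U01n n. Y \<omega>) \<le> 1 / 4"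
    and "integrable (U01n n) (\<lambda>\<omega>. (Y \<omega>)\<^sup>2)" "(LINT \<omega>|U01n n. (Y \<omega>)\<^sup>2) \<le> 1536"
    and "integrable (U01n n) (stat n f)" "(LINT \<omega>|U01n n. stat n f \<omega>) \<ge> 1 / 6 - l2norm f + drift n f"
proof -
  note f[measurable] = alternative_L2[OF assms(1)]
  let ?F = "\<lambda>x. x + prim f x"
  note F = shifted_range[OF assms(1)]
  have m: "(\<lambda>(\<omega>, x). (emp n \<omega> (?F x)) ^ k) \<in> borel_measurable (U01n n \<Otimes>\<^sub>M U01)" for k by measurable
  have b: "\<bar>(\<lambda>(\<omega>, x). (emp n \<omega> (?F x)) ^ k) (\<omega>, x)\<bar> \<le> sqrt n ^ k" if "\<omega> \<in> space (U01n n)" "x \<in> {0<..<1}" for \<omega> x k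
    using power_mono[OF abs_emp_le[OF F[OF that(2)] that(1)], of k] by (simp add: power_abs)
  show Y: "integrable (U01n n) Y" unfolding Y_def using Un_Fubini_bounded(1)[OF m b, of 2] by simp
  have "(LINT \<omega>|U01n n. Y \<omega>) = (LINT x|U01. LINT \<omega>|U01n n. (emp n \<omega> (?F x))\<^sup>2)"
    unfolding Y_def using Un_Fubini_bounded(2)[OF m b, of 2] by simp
  also have "\<dots> \<le> (LINT x|U01. 1 / 4)"
  proof (rule integral_mono)
    show "integrable U01 (\<lambda>x. LINT \<omega>|U01n n. (emp n \<omega> (?F x))\<^sup>2)" using Un_Fubini_bounded(3)[OF m b, of 2] by simp
    fix x assume "x \<in> space U01"
    then have "(LINT \<omega>|U01n n. (emp n \<omega> (?F x))\<^sup>2) = ?F x * (1 - ?F x)"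
      using F assms(2) by (intro emp_moments) auto
    also have "\<dots> = 1/4 - (?F x - 1/2)\<^sup>2" by (simp add: power2_eq_square algebra_simps)
    finally show "(LINT \<omega>|U01n n. (emp n \<omega> (?F x))\<^sup>2) \<le> 1 / 4" by simp
  qed simp
  finally show "(LINT \<omega>|U01n n. Y \<omega>) \<le> 1 / 4" using U01.prob_space by simp
  have Y2: "(Y \<omega>)\<^sup>2 \<le> (LINT x|U01. (emp n \<omega> (?F x)) ^ 4)" if "\<omega> \<in> space (U01n n)" for \<omega>
  proof -
    have L: "(\<lambda>x. (emp n \<omega> (?F x))\<^sup>2) \<in> L2"
    proof (rule L2_bounded)
      show "(\<lambda>x. (emp n \<omega> (?F x))\<^sup>2) \<in> borel_measurable U01"
        using L2_measurable[OF L2_emp_shifted[OF assms(1) that]] by simp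
      show "\<bar>(emp n \<omega> (?F x))\<^sup>2\<bar> \<le> sqrt n ^ 2" if "x \<in> {0<..<1}" for x
        using b[OF \<open>\<omega> \<in> _\<close> that, of 2] by simp
    qed
    have "Y \<omega> \<le> l2norm (\<lambda>x. (emp n \<omega> (?F x))\<^sup>2)"
      using integral_abs_le_l2norm[OF L] by (simp add: Y_def)
    then have "(Y \<omega>)\<^sup>2 \<le> (l2norm (\<lambda>x. (emp n \<omega> (?F x))\<^sup>2))\<^sup>2"
      by (intro power_mono) (simp_all add: Y_def)
    then show ?thesis by (simp add: l2norm_square l2inner_self flip: power_mult)
  qed
  have int4: "integrable (U01n n) (\<lambda>\<omega>. LINT x|U01. (emp n \<omega> (?F x)) ^ 4)"
    using Un_Fubini_bounded(1)[OF m b, of 4] by simp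
  show Y2i: "integrable (U01n n) (\<lambda>\<omega>. (Y \<omega>)\<^sup>2)"
  proof (rule Bochner_Integration.integrable_bound[OF int4])
    show "(\<lambda>\<omega>. (Y \<omega>)\<^sup>2) \<in> borel_measurable (U01n n)"
      using borel_measurable_integrable[OF Y] by simp
    show "AE \<omega> in U01n n. norm ((Y \<omega>)\<^sup>2) \<le> norm (LINT x|U01. (emp n \<omega> (?F x)) ^ 4)"
      using Y2 by (intro AE_I2) force
  qed
  have "(LINT \<omega>|U01n n. (Y \<omega>)\<^sup>2) \<le> (LINT \<omega>|U01n n. LINT x|U01. (emp n \<omega> (?F x)) ^ 4)"
    by (intro integral_mono Y2i int4 Y2)
  also have "\<dots> = (LINT x|U01. LINT \<omega>|U01n n. (emp n \<omega> (?F x)) ^ 4)"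
    using Un_Fubini_bounded(2)[OF m b, of 4] by simp
  also have "\<dots> \<le> (LINT x|U01. 1536)"
    using Un_Fubini_bounded(3)[OF m b, of 4] F assms(2)
    by (intro integral_mono) (auto intro!: emp_moment4)
  finally show "(LINT \<omega>|U01n n. (Y \<omega>)\<^sup>2) \<le> 1536" using U01.prob_space by simp
  have ms: "(\<lambda>(\<omega>, x). (emp n \<omega> (?F x) + sqrt n * prim f x)\<^sup>2) \<in> borel_measurable (U01n n \<Otimes>\<^sub>M U01)" by measurable
  have bs: "\<bar>(\<lambda>(\<omega>, x). (emp n \<omega> (?F x) + sqrt n * prim f x)\<^sup>2) (\<omega>, x)\<bar> \<le> (sqrt n + sqrt n * l2norm f)\<^sup>2"
    if "\<omega> \<in> space (U01n n)" "x \<in> {0<..<1}" for \<omega> x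
  proof -
    have "\<bar>emp n \<omega> (?F x) + sqrt n * prim f x\<bar> \<le> sqrt n + sqrt n * l2norm f"
      using abs_emp_le[OF F[OF that(2)] that(1)] mult_left_mono[OF abs_prim_le[OF f, of x], of "sqrt n"]
      by (auto simp: abs_mult intro!: order_trans[OF abs_triangle_ineq] add_mono)
    then have "\<bar>emp n \<omega> (?F x) + sqrt n * prim f x\<bar>\<^sup>2 \<le> (sqrt n + sqrt n * l2norm f)\<^sup>2"
      by (intro power_mono) auto
    then show ?thesis by simp
  qed
  show "integrable (U01n n) (stat n f)"
    using Un_Fubini_bounded(1)[OF ms bs] by (simp add: stat_def[abs_def])
  have xx: "(LINT x|U01. x * (1 - x)) = 1 / 6"
  proof -
    have "(LINT x|U01. x * (1 - x)) = (1\<^sup>2 / 2 - 1 ^ 3 / 3) - (0\<^sup>2 / 2 - 0 ^ 3 / (3::real))"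
      by (rule U01_integral) (auto intro!: derivative_eq_intros continuous_intros simp: power2_eq_square algebra_simps)
    then show ?thesis by simp
  qed
  have I: "integrable U01 (\<lambda>x. x * (1 - x))" "integrable U01 (\<lambda>x. \<bar>prim f x\<bar>)" "integrable U01 (\<lambda>x. real n * (prim f x)\<^sup>2)"
    using L2_square_integrable[OF L2_prim[OF f]] L2_integrable[OF L2_prim[OF f]]
    by (auto intro!: U01_integrable_continuous continuous_intros)
  have "1 / 6 - l2norm f + drift n f \<le> 1/6 - (LINT x|U01. \<bar>prim f x\<bar>) + drift n f"
    using integral_abs_le_l2norm[OF L2_prim[OF f]] l2norm_prim_le[OF f] by simp
  also have "\<dots> = (LINT x|U01. x * (1 - x) - \<bar>prim f x\<bar> + real n * (prim f x)\<^sup>2)"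
    using I by (simp add: xx drift_def l2norm_square l2inner_self)
  also have "\<dots> \<le> (LINT x|U01. LINT \<omega>|U01n n. (emp n \<omega> (?F x) + sqrt n * prim f x)\<^sup>2)"
  proof (rule integral_mono)
    show "integrable U01 (\<lambda>x. x * (1 - x) - \<bar>prim f x\<bar> + real n * (prim f x)\<^sup>2)" using I by simp
    show "integrable U01 (\<lambda>x. LINT \<omega>|U01n n. (emp n \<omega> (?F x) + sqrt n * prim f x)\<^sup>2)"
      using Un_Fubini_bounded(3)[OF ms bs] by simp
    fix x assume "x \<in> space U01"
    then have x: "x \<in> {0<..<1}" by simp
    note E = emp_moments[OF F[OF x] assms(2)]
    have E2: "integrable (U01n n) (\<lambda>\<omega>. (emp n \<omega> (?F x))\<^sup>2)"
      using b[OF _ x, of _ 2] by (intro Un.integrable_const_bound[where B="sqrt n ^ 2"]) auto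
    have "(LINT \<omega>|U01n n. (emp n \<omega> (?F x) + sqrt n * prim f x)\<^sup>2)
        = (LINT \<omega>|U01n n. (emp n \<omega> (?F x))\<^sup>2 + (2 * sqrt n * prim f x) * emp n \<omega> (?F x) + real n * (prim f x)\<^sup>2)"
      by (intro Bochner_Integration.integral_cong refl) (simp add: power2_sum power_mult_distrib algebra_simps)
    also have "\<dots> = ?F x * (1 - ?F x) + real n * (prim f x)\<^sup>2"
      using E E2 Un.prob_space[of n] by simp
    finally have E3: "(LINT \<omega>|U01n n. (emp n \<omega> (?F x) + sqrt n * prim f x)\<^sup>2) = ?F x * (1 - ?F x) + real n * (prim f x)\<^sup>2" .
    have "?F x * (1 - ?F x) \<ge> x * (1 - x) - \<bar>prim f x\<bar>"
    proof -
      have "?F x * (1 - ?F x) - x * (1 - x) = prim f x * (1 - x - ?F x)" by (simp add: algebra_simps)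
      moreover have "\<bar>prim f x * (1 - x - ?F x)\<bar> \<le> \<bar>prim f x\<bar> * 1"
        unfolding abs_mult using F[OF x] x by (intro mult_left_mono) auto
      ultimately show ?thesis by linarith
    qed
    then show "x * (1 - x) - \<bar>prim f x\<bar> + real n * (prim f x)\<^sup>2 \<le> (LINT \<omega>|U01n n. (emp n \<omega> (?F x) + sqrt n * prim f x)\<^sup>2)"
      unfolding E3 by simp
  qed
  also have "\<dots> = (LINT \<omega>|U01n n. stat n f \<omega>)"
    using Un_Fubini_bounded(2)[OF ms bs] by (simp add: stat_def)
  finally show "(LINT \<omega>|U01n n. stat n f \<omega>) \<ge> 1 / 6 - l2norm f + drift n f" .
qed


text \<open>The mean of the statistic under \<open>f\<close> exceeds its null mean 1/6 by almost the drift. If the tests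
  were useless at every threshold, the tail probabilities of the two versions would nearly agree, and
  so would their truncated means; but second moments of the statistic show that truncation at a high
  level loses little of the mean. The second moments are bounded as long as the drift is; a large
  drift is detected directly.\<close>

lemma detection:
  assumes "\<delta> > 0"
  obtains \<eta> \<kappa> where "\<eta> > 0" "\<kappa> > 0"
    "\<And>n f. n \<ge> 1 \<Longrightarrow> alternative f \<Longrightarrow> l2norm f \<le> \<kappa> \<Longrightarrow> drift n f \<ge> \<delta> \<Longrightarrow>
       \<exists>t. type_I n (cvm_test n t) + type_II n (cvm_test n t) f \<le> 1 - \<eta>"
proof -
  define M where "M = 4 * 12936 / \<delta>"
  define d where "d = \<delta> / 8"
  define K where "K = nat \<lceil>M / d\<rceil> + 1"
  define \<eta> where "\<eta> = min (1 / 2) (\<delta> / (8 * (real K * d)))"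
  have d: "d > 0" using assms by (simp add: d_def)
  have M: "M > 0" using assms by (simp add: M_def)
  have "real K \<ge> M / d" unfolding K_def by linarith
  then have KM: "real K * d \<ge> M" using d by (simp add: field_simps)
  have Kd: "real K * d > 0" using KM M by linarith
  have \<eta>: "\<eta> > 0" using assms Kd by (simp add: \<eta>_def)
  have "\<eta> \<le> \<delta> / (8 * (real K * d))" by (simp add: \<eta>_def)
  then have \<eta>K: "real K * d * \<eta> \<le> \<delta> / 8" using Kd by (simp add: field_simps)
  show ?thesis
  proof
    show "\<eta> > 0" "\<delta> / 4 > 0" using \<eta> assms by auto
    fix n f assume n: "n \<ge> 1" and alt: "alternative f" and small: "l2norm f \<le> \<delta> / 4" and dr: "drift n f \<ge> \<delta>"
    note f = alternative_L2[OF alt]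
    note [measurable] = measurable_stat[OF f]
    let ?P = "\<lambda>Q. measure (U01n n) {\<omega> \<in> space (U01n n). Q \<omega>}"
    define Y where "Y \<omega> = (LINT x|U01. (emp n \<omega> (x + prim f x))\<^sup>2)" for \<omega>
    note Ym = shifted_emp_moments[OF alt n, folded Y_def]
    have Y0: "Y \<omega> \<ge> 0" for \<omega> by (simp add: Y_def)
    have tests: "type_I n (cvm_test n (\<tau> / real n)) + type_II n (cvm_test n (\<tau> / real n)) f
        = ?P (\<lambda>\<omega>. null_stat n \<omega> > \<tau>) + ?P (\<lambda>\<omega>. stat n f \<omega> \<le> \<tau>)" for \<tau>
      using n by (simp add: type_I_eq type_II_eq alt stat_zero)
    have compl: "?P (\<lambda>\<omega>. stat n f \<omega> \<le> \<tau>) = 1 - ?P (\<lambda>\<omega>. stat n f \<omega> > \<tau>)" for \<tau>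
      by (subst Un.prob_neg[symmetric]) (auto simp: not_less)
    have nY: "l2norm (\<lambda>x. emp n \<omega> (x + prim f x)) = sqrt (Y \<omega>)" for \<omega>
      by (simp add: l2norm_def l2inner_self Y_def)
    show "\<exists>t. type_I n (cvm_test n t) + type_II n (cvm_test n t) f \<le> 1 - \<eta>"
    proof (cases "drift n f > 9")
      case True
      \<comment> \<open>a large drift dominates the fluctuations: Markov's inequality at the threshold 4\<close>
      have "stat n f \<omega> \<le> 4 \<Longrightarrow> Y \<omega> \<ge> 1" if "\<omega> \<in> space (U01n n)" for \<omega>
      proof -
        assume "stat n f \<omega> \<le> 4"
        then have "(l2norm (\<lambda>x. emp n \<omega> (x + prim f x) + sqrt n * prim f x))\<^sup>2 \<le> 2\<^sup>2"
          by (simp add: stat_eq_norm)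
        then have "l2norm (\<lambda>x. emp n \<omega> (x + prim f x) + sqrt n * prim f x) \<le> 2"
          by (rule power2_le_imp_le) simp
        moreover have "sqrt (drift n f) \<le> l2norm (\<lambda>x. emp n \<omega> (x + prim f x) + sqrt n * prim f x) + sqrt (Y \<omega>)"
        proof -
          have "l2norm (\<lambda>x. (emp n \<omega> (x + prim f x) + sqrt n * prim f x) + (-1) * emp n \<omega> (x + prim f x))
            \<le> l2norm (\<lambda>x. emp n \<omega> (x + prim f x) + sqrt n * prim f x) + l2norm (\<lambda>x. (-1) * emp n \<omega> (x + prim f x))"
            by (intro l2norm_triangle L2_add L2_scale L2_emp_shifted L2_prim f alt that)
          moreover have "l2norm (\<lambda>x. (-1) * emp n \<omega> (x + prim f x)) = sqrt (Y \<omega>)"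
            unfolding l2norm_scale nY by simp
          moreover have "(\<lambda>x. (emp n \<omega> (x + prim f x) + sqrt n * prim f x) + (-1) * emp n \<omega> (x + prim f x)) = (\<lambda>x. sqrt n * prim f x)"
            by simp
          ultimately show ?thesis by (simp only: l2norm_shift)
        qed
        moreover have "sqrt 9 \<le> sqrt (drift n f)" using True by (intro real_sqrt_le_mono) simp
        moreover have "sqrt 9 = (3::real)" by simp
        ultimately have "1 \<le> sqrt (Y \<omega>)" by linarith
        then show "Y \<omega> \<ge> 1" by simp
      qed
      then have "?P (\<lambda>\<omega>. stat n f \<omega> \<le> 4) \<le> ?P (\<lambda>\<omega>. Y \<omega> \<ge> 1)"
        using borel_measurable_integrable[OF Ym(1)] by (intro Un.finite_measure_mono) auto
      also have "\<dots> \<le> 1 / 4" using Un_markov[OF Ym(1) Y0, of 1] Ym(2) by simp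
      finally have "?P (\<lambda>\<omega>. stat n f \<omega> \<le> 4) \<le> 1 / 4" .
      moreover have "?P (\<lambda>\<omega>. null_stat n \<omega> > 4) \<le> ?P (\<lambda>\<omega>. null_stat n \<omega> \<ge> 4)"
        by (intro Un.finite_measure_mono) auto
      moreover have "?P (\<lambda>\<omega>. null_stat n \<omega> \<ge> 4) \<le> 1 / 24"
        using Un_markov[OF expectation_null_stat(1)[OF n] null_stat_nonneg, of 4] expectation_null_stat(2)[OF n] by simp
      moreover have "\<eta> \<le> 1 / 2" by (simp add: \<eta>_def)
      ultimately show ?thesis using tests[of 4] by (intro exI[of _ "4 / real n"]) linarith
    next
      case False
      show ?thesis
      proof (rule ccontr)
        assume "\<not> ?thesis"
        then have bad0: "?P (\<lambda>\<omega>. null_stat n \<omega> > \<tau>) + ?P (\<lambda>\<omega>. stat n f \<omega> \<le> \<tau>) > 1 - \<eta>" for \<tau>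
          using tests[of \<tau>] by (metis not_le)
        have bad: "?P (\<lambda>\<omega>. stat n f \<omega> > \<tau>) \<le> ?P (\<lambda>\<omega>. null_stat n \<omega> > \<tau>) + \<eta>" for \<tau>
          using bad0[of \<tau>] compl[of \<tau>] by linarith
        have ob: "integrable (U01n n) (\<lambda>\<omega>. of_bool (X \<omega> > \<tau>) :: real)"
          "(LINT \<omega>|U01n n. of_bool (X \<omega> > \<tau>)) = ?P (\<lambda>\<omega>. X \<omega> > \<tau>)"
          if [measurable]: "X \<in> borel_measurable (U01n n)" for X and \<tau> :: real
        proof -
          have eq: "of_bool (X \<omega> > \<tau>) = (indicator {\<omega> \<in> space (U01n n). X \<omega> > \<tau>} \<omega> :: real)" if "\<omega> \<in> space (U01n n)" for \<omega>
            using that by (simp add: indicator_def)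
          show "integrable (U01n n) (\<lambda>\<omega>. of_bool (X \<omega> > \<tau>) :: real)"
            by (subst Bochner_Integration.integrable_cong[OF refl eq]) (auto simp: Un.emeasure_eq_measure)
          have "(LINT \<omega>|U01n n. of_bool (X \<omega> > \<tau>)) = (LINT \<omega>|U01n n. indicator {\<omega> \<in> space (U01n n). X \<omega> > \<tau>} \<omega> :: real)"
            by (intro Bochner_Integration.integral_cong refl eq)
          also have "\<dots> = ?P (\<lambda>\<omega>. X \<omega> > \<tau>)"
            by (simp add: Int_def) (intro arg_cong[of _ _ "measure _"], auto)
          finally show "(LINT \<omega>|U01n n. of_bool (X \<omega> > \<tau>)) = ?P (\<lambda>\<omega>. X \<omega> > \<tau>)" .
        qed
        define st where "st X \<omega> = d * (\<Sum>k<K. of_bool (X \<omega> > real k * d))" for X :: "(nat \<Rightarrow> real) \<Rightarrow> real" and \<omega>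
        have st: "integrable (U01n n) (st X)" "(LINT \<omega>|U01n n. st X \<omega>) = d * (\<Sum>k<K. ?P (\<lambda>\<omega>. X \<omega> > real k * d))"
          if "X \<in> borel_measurable (U01n n)" for X
        proof -
          show "integrable (U01n n) (st X)"
            unfolding st_def by (intro integrable_mult_right Bochner_Integration.integrable_sum ob(1)[OF that])
          have "(LINT \<omega>|U01n n. st X \<omega>) = d * (LINT \<omega>|U01n n. (\<Sum>k<K. of_bool (X \<omega> > real k * d)))"
            unfolding st_def by (rule integral_mult_right_zero)
          also have "(LINT \<omega>|U01n n. (\<Sum>k<K. of_bool (X \<omega> > real k * d) :: real)) = (\<Sum>k<K. LINT \<omega>|U01n n. of_bool (X \<omega> > real k * d))"
            by (intro Bochner_Integration.integral_sum ob(1)[OF that])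
          finally show "(LINT \<omega>|U01n n. st X \<omega>) = d * (\<Sum>k<K. ?P (\<lambda>\<omega>. X \<omega> > real k * d))"
            unfolding ob(2)[OF that] .
        qed
        have sf: "integrable (U01n n) (\<lambda>\<omega>. (stat n f \<omega>)\<^sup>2)" "(LINT \<omega>|U01n n. (stat n f \<omega>)\<^sup>2) \<le> 12936"
        proof -
          have le: "(stat n f \<omega>)\<^sup>2 \<le> 8 * (Y \<omega>)\<^sup>2 + 8 * 81" if "\<omega> \<in> space (U01n n)" for \<omega>
          proof -
            have "l2norm (\<lambda>x. emp n \<omega> (x + prim f x) + sqrt n * prim f x) \<le> sqrt (Y \<omega>) + sqrt (drift n f)"
              using l2norm_triangle[OF L2_emp_shifted[OF alt that] L2_scale[OF L2_prim[OF f], of "sqrt n"]]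
              by (simp add: nY l2norm_shift)
            then have "stat n f \<omega> \<le> (sqrt (Y \<omega>) + sqrt (drift n f))\<^sup>2"
              unfolding stat_eq_norm by (intro power_mono) auto
            also have "\<dots> \<le> 2 * Y \<omega> + 2 * drift n f"
              using zero_le_power2[of "sqrt (Y \<omega>) - sqrt (drift n f)"] Y0[of \<omega>]
              by (simp add: power2_sum power2_diff)
            also have "\<dots> \<le> 2 * Y \<omega> + 18" using False by simp
            finally have "(stat n f \<omega>)\<^sup>2 \<le> (2 * Y \<omega> + 18)\<^sup>2"
              using stat_nonneg by (intro power_mono)
            also have "\<dots> \<le> 8 * (Y \<omega>)\<^sup>2 + 8 * 81"
              using zero_le_power2[of "2 * Y \<omega> - 18"] by (simp add: power2_sum power2_diff power_mult_distrib)
            finally show ?thesis .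
          qed
          have I: "integrable (U01n n) (\<lambda>\<omega>. 8 * (Y \<omega>)\<^sup>2 + 8 * 81)" using Ym(3) by simp
          show i: "integrable (U01n n) (\<lambda>\<omega>. (stat n f \<omega>)\<^sup>2)"
          proof (rule Bochner_Integration.integrable_bound[OF I])
            show "AE \<omega> in U01n n. norm ((stat n f \<omega>)\<^sup>2) \<le> norm (8 * (Y \<omega>)\<^sup>2 + 8 * 81)"
              using le by (intro AE_I2) force
          qed measurable
          have "(LINT \<omega>|U01n n. (stat n f \<omega>)\<^sup>2) \<le> (LINT \<omega>|U01n n. 8 * (Y \<omega>)\<^sup>2 + 8 * 81)"
            by (intro integral_mono i I le)
          also have "\<dots> = 8 * (LINT \<omega>|U01n n. (Y \<omega>)\<^sup>2) + 8 * 81"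
            using Ym(3) Un.prob_space[of n] by simp
          also have "\<dots> \<le> 12936" using Ym(4) by simp
          finally show "(LINT \<omega>|U01n n. (stat n f \<omega>)\<^sup>2) \<le> 12936" .
        qed
        have "1 / 6 + 3 * \<delta> / 4 \<le> (LINT \<omega>|U01n n. stat n f \<omega>)" using Ym(6) small dr by linarith
        moreover have "(LINT \<omega>|U01n n. (stat n f \<omega>)\<^sup>2) / M \<le> \<delta> / 4"
          using sf(2) M assms by (simp add: M_def field_simps)
        ultimately have "1 / 6 + \<delta> / 2 \<le> (LINT \<omega>|U01n n. stat n f \<omega> - (stat n f \<omega>)\<^sup>2 / M)"
          using Ym(5) sf(1) by simp
        also have "\<dots> \<le> (LINT \<omega>|U01n n. st (stat n f) \<omega>)"
        proof (rule integral_mono)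
          show "integrable (U01n n) (\<lambda>\<omega>. stat n f \<omega> - (stat n f \<omega>)\<^sup>2 / M)" using Ym(5) sf(1) by simp
          fix \<omega>
          define z where "z = stat n f \<omega>"
          have "z - z\<^sup>2 / M \<le> min z M"
          proof -
            have "0 \<le> (M - z)\<^sup>2 + z * M" using M stat_nonneg[of n f \<omega>] by (simp add: z_def)
            then have "z * M - z\<^sup>2 \<le> M * M" by (simp add: power2_eq_square algebra_simps)
            then have "z - z\<^sup>2 / M \<le> M" using M by (simp add: field_simps)
            moreover have "z - z\<^sup>2 / M \<le> z" using M by simp
            ultimately show ?thesis by simp
          qed
          also have "\<dots> \<le> min z (real K * d)" using KM by simp
          also have "\<dots> \<le> st (stat n f) \<omega>"
            unfolding st_def z_def by (intro staircase_bounds stat_nonneg) (use d in simp)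
          finally show "stat n f \<omega> - (stat n f \<omega>)\<^sup>2 / M \<le> st (stat n f) \<omega>" by (simp add: z_def)
        qed (intro st, measurable)
        also have "\<dots> = d * (\<Sum>k<K. ?P (\<lambda>\<omega>. stat n f \<omega> > real k * d))" by (intro st) measurable
        also have "\<dots> \<le> d * (\<Sum>k<K. ?P (\<lambda>\<omega>. null_stat n \<omega> > real k * d) + \<eta>)"
          using d by (intro mult_left_mono sum_mono bad) auto
        also have "\<dots> = (LINT \<omega>|U01n n. st (null_stat n) \<omega>) + real K * d * \<eta>"
          by (simp add: st sum.distrib algebra_simps)
        also have "(LINT \<omega>|U01n n. st (null_stat n) \<omega>) \<le> (LINT \<omega>|U01n n. null_stat n \<omega> + d)"
        proof (rule integral_mono)
          show "integrable (U01n n) (\<lambda>\<omega>. null_stat n \<omega> + d)" using expectation_null_stat[OF n] by simp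
          show "st (null_stat n) \<omega> \<le> null_stat n \<omega> + d" for \<omega>
            using staircase_bounds(2)[of "null_stat n \<omega>" d K] null_stat_nonneg d unfolding st_def by force
        qed (intro st, measurable)
        also have "\<dots> = 1 / 6 + d" using expectation_null_stat[OF n] Un.prob_space[of n] by simp
        finally have "1 / 6 + \<delta> / 2 \<le> 1 / 6 + d + real K * d * \<eta>" by simp
        moreover have "d = \<delta> / 8" by (simp add: d_def)
        ultimately show False using \<eta>K assms by linarith
      qed
    qed
  qed
qed

lemma inconsistent_imp_drift:
  assumes "cvm_inconsistent \<nu> f" "\<And>i. \<nu> i \<ge> 1" "\<forall>\<^sub>F i in sequentially. alternative (f i)"
    and "(\<lambda>i. l2norm (f i)) \<longlonglongrightarrow> 0"
  shows "(\<lambda>i. drift (\<nu> i) (f i)) \<longlonglongrightarrow> 0"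
proof (rule ccontr)
  assume "\<not> ?thesis"
  then obtain \<delta> where \<delta>: "\<delta> > 0" "\<not> (\<forall>\<^sub>F i in sequentially. dist (drift (\<nu> i) (f i)) 0 < \<delta>)"
    unfolding tendsto_iff by blast
  then have \<delta>2: "\<exists>\<^sub>F i in sequentially. drift (\<nu> i) (f i) \<ge> \<delta>"
    by (simp add: frequently_def not_le)
  obtain \<eta> \<kappa> where \<eta>: "\<eta> > 0" "\<kappa> > 0" and det: "\<And>n f. n \<ge> 1 \<Longrightarrow> alternative f \<Longrightarrow> l2norm f \<le> \<kappa> \<Longrightarrow> drift n f \<ge> \<delta> \<Longrightarrow>
       \<exists>t. type_I n (cvm_test n t) + type_II n (cvm_test n t) f \<le> 1 - \<eta>"
    using detection[OF \<delta>(1)] by metis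
  define t where "t i = (SOME t. type_I (\<nu> i) (cvm_test (\<nu> i) t) + type_II (\<nu> i) (cvm_test (\<nu> i) t) (f i) \<le> 1 - \<eta>)" for i
  have "\<forall>\<^sub>F i in sequentially. l2norm (f i) \<le> \<kappa>"
    using order_tendstoD(2)[OF assms(4) \<eta>(2)] by eventually_elim simp
  from frequently_eventually_conj[OF \<delta>2 eventually_conj[OF this assms(3)]]
  have freq: "\<exists>\<^sub>F i in sequentially. type_I (\<nu> i) (cvm_test (\<nu> i) (t i)) + type_II (\<nu> i) (cvm_test (\<nu> i) (t i)) (f i) \<le> 1 - \<eta>"
  proof (rule frequently_elim1)
    fix i assume "(l2norm (f i) \<le> \<kappa> \<and> alternative (f i)) \<and> drift (\<nu> i) (f i) \<ge> \<delta>"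
    then show "type_I (\<nu> i) (cvm_test (\<nu> i) (t i)) + type_II (\<nu> i) (cvm_test (\<nu> i) (t i)) (f i) \<le> 1 - \<eta>"
      unfolding t_def by (intro someI_ex[of "\<lambda>t. type_I _ (cvm_test _ t) + type_II _ (cvm_test _ t) _ \<le> _"] det assms(2)) auto
  qed
  have "1 \<le> liminf (\<lambda>i. ereal (type_I (\<nu> i) (cvm_test (\<nu> i) (t i)) + type_II (\<nu> i) (cvm_test (\<nu> i) (t i)) (f i)))"
    using assms(1) by (simp add: cvm_inconsistent_def)
  moreover have "ereal (1 - \<eta>) < 1" using \<eta>(1) by simp
  ultimately have "\<forall>\<^sub>F i in sequentially. 1 - \<eta> < type_I (\<nu> i) (cvm_test (\<nu> i) (t i)) + type_II (\<nu> i) (cvm_test (\<nu> i) (t i)) (f i)"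
    unfolding le_Liminf_iff less_ereal.simps(1)[symmetric] by blast
  with freq show False by (simp add: frequently_def not_le)
qed

section \<open>The limit law of the null statistic\<close>

abbreviation Gauss :: "real measure" where "Gauss \<equiv> std_normal_distribution"

interpretation gauss: prob_space Gauss by (rule real_distribution.axioms(1)[OF real_dist_normal_dist])
interpretation Gs: sequence_space Gauss by unfold_locales

definition GaussN :: "(nat \<Rightarrow> real) measure" where "GaussN = PiM UNIV (\<lambda>_. Gauss)"

interpretation GN: prob_space GaussN unfolding GaussN_def by (rule Gs.prob_space_axioms)

lemma sets_Gauss [measurable_cong]: "sets Gauss = sets borel" by simp

lemma measurable_GaussN_component [measurable]: "(\<lambda>W. W j) \<in> borel_measurable GaussN"
proof -
  have "(\<lambda>W. W j) \<in> measurable GaussN Gauss" unfolding GaussN_def by (rule measurable_component_singleton) simp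
  then show ?thesis by simp
qed

lemma Gauss_component: "distr GaussN Gauss (\<lambda>W. W j) = Gauss"
  unfolding GaussN_def by (rule Gs.PiM_component) simp

lemma GaussN_square: "integrable GaussN (\<lambda>W. (W j)\<^sup>2)" "(LINT W|GaussN. (W j)\<^sup>2) = 1"
proof -
  have [measurable]: "(\<lambda>W. W j) \<in> measurable GaussN Gauss" by simp
  have "integrable Gauss (\<lambda>x. x\<^sup>2)" "(LINT x|Gauss. x\<^sup>2) = 1"
    using std_normal_distribution_even_moments[of 1] by (simp_all add: numeral_2_eq_2)
  then show "integrable GaussN (\<lambda>W. (W j)\<^sup>2)" "(LINT W|GaussN. (W j)\<^sup>2) = 1"
    using integrable_distr_eq[of "\<lambda>W. W j" GaussN Gauss "\<lambda>x. x\<^sup>2"] integral_distr[of "\<lambda>W. W j" GaussN Gauss "\<lambda>x. x\<^sup>2"]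
    by (simp_all add: Gauss_component)
qed

text \<open>Only finitely many coordinates of the Gaussian sequence are involved.\<close>

lemma GaussN_char:
  "(LINT W|GaussN. iexp (\<Sum>j<m. W j * c j)) = of_real (exp (- (\<Sum>j<m. (c j)\<^sup>2) / 2))"
proof -
  have D: "distr GaussN (PiM {..<m} (\<lambda>_. Gauss)) (\<lambda>W. restrict W {..<m}) = PiM {..<m} (\<lambda>_. Gauss)"
    unfolding GaussN_def by (rule Gs.distr_PiM_restrict_finite) auto
  have int: "integrable Gauss (\<lambda>w. iexp (w * c j))" for j
    by (rule gauss.integrable_const_bound[where B=1]) auto
  have val: "(LINT w|Gauss. iexp (w * c j)) = of_real (exp (- (c j)\<^sup>2 / 2))" for j
    using fun_cong[OF char_std_normal_distribution, of "c j"] unfolding char_def by (simp add: mult.commute)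
  have "(LINT W|GaussN. iexp (\<Sum>j<m. W j * c j)) = (LINT W|GaussN. (\<Prod>j<m. iexp (restrict W {..<m} j * c j)))"
    by (intro Bochner_Integration.integral_cong refl) (auto simp: exp_sum sum_distrib_left intro!: prod.cong)
  also have "\<dots> = (LINT v|distr GaussN (PiM {..<m} (\<lambda>_. Gauss)) (\<lambda>W. restrict W {..<m}). (\<Prod>j<m. iexp (v j * c j)))"
  proof (rule integral_distr[symmetric])
    show "(\<lambda>W. restrict W {..<m}) \<in> measurable GaussN (PiM {..<m} (\<lambda>_. Gauss))"
      unfolding GaussN_def by (rule measurable_restrict_subset) simp
    show "(\<lambda>v. \<Prod>j<m. iexp (v j * c j)) \<in> borel_measurable (PiM {..<m} (\<lambda>_. Gauss))"
    proof (rule borel_measurable_prod)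
      fix j assume "j \<in> {..<m}"
      then have "(\<lambda>v. v j) \<in> borel_measurable (PiM {..<m} (\<lambda>_. Gauss))"
        using measurable_component_singleton[of j "{..<m}" "\<lambda>_. Gauss"] by simp
      from measurable_compose[OF this, of "\<lambda>x. iexp (x * c j)" borel]
      show "(\<lambda>v. iexp (v j * c j)) \<in> borel_measurable (PiM {..<m} (\<lambda>_. Gauss))" by simp
    qed
  qed
  also have "\<dots> = (LINT v|PiM {..<m} (\<lambda>_. Gauss). (\<Prod>j<m. iexp (v j * c j)))"
    unfolding D ..
  also have "\<dots> = (\<Prod>j<m. LINT w|Gauss. iexp (w * c j))"
    by (rule Gs.product_integral_prod[OF _ int]) simp
  also have "\<dots> = of_real (exp (- (\<Sum>j<m. (c j)\<^sup>2) / 2))"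
    unfolding val of_real_prod[symmetric] exp_sum[OF finite_lessThan, symmetric]
    by (simp add: sum_negf sum_divide_distrib)
  finally show ?thesis .
qed

text \<open>The central limit theorem for bounded summands, in terms of characteristic functions at the
  point 1.\<close>

lemma iid_char_tendsto:
  assumes [measurable]: "g \<in> borel_measurable U01" and B: "\<And>u. u \<in> {0<..<1} \<Longrightarrow> \<bar>g u\<bar> \<le> B"
    and mean: "(LINT u|U01. g u) = 0"
  shows "(\<lambda>n. LINT \<omega>|U01n n. iexp ((\<Sum>i<n. g (\<omega> i)) / sqrt n)) \<longlonglongrightarrow> of_real (exp (- (LINT u|U01. (g u)\<^sup>2) / 2))"
proof -
  define s2 where "s2 = (LINT u|U01. (g u)\<^sup>2)"
  have s20: "s2 \<ge> 0" by (simp add: s2_def)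
  define \<mu> where "\<mu> = distr U01 borel g"
  interpret mu: real_distribution \<mu> unfolding \<mu>_def by simp
  have L2g: "g \<in> L2" by (rule L2_bounded[OF assms(1) B])
  have B0: "B \<ge> 0" using B[of "1/2"] by force
  have char_eq: "char \<mu> t = (LINT u|U01. iexp (t * g u))" for t
    unfolding char_def \<mu>_def by (subst integral_distr) auto
  have eq: "(LINT \<omega>|U01n n. iexp ((\<Sum>i<n. g (\<omega> i)) / sqrt n)) = (char \<mu> (1 / sqrt n)) ^ n" for n
  proof -
    have "(LINT \<omega>|U01n n. iexp ((\<Sum>i<n. g (\<omega> i)) / sqrt n)) = (LINT \<omega>|U01n n. (\<Prod>i<n. iexp (1 / sqrt n * g (\<omega> i))))"
      by (simp add: exp_sum[symmetric] sum_distrib_left sum_divide_distrib)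
    also have "\<dots> = (\<Prod>i<n. LINT u|U01. iexp (1 / sqrt n * g u))"
      by (rule Up.product_integral_prod) (auto intro!: U01.integrable_const_bound[where B=1])
    finally show ?thesis by (simp add: char_eq)
  qed
  have approx: "cmod (char \<mu> (1 / sqrt n) - of_real (1 - s2 / (2 * n))) \<le> B ^ 3 / 6 / (n * sqrt n)" if "n \<ge> 1" for n :: nat
  proof -
    have "(LINT u|U01. min (6 * (g u)\<^sup>2) (\<bar>1 / sqrt n\<bar> * \<bar>g u\<bar> ^ 3)) \<le> (LINT u|U01. 1 / sqrt n * B ^ 3)"
    proof (rule integral_mono)
      show "integrable U01 (\<lambda>u. min (6 * (g u)\<^sup>2) (\<bar>1 / sqrt n\<bar> * \<bar>g u\<bar> ^ 3))"
        by (rule Bochner_Integration.integrable_bound[of _ "\<lambda>u. 6 * (g u)\<^sup>2"])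
           (auto simp: L2_square_integrable[OF L2g] intro!: AE_I2)
      fix u assume "u \<in> space U01"
      then have "\<bar>1 / sqrt n\<bar> * \<bar>g u\<bar> ^ 3 \<le> 1 / sqrt n * B ^ 3"
        using B by (intro mult_mono power_mono) auto
      then show "min (6 * (g u)\<^sup>2) (\<bar>1 / sqrt n\<bar> * \<bar>g u\<bar> ^ 3) \<le> 1 / sqrt n * B ^ 3" by linarith
    qed simp
    also have "\<dots> = 1 / sqrt n * B ^ 3" using U01.prob_space by simp
    finally have le: "(LINT u|U01. min (6 * (g u)\<^sup>2) (\<bar>1 / sqrt n\<bar> * \<bar>g u\<bar> ^ 3)) \<le> 1 / sqrt n * B ^ 3" .
    have "cmod (char \<mu> (1 / sqrt n) - (1 - (1 / sqrt (real n))\<^sup>2 * s2 / 2)) \<le>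
       ((1 / sqrt n)\<^sup>2 / 6) * (LINT u|U01. min (6 * (g u)\<^sup>2) (\<bar>1 / sqrt n\<bar> * \<bar>g u\<bar> ^ 3))"
      using mean by (intro U01.char_approx3') (auto simp: s2_def \<mu>_def L2_integrable[OF L2g] L2_square_integrable[OF L2g])
    also have "\<dots> \<le> ((1 / sqrt n)\<^sup>2 / 6) * (1 / sqrt n * B ^ 3)"
      by (intro mult_left_mono le) simp
    also have "\<dots> = B ^ 3 / 6 / (n * sqrt n)" by (simp add: power_divide)
    finally show ?thesis by (simp add: power_divide mult.commute)
  qed
  have "(\<lambda>n. (char \<mu> (1 / sqrt n)) ^ n - of_real ((1 + (- s2 / 2) / real n) ^ n)) \<longlonglongrightarrow> 0"
  proof (rule Lim_null_comparison)
    obtain N :: nat where N: "real N > s2" using reals_Archimedean2 by blast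
    show "\<forall>\<^sub>F n in sequentially. norm ((char \<mu> (1 / sqrt n)) ^ n - of_real ((1 + (- s2 / 2) / real n) ^ n)) \<le> B ^ 3 / 6 / sqrt n"
    proof (rule eventually_sequentiallyI[of "max 1 N"])
      fix n assume n: "n \<ge> max 1 N"
      then have n1: "real n > 0" and ns: "s2 \<le> real n" using N by (auto intro: order_trans less_imp_le)
      have le1: "cmod (of_real (1 - s2 / (2 * n))) \<le> 1"
      proof -
        have "s2 / (2 * n) \<le> 1" "0 \<le> s2 / (2 * n)" using n1 ns s20 by (auto simp: divide_le_eq)
        then show ?thesis unfolding norm_of_real by linarith
      qed
      have "norm ((char \<mu> (1 / sqrt n)) ^ n - of_real (1 - s2 / (2 * n)) ^ n)
          \<le> n * norm (char \<mu> (1 / sqrt n) - of_real (1 - s2 / (2 * n)))"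
        by (rule norm_power_diff[OF mu.cmod_char_le_1 le1])
      also have "\<dots> \<le> n * (B ^ 3 / 6 / (n * sqrt n))"
        using approx[of n] n by (intro mult_left_mono) auto
      also have "\<dots> = B ^ 3 / 6 / sqrt n" using n1 by simp
      finally show "norm ((char \<mu> (1 / sqrt n)) ^ n - of_real ((1 + (- s2 / 2) / real n) ^ n)) \<le> B ^ 3 / 6 / sqrt n"
        by (simp add: mult.commute)
    qed
    show "(\<lambda>n. B ^ 3 / 6 / sqrt (real n)) \<longlonglongrightarrow> 0"
      by (intro real_tendsto_divide_at_top[OF tendsto_const] filterlim_compose[OF sqrt_at_top filterlim_real_sequentially])
  qed
  from Lim_transform[OF _ this, of "of_real (exp (- s2 / 2))"] have "(\<lambda>n. (char \<mu> (1 / sqrt n)) ^ n) \<longlonglongrightarrow> of_real (exp (- s2 / 2))"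
    using tendsto_of_real[OF tendsto_exp_limit_sequentially] by blast
  then show ?thesis unfolding eq s2_def .
qed

text \<open>Eigenvalues of the covariance kernel, indexed from 0.\<close>

definition eigenvalue :: "nat \<Rightarrow> real" where "eigenvalue j = 1 / (pi * real (Suc j))\<^sup>2"

lemma eigenvalue_pos: "eigenvalue j > 0" by (simp add: eigenvalue_def)

lemma eigenvalue_sums: "eigenvalue sums (1 / 6)"
  unfolding eigenvalue_def[abs_def] using sums_divide[OF inverse_squares_sums, of "pi\<^sup>2"]
  by (simp add: power_mult_distrib mult.commute add.commute)

definition head_energy :: "nat \<Rightarrow> nat \<Rightarrow> (nat \<Rightarrow> real) \<Rightarrow> real" where
  "head_energy m n \<omega> = (\<Sum>j<m. (emp_coef n (Suc j) \<omega>)\<^sup>2)"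

lemma head_energy_eq: "head_energy m n \<omega> = null_stat n \<omega> - tail_energy m n \<omega>"
  unfolding head_energy_def tail_energy_def by (simp add: lessThan_Suc_atMost sum.atLeast1_atMost_eq)

text \<open>For a standard Gaussian vector \<open>W\<close>, averaging \<open>exp (i * sqrt (2 * s) * \<langle>W, v\<rangle>)\<close> over \<open>W\<close> gives
  \<open>exp (- s * \<bar>v\<bar>\<^sup>2)\<close>. Conversely, for fixed \<open>W\<close> the product \<open>\<langle>W, v\<rangle>\<close> with the vector \<open>v\<close> of empirical
  coefficients is a normalized sum of independent variables, to which the one-dimensional central
  limit theorem applies. Exchanging the two averages yields the limit of the Laplace transform of
  \<open>\<bar>v\<bar>\<^sup>2\<close>, already in the form of a Laplace transform of a quadratic form in \<open>W\<close>.\<close>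

lemma head_energy_Laplace_tendsto:
  assumes "s \<ge> 0"
  shows "(\<lambda>n. LINT \<omega>|U01n n. exp (- s * head_energy m n \<omega>)) \<longlonglongrightarrow> (LINT W|GaussN. exp (- s * (\<Sum>j<m. eigenvalue j * (W j)\<^sup>2)))"
proof -
  define q where "q = sqrt (2 * s)"
  have q2: "q\<^sup>2 = 2 * s" using assms by (simp add: q_def)
  let ?X = "\<lambda>n \<omega> W. \<Sum>j<m. W j * (q * emp_coef n (Suc j) \<omega>)"
  define g where "g W u = (\<Sum>j<m. (W j * q / (pi * real (Suc j))) * \<phi> (Suc j) u)" for W :: "nat \<Rightarrow> real" and u
  have X: "?X n \<omega> W = (\<Sum>i<n. g W (\<omega> i)) / sqrt n" for n \<omega> W
  proof -
    have "(\<Sum>i<n. g W (\<omega> i)) = (\<Sum>j<m. (W j * q / (pi * real (Suc j))) * (\<Sum>i<n. \<phi> (Suc j) (\<omega> i)))"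
      unfolding g_def sum_distrib_left by (rule sum.swap)
    then show ?thesis
      by (simp only: sum_divide_distrib[of _ "{..<m}"]) (intro sum.cong refl, simp add: emp_coef_def)
  qed
  have gL: "g W \<in> L2" for W unfolding g_def by (intro L2_sum L2_scale L2_phi)
  have gm: "g W \<in> borel_measurable U01" for W using gL by (rule L2_measurable)
  have gB: "\<bar>g W u\<bar> \<le> (\<Sum>j<m. \<bar>W j * q / (pi * real (Suc j))\<bar> * sqrt 2)" for W u
    unfolding g_def by (intro order_trans[OF sum_abs] sum_mono) (simp only: abs_mult[of _ "\<phi> _ _"], intro mult_left_mono abs_phi_le, simp)
  have gmean: "(LINT u|U01. g W u) = 0" for W
  proof -
    have "l2inner (g W) (\<lambda>_. 1) = 0"
      unfolding g_def l2inner_sum_left[OF L2_scale[OF L2_phi] L2_const] l2inner_scale_left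
      by (intro sum.neutral) (simp add: l2inner_eq)
    then show ?thesis by (simp add: l2inner_eq)
  qed
  have gsq: "(LINT u|U01. (g W u)\<^sup>2) = 2 * s * (\<Sum>j<m. eigenvalue j * (W j)\<^sup>2)" for W
  proof -
    define a where "a j = W j * q / (pi * real (Suc j))" for j
    have "(LINT u|U01. (g W u)\<^sup>2) = l2inner (g W) (g W)" by (simp add: l2inner_self)
    also have "\<dots> = (\<Sum>j<m. \<Sum>k<m. a j * (a k * l2inner (\<phi> (Suc j)) (\<phi> (Suc k))))"
      unfolding g_def a_def[symmetric]
      by (simp add: l2inner_sum_left l2inner_sum_right L2_scale L2_sum l2inner_scale_left l2inner_scale_right sum_distrib_left)
    also have "\<dots> = (\<Sum>j<m. \<Sum>k<m. if k = j then (a j)\<^sup>2 else 0)"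
      by (intro sum.cong refl) (auto simp: l2inner_trig power2_eq_square)
    also have "\<dots> = (\<Sum>j<m. (a j)\<^sup>2)" by (intro sum.cong refl) (subst sum.delta, auto)
    also have "\<dots> = 2 * s * (\<Sum>j<m. eigenvalue j * (W j)\<^sup>2)"
      unfolding sum_distrib_left by (intro sum.cong refl) (simp add: a_def eigenvalue_def power_divide power_mult_distrib q2)
    finally show ?thesis .
  qed
  have swap: "complex_of_real (LINT \<omega>|U01n n. exp (- s * head_energy m n \<omega>)) = (LINT W|GaussN. LINT \<omega>|U01n n. iexp (?X n \<omega> W))" for n
  proof -
    interpret pair_prob_space "U01n n" GaussN ..
    have int: "integrable (U01n n \<Otimes>\<^sub>M GaussN) (\<lambda>(\<omega>, W). iexp (?X n \<omega> W))"
      by (rule integrable_const_bound[where B=1]) (auto intro!: AE_I2)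
    have "complex_of_real (LINT \<omega>|U01n n. exp (- s * head_energy m n \<omega>)) = (LINT \<omega>|U01n n. complex_of_real (exp (- s * head_energy m n \<omega>)))"
      by (rule integral_complex_of_real[symmetric])
    also have "\<dots> = (LINT \<omega>|U01n n. LINT W|GaussN. iexp (?X n \<omega> W))"
    proof (intro Bochner_Integration.integral_cong refl)
      fix \<omega>
      have "- (\<Sum>j<m. (q * emp_coef n (Suc j) \<omega>)\<^sup>2) / 2 = - s * head_energy m n \<omega>"
        by (simp add: head_energy_def power_mult_distrib q2 sum_distrib_left[symmetric])
      then show "complex_of_real (exp (- s * head_energy m n \<omega>)) = (LINT W|GaussN. iexp (?X n \<omega> W))"
        unfolding GaussN_char by simp
    qed
    also have "\<dots> = (LINT W|GaussN. LINT \<omega>|U01n n. iexp (?X n \<omega> W))"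
      using Fubini_integral[OF int] by simp
    finally show ?thesis .
  qed
  have "(\<lambda>n. LINT W|GaussN. LINT \<omega>|U01n n. iexp (?X n \<omega> W)) \<longlonglongrightarrow> (LINT W|GaussN. of_real (exp (- s * (\<Sum>j<m. eigenvalue j * (W j)\<^sup>2))))"
  proof (rule integral_dominated_convergence[where w="\<lambda>_. 1"])
    show "(\<lambda>W. LINT \<omega>|U01n n. iexp (?X n \<omega> W)) \<in> borel_measurable GaussN" for n
    proof (rule Un.borel_measurable_lebesgue_integral)
      show "(\<lambda>(W, \<omega>). iexp (?X n \<omega> W)) \<in> borel_measurable (GaussN \<Otimes>\<^sub>M U01n n)" by measurable
    qed
    show "AE W in GaussN. (\<lambda>n. LINT \<omega>|U01n n. iexp (?X n \<omega> W)) \<longlonglongrightarrow> of_real (exp (- s * (\<Sum>j<m. eigenvalue j * (W j)\<^sup>2)))"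
      using iid_char_tendsto[OF gm gB gmean] by (intro AE_I2) (simp add: X gsq)
    show "AE W in GaussN. norm (LINT \<omega>|U01n n. iexp (?X n \<omega> W)) \<le> 1" for n
    proof (intro AE_I2)
      fix W
      have "norm (LINT \<omega>|U01n n. iexp (?X n \<omega> W)) \<le> (LINT \<omega>|U01n n. norm (iexp (?X n \<omega> W)))"
        by (rule integral_norm_bound)
      also have "\<dots> = 1" using Un.prob_space[of n] by simp
      finally show "norm (LINT \<omega>|U01n n. iexp (?X n \<omega> W)) \<le> 1" .
    qed
  qed (simp_all, measurable)
  then have "(\<lambda>n. complex_of_real (LINT \<omega>|U01n n. exp (- s * head_energy m n \<omega>))) \<longlonglongrightarrow>
      complex_of_real (LINT W|GaussN. exp (- s * (\<Sum>j<m. eigenvalue j * (W j)\<^sup>2)))"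
    unfolding swap integral_complex_of_real .
  then show ?thesis unfolding tendsto_of_real_iff .
qed

subsection \<open>The limit variable\<close>

text \<open>The weighted chi-square series, distributed as the squared norm of a Brownian bridge. The series
  converges with probability 1; elsewhere the value is a default.\<close>

definition limit_var :: "(nat \<Rightarrow> real) \<Rightarrow> real" where
  "limit_var W = (\<Sum>j. eigenvalue j * (W j)\<^sup>2)"

definition limit_var_tail :: "(nat \<Rightarrow> real) \<Rightarrow> real" where
  "limit_var_tail W = (\<Sum>j. eigenvalue (Suc j) * (W j)\<^sup>2)"

lemma measurable_limit_var [measurable]: "limit_var \<in> borel_measurable GaussN"
  unfolding limit_var_def by measurable

lemma measurable_limit_var_tail [measurable]: "limit_var_tail \<in> borel_measurable GaussN"
  unfolding limit_var_tail_def by measurable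

text \<open>A nonnegative series with finite mean converges almost surely.\<close>

lemma AE_summable_squares:
  assumes "summable l" "\<And>j. 0 \<le> l j"
  shows "AE W in GaussN. summable (\<lambda>j. l j * (W j)\<^sup>2)"
proof -
  have "(\<integral>\<^sup>+W. (\<Sum>j. ennreal (l j * (W j)\<^sup>2)) \<partial>GaussN) = (\<Sum>j. \<integral>\<^sup>+W. ennreal (l j * (W j)\<^sup>2) \<partial>GaussN)"
    by (rule nn_integral_suminf) measurable
  also have "\<dots> = (\<Sum>j. ennreal (l j))"
  proof (intro suminf_cong)
    fix j
    have "(\<integral>\<^sup>+W. ennreal (l j * (W j)\<^sup>2) \<partial>GaussN) = ennreal (LINT W|GaussN. l j * (W j)\<^sup>2)"
      using GaussN_square assms(2) by (intro nn_integral_eq_integral) auto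
    then show "(\<integral>\<^sup>+W. ennreal (l j * (W j)\<^sup>2) \<partial>GaussN) = ennreal (l j)"
      by (simp add: GaussN_square)
  qed
  also have "\<dots> = ennreal (\<Sum>j. l j)" using assms by (intro suminf_ennreal2) auto
  finally have "(\<integral>\<^sup>+W. (\<Sum>j. ennreal (l j * (W j)\<^sup>2)) \<partial>GaussN) \<noteq> \<infinity>" by simp
  then have "AE W in GaussN. (\<Sum>j. ennreal (l j * (W j)\<^sup>2)) \<noteq> \<infinity>"
    by (intro nn_integral_noteq_infinite) auto
  then show ?thesis
    by eventually_elim (use assms(2) in \<open>auto intro!: summable_suminf_not_top\<close>)
qed

lemma AE_summable_limit_var: "AE W in GaussN. summable (\<lambda>j. eigenvalue j * (W j)\<^sup>2)"
  using eigenvalue_sums eigenvalue_pos by (intro AE_summable_squares) (auto simp: sums_iff intro: less_imp_le)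

lemma AE_summable_limit_var_tail: "AE W in GaussN. summable (\<lambda>j. eigenvalue (Suc j) * (W j)\<^sup>2)"
  using eigenvalue_sums eigenvalue_pos by (intro AE_summable_squares) (auto simp: sums_iff summable_Suc_iff intro: less_imp_le)

lemma AE_limit_var_nonneg: "AE W in GaussN. 0 \<le> limit_var W"
  using AE_summable_limit_var
  by eventually_elim (auto simp: limit_var_def intro!: suminf_nonneg mult_nonneg_nonneg less_imp_le[OF eigenvalue_pos])

text \<open>The tails of both series are small in mean uniformly in \<open>n\<close>, so the limit passes from finitely many
  coefficients to all of them.\<close>

lemma null_stat_Laplace_tendsto:
  assumes "s \<ge> 0"
  shows "(\<lambda>n. LINT \<omega>|U01n n. exp (- s * null_stat n \<omega>)) \<longlonglongrightarrow> (LINT W|GaussN. exp (- s * limit_var W))"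
proof (rule LIMSEQ_I)
  fix e :: real assume e: "e > 0"
  let ?L = "\<lambda>n. LINT \<omega>|U01n n. exp (- s * null_stat n \<omega>)"
  let ?Z = "\<lambda>m. LINT W|GaussN. exp (- s * (\<Sum>j<m. eigenvalue j * (W j)\<^sup>2))"
  have "?Z \<longlonglongrightarrow> (LINT W|GaussN. exp (- s * limit_var W))"
  proof (rule integral_dominated_convergence[where w="\<lambda>_. 1"])
    show "AE W in GaussN. (\<lambda>m. exp (- s * (\<Sum>j<m. eigenvalue j * (W j)\<^sup>2))) \<longlonglongrightarrow> exp (- s * limit_var W)"
      using AE_summable_limit_var
      by eventually_elim (auto simp: limit_var_def intro!: tendsto_intros summable_LIMSEQ)
    show "AE W in GaussN. norm (exp (- s * (\<Sum>j<m. eigenvalue j * (W j)\<^sup>2))) \<le> 1" for m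
      using assms by (intro AE_I2) (auto intro!: mult_nonneg_nonneg sum_nonneg less_imp_le[OF eigenvalue_pos])
  qed (simp_all, measurable)
  from tendstoD[OF this, of "e / 3"] e
  have 1: "\<forall>\<^sub>F m in sequentially. norm (?Z m - (LINT W|GaussN. exp (- s * limit_var W))) < e / 3"
    by (simp add: dist_norm)
  have "(\<lambda>m. s * trace_tail m) \<longlonglongrightarrow> s * 0" by (intro tendsto_intros trace_tail_tendsto)
  from order_tendstoD(2)[OF this, of "e / 3"] e have "\<forall>\<^sub>F m in sequentially. s * trace_tail m < e / 3" by simp
  from eventually_happens[OF eventually_conj[OF 1 this]]
  obtain m where m: "norm (?Z m - (LINT W|GaussN. exp (- s * limit_var W))) < e / 3" "s * trace_tail m < e / 3" by auto
  have "\<forall>\<^sub>F n in sequentially. norm ((LINT \<omega>|U01n n. exp (- s * head_energy m n \<omega>)) - ?Z m) < e / 3"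
    using tendstoD[OF head_energy_Laplace_tendsto[OF assms, of m], of "e / 3"] e by (simp add: dist_norm)
  then obtain N where N: "\<And>n. n \<ge> N \<Longrightarrow> norm ((LINT \<omega>|U01n n. exp (- s * head_energy m n \<omega>)) - ?Z m) < e / 3"
    by (auto simp: eventually_sequentially)
  have "norm (?L n - (LINT W|GaussN. exp (- s * limit_var W))) < e" if n: "n \<ge> max 1 N" for n
  proof -
    have n1: "n \<ge> 1" using n by simp
    have D: "0 \<le> tail_energy m n \<omega>" if "\<omega> \<in> space (U01n n)" for \<omega> using tail_energy_residual[OF that] by simp
    have Vn: "0 \<le> head_energy m n \<omega>" for \<omega> by (simp add: head_energy_def sum_nonneg)
    have Vm [measurable]: "head_energy m n \<in> borel_measurable (U01n n)" unfolding head_energy_def by measurable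
    have diff: "norm (exp (- s * null_stat n \<omega>) - exp (- s * head_energy m n \<omega>)) \<le> s * tail_energy m n \<omega>" if "\<omega> \<in> space (U01n n)" for \<omega>
    proof -
      have "exp (- s * head_energy m n \<omega>) - exp (- s * null_stat n \<omega>) = exp (- s * head_energy m n \<omega>) * (1 - exp (- (s * tail_energy m n \<omega>)))"
        by (simp add: head_energy_eq right_diff_distrib flip: exp_add)
      also have "\<dots> \<le> 1 * (1 - exp (- (s * tail_energy m n \<omega>)))"
        using assms D[OF that] Vn by (intro mult_right_mono) auto
      also have "\<dots> \<le> s * tail_energy m n \<omega>" using exp_ge_add_one_self[of "- (s * tail_energy m n \<omega>)"] by simp
      finally have "exp (- s * head_energy m n \<omega>) - exp (- s * null_stat n \<omega>) \<le> s * tail_energy m n \<omega>" .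
      moreover have "exp (- s * null_stat n \<omega>) \<le> exp (- s * head_energy m n \<omega>)"
        using assms D[OF that] by (simp add: head_energy_eq mult_left_mono)
      ultimately show ?thesis by simp
    qed
    have i1: "integrable (U01n n) (\<lambda>\<omega>. exp (- s * null_stat n \<omega>))"
      using assms null_stat_nonneg by (intro Un.integrable_const_bound[where B=1]) auto
    have i2: "integrable (U01n n) (\<lambda>\<omega>. exp (- s * head_energy m n \<omega>))"
      using assms Vn by (intro Un.integrable_const_bound[where B=1]) auto
    have "norm (?L n - (LINT \<omega>|U01n n. exp (- s * head_energy m n \<omega>))) = norm (LINT \<omega>|U01n n. exp (- s * null_stat n \<omega>) - exp (- s * head_energy m n \<omega>))"
      using i1 i2 by simp
    also have "\<dots> \<le> (LINT \<omega>|U01n n. norm (exp (- s * null_stat n \<omega>) - exp (- s * head_energy m n \<omega>)))"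
      by (rule integral_norm_bound)
    also have "\<dots> \<le> (LINT \<omega>|U01n n. s * tail_energy m n \<omega>)"
      using i1 i2 expectation_tail_energy(1)[OF n1] by (intro integral_mono integrable_norm Bochner_Integration.integrable_diff diff) auto
    also have "\<dots> = s * trace_tail m" using expectation_tail_energy(2)[OF n1] by simp
    finally have "norm (?L n - (LINT \<omega>|U01n n. exp (- s * head_energy m n \<omega>))) < e / 3" using m(2) by linarith
    then show ?thesis using N[of n] n m(1) unfolding real_norm_def by linarith
  qed
  then show "\<exists>N. \<forall>n\<ge>N. norm (?L n - (LINT W|GaussN. exp (- s * limit_var W))) < e" by blast
qed

subsection \<open>Convergence of the distribution functions\<close>

text \<open>By Weierstrass, polynomials approximate continuous functions on the compact interval. The lemma is
  applied to \<open>- exp (- S)\<close> for a nonnegative statistic \<open>S\<close>: the moments are Laplace transforms of \<open>S\<close>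
  at integers, and the sign makes the transformation increasing.\<close>

lemma weak_limit_of_moments:
  fixes M :: "nat \<Rightarrow> real measure"
  assumes M: "\<And>n. real_distribution (M n)" and N: "real_distribution N"
    and supp: "\<And>n. AE x in M n. x \<in> {-1..0}" "AE x in N. x \<in> {-1..0}"
    and moments: "\<And>k. (\<lambda>n. LINT x|M n. x ^ k) \<longlonglongrightarrow> (LINT x|N. x ^ k)"
  shows "weak_conv_m M N"
proof (rule integral_cts_step_conv_imp_weak_conv[OF M N])
  fix a b :: real assume ab: "a < b"
  let ?h = "cts_step a b"
  have hb: "\<bar>?h x\<bar> \<le> 1" for x using ab by (auto simp: cts_step_def)
  have conth: "continuous_on {-1..0} ?h"
    using cts_step_uniformly_continuous[OF ab] by (meson continuous_on_subset subset_UNIV uniformly_continuous_imp_continuous)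
  show "(\<lambda>n. integral\<^sup>L (M n) ?h) \<longlonglongrightarrow> integral\<^sup>L N ?h"
  proof (rule LIMSEQ_I)
    fix e :: real assume e: "e > 0"
    obtain g where g: "real_polynomial_function g" and close: "\<And>x. x \<in> {-1..0} \<Longrightarrow> \<bar>?h x - g x\<bar> < e / 3"
      using Stone_Weierstrass_real_polynomial_function[OF compact_Icc conth, of "e / 3"] e by auto
    obtain c d where gp: "g = (\<lambda>x. \<Sum>i\<le>d. c i * x ^ i)"
      using g by (auto simp: real_polynomial_function_iff_sum)
    have pw: "integrable L (\<lambda>x. x ^ i)" if "real_distribution L" "AE x in L. x \<in> {-1..0}" for L :: "real measure" and i
    proof -
      interpret real_distribution L by fact
      show ?thesis
      proof (rule integrable_const_bound[where B=1])
        show "AE x in L. norm (x ^ i) \<le> 1"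
          using that(2) by eventually_elim (auto simp: power_abs intro!: power_le_one)
      qed simp
    qed
    have gint: "integrable L g" "(LINT x|L. g x) = (\<Sum>i\<le>d. c i * (LINT x|L. x ^ i))"
      if "real_distribution L" "AE x in L. x \<in> {-1..0}" for L
      unfolding gp using pw[OF that] by simp_all
    have near: "\<bar>integral\<^sup>L L ?h - integral\<^sup>L L g\<bar> \<le> e / 3"
      if L: "real_distribution L" "AE x in L. x \<in> {-1..0}" for L
    proof -
      interpret real_distribution L by fact
      have hi: "integrable L ?h" by (rule integrable_cts_step[OF ab])
      have "\<bar>integral\<^sup>L L ?h - integral\<^sup>L L g\<bar> = \<bar>LINT x|L. ?h x - g x\<bar>"
        using hi gint(1)[OF L] by simp
      also have "\<dots> \<le> (LINT x|L. \<bar>?h x - g x\<bar>)" by (rule integral_abs_bound)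
      also have "\<dots> \<le> (LINT x|L. e / 3)"
      proof (rule integral_mono_AE)
        show "AE x in L. \<bar>?h x - g x\<bar> \<le> e / 3"
          using L(2) by eventually_elim (use close in \<open>auto intro: less_imp_le\<close>)
      qed (use hi gint(1)[OF L] in auto)
      also have "\<dots> = e / 3" using prob_space by simp
      finally show ?thesis .
    qed
    have "(\<lambda>n. LINT x|M n. g x) \<longlonglongrightarrow> (LINT x|N. g x)"
      unfolding gint(2)[OF M supp(1)] gint(2)[OF N supp(2)] by (intro tendsto_intros moments)
    from tendstoD[OF this, of "e / 3"] e
    obtain n0 where n0: "\<And>n. n \<ge> n0 \<Longrightarrow> \<bar>(LINT x|M n. g x) - (LINT x|N. g x)\<bar> < e / 3"
      unfolding eventually_sequentially dist_real_def by auto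
    have "norm (integral\<^sup>L (M n) ?h - integral\<^sup>L N ?h) < e" if "n \<ge> n0" for n
      using near[OF M supp(1), of n] near[OF N supp(2)] n0[OF that] unfolding real_norm_def by linarith
    then show "\<exists>n0. \<forall>n\<ge>n0. norm (integral\<^sup>L (M n) ?h - integral\<^sup>L N ?h) < e" by blast
  qed
qed

definition null_cdf :: "nat \<Rightarrow> real \<Rightarrow> real" where
  "null_cdf n x = measure (U01n n) {\<omega> \<in> space (U01n n). null_stat n \<omega> \<le> x}"

definition limit_cdf :: "real \<Rightarrow> real" where
  "limit_cdf x = measure GaussN {W \<in> space GaussN. limit_var W \<le> x}"

text \<open>Given all other coordinates, the limit variable is a multiple of the squared first coordinate plus a
  constant. Absence of atoms and strict increase are thereby inherited from the one-dimensional
  normal law.\<close>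

lemma limit_var_decomposition:
  assumes [measurable]: "A \<in> sets borel"
  shows "emeasure GaussN {W \<in> space GaussN. limit_var W \<in> A} =
     (\<integral>\<^sup>+W. emeasure Gauss {w. eigenvalue 0 * w\<^sup>2 + limit_var_tail W \<in> A} \<partial>GaussN)"
proof -
  interpret P: pair_sigma_finite Gauss GaussN ..
  have D: "distr (Gauss \<Otimes>\<^sub>M GaussN) GaussN (\<lambda>(s, \<omega>). case_nat s \<omega>) = GaussN"
    unfolding GaussN_def by (rule Gs.PiM_iter)
  have [measurable]: "(\<lambda>(s, \<omega>). case_nat s \<omega>) \<in> measurable (Gauss \<Otimes>\<^sub>M GaussN) GaussN"
    unfolding GaussN_def by measurable
  let ?S = "{p \<in> space (Gauss \<Otimes>\<^sub>M GaussN). limit_var (case p of (s, \<omega>) \<Rightarrow> case_nat s \<omega>) \<in> A}"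
  have [measurable]: "?S \<in> sets (Gauss \<Otimes>\<^sub>M GaussN)" by measurable
  have "emeasure GaussN {W \<in> space GaussN. limit_var W \<in> A} = emeasure (distr (Gauss \<Otimes>\<^sub>M GaussN) GaussN (\<lambda>(s, \<omega>). case_nat s \<omega>)) {W \<in> space GaussN. limit_var W \<in> A}"
    by (simp only: D)
  also have "\<dots> = emeasure (Gauss \<Otimes>\<^sub>M GaussN) ?S"
  proof (subst emeasure_distr)
    show "{W \<in> space GaussN. limit_var W \<in> A} \<in> sets GaussN" by measurable
    show "emeasure (Gauss \<Otimes>\<^sub>M GaussN) ((\<lambda>(s, \<omega>). case_nat s \<omega>) -` {W \<in> space GaussN. limit_var W \<in> A} \<inter> space (Gauss \<Otimes>\<^sub>M GaussN)) = emeasure (Gauss \<Otimes>\<^sub>M GaussN) ?S"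
      by (intro arg_cong[of _ _ "emeasure _"]) (auto simp: space_pair_measure GaussN_def space_PiM)
  qed measurable
  also have "\<dots> = (\<integral>\<^sup>+W. emeasure Gauss ((\<lambda>w. (w, W)) -` ?S) \<partial>GaussN)"
    by (rule P.emeasure_pair_measure_alt2) measurable
  also have "\<dots> = (\<integral>\<^sup>+W. emeasure Gauss {w. eigenvalue 0 * w\<^sup>2 + limit_var_tail W \<in> A} \<partial>GaussN)"
  proof (rule nn_integral_cong_AE)
    show "AE W in GaussN. emeasure Gauss ((\<lambda>w. (w, W)) -` ?S) = emeasure Gauss {w. eigenvalue 0 * w\<^sup>2 + limit_var_tail W \<in> A}"
      using AE_summable_limit_var_tail AE_space
    proof eventually_elim
      case (elim W)
      have "limit_var (case_nat w W) = eigenvalue 0 * w\<^sup>2 + limit_var_tail W" for w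
      proof -
        have "summable (\<lambda>j. eigenvalue j * (case_nat w W j)\<^sup>2)"
          using elim(1) by (subst summable_Suc_iff[symmetric]) simp
        from suminf_split_head[OF this] show ?thesis by (simp add: limit_var_def limit_var_tail_def)
      qed
      then show ?case using elim(2)
        by (intro arg_cong[of _ _ "emeasure _"]) (auto simp: space_pair_measure)
    qed
  qed
  finally show ?thesis .
qed

lemma Gauss_null: "A \<in> null_sets lborel \<Longrightarrow> emeasure Gauss A = 0"
proof -
  assume A: "A \<in> null_sets lborel"
  have "A \<in> null_sets (density lborel (\<lambda>x. ennreal (std_normal_density x)))"
    using A AE_not_in[OF A] by (subst null_sets_density_iff) (auto elim: eventually_mono)
  then show ?thesis by (simp add: null_sets_def)
qed

lemma Gauss_interval_pos:
  assumes "a < b"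
  shows "emeasure Gauss {a<..<b} > 0"
proof (rule ccontr)
  assume "\<not> ?thesis"
  then have "{a<..<b} \<in> null_sets (density lborel (\<lambda>x. ennreal (std_normal_density x)))"
    by (auto simp: null_sets_def)
  then have "AE x in lborel. x \<in> {a<..<b} \<longrightarrow> ennreal (std_normal_density x) = 0"
    by (subst (asm) null_sets_density_iff) auto
  then have "AE x in lborel. x \<notin> {a<..<b}"
    by eventually_elim (auto simp: ennreal_eq_0_iff not_le normal_density_pos dest!: leD)
  then have "emeasure lborel {a<..<b} = 0"
    by (subst (asm) AE_iff_null) (auto simp: null_sets_def greaterThanLessThan_def greaterThan_def lessThan_def Int_def)
  then show False using assms by (simp add: ennreal_eq_0_iff)
qed

lemma limit_var_no_atom: "measure GaussN {W \<in> space GaussN. limit_var W = x} = 0"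
proof -
  have "emeasure Gauss {w. eigenvalue 0 * w\<^sup>2 + b \<in> {x}} = 0" for b
  proof (rule Gauss_null)
    have "{w. eigenvalue 0 * w\<^sup>2 + b \<in> {x}} \<subseteq> {sqrt ((x - b) / eigenvalue 0), - sqrt ((x - b) / eigenvalue 0)}"
    proof
      fix w assume "w \<in> {w. eigenvalue 0 * w\<^sup>2 + b \<in> {x}}"
      then have "w\<^sup>2 = (x - b) / eigenvalue 0" using eigenvalue_pos[of 0] by (auto simp: field_simps)
      then have "\<bar>w\<bar> = sqrt ((x - b) / eigenvalue 0)" by (metis real_sqrt_abs)
      then show "w \<in> {sqrt ((x - b) / eigenvalue 0), - sqrt ((x - b) / eigenvalue 0)}" by (auto simp: abs_if split: if_splits)
    qed
    then show "{w. eigenvalue 0 * w\<^sup>2 + b \<in> {x}} \<in> null_sets lborel"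
      by (intro countable_imp_null_set_lborel countable_finite) (auto intro: finite_subset)
  qed
  then have "emeasure GaussN {W \<in> space GaussN. limit_var W \<in> {x}} = 0"
    by (subst limit_var_decomposition) auto
  then show ?thesis by (simp add: measure_def)
qed

lemma limit_cdf_mono: "x \<le> y \<Longrightarrow> limit_cdf x \<le> limit_cdf y"
  unfolding limit_cdf_def by (intro GN.finite_measure_mono) auto

lemma null_cdf_mono: "x \<le> y \<Longrightarrow> null_cdf n x \<le> null_cdf n y"
  unfolding null_cdf_def by (intro Un.finite_measure_mono) auto

text \<open>If the limit variable is at most \<open>x\<close> with positive probability, the tail series is below \<open>x\<close> with
  positive probability; given such a tail, the first coordinate puts mass on an open set where the
  sum lies between \<open>x - a\<close> and \<open>x\<close>.\<close>

lemma limit_cdf_strict: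
  assumes "limit_cdf x > 0" "a > 0"
  shows "limit_cdf (x - a) < limit_cdf x"
proof -
  have l0: "eigenvalue 0 > 0" by (rule eigenvalue_pos)
  have "emeasure GaussN {W \<in> space GaussN. limit_var W \<in> {x - a<..x}} \<noteq> 0"
  proof
    assume "emeasure GaussN {W \<in> space GaussN. limit_var W \<in> {x - a<..x}} = 0"
    then have "(\<integral>\<^sup>+W. emeasure Gauss {w. eigenvalue 0 * w\<^sup>2 + limit_var_tail W \<in> {x - a<..x}} \<partial>GaussN) = 0"
      by (subst (asm) limit_var_decomposition) auto
    moreover have meas: "(\<lambda>W. emeasure Gauss {w. eigenvalue 0 * w\<^sup>2 + limit_var_tail W \<in> {x - a<..x}}) \<in> borel_measurable GaussN"
    proof -
      have "{p \<in> space (GaussN \<Otimes>\<^sub>M Gauss). eigenvalue 0 * (snd p)\<^sup>2 + limit_var_tail (fst p) \<in> {x - a<..x}} \<in> sets (GaussN \<Otimes>\<^sub>M Gauss)" (is "?S \<in> _")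
        by measurable
      from gauss.measurable_emeasure_Pair[OF this]
      show ?thesis
        by (rule measurable_cong[THEN iffD1, rotated]) (auto intro!: arg_cong[of _ _ "emeasure _"] simp: space_pair_measure)
    qed
    ultimately have "AE W in GaussN. emeasure Gauss {w. eigenvalue 0 * w\<^sup>2 + limit_var_tail W \<in> {x - a<..x}} = 0"
      by (subst (asm) nn_integral_0_iff_AE) auto
    then have "AE W in GaussN. \<not> limit_var_tail W < x"
    proof eventually_elim
      case (elim W)
      show ?case
      proof
        assume lt: "limit_var_tail W < x"
        define p q where "p = sqrt (max 0 (x - a - limit_var_tail W) / eigenvalue 0)" and "q = sqrt ((x - limit_var_tail W) / eigenvalue 0)"
        have pq: "p < q" unfolding p_def q_def using lt assms(2) l0
          by (intro real_sqrt_less_mono divide_strict_right_mono) auto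
        have p0: "p \<ge> 0" unfolding p_def using l0 by simp
        have "{p<..<q} \<subseteq> {w. eigenvalue 0 * w\<^sup>2 + limit_var_tail W \<in> {x - a<..x}}"
        proof
          fix w assume w: "w \<in> {p<..<q}"
          have "p\<^sup>2 < w\<^sup>2" "w\<^sup>2 < q\<^sup>2" using w p0 by (auto intro!: power_strict_mono)
          moreover have "p\<^sup>2 = max 0 (x - a - limit_var_tail W) / eigenvalue 0" "q\<^sup>2 = (x - limit_var_tail W) / eigenvalue 0"
            unfolding p_def q_def using l0 lt by auto
          ultimately have "max 0 (x - a - limit_var_tail W) < eigenvalue 0 * w\<^sup>2" "eigenvalue 0 * w\<^sup>2 < x - limit_var_tail W"
            using l0 by (auto simp: field_simps)
          then show "w \<in> {w. eigenvalue 0 * w\<^sup>2 + limit_var_tail W \<in> {x - a<..x}}" by auto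
        qed
        then have "emeasure Gauss {p<..<q} \<le> emeasure Gauss {w. eigenvalue 0 * w\<^sup>2 + limit_var_tail W \<in> {x - a<..x}}"
          by (intro emeasure_mono) auto
        then show False using Gauss_interval_pos[OF pq] elim by simp
      qed
    qed
    then have "AE W in GaussN. emeasure Gauss {w. eigenvalue 0 * w\<^sup>2 + limit_var_tail W \<in> {..x}} = 0"
    proof eventually_elim
      case (elim W)
      have "{w. eigenvalue 0 * w\<^sup>2 + limit_var_tail W \<in> {..x}} \<subseteq> {0}"
      proof
        fix w assume "w \<in> {w. eigenvalue 0 * w\<^sup>2 + limit_var_tail W \<in> {..x}}"
        then have "eigenvalue 0 * w\<^sup>2 \<le> 0" using elim by auto
        then have "w\<^sup>2 \<le> 0" using l0 by (simp add: mult_le_0_iff)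
        then show "w \<in> {0}" by simp
      qed
      then have "emeasure Gauss {w. eigenvalue 0 * w\<^sup>2 + limit_var_tail W \<in> {..x}} \<le> emeasure Gauss {0}"
        by (intro emeasure_mono) auto
      also have "\<dots> = 0" by (intro Gauss_null) auto
      finally show ?case by simp
    qed
    then have "(\<integral>\<^sup>+W. emeasure Gauss {w. eigenvalue 0 * w\<^sup>2 + limit_var_tail W \<in> {..x}} \<partial>GaussN) = (\<integral>\<^sup>+W. 0 \<partial>GaussN)"
      by (rule nn_integral_cong_AE)
    then have "emeasure GaussN {W \<in> space GaussN. limit_var W \<in> {..x}} = 0"
      by (subst limit_var_decomposition) auto
    then have "limit_cdf x = 0" by (simp add: limit_cdf_def measure_def)
    then show False using assms(1) by simp
  qed
  then have "measure GaussN {W \<in> space GaussN. limit_var W \<in> {x - a<..x}} > 0"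
    by (simp add: GN.emeasure_eq_measure zero_less_measure_iff)
  moreover have "limit_cdf x = limit_cdf (x - a) + measure GaussN {W \<in> space GaussN. limit_var W \<in> {x - a<..x}}"
    unfolding limit_cdf_def using assms(2)
    by (subst GN.finite_measure_Union[symmetric]) (auto intro!: arg_cong[of _ _ "measure _"])
  ultimately show ?thesis by simp
qed

lemma limit_cdf_cdf: "limit_cdf = cdf (distr GaussN borel limit_var)"
  by (auto simp: fun_eq_iff limit_cdf_def cdf_def measure_distr intro!: arg_cong[of _ _ "measure _"])

lemma real_distribution_limit_var: "real_distribution (distr GaussN borel limit_var)"
  by (rule GN.real_distribution_distr) measurable

lemma limit_cdf_isCont: "isCont limit_cdf x"
proof -
  interpret real_distribution "distr GaussN borel limit_var" by (rule real_distribution_limit_var)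
  have "measure (distr GaussN borel limit_var) {x} = measure GaussN {W \<in> space GaussN. limit_var W = x}"
    by (subst measure_distr) (auto intro!: arg_cong[of _ _ "measure _"])
  then show ?thesis unfolding limit_cdf_cdf by (simp add: isCont_cdf limit_var_no_atom)
qed

lemma limit_cdf_at_top: "(limit_cdf \<longlongrightarrow> 1) at_top" and limit_cdf_at_bot: "(limit_cdf \<longlongrightarrow> 0) at_bot"
proof -
  interpret real_distribution "distr GaussN borel limit_var" by (rule real_distribution_limit_var)
  show "(limit_cdf \<longlongrightarrow> 1) at_top" "(limit_cdf \<longlongrightarrow> 0) at_bot"
    unfolding limit_cdf_cdf by (rule cdf_lim_at_top_prob, rule cdf_lim_at_bot)
qed

lemma null_cdf_tendsto: "(\<lambda>n. null_cdf n x) \<longlonglongrightarrow> limit_cdf x"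
proof -
  define M where "M n = distr (U01n n) borel (\<lambda>\<omega>. - exp (- null_stat n \<omega>))" for n
  define N where "N = distr GaussN borel (\<lambda>W. - exp (- limit_var W))"
  have M: "real_distribution (M n)" for n unfolding M_def by (rule Un.real_distribution_distr) measurable
  have N: "real_distribution N" unfolding N_def by (rule GN.real_distribution_distr) measurable
  interpret N: real_distribution N by (rule N)
  have "weak_conv_m M N"
  proof (rule weak_limit_of_moments[OF M N])
    show "AE x in M n. x \<in> {-1..0}" for n
      unfolding M_def by (subst AE_distr_iff) (auto simp: null_stat_nonneg intro!: AE_I2)
    show "AE x in N. x \<in> {-1..0}"
      unfolding N_def by (subst AE_distr_iff) (use AE_limit_var_nonneg in auto)
    fix k
    have pw: "(- exp (- z)) ^ k = (-1) ^ k * exp (- real k * z)" for z :: real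
      by (simp add: power_minus[of "exp _"] exp_of_nat_mult[symmetric])
    have "(LINT x|M n. x ^ k) = (-1) ^ k * (LINT \<omega>|U01n n. exp (- real k * null_stat n \<omega>))" for n
      unfolding M_def by (subst integral_distr) (auto simp: pw)
    moreover have "(LINT x|N. x ^ k) = (-1) ^ k * (LINT W|GaussN. exp (- real k * limit_var W))"
      unfolding N_def by (subst integral_distr) (auto simp: pw)
    ultimately show "(\<lambda>n. LINT x|M n. x ^ k) \<longlonglongrightarrow> (LINT x|N. x ^ k)"
      by (simp only:) (intro tendsto_mult tendsto_const null_stat_Laplace_tendsto, simp)
  qed
  moreover have "isCont (cdf N) (- exp (- x))"
  proof -
    have "measure N {- exp (- x)} = measure GaussN {W \<in> space GaussN. limit_var W = x}"
      unfolding N_def by (subst measure_distr) (auto intro!: arg_cong[of _ _ "measure _"])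
    then show ?thesis by (simp add: N.isCont_cdf limit_var_no_atom)
  qed
  ultimately have "(\<lambda>n. cdf (M n) (- exp (- x))) \<longlonglongrightarrow> cdf N (- exp (- x))"
    by (simp add: weak_conv_m_def weak_conv_def)
  moreover have "cdf (M n) (- exp (- x)) = null_cdf n x" for n
    unfolding cdf_def M_def null_cdf_def by (subst measure_distr) (auto intro!: arg_cong[of _ _ "measure _"])
  moreover have "cdf N (- exp (- x)) = limit_cdf x"
    unfolding cdf_def N_def limit_cdf_def by (subst measure_distr) (auto intro!: arg_cong[of _ _ "measure _"])
  ultimately show ?thesis by simp
qed

section \<open>Error probabilities and the drift\<close>

lemma limit_cdf_bounds: "0 \<le> limit_cdf x" "limit_cdf x \<le> 1"
  by (simp_all add: limit_cdf_def)

lemma limit_cdf_surj: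
  assumes "0 < p" "p < 1"
  obtains x where "limit_cdf x = p"
proof -
  obtain a where a: "limit_cdf a < p"
    using order_tendstoD(2)[OF limit_cdf_at_bot assms(1)] by (auto simp: eventually_at_bot_linorder)
  obtain b where b: "limit_cdf b > p"
    using order_tendstoD(1)[OF limit_cdf_at_top assms(2)] by (auto simp: eventually_at_top_linorder)
  have "a \<le> b" using a b limit_cdf_mono[of b a] by linarith
  then obtain x where "limit_cdf x = p"
    using IVT[of limit_cdf a p b] a b limit_cdf_isCont by auto
  then show ?thesis by (rule that)
qed

text \<open>Polya's theorem: by monotonicity the deviation is controlled by finitely many points, at which the
  limit takes equally spaced values.\<close>

lemma monotone_convergence_uniform:
  fixes F :: "nat \<Rightarrow> real \<Rightarrow> real"
  assumes mono: "\<And>n x y. x \<le> y \<Longrightarrow> F n x \<le> F n y"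
    and bounds: "\<And>n x. 0 \<le> F n x" "\<And>n x. F n x \<le> 1"
    and lim: "\<And>x. (\<lambda>n. F n x) \<longlonglongrightarrow> limit_cdf x" and e: "e > 0"
  shows "\<forall>\<^sub>F n in sequentially. \<forall>x. \<bar>F n x - limit_cdf x\<bar> \<le> e"
proof -
  obtain K0 :: nat where "1 / (e / 2) < real K0" using reals_Archimedean2 by blast
  then obtain K :: nat where K: "K > 0" "1 / real K \<le> e / 2"
    using e by (metis bot_nat_0.not_eq_extremum divide_less_eq divide_nonneg_pos frac_le_eq half_gt_zero less_eq_real_def mult.commute not_less of_nat_0 of_nat_0_less_iff zero_less_one)
  have "\<exists>X. \<forall>k\<in>{1..<K}. limit_cdf (X k) = real k / real K"
  proof (rule bchoice, rule ballI)
    fix k assume "k \<in> {1..<K}"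
    then have "0 < real k / real K" "real k / real K < 1" by auto
    then show "\<exists>x. limit_cdf x = real k / real K" using limit_cdf_surj by metis
  qed
  then obtain X where X: "\<And>k. k \<in> {1..<K} \<Longrightarrow> limit_cdf (X k) = real k / real K" by blast
  have "\<forall>\<^sub>F n in sequentially. \<forall>k\<in>{1..<K}. \<bar>F n (X k) - limit_cdf (X k)\<bar> < e / 2"
    using tendstoD[OF lim, of "e / 2"] e
    by (intro eventually_ball_finite) (auto simp: dist_real_def)
  then show ?thesis
  proof eventually_elim
    case (elim n)
    have near: "\<bar>F n (X k) - real k / real K\<bar> < e / 2" if "k \<in> {1..<K}" for k
      using elim that by (simp add: X)
    show ?case
    proof
      fix x
      define z where "z = real K * limit_cdf x"
      have z: "0 \<le> z" "z \<le> real K" using limit_cdf_bounds[of x] K(1) by (auto simp: z_def mult_left_le)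
      have Gz: "limit_cdf x = z / real K" using K(1) by (simp add: z_def)
      have up: "F n x \<le> limit_cdf x + e"
      proof -
        \<comment> \<open>the next grid value above \<open>limit_cdf x\<close>\<close>
        define k where "k = nat \<lfloor>z\<rfloor> + 1"
        have k: "z < real k" "real k \<le> z + 1" using z(1) unfolding k_def by linarith+
        have kK: "real k / real K \<le> limit_cdf x + 1 / real K"
          unfolding Gz add_divide_distrib[symmetric] using k(2) by (intro divide_right_mono) auto
        show ?thesis
        proof (cases "k < K")
          case True
          then have kin: "k \<in> {1..<K}" by (simp add: k_def)
          have "limit_cdf x < limit_cdf (X k)" unfolding X[OF kin] Gz using k(1) K(1) by (intro divide_strict_right_mono) auto
          then have "x \<le> X k" using limit_cdf_mono[of "X k" x] by linarith
          then show ?thesis using mono[of x "X k" n] near[OF kin] kK K(2) by linarith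
        next
          case False
          then have "1 \<le> real k / real K" using K(1) by (simp add: le_divide_eq)
          then show ?thesis using bounds(2)[of n x] kK K(2) e by linarith
        qed
      qed
      have low: "F n x \<ge> limit_cdf x - e"
      proof -
        \<comment> \<open>the last grid value strictly below \<open>limit_cdf x\<close>\<close>
        define k where "k = nat (\<lceil>z\<rceil> - 1)"
        show ?thesis
        proof (cases "z \<le> 1")
          case True
          then have "limit_cdf x \<le> 1 / real K" unfolding Gz by (intro divide_right_mono) auto
          then show ?thesis using bounds(1)[of n x] K(2) e by linarith
        next
          case False
          have k: "real k < z" "z - 1 \<le> real k" "1 \<le> k" using False unfolding k_def by linarith+
          have "real k < real K" using k(1) z(2) by linarith
          then have kin: "k \<in> {1..<K}" using k(3) by simp
          have kK: "limit_cdf x - 1 / real K \<le> real k / real K"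
            unfolding Gz diff_divide_distrib[symmetric] using k(2) by (intro divide_right_mono) auto
          have "limit_cdf (X k) < limit_cdf x" unfolding X[OF kin] Gz using k(1) K(1) by (intro divide_strict_right_mono) auto
          then have "X k \<le> x" using limit_cdf_mono[of x "X k"] by linarith
          then show ?thesis using mono[of "X k" x n] near[OF kin] kK K(2) by linarith
        qed
      qed
      show "\<bar>F n x - limit_cdf x\<bar> \<le> e" using up low by linarith
    qed
  qed
qed

lemma null_cdf_uniform: "e > 0 \<Longrightarrow> \<forall>\<^sub>F n in sequentially. \<forall>x. \<bar>null_cdf n x - limit_cdf x\<bar> \<le> e"
  by (rule monotone_convergence_uniform[OF null_cdf_mono _ _ null_cdf_tendsto]) (auto simp: null_cdf_def)

text \<open>Polya's theorem for the functions obtained by shifting the argument by \<open>1 / Suc n\<close>.\<close>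

lemma limit_cdf_uniformly_continuous:
  assumes "e > 0"
  obtains \<delta> where "\<delta> > 0" "\<And>x y. \<bar>x - y\<bar> \<le> \<delta> \<Longrightarrow> \<bar>limit_cdf x - limit_cdf y\<bar> \<le> e"
proof -
  have "\<forall>\<^sub>F n in sequentially. \<forall>x. \<bar>limit_cdf (x + 1 / real (Suc n)) - limit_cdf x\<bar> \<le> e"
  proof (rule monotone_convergence_uniform[OF _ _ _ _ assms])
    fix x
    have "(\<lambda>n. x + 1 / real (Suc n)) \<longlonglongrightarrow> x + 0"
      by (intro tendsto_intros LIMSEQ_inverse_real_of_nat[unfolded inverse_eq_divide])
    then show "(\<lambda>n. limit_cdf (x + 1 / real (Suc n))) \<longlonglongrightarrow> limit_cdf x"
      using isCont_tendsto_compose[OF limit_cdf_isCont, of "\<lambda>n. x + 1 / real (Suc n)" x sequentially] by simp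
  qed (auto intro: limit_cdf_mono simp: limit_cdf_bounds)
  then obtain n where n: "\<And>x. \<bar>limit_cdf (x + 1 / real (Suc n)) - limit_cdf x\<bar> \<le> e"
    using eventually_happens[of _ sequentially] by auto
  show ?thesis
  proof
    show "1 / real (Suc n) > 0" by simp
    have *: "\<bar>limit_cdf x - limit_cdf y\<bar> \<le> e" if "x \<le> y" "y \<le> x + 1 / real (Suc n)" for x y
      using n[of x] limit_cdf_mono[OF that(1)] limit_cdf_mono[OF that(2)] by linarith
    show "\<bar>limit_cdf x - limit_cdf y\<bar> \<le> e" if "\<bar>x - y\<bar> \<le> 1 / real (Suc n)" for x y
    proof (cases "x \<le> y")
      case True then show ?thesis using that by (intro *) auto
    next
      case False
      then have "\<bar>limit_cdf y - limit_cdf x\<bar> \<le> e" using that by (intro *) auto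
      then show ?thesis by (simp add: abs_minus_commute)
    qed
  qed
qed

lemma type_I_null_cdf: "n \<ge> 1 \<Longrightarrow> type_I n (cvm_test n t) = 1 - null_cdf n (real n * t)"
  unfolding null_cdf_def by (subst Un.prob_neg[symmetric]) (auto simp: type_I_eq stat_zero not_le)

lemma type_II_bounds:
  assumes "alternative f" "n \<ge> 1" "\<delta> > 0"
  shows "type_II n (cvm_test n t) f \<le> null_cdf n (real n * t - drift n f + \<delta>) + approx_error m n f / \<delta>"
    and "null_cdf n (real n * t - drift n f - \<delta>) - approx_error m n f / \<delta> \<le> type_II n (cvm_test n t) f"
proof -
  note [measurable] = measurable_stat[OF alternative_L2[OF assms(1)]]
  let ?\<Delta> = "\<lambda>\<omega>. \<bar>stat n f \<omega> - null_stat n \<omega> - drift n f\<bar>"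
  let ?P = "\<lambda>Q. measure (U01n n) {\<omega> \<in> space (U01n n). Q \<omega>}"
  have "?P (\<lambda>\<omega>. ?\<Delta> \<omega> \<ge> \<delta>) \<le> (LINT \<omega>|U01n n. ?\<Delta> \<omega>) / \<delta>"
    by (rule Un_markov[OF stat_approx(1)[OF assms(1,2)] _ assms(3)]) simp
  also have "\<dots> \<le> approx_error m n f / \<delta>"
    using stat_approx(2)[OF assms(1,2)] assms(3) by (intro divide_right_mono) auto
  finally have \<Delta>: "?P (\<lambda>\<omega>. ?\<Delta> \<omega> \<ge> \<delta>) \<le> approx_error m n f / \<delta>" .
  have union: "?P A \<le> ?P B + ?P D" if [measurable]: "Measurable.pred (U01n n) A" "Measurable.pred (U01n n) B" "Measurable.pred (U01n n) D"
     and "\<And>\<omega>. A \<omega> \<Longrightarrow> B \<omega> \<or> D \<omega>" for A B D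
  proof -
    have "?P A \<le> measure (U01n n) ({\<omega> \<in> space (U01n n). B \<omega>} \<union> {\<omega> \<in> space (U01n n). D \<omega>})"
      using that(4) by (intro Un.finite_measure_mono) auto
    also have "\<dots> \<le> ?P B + ?P D" by (intro measure_Un_le) auto
    finally show ?thesis .
  qed
  have "?P (\<lambda>\<omega>. stat n f \<omega> \<le> real n * t) \<le> ?P (\<lambda>\<omega>. null_stat n \<omega> \<le> real n * t - drift n f + \<delta>) + ?P (\<lambda>\<omega>. ?\<Delta> \<omega> \<ge> \<delta>)"
    by (rule union) (measurable, linarith)
  then show "type_II n (cvm_test n t) f \<le> null_cdf n (real n * t - drift n f + \<delta>) + approx_error m n f / \<delta>"
    using \<Delta> assms by (simp add: type_II_eq null_cdf_def)
  have "?P (\<lambda>\<omega>. null_stat n \<omega> \<le> real n * t - drift n f - \<delta>) \<le> ?P (\<lambda>\<omega>. stat n f \<omega> \<le> real n * t) + ?P (\<lambda>\<omega>. ?\<Delta> \<omega> \<ge> \<delta>)"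
    by (rule union) (measurable, linarith)
  then show "null_cdf n (real n * t - drift n f - \<delta>) - approx_error m n f / \<delta> \<le> type_II n (cvm_test n t) f"
    using \<Delta> assms by (simp add: type_II_eq null_cdf_def)
qed

text \<open>As the norms vanish, the coupled empirical process is asymptotically the uniform one; only the drift
  can tell such alternatives from the hypothesis.\<close>

locale vanishing_alternatives =
  fixes \<nu> :: "nat \<Rightarrow> nat" and f :: "nat \<Rightarrow> real \<Rightarrow> real"
  assumes sizes: "filterlim \<nu> at_top sequentially"
    and alt: "\<forall>\<^sub>F i in sequentially. alternative (f i)"
    and norm: "(\<lambda>i. l2norm (f i)) \<longlonglongrightarrow> 0"
begin

lemma sizes_pos: "\<forall>\<^sub>F i in sequentially. \<nu> i \<ge> 1"
  using sizes by (simp add: filterlim_at_top)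

lemma type_I_asymptotic:
  "(\<lambda>i. type_I (\<nu> i) (cvm_test (\<nu> i) (t i)) - (1 - limit_cdf (real (\<nu> i) * t i))) \<longlonglongrightarrow> 0"
proof (rule tendstoI)
  fix e :: real assume e: "e > 0"
  have "\<forall>\<^sub>F n in sequentially. \<forall>x. \<bar>null_cdf n x - limit_cdf x\<bar> \<le> e / 2" using e by (intro null_cdf_uniform) simp
  from eventually_compose_filterlim[OF this sizes] sizes_pos
  show "\<forall>\<^sub>F i in sequentially. dist (type_I (\<nu> i) (cvm_test (\<nu> i) (t i)) - (1 - limit_cdf (real (\<nu> i) * t i))) 0 < e"
  proof eventually_elim
    case (elim i)
    then have "\<bar>null_cdf (\<nu> i) (real (\<nu> i) * t i) - limit_cdf (real (\<nu> i) * t i)\<bar> \<le> e / 2" by blast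
    then show ?case using e unfolding type_I_null_cdf[OF elim(2)] dist_real_def by linarith
  qed
qed

text \<open>The hypothesis on single coefficients says that the shift vanishes weakly. Then the statistic is its
  null version plus the drift up to an error that is small in mean, and such an error is absorbed by
  the uniform continuity of the limit distribution function.\<close>

lemma type_II_asymptotic:
  assumes bdd: "\<forall>\<^sub>F i in sequentially. drift (\<nu> i) (f i) \<le> A"
    and weak: "\<And>j. j \<ge> 1 \<Longrightarrow> (\<lambda>i. real (\<nu> i) * (l2inner (f i) (\<phi> j))\<^sup>2) \<longlonglongrightarrow> 0"
  shows "(\<lambda>i. type_II (\<nu> i) (cvm_test (\<nu> i) (t i)) (f i) - limit_cdf (real (\<nu> i) * t i - drift (\<nu> i) (f i))) \<longlonglongrightarrow> 0"
proof (rule tendstoI)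
  fix e :: real assume e: "e > 0"
  obtain \<delta> where \<delta>: "\<delta> > 0" and uc: "\<And>x y. \<bar>x - y\<bar> \<le> \<delta> \<Longrightarrow> \<bar>limit_cdf x - limit_cdf y\<bar> \<le> e / 4"
    using limit_cdf_uniformly_continuous[of "e / 4"] e by (metis divide_pos_pos zero_less_numeral)
  obtain m where m: "\<forall>\<^sub>F i in sequentially. approx_error m (\<nu> i) (f i) < e / 4 * \<delta>"
    using approx_error_eventually_small[OF norm bdd weak, of "e / 4 * \<delta>"] e \<delta> by (metis divide_pos_pos mult_pos_pos zero_less_numeral)
  have "\<forall>\<^sub>F n in sequentially. \<forall>x. \<bar>null_cdf n x - limit_cdf x\<bar> \<le> e / 4" using e by (intro null_cdf_uniform) simp
  from eventually_compose_filterlim[OF this sizes] sizes_pos alt m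
  show "\<forall>\<^sub>F i in sequentially. dist (type_II (\<nu> i) (cvm_test (\<nu> i) (t i)) (f i) - limit_cdf (real (\<nu> i) * t i - drift (\<nu> i) (f i))) 0 < e"
  proof eventually_elim
    case (elim i)
    let ?x = "real (\<nu> i) * t i - drift (\<nu> i) (f i)"
    have er: "approx_error m (\<nu> i) (f i) / \<delta> < e / 4" using elim(4) \<delta> by (simp add: field_simps)
    have "\<bar>limit_cdf (?x + \<delta>) - limit_cdf ?x\<bar> \<le> e / 4" "\<bar>limit_cdf (?x - \<delta>) - limit_cdf ?x\<bar> \<le> e / 4"
      using uc[of "?x + \<delta>" ?x] uc[of "?x - \<delta>" ?x] \<delta> by auto
    then show ?case
      using type_II_bounds[OF elim(3,2) \<delta>, of "t i" m] er elim(1)[rule_format, of "?x + \<delta>"] elim(1)[rule_format, of "?x - \<delta>"]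
      unfolding dist_real_def by linarith
  qed
qed

text \<open>A shift that vanishes in norm vanishes weakly.\<close>

lemma weak_of_drift:
  assumes "(\<lambda>i. drift (\<nu> i) (f i)) \<longlonglongrightarrow> 0" "j \<ge> 1"
  shows "(\<lambda>i. real (\<nu> i) * (l2inner (f i) (\<phi> j))\<^sup>2) \<longlonglongrightarrow> 0"
proof (rule Lim_null_comparison)
  show "\<forall>\<^sub>F i in sequentially. norm (real (\<nu> i) * (l2inner (f i) (\<phi> j))\<^sup>2) \<le> (pi * real j)\<^sup>2 * drift (\<nu> i) (f i)"
    using alt
  proof eventually_elim
    case (elim i)
    have "(l2inner (f i) (\<phi> j))\<^sup>2 / (pi * real j)\<^sup>2 \<le> (l2norm (prim (f i)))\<^sup>2"
      using prim_norm_ge[of "f i" "{j}"] elim assms(2) by (simp add: alternative_L2 alternative_mean)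
    then have "(l2inner (f i) (\<phi> j))\<^sup>2 \<le> (pi * real j)\<^sup>2 * (l2norm (prim (f i)))\<^sup>2"
      using assms(2) by (simp add: divide_le_eq mult.commute)
    then have "real (\<nu> i) * (l2inner (f i) (\<phi> j))\<^sup>2 \<le> real (\<nu> i) * ((pi * real j)\<^sup>2 * (l2norm (prim (f i)))\<^sup>2)"
      by (intro mult_left_mono) auto
    then show ?case by (simp add: drift_def mult_ac)
  qed
  show "(\<lambda>i. (pi * real j)\<^sup>2 * drift (\<nu> i) (f i)) \<longlonglongrightarrow> 0"
    using tendsto_mult_left[OF assms(1), of "(pi * real j)\<^sup>2"] by simp
qed

lemma inconsistent_of_drift:
  assumes "(\<lambda>i. drift (\<nu> i) (f i)) \<longlonglongrightarrow> 0"
  shows "cvm_inconsistent \<nu> f"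
  unfolding cvm_inconsistent_def
proof
  fix t :: "nat \<Rightarrow> real"
  have bdd: "\<forall>\<^sub>F i in sequentially. drift (\<nu> i) (f i) \<le> 1"
    using order_tendstoD(2)[OF assms, of 1] by (auto elim: eventually_mono)
  have "(\<lambda>i. limit_cdf (real (\<nu> i) * t i) - limit_cdf (real (\<nu> i) * t i - drift (\<nu> i) (f i))) \<longlonglongrightarrow> 0"
  proof (rule tendstoI)
    fix e :: real assume e: "e > 0"
    obtain \<delta> where \<delta>: "\<delta> > 0" and uc: "\<And>x y. \<bar>x - y\<bar> \<le> \<delta> \<Longrightarrow> \<bar>limit_cdf x - limit_cdf y\<bar> \<le> e / 2"
      using limit_cdf_uniformly_continuous[of "e / 2"] e by (metis divide_pos_pos zero_less_numeral)
    show "\<forall>\<^sub>F i in sequentially. dist (limit_cdf (real (\<nu> i) * t i) - limit_cdf (real (\<nu> i) * t i - drift (\<nu> i) (f i))) 0 < e"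
      using order_tendstoD(2)[OF assms \<delta>]
    proof eventually_elim
      case (elim i)
      then show ?case using uc[of "real (\<nu> i) * t i" "real (\<nu> i) * t i - drift (\<nu> i) (f i)"] e
        by (simp add: dist_real_def)
    qed
  qed
  from tendsto_diff[OF tendsto_add[OF type_I_asymptotic[of t] type_II_asymptotic[OF bdd weak_of_drift[OF assms], of t]] this]
  have "(\<lambda>i. type_I (\<nu> i) (cvm_test (\<nu> i) (t i)) + type_II (\<nu> i) (cvm_test (\<nu> i) (t i)) (f i) - 1) \<longlonglongrightarrow> 0"
    by (simp add: algebra_simps)
  from tendsto_add[OF this tendsto_const[of 1]]
  have "(\<lambda>i. type_I (\<nu> i) (cvm_test (\<nu> i) (t i)) + type_II (\<nu> i) (cvm_test (\<nu> i) (t i)) (f i)) \<longlonglongrightarrow> 1" by simp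
  then have "(\<lambda>i. ereal (type_I (\<nu> i) (cvm_test (\<nu> i) (t i)) + type_II (\<nu> i) (cvm_test (\<nu> i) (t i)) (f i))) \<longlonglongrightarrow> ereal 1"
    by simp
  from lim_imp_Liminf[OF _ this]
  show "1 \<le> liminf (\<lambda>i. ereal (type_I (\<nu> i) (cvm_test (\<nu> i) (t i)) + type_II (\<nu> i) (cvm_test (\<nu> i) (t i)) (f i)))"
    by (simp add: one_ereal_def)
qed

lemma limit_cdf_threshold:
  assumes "\<alpha> \<in> {0<..<1}" "(\<lambda>i. type_I (\<nu> i) (cvm_test (\<nu> i) (t i))) \<longlonglongrightarrow> \<alpha>"
  shows "(\<lambda>i. limit_cdf (real (\<nu> i) * t i)) \<longlonglongrightarrow> 1 - \<alpha>"
proof -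
  from tendsto_diff[OF type_I_asymptotic[of t] assms(2)]
  have "(\<lambda>i. limit_cdf (real (\<nu> i) * t i) - 1) \<longlonglongrightarrow> 0 - \<alpha>" by simp
  from tendsto_add[OF this tendsto_const[of 1]] show ?thesis by simp
qed

text \<open>If the drift stays above \<open>\<delta>\<close>, the type II error is at most the limit distribution function at a
  quantile minus \<open>\<delta>\<close>, which by strict increase is less than \<open>1 - \<alpha>\<close>. If the drift is small infinitely
  often, thresholds at the median of the limit law give errors arbitrarily close to 1/2 infinitely
  often.\<close>

lemma consistent_iff_drift:
  assumes bdd: "\<forall>\<^sub>F i in sequentially. drift (\<nu> i) (f i) \<le> A"
    and weak: "\<And>j. j \<ge> 1 \<Longrightarrow> (\<lambda>i. real (\<nu> i) * (l2inner (f i) (\<phi> j))\<^sup>2) \<longlonglongrightarrow> 0"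
  shows "cvm_consistent \<nu> f \<longleftrightarrow> (\<exists>\<delta>>0. \<forall>\<^sub>F i in sequentially. drift (\<nu> i) (f i) \<ge> \<delta>)"
proof
  have asy: "(\<lambda>i. type_II (\<nu> i) (cvm_test (\<nu> i) (t i)) (f i) - limit_cdf (real (\<nu> i) * t i - drift (\<nu> i) (f i))) \<longlonglongrightarrow> 0" for t
    by (rule type_II_asymptotic[OF bdd]) (rule weak)
  {
    assume "\<exists>\<delta>>0. \<forall>\<^sub>F i in sequentially. drift (\<nu> i) (f i) \<ge> \<delta>"
    then obtain \<delta> where \<delta>: "\<delta> > 0" "\<forall>\<^sub>F i in sequentially. drift (\<nu> i) (f i) \<ge> \<delta>" by blast
    show "cvm_consistent \<nu> f"
      unfolding cvm_consistent_def
    proof (intro ballI allI impI)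
      fix \<alpha> :: real and t :: "nat \<Rightarrow> real"
      assume \<alpha>: "\<alpha> \<in> {0<..<1}" and t: "(\<lambda>i. type_I (\<nu> i) (cvm_test (\<nu> i) (t i))) \<longlonglongrightarrow> \<alpha>"
      obtain x where x: "limit_cdf x = 1 - \<alpha>" using \<alpha> limit_cdf_surj[of "1 - \<alpha>"] by auto
      have "limit_cdf x < limit_cdf (x + \<delta> / 2)"
        using limit_cdf_strict[of "x + \<delta> / 2" "\<delta> / 2"] limit_cdf_mono[of x "x + \<delta> / 2"] x \<alpha> \<delta>(1) by auto
      moreover have lt: "limit_cdf (x - \<delta> / 2) < 1 - \<alpha>" using limit_cdf_strict[of x "\<delta> / 2"] x \<alpha> \<delta>(1) by auto
      ultimately have "\<forall>\<^sub>F i in sequentially. limit_cdf (real (\<nu> i) * t i) < limit_cdf (x + \<delta> / 2)"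
        using order_tendstoD(2)[OF limit_cdf_threshold[OF \<alpha> t], of "limit_cdf (x + \<delta> / 2)"] x by simp
      define \<kappa> where "\<kappa> = (1 - \<alpha> - limit_cdf (x - \<delta> / 2)) / 2"
      have \<kappa>: "\<kappa> > 0" using lt by (simp add: \<kappa>_def)
      have "\<forall>\<^sub>F i in sequentially. type_II (\<nu> i) (cvm_test (\<nu> i) (t i)) (f i) \<le> limit_cdf (x - \<delta> / 2) + \<kappa>"
        using \<open>\<forall>\<^sub>F i in sequentially. limit_cdf (real (\<nu> i) * t i) < limit_cdf (x + \<delta> / 2)\<close> \<delta>(2) order_tendstoD(2)[OF asy[of t] \<kappa>]
      proof eventually_elim
        case (elim i)
        have "real (\<nu> i) * t i < x + \<delta> / 2" using elim(1) limit_cdf_mono[of "x + \<delta> / 2" "real (\<nu> i) * t i"] by linarith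
        then have "limit_cdf (real (\<nu> i) * t i - drift (\<nu> i) (f i)) \<le> limit_cdf (x - \<delta> / 2)"
          using elim(2) by (intro limit_cdf_mono) linarith
        then show ?case using elim(3) by linarith
      qed
      then have "limsup (\<lambda>i. ereal (type_II (\<nu> i) (cvm_test (\<nu> i) (t i)) (f i))) \<le> ereal (limit_cdf (x - \<delta> / 2) + \<kappa>)"
        by (intro Limsup_bounded) auto
      also have "\<dots> < ereal (1 - \<alpha>)" using lt by (simp add: \<kappa>_def field_simps)
      finally show "limsup (\<lambda>i. ereal (type_II (\<nu> i) (cvm_test (\<nu> i) (t i)) (f i))) < ereal (1 - \<alpha>)" .
    qed
  }
  assume cons: "cvm_consistent \<nu> f"
  show "\<exists>\<delta>>0. \<forall>\<^sub>F i in sequentially. drift (\<nu> i) (f i) \<ge> \<delta>"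
  proof (rule ccontr)
    assume "\<not> ?thesis"
    then have small: "\<exists>\<^sub>F i in sequentially. drift (\<nu> i) (f i) < \<delta>" if "\<delta> > 0" for \<delta>
      using that unfolding frequently_def not_less by blast
    obtain x where x: "limit_cdf x = 1 / 2" using limit_cdf_surj[of "1 / 2"] by auto
    define t where "t i = x / real (\<nu> i)" for i
    have nt: "\<forall>\<^sub>F i in sequentially. real (\<nu> i) * t i = x"
      using sizes_pos by eventually_elim (simp add: t_def)
    have "(\<lambda>i. type_I (\<nu> i) (cvm_test (\<nu> i) (t i)) - (1 - limit_cdf (real (\<nu> i) * t i)) + (1 - limit_cdf (real (\<nu> i) * t i))) \<longlonglongrightarrow> 0 + 1 / 2"
      by (intro tendsto_add type_I_asymptotic tendsto_eventually) (use nt in eventually_elim, simp add: x)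
    then have "(\<lambda>i. type_I (\<nu> i) (cvm_test (\<nu> i) (t i))) \<longlonglongrightarrow> 1 / 2" by simp
    then have "limsup (\<lambda>i. ereal (type_II (\<nu> i) (cvm_test (\<nu> i) (t i)) (f i))) < ereal (1 - 1 / 2)"
      using cons[unfolded cvm_consistent_def, rule_format, of "1 / 2" t] by simp
    then obtain y where y: "limsup (\<lambda>i. ereal (type_II (\<nu> i) (cvm_test (\<nu> i) (t i)) (f i))) < ereal y" "y < 1 / 2"
      using ereal_dense2 by fastforce
    have y': "\<forall>\<^sub>F i in sequentially. type_II (\<nu> i) (cvm_test (\<nu> i) (t i)) (f i) < y"
      using Limsup_lessD[OF y(1)] by simp
    define \<kappa> where "\<kappa> = (1 / 2 - y) / 2"
    have \<kappa>: "\<kappa> > 0" using y(2) by (simp add: \<kappa>_def)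
    obtain \<delta> where \<delta>: "\<delta> > 0" and uc: "\<And>x y. \<bar>x - y\<bar> \<le> \<delta> \<Longrightarrow> \<bar>limit_cdf x - limit_cdf y\<bar> \<le> \<kappa>"
      using limit_cdf_uniformly_continuous[OF \<kappa>] by metis
    have "- \<kappa> < 0" using \<kappa> by simp
    have "\<forall>\<^sub>F i in sequentially. \<not> drift (\<nu> i) (f i) < \<delta>"
      using y' nt order_tendstoD(1)[OF asy[of t] \<open>- \<kappa> < 0\<close>]
    proof eventually_elim
      case (elim i)
      show ?case
      proof
        assume "drift (\<nu> i) (f i) < \<delta>"
        then have "\<bar>limit_cdf x - limit_cdf (x - drift (\<nu> i) (f i))\<bar> \<le> \<kappa>" using uc[of x "x - drift (\<nu> i) (f i)"] by simp
        moreover have "y = 1 / 2 - 2 * \<kappa>" by (simp add: \<kappa>_def field_simps)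
        ultimately show False using elim(1) elim(3)[unfolded elim(2)] x by linarith
      qed
    qed
    then show False using small[OF \<delta>] by (simp add: frequently_def)
  qed
qed

end

section \<open>Frequency bands at the rate\<close>

text \<open>The frequencies below a cutoff.\<close>

abbreviation (input) band :: "real \<Rightarrow> nat set" where
  "band l \<equiv> {j. 1 \<le> j \<and> real j < l}"

lemma finite_band [simp]: "finite (band l)"
  by (rule finite_subset[of _ "{..nat \<lceil>l\<rceil>}"]) (auto simp: le_nat_iff ceiling_le_iff le_ceiling_iff)

lemma finite_band_Suc [simp]: "finite {j. Suc 0 \<le> j \<and> real j < l}"
  using finite_band[of l] by simp

lemma band_mono: "l \<le> l' \<Longrightarrow> band l \<subseteq> band l'" by auto

locale rate =
  fixes r s :: real
  assumes r: "0 < r" "r < 1/2" and s: "s = 2 * r / (1 - 2 * r)"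
begin

abbreviation rt :: "nat \<Rightarrow> real" where "rt n \<equiv> real n powr (- r)"
abbreviation k :: "nat \<Rightarrow> real" where "k n \<equiv> real (kn r n)"

lemma rt_square: "(rt n)\<^sup>2 = real n powr (- 2 * r)"
  by (simp add: power2_eq_square flip: powr_add)

lemma rt_pos: "n \<ge> 1 \<Longrightarrow> 0 < rt n" by simp

lemma rt_tendsto: "rt \<longlonglongrightarrow> 0"
  using r by (intro tendsto_neg_powr filterlim_real_sequentially) auto

lemma s_pos: "s > 0" using r by (simp add: s)

lemma k_ge_1: "n \<ge> 1 \<Longrightarrow> 1 \<le> k n"
proof -
  assume n: "n \<ge> 1"
  have "1 \<le> real n powr ((1 - 2 * r) / 2)" using n r by (intro ge_one_powr_ge_zero) auto
  then have "1 \<le> nat \<lfloor>real n powr ((1 - 2 * r) / 2)\<rfloor>" by (intro le_nat_floor) simp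
  then have "real 1 \<le> k n" unfolding kn_def by (rule of_nat_mono)
  then show "1 \<le> k n" by simp
qed

lemma k_le: "k n \<le> real n powr ((1 - 2 * r) / 2)"
  unfolding kn_def by simp

lemma k_ge: "n \<ge> 1 \<Longrightarrow> real n powr ((1 - 2 * r) / 2) \<le> 2 * k n"
  using k_ge_1[of n] unfolding kn_def by linarith

lemma rate_square: "n \<ge> 1 \<Longrightarrow> (real n powr ((1 - 2 * r) / 2))\<^sup>2 = real n * (rt n)\<^sup>2"
proof -
  assume n: "n \<ge> 1"
  have "(real n powr ((1 - 2 * r) / 2))\<^sup>2 = real n powr (1 + (- 2 * r))"
    by (simp add: power2_eq_square flip: powr_add)
  also have "\<dots> = real n * (rt n)\<^sup>2" unfolding powr_add rt_square using n by simp
  finally show "(real n powr ((1 - 2 * r) / 2))\<^sup>2 = real n * (rt n)\<^sup>2" .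
qed

lemma k_square_le: "n \<ge> 1 \<Longrightarrow> (k n)\<^sup>2 \<le> real n * (rt n)\<^sup>2"
  unfolding rate_square[symmetric] by (intro power_mono k_le) simp

lemma k_square_ge: "n \<ge> 1 \<Longrightarrow> real n * (rt n)\<^sup>2 \<le> 4 * (k n)\<^sup>2"
proof -
  assume n: "n \<ge> 1"
  have "(real n powr ((1 - 2 * r) / 2))\<^sup>2 \<le> (2 * k n)\<^sup>2" by (intro power_mono k_ge n) simp
  then show "real n * (rt n)\<^sup>2 \<le> 4 * (k n)\<^sup>2" unfolding rate_square[OF n] power_mult_distrib by simp
qed

text \<open>The smoothness \<open>s\<close> is matched to the rate: a cutoff at \<open>k n\<close> corresponds to a tail of size
  \<open>(rt n)\<^sup>2\<close> in the Besov ball.\<close>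

lemma rate_powr: "n \<ge> 1 \<Longrightarrow> (real n powr ((1 - 2 * r) / 2)) powr (2 * s) = 1 / (rt n)\<^sup>2"
proof -
  assume n: "n \<ge> 1"
  have "(1 - 2 * r) / 2 * (2 * s) = 2 * r" using r by (simp add: s)
  then have "(real n powr ((1 - 2 * r) / 2)) powr (2 * s) = real n powr (2 * r)" by (simp add: powr_powr)
  also have "\<dots> = 1 / (rt n)\<^sup>2" unfolding rt_square by (simp add: powr_minus field_simps)
  finally show "(real n powr ((1 - 2 * r) / 2)) powr (2 * s) = 1 / (rt n)\<^sup>2" .
qed

lemma k_at_top: "filterlim k at_top sequentially"
proof (rule filterlim_at_top_mono)
  have "filterlim (\<lambda>n. real n powr ((1 - 2 * r) / 2)) at_top sequentially"
  proof -
    have "(\<lambda>n. real n powr (- ((1 - 2 * r) / 2))) \<longlonglongrightarrow> 0"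
      using r by (intro tendsto_neg_powr filterlim_real_sequentially) auto
    moreover have "\<forall>\<^sub>F n in sequentially. 0 < real n powr (- ((1 - 2 * r) / 2))"
      using eventually_ge_at_top[of 1] by eventually_elim simp
    ultimately show ?thesis
      using filterlim_inverse_at_top by (fastforce simp: powr_minus)
  qed
  from filterlim_tendsto_pos_mult_at_top[OF tendsto_const[of "1 / 2"] _ this]
  show "filterlim (\<lambda>n. real n powr ((1 - 2 * r) / 2) / 2) at_top sequentially" by simp
  show "\<forall>\<^sub>F n in sequentially. real n powr ((1 - 2 * r) / 2) / 2 \<le> k n"
    using eventually_ge_at_top[of 1] by eventually_elim (use k_ge in force)
qed

text \<open>Frequencies beyond \<open>l * k n\<close> contribute at most a constant multiple of \<open>1 / l\<^sup>2\<close>.\<close>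

lemma drift_le:
  assumes "cos_expansion \<eta> g" "n \<ge> 1" "l > 0" "l2norm g \<le> D * rt n"
  shows "drift n g \<le> real n * (\<Sum>j\<in>band (l * k n). (\<eta> j)\<^sup>2 / (pi * real j)\<^sup>2) + (2 * D / (pi * l))\<^sup>2"
proof -
  have kp: "k n > 0" using k_ge_1[OF assms(2)] by linarith
  have "drift n g \<le> real n * ((\<Sum>j\<in>band (l * k n). (\<eta> j)\<^sup>2 / (pi * real j)\<^sup>2) + (l2norm g)\<^sup>2 / (pi * (l * k n))\<^sup>2)"
    unfolding drift_def using assms(3) kp by (intro mult_left_mono prim_norm_le[OF assms(1)]) auto
  also have "\<dots> = real n * (\<Sum>j\<in>band (l * k n). (\<eta> j)\<^sup>2 / (pi * real j)\<^sup>2) + real n * (l2norm g)\<^sup>2 / (pi * (l * k n))\<^sup>2"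
    by (simp add: distrib_left)
  also have "real n * (l2norm g)\<^sup>2 / (pi * (l * k n))\<^sup>2 \<le> (2 * D / (pi * l))\<^sup>2"
  proof -
    have "real n * (l2norm g)\<^sup>2 \<le> real n * (D * rt n)\<^sup>2"
      using assms(4) by (intro mult_left_mono power_mono) auto
    also have "\<dots> = D\<^sup>2 * (real n * (rt n)\<^sup>2)" by (simp add: power_mult_distrib)
    also have "\<dots> \<le> D\<^sup>2 * (4 * (k n)\<^sup>2)" by (intro mult_left_mono k_square_ge assms(2)) simp
    finally have "real n * (l2norm g)\<^sup>2 / (pi * (l * k n))\<^sup>2 \<le> D\<^sup>2 * (4 * (k n)\<^sup>2) / (pi * (l * k n))\<^sup>2"
      by (intro divide_right_mono) auto
    also have "\<dots> = (2 * D / (pi * l))\<^sup>2"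
      using kp assms(3) by (simp add: power_divide power_mult_distrib field_simps)
    finally show ?thesis .
  qed
  finally show ?thesis by simp
qed

text \<open>On frequencies up to \<open>l * k n\<close> the damping costs at most the factor \<open>(pi * l * k n)\<^sup>2\<close>.\<close>

lemma band_coefficients_le:
  assumes "alternative g" "n \<ge> 1" "l > 0" "J \<subseteq> {1..}" "finite J" "\<And>j. j \<in> J \<Longrightarrow> real j \<le> l * k n"
  shows "(\<Sum>j\<in>J. (l2inner g (\<phi> j))\<^sup>2) \<le> (pi * l)\<^sup>2 * drift n g * (rt n)\<^sup>2"
proof -
  have n: "real n > 0" using assms(2) by simp
  have "(\<Sum>j\<in>J. (l2inner g (\<phi> j))\<^sup>2) \<le> (\<Sum>j\<in>J. (pi * (l * k n))\<^sup>2 * ((l2inner g (\<phi> j))\<^sup>2 / (pi * real j)\<^sup>2))"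
  proof (rule sum_mono)
    fix j assume j: "j \<in> J"
    then have j1: "real j \<ge> 1" using assms(4) by auto
    have "(pi * real j)\<^sup>2 \<le> (pi * (l * k n))\<^sup>2" using assms(6)[OF j] by (intro power_mono mult_left_mono) auto
    then have "(l2inner g (\<phi> j))\<^sup>2 * (pi * real j)\<^sup>2 \<le> (l2inner g (\<phi> j))\<^sup>2 * (pi * (l * k n))\<^sup>2"
      by (intro mult_left_mono) auto
    then show "(l2inner g (\<phi> j))\<^sup>2 \<le> (pi * (l * k n))\<^sup>2 * ((l2inner g (\<phi> j))\<^sup>2 / (pi * real j)\<^sup>2)"
      using j1 by (simp add: pos_le_divide_eq mult.commute)
  qed
  also have "\<dots> = (pi * (l * k n))\<^sup>2 * (\<Sum>j\<in>J. (l2inner g (\<phi> j))\<^sup>2 / (pi * real j)\<^sup>2)"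
    by (simp add: sum_distrib_left)
  also have "\<dots> \<le> (pi * (l * k n))\<^sup>2 * (l2norm (prim g))\<^sup>2"
    using assms(1,4,5) by (intro mult_left_mono prim_norm_ge alternative_L2 alternative_mean) auto
  also have "\<dots> = (pi * l)\<^sup>2 * (l2norm (prim g))\<^sup>2 * (k n)\<^sup>2" by (simp add: power_mult_distrib)
  also have "\<dots> \<le> (pi * l)\<^sup>2 * (l2norm (prim g))\<^sup>2 * (real n * (rt n)\<^sup>2)"
    by (intro mult_left_mono k_square_le assms(2)) auto
  also have "\<dots> = (pi * l)\<^sup>2 * drift n g * (rt n)\<^sup>2" by (simp add: drift_def)
  finally show ?thesis .
qed

end

locale cvm_alternatives = rate +
  fixes c C :: real and \<theta> :: "nat \<Rightarrow> nat \<Rightarrow> real" and f :: "nat \<Rightarrow> real \<Rightarrow> real"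
  assumes cC: "0 < c" "c < C"
    and expansion: "\<And>n. n \<ge> 1 \<Longrightarrow> cos_expansion (\<theta> n) (f n)"
    and alt: "\<And>n. n \<ge> 1 \<Longrightarrow> alternative (f n)"
    and norm_f: "\<And>n. n \<ge> 1 \<Longrightarrow> c * real n powr (-r) \<le> l2norm (f n) \<and> l2norm (f n) \<le> C * real n powr (-r)"
    and G1: "condition_G1 r \<theta>"
begin

lemma C_pos: "C > 0" using cC by simp

lemma L2_f: "n \<ge> 1 \<Longrightarrow> f n \<in> L2" using alt alternative_L2 by blast

definition low :: "real \<Rightarrow> nat \<Rightarrow> real" where
  "low l n = (\<Sum>j\<in>band (l * k n). (\<theta> n j)\<^sup>2)"

lemma low_nonneg: "0 \<le> low l n" unfolding low_def by (intro sum_nonneg) auto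

lemma low_mono: "l \<le> l' \<Longrightarrow> low l n \<le> low l' n"
  unfolding low_def by (intro sum_mono2 finite_band band_mono mult_right_mono) auto

lemma norm_square_le: "n \<ge> 1 \<Longrightarrow> (l2norm (f n))\<^sup>2 \<le> C\<^sup>2 * (rt n)\<^sup>2"
  using norm_f[of n] power_mono[of "l2norm (f n)" "C * rt n" 2] by (simp add: power_mult_distrib)

lemma norm_square_ge: "n \<ge> 1 \<Longrightarrow> c\<^sup>2 * (rt n)\<^sup>2 \<le> (l2norm (f n))\<^sup>2"
  using norm_f[of n] power_mono[of "c * rt n" "l2norm (f n)" 2] cC by (simp add: power_mult_distrib)

lemma G1E:
  assumes "e > 0"
  obtains l where "l > 0" "\<forall>\<^sub>F n in sequentially. real n * (\<Sum>j\<in>band (l * k n). (\<theta> n j)\<^sup>2 / (real j)\<^sup>2) < e"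
proof -
  from G1[unfolded condition_G1_def, rule_format, OF assms] obtain l n0 where l: "l > 0"
    "\<And>n. n > n0 \<Longrightarrow> real n * (\<Sum>j | 1 \<le> j \<and> real j < l * real (kn r n). (\<theta> n j)\<^sup>2 / (real j)\<^sup>2) < e"
    by blast
  then show ?thesis by (intro that[of l]) (auto intro: eventually_mono[OF eventually_gt_at_top[of n0]])
qed

lemma pi_damp: "(\<Sum>j\<in>J. (\<theta> n j)\<^sup>2 / (pi * real j)\<^sup>2) \<le> (\<Sum>j\<in>J. (\<theta> n j)\<^sup>2 / (real j)\<^sup>2)"
proof (rule sum_mono)
  fix j
  have "1\<^sup>2 \<le> pi\<^sup>2" using pi_gt3 by (intro power_mono) auto
  then have "(\<theta> n j)\<^sup>2 / (real j)\<^sup>2 / pi\<^sup>2 \<le> (\<theta> n j)\<^sup>2 / (real j)\<^sup>2 / 1"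
    by (intro divide_left_mono) auto
  then show "(\<theta> n j)\<^sup>2 / (pi * real j)\<^sup>2 \<le> (\<theta> n j)\<^sup>2 / (real j)\<^sup>2"
    by (simp add: power_mult_distrib mult.commute)
qed

text \<open>Three ranges of frequencies: the first is controlled by G1, the last by the damping, and on the
  middle one \<open>j\<close> is comparable to \<open>k n\<close>.\<close>

lemma drift_split:
  assumes "n \<ge> 1" "0 < a" "a \<le> b"
  shows "drift n (f n) \<le> real n * (\<Sum>j\<in>band (a * k n). (\<theta> n j)\<^sup>2 / (real j)\<^sup>2)
     + (2 / (pi * a))\<^sup>2 * (low b n / (rt n)\<^sup>2) + (2 * C / (pi * b))\<^sup>2"
proof -
  have kp: "k n > 0" using k_ge_1[OF assms(1)] by linarith
  let ?A = "band (a * k n)" and ?B = "band (b * k n)"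
  have sub: "?A \<subseteq> ?B" using assms kp by (intro band_mono mult_right_mono) auto
  have split: "(\<Sum>j\<in>?B. (\<theta> n j)\<^sup>2 / (pi * real j)\<^sup>2) = (\<Sum>j\<in>?A. (\<theta> n j)\<^sup>2 / (pi * real j)\<^sup>2) + (\<Sum>j\<in>?B - ?A. (\<theta> n j)\<^sup>2 / (pi * real j)\<^sup>2)"
    using sum.subset_diff[OF sub finite_band] by (simp only: add.commute)
  have "(\<Sum>j\<in>?B - ?A. (\<theta> n j)\<^sup>2 / (pi * real j)\<^sup>2) \<le> (\<Sum>j\<in>?B - ?A. (\<theta> n j)\<^sup>2 / (pi * (a * k n))\<^sup>2)"
    using assms(2) kp by (intro sum_mono divide_left_mono power_mono mult_left_mono) auto
  also have "\<dots> = (\<Sum>j\<in>?B - ?A. (\<theta> n j)\<^sup>2) / (pi * (a * k n))\<^sup>2" by (simp add: sum_divide_distrib)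
  also have "\<dots> \<le> low b n / (pi * (a * k n))\<^sup>2"
    unfolding low_def by (intro divide_right_mono sum_mono2) auto
  finally have mid: "real n * (\<Sum>j\<in>?B - ?A. (\<theta> n j)\<^sup>2 / (pi * real j)\<^sup>2) \<le> real n * (low b n / (pi * (a * k n))\<^sup>2)"
    by (intro mult_left_mono) auto
  also have "\<dots> \<le> (2 / (pi * a))\<^sup>2 * (low b n / (rt n)\<^sup>2)"
  proof -
    have rp: "(rt n)\<^sup>2 > 0" using rt_pos[OF assms(1)] by simp
    have "real n \<le> 4 * (k n)\<^sup>2 / (rt n)\<^sup>2" using k_square_ge[OF assms(1)] rp by (simp add: pos_le_divide_eq)
    then have "real n * (low b n / (pi * (a * k n))\<^sup>2) \<le> 4 * (k n)\<^sup>2 / (rt n)\<^sup>2 * (low b n / (pi * (a * k n))\<^sup>2)"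
      using low_nonneg by (intro mult_right_mono) auto
    also have "\<dots> = (2 / (pi * a))\<^sup>2 * (low b n / (rt n)\<^sup>2)"
      using kp by (simp add: power_divide power_mult_distrib)
    finally show ?thesis .
  qed
  finally have "real n * (\<Sum>j\<in>?B - ?A. (\<theta> n j)\<^sup>2 / (pi * real j)\<^sup>2) \<le> (2 / (pi * a))\<^sup>2 * (low b n / (rt n)\<^sup>2)" .
  moreover have "real n * (\<Sum>j\<in>?A. (\<theta> n j)\<^sup>2 / (pi * real j)\<^sup>2) \<le> real n * (\<Sum>j\<in>?A. (\<theta> n j)\<^sup>2 / (real j)\<^sup>2)"
    by (intro mult_left_mono pi_damp) auto
  moreover have "drift n (f n) \<le> real n * (\<Sum>j\<in>?B. (\<theta> n j)\<^sup>2 / (pi * real j)\<^sup>2) + (2 * C / (pi * b))\<^sup>2"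
    using norm_f[OF assms(1)] assms(2,3) by (intro drift_le expansion assms(1)) auto
  ultimately show ?thesis unfolding split distrib_left by linarith
qed

lemma low_le_drift:
  assumes "n \<ge> 1" "l > 0"
  shows "low l n \<le> (pi * l)\<^sup>2 * drift n (f n) * (rt n)\<^sup>2"
proof -
  have "low l n = (\<Sum>j\<in>band (l * k n). (l2inner (f n) (\<phi> j))\<^sup>2)"
    unfolding low_def by (intro sum.cong) (auto simp: cos_expansion_coeff[OF expansion[OF assms(1)]])
  also have "\<dots> \<le> (pi * l)\<^sup>2 * drift n (f n) * (rt n)\<^sup>2"
    by (rule band_coefficients_le[OF alt[OF assms(1)] assms]) auto
  finally show ?thesis .
qed

text \<open>Each frequency is eventually below the cutoff in G1, because \<open>k n\<close> tends to infinity.\<close>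

lemma coeff_weak:
  assumes "j \<ge> 1"
  shows "(\<lambda>n. real n * (\<theta> n j)\<^sup>2) \<longlonglongrightarrow> 0"
proof (rule tendstoI)
  fix e :: real assume e: "e > 0"
  have j: "real j > 0" using assms by simp
  obtain l where l: "l > 0" "\<forall>\<^sub>F n in sequentially. real n * (\<Sum>i\<in>band (l * k n). (\<theta> n i)\<^sup>2 / (real i)\<^sup>2) < e / (real j)\<^sup>2"
    by (rule G1E[of "e / (real j)\<^sup>2"]) (use e j in auto)
  have "\<forall>\<^sub>F n in sequentially. real j / l < k n"
    using k_at_top by (simp add: filterlim_at_top_dense)
  with l(2) show "\<forall>\<^sub>F n in sequentially. dist (real n * (\<theta> n j)\<^sup>2) 0 < e"
  proof eventually_elim
    case (elim n)
    have "j \<in> band (l * k n)" using elim(2) l(1) assms by (simp add: field_simps)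
    then have "(\<theta> n j)\<^sup>2 / (real j)\<^sup>2 \<le> (\<Sum>i\<in>band (l * k n). (\<theta> n i)\<^sup>2 / (real i)\<^sup>2)"
      by (intro member_le_sum) auto
    then have "real n * ((\<theta> n j)\<^sup>2 / (real j)\<^sup>2) \<le> real n * (\<Sum>i\<in>band (l * k n). (\<theta> n i)\<^sup>2 / (real i)\<^sup>2)"
      by (intro mult_left_mono) auto
    then have "real n * (\<theta> n j)\<^sup>2 / (real j)\<^sup>2 < e / (real j)\<^sup>2" using elim(1) by simp
    then show ?case using j by (simp add: divide_less_cancel)
  qed
qed

lemma drift_bounded: obtains A where "\<forall>\<^sub>F n in sequentially. drift n (f n) \<le> A"
proof -
  obtain l where l: "l > 0" "\<forall>\<^sub>F n in sequentially. real n * (\<Sum>j\<in>band (l * k n). (\<theta> n j)\<^sup>2 / (real j)\<^sup>2) < 1"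
    by (rule G1E[of 1]) auto
  have "\<forall>\<^sub>F n in sequentially. drift n (f n) \<le> 1 + (2 * C / (pi * l))\<^sup>2"
    using l(2) eventually_ge_at_top[of 1]
  proof eventually_elim
    case (elim n)
    have "real n * (\<Sum>j\<in>band (l * k n). (\<theta> n j)\<^sup>2 / (pi * real j)\<^sup>2) \<le> real n * (\<Sum>j\<in>band (l * k n). (\<theta> n j)\<^sup>2 / (real j)\<^sup>2)"
      by (intro mult_left_mono pi_damp) auto
    then show ?case
      using drift_le[OF expansion[OF elim(2)] elim(2) l(1), of C] norm_f[OF elim(2)] elim(1) by linarith
  qed
  then show ?thesis by (rule that)
qed

lemma norm_bound_tendsto:
  assumes "\<And>i. l2norm (g i) \<le> D * rt (\<nu> i)" "filterlim \<nu> at_top sequentially"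
  shows "(\<lambda>i. l2norm (g i)) \<longlonglongrightarrow> 0"
proof (rule Lim_null_comparison)
  show "\<forall>\<^sub>F i in sequentially. norm (l2norm (g i)) \<le> D * rt (\<nu> i)" using assms(1) by simp
  show "(\<lambda>i. D * rt (\<nu> i)) \<longlonglongrightarrow> 0"
    using tendsto_mult_left[OF filterlim_compose[OF rt_tendsto assms(2)], of D] by simp
qed

sublocale van: vanishing_alternatives "\<lambda>n. n" f
proof
  show "filterlim (\<lambda>n::nat. n) at_top sequentially" by (rule filterlim_ident)
  show "\<forall>\<^sub>F n in sequentially. alternative (f n)"
    using eventually_ge_at_top[of 1] by eventually_elim (rule alt)
  show "(\<lambda>n. l2norm (f n)) \<longlonglongrightarrow> 0"
  proof (rule Lim_null_comparison)
    show "\<forall>\<^sub>F n in sequentially. norm (l2norm (f n)) \<le> C * rt n"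
      using eventually_ge_at_top[of 1] by eventually_elim (use norm_f in auto)
    show "(\<lambda>n. C * rt n) \<longlonglongrightarrow> 0" using tendsto_mult_left[OF rt_tendsto, of C] by simp
  qed
qed

lemma weak_f:
  assumes "j \<ge> 1"
  shows "(\<lambda>n. real n * (l2inner (f n) (\<phi> j))\<^sup>2) \<longlonglongrightarrow> 0"
proof (rule Lim_transform_eventually[OF coeff_weak[OF assms]])
  show "\<forall>\<^sub>F n in sequentially. real n * (\<theta> n j)\<^sup>2 = real n * (l2inner (f n) (\<phi> j))\<^sup>2"
    using eventually_ge_at_top[of 1]
  proof eventually_elim
    case (elim n)
    show ?case using cos_expansion_coeff[OF expansion[OF elim] assms] by simp
  qed
qed

lemma consistent_iff_drift_ge:
  "cvm_consistent (\<lambda>n. n) f \<longleftrightarrow> (\<exists>\<delta>>0. \<forall>\<^sub>F n in sequentially. drift n (f n) \<ge> \<delta>)"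
proof -
  obtain A where "\<forall>\<^sub>F n in sequentially. drift n (f n) \<le> A" by (rule drift_bounded)
  then show ?thesis by (rule van.consistent_iff_drift) (rule weak_f)
qed

lemma inconsistent_iff_drift:
  "cvm_inconsistent (\<lambda>n. n) f \<longleftrightarrow> (\<lambda>n. drift n (f n)) \<longlonglongrightarrow> 0"
proof
  assume "(\<lambda>n. drift n (f n)) \<longlonglongrightarrow> 0"
  then show "cvm_inconsistent (\<lambda>n. n) f" by (rule van.inconsistent_of_drift)
next
  assume inc: "cvm_inconsistent (\<lambda>n. n) f"
  \<comment> \<open>shift the index: the sample size 0 carries no information\<close>
  have "cvm_inconsistent Suc (\<lambda>n. f (Suc n))"
    unfolding cvm_inconsistent_def
  proof
    fix t :: "nat \<Rightarrow> real"
    have "liminf (\<lambda>i. ereal (type_I i (cvm_test i (t (i - 1))) + type_II i (cvm_test i (t (i - 1))) (f i))) \<ge> 1"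
      using inc[unfolded cvm_inconsistent_def, rule_format, of "\<lambda>i. t (i - 1)"] by simp
    then have L: "\<forall>\<^sub>F i in sequentially. y < ereal (type_I i (cvm_test i (t (i - 1))) + type_II i (cvm_test i (t (i - 1))) (f i))" if "y < 1" for y
      using that unfolding le_Liminf_iff by blast
    show "1 \<le> liminf (\<lambda>i. ereal (type_I (Suc i) (cvm_test (Suc i) (t i)) + type_II (Suc i) (cvm_test (Suc i) (t i)) (f (Suc i))))"
      unfolding le_Liminf_iff
    proof (intro allI impI)
      fix y :: ereal assume "y < 1"
      from L[OF this] have "\<forall>\<^sub>F i in sequentially. y < ereal (type_I (Suc i) (cvm_test (Suc i) (t (Suc i - 1))) + type_II (Suc i) (cvm_test (Suc i) (t (Suc i - 1))) (f (Suc i)))"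
        by (subst eventually_sequentially_Suc)
      then show "\<forall>\<^sub>F i in sequentially. y < ereal (type_I (Suc i) (cvm_test (Suc i) (t i)) + type_II (Suc i) (cvm_test (Suc i) (t i)) (f (Suc i)))"
        by simp
    qed
  qed
  then have "(\<lambda>i. drift (Suc i) (f (Suc i))) \<longlonglongrightarrow> 0"
    by (rule inconsistent_imp_drift) (simp_all add: alt LIMSEQ_Suc[OF van.norm])
  then show "(\<lambda>n. drift n (f n)) \<longlonglongrightarrow> 0" by (rule LIMSEQ_imp_Suc)
qed

subsection \<open>Consistency in terms of low frequencies\<close>

text \<open>The condition in (a).\<close>

definition detectable :: bool where
  "detectable \<longleftrightarrow> (\<exists>c1>0. \<exists>c2>0. \<exists>n0. \<forall>n>n0. low c2 n > c1 * (rt n)\<^sup>2)"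

lemma choose_large:
  assumes "e > 0"
  obtains L where "L > 0" "\<And>b. b \<ge> L \<Longrightarrow> 2 * D / (pi * b) \<le> e"
proof
  show "max 1 (2 * \<bar>D\<bar> / (pi * e)) > 0" by simp
  fix b assume b: "b \<ge> max 1 (2 * \<bar>D\<bar> / (pi * e))"
  then have "2 * \<bar>D\<bar> \<le> b * (pi * e)" using assms by (simp add: pos_divide_le_eq)
  then have "2 * D \<le> e * (pi * b)" by (simp add: mult_ac)
  then show "2 * D / (pi * b) \<le> e" using b by (simp add: pos_divide_le_eq)
qed

lemma consistent_iff_detectable: "cvm_consistent (\<lambda>n. n) f \<longleftrightarrow> detectable"
proof
  assume "cvm_consistent (\<lambda>n. n) f"
  then obtain \<delta> where \<delta>: "\<delta> > 0" "\<forall>\<^sub>F n in sequentially. drift n (f n) \<ge> \<delta>"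
    unfolding consistent_iff_drift_ge by blast
  obtain a where a: "a > 0" "\<forall>\<^sub>F n in sequentially. real n * (\<Sum>j\<in>band (a * k n). (\<theta> n j)\<^sup>2 / (real j)\<^sup>2) < \<delta> / 4"
    by (rule G1E[of "\<delta> / 4"]) (use \<delta>(1) in auto)
  obtain L where L: "L > 0" "\<And>b. b \<ge> L \<Longrightarrow> 2 * C / (pi * b) \<le> sqrt (\<delta> / 4)"
    by (rule choose_large[of "sqrt (\<delta> / 4)" C]) (use \<delta>(1) in auto)
  define b where "b = max a L"
  have b: "b > 0" "a \<le> b" using a(1) by (auto simp: b_def)
  have "(2 * C / (pi * b))\<^sup>2 \<le> (sqrt (\<delta> / 4))\<^sup>2"
    using L(2)[of b] b C_pos by (intro power_mono) (auto simp: b_def)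
  then have tail: "(2 * C / (pi * b))\<^sup>2 \<le> \<delta> / 4" using \<delta>(1) by simp
  define c1 where "c1 = \<delta> / 4 / (2 / (pi * a))\<^sup>2"
  have c1: "c1 > 0" using \<delta>(1) a(1) by (simp add: c1_def)
  have "\<forall>\<^sub>F n in sequentially. low b n > c1 * (rt n)\<^sup>2"
    using \<delta>(2) a(2) eventually_ge_at_top[of 1]
  proof eventually_elim
    case (elim n)
    have "\<delta> / 2 \<le> (2 / (pi * a))\<^sup>2 * (low b n / (rt n)\<^sup>2)"
      using drift_split[OF elim(3) a(1) b(2)] elim(1,2) tail by linarith
    then have "\<delta> / 4 < (2 / (pi * a))\<^sup>2 * (low b n / (rt n)\<^sup>2)" using \<delta>(1) by linarith
    moreover have "(2 / (pi * a))\<^sup>2 > 0" using a(1) by simp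
    ultimately have "c1 < low b n / (rt n)\<^sup>2" unfolding c1_def by (simp only: pos_divide_less_eq mult.commute)
    then show ?case using rt_pos[OF elim(3)] by (simp add: pos_less_divide_eq)
  qed
  then obtain n0 where "\<And>n. n \<ge> n0 \<Longrightarrow> low b n > c1 * (rt n)\<^sup>2" by (auto simp: eventually_sequentially)
  then show detectable unfolding detectable_def using c1 b by (meson less_imp_le)
next
  assume detectable
  then obtain c1 c2 n0 where d: "c1 > 0" "c2 > 0" "\<And>n. n > n0 \<Longrightarrow> low c2 n > c1 * (rt n)\<^sup>2"
    unfolding detectable_def by blast
  have "\<forall>\<^sub>F n in sequentially. drift n (f n) \<ge> c1 / (pi * c2)\<^sup>2"
    using eventually_gt_at_top[of n0] eventually_ge_at_top[of 1]
  proof eventually_elim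
    case (elim n)
    have "c1 * (rt n)\<^sup>2 \<le> (pi * c2)\<^sup>2 * drift n (f n) * (rt n)\<^sup>2"
      using d(3)[OF elim(1)] low_le_drift[OF elim(2) d(2)] by linarith
    then have "c1 \<le> (pi * c2)\<^sup>2 * drift n (f n)" using rt_pos[OF elim(2)] by simp
    then show ?case using d(2) by (simp add: pos_divide_le_eq mult.commute)
  qed
  then show "cvm_consistent (\<lambda>n. n) f"
    unfolding consistent_iff_drift_ge using d(1,2) by (intro exI[of _ "c1 / (pi * c2)\<^sup>2"]) auto
qed

lemma inconsistent_iff_low:
  "cvm_inconsistent (\<lambda>n. n) f \<longleftrightarrow> (\<forall>c2>0. (\<lambda>n. low c2 n / (rt n)\<^sup>2) \<longlonglongrightarrow> 0)"
  unfolding inconsistent_iff_drift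
proof (intro iffI allI impI)
  fix c2 :: real assume dr: "(\<lambda>n. drift n (f n)) \<longlonglongrightarrow> 0" and c2: "c2 > 0"
  show "(\<lambda>n. low c2 n / (rt n)\<^sup>2) \<longlonglongrightarrow> 0"
  proof (rule Lim_null_comparison)
    show "\<forall>\<^sub>F n in sequentially. norm (low c2 n / (rt n)\<^sup>2) \<le> (pi * c2)\<^sup>2 * drift n (f n)"
      using eventually_ge_at_top[of 1]
    proof eventually_elim
      case (elim n)
      then show ?case using low_le_drift[OF elim c2] rt_pos[OF elim] low_nonneg[of c2 n]
        by (simp add: pos_divide_le_eq)
    qed
    show "(\<lambda>n. (pi * c2)\<^sup>2 * drift n (f n)) \<longlonglongrightarrow> 0"
      using tendsto_mult_left[OF dr, of "(pi * c2)\<^sup>2"] by simp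
  qed
next
  assume lo: "\<forall>c2>0. (\<lambda>n. low c2 n / (rt n)\<^sup>2) \<longlonglongrightarrow> 0"
  show "(\<lambda>n. drift n (f n)) \<longlonglongrightarrow> 0"
  proof (rule tendstoI)
    fix e :: real assume e: "e > 0"
    obtain a where a: "a > 0" "\<forall>\<^sub>F n in sequentially. real n * (\<Sum>j\<in>band (a * k n). (\<theta> n j)\<^sup>2 / (real j)\<^sup>2) < e / 3"
      by (rule G1E[of "e / 3"]) (use e in auto)
    obtain L where L: "L > 0" "\<And>b. b \<ge> L \<Longrightarrow> 2 * C / (pi * b) \<le> sqrt (e / 3)"
      by (rule choose_large[of "sqrt (e / 3)" C]) (use e in auto)
    define b where "b = max a L"
    have b: "b > 0" "a \<le> b" using a(1) by (auto simp: b_def)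
    have "(2 * C / (pi * b))\<^sup>2 \<le> (sqrt (e / 3))\<^sup>2"
      using L(2)[of b] b C_pos by (intro power_mono) (auto simp: b_def)
    then have tail: "(2 * C / (pi * b))\<^sup>2 \<le> e / 3" using e by simp
    have "(\<lambda>n. (2 / (pi * a))\<^sup>2 * (low b n / (rt n)\<^sup>2)) \<longlonglongrightarrow> 0"
      using tendsto_mult_left[OF lo[rule_format, OF b(1)], of "(2 / (pi * a))\<^sup>2"] by simp
    from order_tendstoD(2)[OF this, of "e / 3"] e
    have "\<forall>\<^sub>F n in sequentially. (2 / (pi * a))\<^sup>2 * (low b n / (rt n)\<^sup>2) < e / 3" by simp
    then show "\<forall>\<^sub>F n in sequentially. dist (drift n (f n)) 0 < e"
      using a(2) eventually_ge_at_top[of 1]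
    proof eventually_elim
      case (elim n)
      then show ?case using drift_split[OF elim(3) a(1) b(2)] tail drift_nonneg[of n "f n"]
        unfolding dist_real_def by linarith
    qed
  qed
qed

end

context cvm_alternatives
begin

subsection \<open>Truncations\<close>

text \<open>For the finitely many small \<open>n\<close> a larger multiple of \<open>k n\<close> catches half of the energy, so the
  condition can be had for all \<open>n \<ge> 1\<close> at once and for all larger multiples.\<close>

lemma detectable_uniform:
  assumes detectable
  obtains a b where "a > 0" "b > 0" "\<forall>b'\<ge>b. \<forall>n\<ge>1. low b' n \<ge> a * (rt n)\<^sup>2"
proof -
  obtain c1 c2 n0 where d: "c1 > 0" "c2 > 0" "\<And>n. n > n0 \<Longrightarrow> low c2 n > c1 * (rt n)\<^sup>2"
    using assms unfolding detectable_def by blast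
  have "\<exists>N. \<forall>n\<in>{1..n0}. (\<Sum>j=1..N n. (\<theta> n j)\<^sup>2) \<ge> c\<^sup>2 / 2 * (rt n)\<^sup>2"
  proof (rule bchoice, rule ballI)
    fix n assume "n \<in> {1..n0}"
    then have n: "n \<ge> 1" by simp
    have "c\<^sup>2 / 2 * (rt n)\<^sup>2 < c\<^sup>2 * (rt n)\<^sup>2" using cC rt_pos[OF n] by simp
    then have "c\<^sup>2 / 2 * (rt n)\<^sup>2 < (l2norm (f n))\<^sup>2" using norm_square_ge[OF n] by linarith
    from order_tendstoD(1)[OF cos_expansion_norm[OF expansion[OF n]] this]
    show "\<exists>N. (\<Sum>j=1..N. (\<theta> n j)\<^sup>2) \<ge> c\<^sup>2 / 2 * (rt n)\<^sup>2"
      by (auto simp: eventually_sequentially intro: less_imp_le)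
  qed
  then obtain N where N: "\<And>n. n \<in> {1..n0} \<Longrightarrow> (\<Sum>j=1..N n. (\<theta> n j)\<^sup>2) \<ge> c\<^sup>2 / 2 * (rt n)\<^sup>2" by blast
  define M where "M = Max (insert 0 (N ` {1..n0}))"
  \<comment> \<open>\<open>k n \<ge> 1\<close>, so the multiple \<open>M + 1\<close> exceeds every \<open>N n\<close>\<close>
  define b where "b = max c2 (real M + 1)"
  define a where "a = min c1 (c\<^sup>2 / 2)"
  have NM: "N n \<le> M" if "n \<in> {1..n0}" for n unfolding M_def using that by (intro Max_ge) auto
  show ?thesis
  proof (rule that[of a b])
    show b0: "b > 0" using d cC by (auto simp: a_def b_def)
    show "a > 0" using d cC by (auto simp: a_def b_def)
    show "\<forall>b'\<ge>b. \<forall>n\<ge>1. low b' n \<ge> a * (rt n)\<^sup>2"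
    proof (intro allI impI)
      fix b' n assume b': "b' \<ge> b" and n: "n \<ge> (1::nat)"
      have "low b n \<ge> a * (rt n)\<^sup>2"
      proof (cases "n > n0")
        case True
        have "a * (rt n)\<^sup>2 \<le> c1 * (rt n)\<^sup>2" by (intro mult_right_mono) (auto simp: a_def)
        also have "\<dots> \<le> low c2 n" using d(3)[OF True] by simp
        also have "\<dots> \<le> low b n" by (intro low_mono) (simp add: b_def)
        finally show ?thesis .
      next
        case False
        then have nn: "n \<in> {1..n0}" using n by simp
        have "a * (rt n)\<^sup>2 \<le> c\<^sup>2 / 2 * (rt n)\<^sup>2" by (intro mult_right_mono) (auto simp: a_def)
        also have "\<dots> \<le> (\<Sum>j=1..N n. (\<theta> n j)\<^sup>2)" by (rule N[OF nn])
        also have "\<dots> \<le> low b n"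
          unfolding low_def
        proof (intro sum_mono2 finite_band subsetI)
          fix j assume j: "j \<in> {1..N n}"
          have "real j < real M + 1" using j NM[OF nn] by simp
          also have "\<dots> \<le> b * 1" by (simp add: b_def)
          also have "\<dots> \<le> b * k n" using k_ge_1[OF n] b0 by (intro mult_left_mono) auto
          finally show "j \<in> band (b * k n)" using j by simp
        qed simp
        finally show ?thesis .
      qed
      also have "\<dots> \<le> low b' n" by (rule low_mono[OF b'])
      finally show "low b' n \<ge> a * (rt n)\<^sup>2" .
    qed
  qed
qed

definition trunc :: "real \<Rightarrow> nat \<Rightarrow> real \<Rightarrow> real" where
  "trunc b n = psum (\<theta> n) (band (b * k n))"

lemma L2_trunc: "trunc b n \<in> L2" unfolding trunc_def by (rule L2_psum)

lemma trunc_expansion: "cos_expansion (\<lambda>j. if j \<in> band (b * k n) then \<theta> n j else 0) (trunc b n)"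
  unfolding trunc_def by (rule cos_expansion_psum) auto

lemma trunc_norm: "(l2norm (trunc b n))\<^sup>2 = low b n"
proof -
  have "(l2norm (trunc b n))\<^sup>2 = l2inner (trunc b n) (trunc b n)" by (rule l2norm_square)
  also have "\<dots> = (\<Sum>j\<in>band (b * k n). \<theta> n j * l2inner (\<phi> j) (trunc b n))"
    by (subst trunc_def) (rule l2inner_psum[OF L2_trunc])
  also have "\<dots> = low b n"
    unfolding low_def
  proof (intro sum.cong refl)
    fix j assume j: "j \<in> band (b * k n)"
    have "l2inner (trunc b n) (\<phi> j) = \<theta> n j"
      using l2inner_psum_phi[of "band (b * k n)" j "\<theta> n"] j by (auto simp: trunc_def)
    then show "\<theta> n j * l2inner (\<phi> j) (trunc b n) = (\<theta> n j)\<^sup>2"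
      by (simp add: l2inner_commute power2_eq_square)
  qed
  finally show ?thesis .
qed

lemma rest_expansion:
  assumes "n \<ge> 1"
  shows "cos_expansion (\<lambda>j. \<theta> n j - (if j \<in> band (b * k n) then \<theta> n j else 0)) (\<lambda>x. f n x - trunc b n x)"
  by (rule cos_expansion_diff[OF expansion[OF assms] trunc_expansion])

lemma low_le_norm: "n \<ge> 1 \<Longrightarrow> low b n \<le> (l2norm (f n))\<^sup>2"
  unfolding low_def by (rule cos_expansion_sum_le[OF expansion]) auto

lemma inner_trunc: "n \<ge> 1 \<Longrightarrow> l2inner (f n) (trunc b n) = low b n"
proof -
  assume n: "n \<ge> 1"
  have "l2inner (f n) (trunc b n) = (\<Sum>j\<in>band (b * k n). \<theta> n j * l2inner (\<phi> j) (f n))"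
    unfolding l2inner_commute[of "f n"] trunc_def by (rule l2inner_psum[OF L2_f[OF n]])
  also have "\<dots> = low b n"
    unfolding low_def by (intro sum.cong refl) (auto simp: l2inner_commute[of "\<phi> _"] cos_expansion_coeff[OF expansion[OF n]] power2_eq_square)
  finally show ?thesis .
qed

lemma trunc_orthogonal: "n \<ge> 1 \<Longrightarrow> l2inner (trunc b n) (\<lambda>x. f n x - trunc b n x) = 0"
  by (simp add: l2inner_diff_right L2_trunc L2_f l2inner_commute[of _ "f n"] inner_trunc trunc_norm flip: l2norm_square)

lemma rest_norm: "n \<ge> 1 \<Longrightarrow> (l2norm (\<lambda>x. f n x - trunc b n x))\<^sup>2 = (l2norm (f n))\<^sup>2 - low b n"
  unfolding trunc_def low_def by (rule cos_expansion_residual[OF expansion]) auto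

lemma trunc_norm_bounds:
  assumes "n \<ge> 1"
  shows "l2norm (trunc b n) \<le> C * rt n" "l2norm (\<lambda>x. f n x - trunc b n x) \<le> C * rt n"
proof -
  have Cr: "0 \<le> C * rt n" using C_pos by simp
  show "l2norm (trunc b n) \<le> C * rt n"
    by (rule power2_le_imp_le[OF _ Cr]) (use trunc_norm[of b n] low_le_norm[OF assms, of b] norm_square_le[OF assms] in \<open>simp add: power_mult_distrib\<close>)
  show "l2norm (\<lambda>x. f n x - trunc b n x) \<le> C * rt n"
    by (rule power2_le_imp_le[OF _ Cr]) (use rest_norm[OF assms, of b] low_nonneg[of b n] norm_square_le[OF assms] in \<open>simp add: power_mult_distrib\<close>)
qed

text \<open>Below the cutoff the weight is at most \<open>(b * k n) powr (2 * s)\<close>, which compensates the energy of order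
  \<open>(rt n)\<^sup>2\<close>; above it the truncation has no coefficients.\<close>

lemma trunc_besov:
  assumes "n \<ge> 1" "b > 0"
  shows "trunc b n \<in> besov_ball s (b powr (2 * s) * C\<^sup>2)"
  unfolding besov_ball_def mem_Collect_eq
proof (intro exI conjI allI impI)
  show "cos_expansion (\<lambda>j. if j \<in> band (b * k n) then \<theta> n j else 0) (trunc b n)" by (rule trunc_expansion)
  fix l :: real assume l: "l > 0"
  let ?\<eta> = "\<lambda>j. if j \<in> band (b * k n) then \<theta> n j else 0"
  have kp: "k n > 0" using k_ge_1[OF assms(1)] by linarith
  have eq: "(\<Sum>\<^sub>\<infinity>j\<in>{j. real j > l}. (?\<eta> j)\<^sup>2) = (\<Sum>j\<in>{j. real j > l} \<inter> band (b * k n). (\<theta> n j)\<^sup>2)"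
  proof -
    have "(\<Sum>\<^sub>\<infinity>j\<in>{j. real j > l}. (?\<eta> j)\<^sup>2) = (\<Sum>\<^sub>\<infinity>j\<in>{j. real j > l} \<inter> band (b * k n). (\<theta> n j)\<^sup>2)"
      by (rule infsum_cong_neutral) auto
    then show ?thesis by (simp add: infsum_finite)
  qed
  show "l powr (2 * s) * (\<Sum>\<^sub>\<infinity>j\<in>{j. real j > l}. (?\<eta> j)\<^sup>2) \<le> b powr (2 * s) * C\<^sup>2"
  proof (cases "l < b * k n")
    case False
    then have "{j. real j > l} \<inter> band (b * k n) = {}" by auto
    then show ?thesis unfolding eq by simp
  next
    case True
    have "(\<Sum>j\<in>{j. real j > l} \<inter> band (b * k n). (\<theta> n j)\<^sup>2) \<le> (l2norm (f n))\<^sup>2"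
      by (rule cos_expansion_sum_le[OF expansion[OF assms(1)]]) auto
    also have "\<dots> \<le> C\<^sup>2 * (rt n)\<^sup>2" by (rule norm_square_le[OF assms(1)])
    finally have A: "(\<Sum>j\<in>{j. real j > l} \<inter> band (b * k n). (\<theta> n j)\<^sup>2) \<le> C\<^sup>2 * (rt n)\<^sup>2" .
    have "l powr (2 * s) \<le> (b * k n) powr (2 * s)" using True l s_pos by (intro powr_mono2) auto
    also have "\<dots> \<le> (b * real n powr ((1 - 2 * r) / 2)) powr (2 * s)"
      using k_le assms(2) kp s_pos by (intro powr_mono2 mult_left_mono) auto
    also have "\<dots> = b powr (2 * s) / (rt n)\<^sup>2"
      using assms by (simp add: powr_mult rate_powr)
    finally have B: "l powr (2 * s) \<le> b powr (2 * s) / (rt n)\<^sup>2" .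
    have "l powr (2 * s) * (\<Sum>j\<in>{j. real j > l} \<inter> band (b * k n). (\<theta> n j)\<^sup>2) \<le> b powr (2 * s) / (rt n)\<^sup>2 * (C\<^sup>2 * (rt n)\<^sup>2)"
      by (intro mult_mono A B sum_nonneg) auto
    also have "\<dots> = b powr (2 * s) * C\<^sup>2" using assms(1) by simp
    finally show ?thesis unfolding eq .
  qed
qed

subsection \<open>Smooth components\<close>

text \<open>The tail of \<open>g n\<close> beyond a large multiple of \<open>k n\<close> is small in norm, so the inner product with \<open>f n\<close>,
  which is of order \<open>(rt n)\<^sup>2\<close>, comes from low frequencies; by Cauchy--Schwarz \<open>f n\<close> has energy there.\<close>

lemma besov_part_detectable:
  assumes P0: "P0 > 0" and c1: "0 < c1" "c1 < D1"
    and part: "\<And>n. n \<ge> 1 \<Longrightarrow> g n \<in> besov_ball s P0 \<and> c1 * rt n \<le> l2norm (g n) \<and> l2norm (g n) \<le> D1 * rt n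
        \<and> l2inner (f n) (g n) = (l2norm (g n))\<^sup>2"
  shows detectable
proof -
  have D1: "D1 > 0" using c1 by simp
  define e where "e = (c1\<^sup>2 / (2 * C))\<^sup>2"
  have e: "e > 0" using c1 C_pos by (simp add: e_def)
  \<comment> \<open>makes the tail of \<open>g n\<close> beyond \<open>b * k n / 2\<close> at most \<open>e * (rt n)\<^sup>2\<close>\<close>
  define b where "b = 4 * (P0 / e) powr (1 / (2 * s))"
  have b: "b > 0" using P0 e by (simp add: b_def)
  have b4: "(b / 4) powr (2 * s) = P0 / e"
    using P0 e s_pos by (simp add: b_def powr_powr)
  define a where "a = (c1\<^sup>2 / (2 * D1))\<^sup>2 / 2"
  have a: "a > 0" using c1 D1 by (simp add: a_def)
  have "low b n > a * (rt n)\<^sup>2" if n: "n \<ge> 1" for n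
  proof -
    have kp: "k n > 0" using k_ge_1[OF n] by linarith
    have rp: "rt n > 0" by (rule rt_pos[OF n])
    from part[OF n] obtain \<eta> where \<eta>: "cos_expansion \<eta> (g n)"
      and bes: "\<And>l. l > 0 \<Longrightarrow> l powr (2 * s) * (\<Sum>\<^sub>\<infinity>j\<in>{j. real j > l}. (\<eta> j)\<^sup>2) \<le> P0"
      and lo: "c1 * rt n \<le> l2norm (g n)" and up: "l2norm (g n) \<le> D1 * rt n"
      and inn: "l2inner (f n) (g n) = (l2norm (g n))\<^sup>2"
      unfolding besov_ball_def by blast
    define J where "J = band (b * k n)"
    have g: "g n \<in> L2" by (rule cos_expansion_L2[OF \<eta>])
    have rest: "(l2norm (\<lambda>x. g n x - psum \<eta> J x))\<^sup>2 \<le> e * (rt n)\<^sup>2"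
    proof -
      define l where "l = b * k n / 2"
      have l: "l > 0" using b kp by (simp add: l_def)
      have K: "{j. real j > l} = {1..} - {j. 1 \<le> j \<and> real j \<le> l}" using l by (auto simp: Suc_le_eq) 
      have finJ': "finite {j. 1 \<le> j \<and> real j \<le> l}"
        by (rule finite_subset[OF _ finite_band[of "l + 1"]]) auto
      have "(l2norm (\<lambda>x. g n x - psum \<eta> J x))\<^sup>2 = (l2norm (g n))\<^sup>2 - (\<Sum>j\<in>J. (\<eta> j)\<^sup>2)"
        unfolding J_def by (rule cos_expansion_residual[OF \<eta>]) auto
      also have "\<dots> \<le> (l2norm (g n))\<^sup>2 - (\<Sum>j\<in>{j. 1 \<le> j \<and> real j \<le> l}. (\<eta> j)\<^sup>2)"
        unfolding J_def using l by (intro diff_left_mono sum_mono2) (auto simp: l_def)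
      also have "\<dots> = (\<Sum>\<^sub>\<infinity>j\<in>{j. real j > l}. (\<eta> j)\<^sup>2)"
        by (rule cos_expansion_tail[OF \<eta> finJ' _ K, symmetric]) auto
      finally have A: "(l2norm (\<lambda>x. g n x - psum \<eta> J x))\<^sup>2 \<le> (\<Sum>\<^sub>\<infinity>j\<in>{j. real j > l}. (\<eta> j)\<^sup>2)" .
      have "P0 / e / (rt n)\<^sup>2 = (b / 4 * real n powr ((1 - 2 * r) / 2)) powr (2 * s)"
      proof -
        have "(b / 4 * real n powr ((1 - 2 * r) / 2)) powr (2 * s) = (b / 4) powr (2 * s) * (real n powr ((1 - 2 * r) / 2)) powr (2 * s)"
          by (rule powr_mult)
        then show ?thesis unfolding rate_powr[OF n] b4 by simp
      qed
      also have "\<dots> \<le> l powr (2 * s)"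
        using k_ge[OF n] b s_pos unfolding l_def by (intro powr_mono2) auto
      finally have "P0 / e / (rt n)\<^sup>2 * (l2norm (\<lambda>x. g n x - psum \<eta> J x))\<^sup>2 \<le> l powr (2 * s) * (\<Sum>\<^sub>\<infinity>j\<in>{j. real j > l}. (\<eta> j)\<^sup>2)"
        using A by (intro mult_mono) auto
      also have "\<dots> \<le> P0" by (rule bes[OF l])
      finally show ?thesis using P0 e rp by (simp add: field_simps)
    qed
    have rest': "l2norm (\<lambda>x. g n x - psum \<eta> J x) \<le> c1\<^sup>2 / (2 * C) * rt n"
    proof (rule power2_le_imp_le)
      show "(l2norm (\<lambda>x. g n x - psum \<eta> J x))\<^sup>2 \<le> (c1\<^sup>2 / (2 * C) * rt n)\<^sup>2"
        using rest unfolding e_def power_mult_distrib[of "c1\<^sup>2 / (2 * C)"] .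
      show "0 \<le> c1\<^sup>2 / (2 * C) * rt n" using C_pos by simp
    qed
    have "l2inner (f n) (\<lambda>x. g n x - psum \<eta> J x) \<le> l2norm (f n) * l2norm (\<lambda>x. g n x - psum \<eta> J x)"
      using l2inner_le[OF L2_f[OF n] L2_diff[OF g L2_psum], of \<eta> J] by linarith
    also have "\<dots> \<le> (C * rt n) * (c1\<^sup>2 / (2 * C) * rt n)"
      using norm_f[OF n] rest' C_pos by (intro mult_mono) auto
    also have "\<dots> = c1\<^sup>2 / 2 * (rt n)\<^sup>2" using C_pos by (simp add: power2_eq_square)
    finally have high: "l2inner (f n) (\<lambda>x. g n x - psum \<eta> J x) \<le> c1\<^sup>2 / 2 * (rt n)\<^sup>2" .
    have "(c1 * rt n)\<^sup>2 \<le> (l2norm (g n))\<^sup>2" using lo c1(1) by (intro power_mono) auto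
    then have "c1\<^sup>2 * (rt n)\<^sup>2 \<le> l2inner (f n) (\<lambda>x. g n x - psum \<eta> J x) + l2inner (f n) (psum \<eta> J)"
      using inn by (simp add: l2inner_diff_right L2_f[OF n] g power_mult_distrib)
    then have in_low: "c1\<^sup>2 / 2 * (rt n)\<^sup>2 \<le> l2inner (f n) (psum \<eta> J)" using high by simp
    have "l2inner (f n) (psum \<eta> J) = (\<Sum>j\<in>J. \<eta> j * \<theta> n j)"
      unfolding l2inner_commute[of "f n"] l2inner_psum[OF L2_f[OF n]]
      by (intro sum.cong refl) (auto simp: J_def l2inner_commute[of "\<phi> _"] cos_expansion_coeff[OF expansion[OF n]])
    then have "(c1\<^sup>2 / 2 * (rt n)\<^sup>2)\<^sup>2 \<le> (\<Sum>j\<in>J. \<eta> j * \<theta> n j)\<^sup>2"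
      using in_low by (intro power_mono) auto
    also have "\<dots> \<le> (\<Sum>j\<in>J. (\<eta> j)\<^sup>2) * (\<Sum>j\<in>J. (\<theta> n j)\<^sup>2)"
      by (rule Cauchy_Schwarz_ineq_sum)
    also have "\<dots> \<le> (D1 * rt n)\<^sup>2 * low b n"
    proof (intro mult_mono)
      have "(\<Sum>j\<in>J. (\<eta> j)\<^sup>2) \<le> (l2norm (g n))\<^sup>2"
        unfolding J_def by (rule cos_expansion_sum_le[OF \<eta>]) auto
      also have "\<dots> \<le> (D1 * rt n)\<^sup>2" using up by (intro power_mono) auto
      finally show "(\<Sum>j\<in>J. (\<eta> j)\<^sup>2) \<le> (D1 * rt n)\<^sup>2" .
    qed (auto simp: low_def J_def sum_nonneg)
    finally have "(c1\<^sup>2 / 2)\<^sup>2 * (rt n)\<^sup>2 * (rt n)\<^sup>2 \<le> D1\<^sup>2 * low b n * (rt n)\<^sup>2"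
      by (simp add: power_mult_distrib power2_eq_square mult_ac)
    then have "(c1\<^sup>2 / 2)\<^sup>2 * (rt n)\<^sup>2 \<le> D1\<^sup>2 * low b n" using rp by simp
    then have "2 * a * (rt n)\<^sup>2 \<le> low b n"
      using D1 by (simp add: a_def power_divide power_mult_distrib divide_le_eq mult_ac)
    moreover have "a * (rt n)\<^sup>2 > 0" using a rp by simp
    ultimately show ?thesis by simp
  qed
  then have "\<forall>n>0. a * (rt n)\<^sup>2 < low b n" by (simp add: Suc_le_eq)
  with a b show ?thesis unfolding detectable_def by blast
qed

lemma detectable_imp_besov_part:
  assumes detectable
  shows "\<exists>P0>0. \<exists>c1 D1 g. 0 < c1 \<and> c1 < D1 \<and> (\<forall>n\<ge>1. g n \<in> besov_ball s P0 \<and>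
       c1 * rt n \<le> l2norm (g n) \<and> l2norm (g n) \<le> D1 * rt n \<and>
       (l2norm (f n))\<^sup>2 = (l2norm (g n))\<^sup>2 + (l2norm (\<lambda>x. f n x - g n x))\<^sup>2)"
proof -
  obtain a b where ab: "a > 0" "b > 0" "\<forall>b'\<ge>b. \<forall>n\<ge>1. low b' n \<ge> a * (rt n)\<^sup>2"
    by (rule detectable_uniform[OF assms])
  have low: "sqrt a * rt n \<le> l2norm (trunc b n)" if "n \<ge> 1" for n
  proof (rule power2_le_imp_le)
    have "a * (rt n)\<^sup>2 \<le> low b n" using ab(3) that by blast
    then show "(sqrt a * rt n)\<^sup>2 \<le> (l2norm (trunc b n))\<^sup>2"
      using ab(1) by (simp add: trunc_norm power_mult_distrib)
  qed simp
  show ?thesis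
  proof (intro exI conjI allI impI)
    show "b powr (2 * s) * C\<^sup>2 > 0" using ab(2) C_pos by simp
    show "0 < sqrt a" using ab by simp
    show "sqrt a < max C (sqrt a + 1)" by simp
    fix n :: nat assume n: "n \<ge> 1"
    show "trunc b n \<in> besov_ball s (b powr (2 * s) * C\<^sup>2)" by (rule trunc_besov[OF n ab(2)])
    show "sqrt a * rt n \<le> l2norm (trunc b n)" by (rule low[OF n])
    have "C * rt n \<le> max C (sqrt a + 1) * rt n" by (intro mult_right_mono) auto
    then show "l2norm (trunc b n) \<le> max C (sqrt a + 1) * rt n" using trunc_norm_bounds(1)[OF n, of b] by linarith
    show "(l2norm (f n))\<^sup>2 = (l2norm (trunc b n))\<^sup>2 + (l2norm (\<lambda>x. f n x - trunc b n x))\<^sup>2"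
      by (simp add: rest_norm[OF n] trunc_norm)
  qed
qed

end

lemma irrational_between:
  assumes "(a::real) < b"
  obtains x where "a < x" "x < b" "x \<notin> \<rat>"
proof -
  have "uncountable ({a<..<b} - \<rat>)"
    using assms by (intro uncountable_minus_countable countable_rat) (simp add: uncountable_open_interval)
  then have "{a<..<b} - \<rat> \<noteq> {}" by (metis countable_empty)
  then obtain x where "x \<in> {a<..<b} - \<rat>" by blast
  then show ?thesis using that[of x] by simp
qed

text \<open>Condition B separates the frequencies strictly above a cutoff from those strictly below it. An
  irrational multiple of \<open>k n\<close> hits no frequency, so the two parts add up to the whole.\<close>

lemma irrational_multiple_not_nat:
  assumes "b \<notin> \<rat>" "m > 0"
  shows "real j \<noteq> b * real m"
proof
  assume "real j = b * real m"
  then have "b = real j / real m" using assms(2) by simp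
  then show False using assms(1) by simp
qed

context cvm_alternatives
begin

definition rest :: "real \<Rightarrow> nat \<Rightarrow> real \<Rightarrow> real" where
  "rest b n = (\<lambda>x. f n x - trunc b n x)"

lemma L2_rest: "n \<ge> 1 \<Longrightarrow> rest b n \<in> L2"
  unfolding rest_def by (intro L2_diff L2_f L2_trunc)

lemma rest_norm': "n \<ge> 1 \<Longrightarrow> (l2norm (rest b n))\<^sup>2 = (l2norm (f n))\<^sup>2 - low b n"
  unfolding rest_def by (rule rest_norm)

lemma rest_coeff:
  "n \<ge> 1 \<Longrightarrow> j \<ge> 1 \<Longrightarrow> l2inner (rest b n) (\<phi> j) = (if j \<in> band (b * k n) then 0 else \<theta> n j)"
  using cos_expansion_coeff[OF rest_expansion[of n b], of j] by (simp add: rest_def)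

lemma trunc_coeff:
  "j \<ge> 1 \<Longrightarrow> l2inner (trunc b n) (\<phi> j) = (if j \<in> band (b * k n) then \<theta> n j else 0)"
  using cos_expansion_coeff[OF trunc_expansion[of b n], of j] by simp

lemma drift_rest:
  assumes "n \<ge> 1" "b > 0"
  shows "drift n (rest b n) \<le> (2 * C / (pi * b))\<^sup>2"
proof -
  have "drift n (rest b n) \<le> real n * (\<Sum>j\<in>band (b * k n). (\<theta> n j - (if j \<in> band (b * k n) then \<theta> n j else 0))\<^sup>2 / (pi * real j)\<^sup>2)
     + (2 * C / (pi * b))\<^sup>2"
    unfolding rest_def using trunc_norm_bounds(2)[OF assms(1), of b]
    by (intro drift_le rest_expansion assms)
  also have "(\<Sum>j\<in>band (b * k n). (\<theta> n j - (if j \<in> band (b * k n) then \<theta> n j else 0))\<^sup>2 / (pi * real j)\<^sup>2) = 0"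
    by (intro sum.neutral) auto
  finally show ?thesis by simp
qed

text \<open>Condition B provides densities with the required expansions; they agree with the explicit sums
  almost everywhere.\<close>

lemma trunc_alternative:
  assumes B: "\<forall>c>c0. \<forall>n\<ge>1. series_density (\<lambda>j. if real j > c * real (kn r n) then \<theta> n j else 0) \<and>
     series_density (\<lambda>j. if real j < c * real (kn r n) then \<theta> n j else 0)"
    and "b > c0" "n \<ge> 1"
  shows "alternative (trunc b n)"
    and "b \<notin> \<rat> \<Longrightarrow> alternative (rest b n)"
proof -
  obtain h where h: "cos_expansion (\<lambda>j. if real j < b * k n then \<theta> n j else 0) h" "alternative h"
    using B assms(2,3) unfolding series_density_def by blast
  have "AE x in U01. trunc b n x = h x"
    by (rule cos_expansion_unique[OF trunc_expansion h(1)]) auto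
  then show "alternative (trunc b n)" by (rule alternative_cong_AE[OF h(2) L2_trunc])
  assume irr: "b \<notin> \<rat>"
  obtain h' where h': "cos_expansion (\<lambda>j. if real j > b * k n then \<theta> n j else 0) h'" "alternative h'"
    using B assms(2,3) unfolding series_density_def by blast
  have "kn r n > 0" using k_ge_1[OF assms(3)] by simp
  then have ne: "real j \<noteq> b * k n" for j using irrational_multiple_not_nat[OF irr] by blast
  have "AE x in U01. rest b n x = h' x"
    unfolding rest_def
  proof (rule cos_expansion_unique[OF rest_expansion[OF assms(3)] h'(1)])
    fix j assume "j \<ge> (1::nat)"
    then show "\<theta> n j - (if j \<in> band (b * k n) then \<theta> n j else 0) = (if real j > b * k n then \<theta> n j else 0)"
      using ne[of j] by auto
  qed
  then show "alternative (rest b n)" by (rule alternative_cong_AE[OF h'(2) L2_rest[OF assms(3)]])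
qed

text \<open>The triangle inequality for the norms of the three shifts.\<close>

lemma trunc_drift_close:
  assumes "n \<ge> 1" "b > 0"
  shows "\<bar>drift n (f n) - drift n (trunc b n)\<bar> \<le> 2 * C / (pi * b) * (2 * sqrt (drift n (f n)) + 2 * C / (pi * b))"
proof -
  define q where "q = 2 * C / (pi * b)"
  define u v w where "u = sqrt (drift n (f n))" and "v = sqrt (drift n (trunc b n))" and "w = sqrt (drift n (rest b n))"
  have q0: "q \<ge> 0" using C_pos assms(2) by (simp add: q_def)
  have w: "w \<le> q"
    unfolding w_def using drift_rest[OF assms] q0 by (intro real_le_lsqrt) (auto simp: q_def)
  have pos: "0 \<le> u" "0 \<le> v" "0 \<le> w" by (simp_all add: u_def v_def w_def)
  have P: "L2_f' \<in> L2 \<Longrightarrow> (\<lambda>x. sqrt n * prim L2_f' x) \<in> L2" for L2_f' by (intro L2_scale L2_prim)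
  note Lt = L2_trunc[of b n] and Lr = L2_rest[OF assms(1), of b] and Lf = L2_f[OF assms(1)]
  have pd: "prim (f n) x = prim (trunc b n) x + prim (rest b n) x" for x
    using prim_diff[OF Lf Lt, of x] by (simp add: rest_def)
  have "u \<le> v + w"
  proof -
    have "u = l2norm (\<lambda>x. sqrt n * prim (trunc b n) x + sqrt n * prim (rest b n) x)"
      unfolding u_def l2norm_shift[symmetric] pd distrib_left ..
    also have "\<dots> \<le> v + w"
      unfolding v_def w_def l2norm_shift[symmetric] by (intro l2norm_triangle P Lt Lr)
    finally show ?thesis .
  qed
  moreover have "v \<le> u + w"
  proof -
    have "v = l2norm (\<lambda>x. sqrt n * prim (f n) x + (-1) * (sqrt n * prim (rest b n) x))"
      unfolding v_def l2norm_shift[symmetric] pd by (simp add: distrib_left)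
    also have "\<dots> \<le> u + l2norm (\<lambda>x. (-1) * (sqrt n * prim (rest b n) x))"
      unfolding u_def l2norm_shift[symmetric] by (intro l2norm_triangle P Lf L2_scale Lr)
    also have "l2norm (\<lambda>x. (-1) * (sqrt n * prim (rest b n) x)) = w"
      unfolding w_def l2norm_shift[symmetric] by (subst l2norm_scale) simp
    finally show ?thesis .
  qed
  ultimately have d: "\<bar>u - v\<bar> \<le> q" "u + v \<le> 2 * u + q" using w by linarith+
  have "\<bar>drift n (f n) - drift n (trunc b n)\<bar> = \<bar>u\<^sup>2 - v\<^sup>2\<bar>" by (simp add: u_def v_def)
  also have "\<dots> = \<bar>u - v\<bar> * (u + v)" using pos by (simp add: power2_eq_square square_diff_square_factored abs_mult mult.commute)
  also have "\<dots> \<le> q * (2 * u + q)" using d pos q0 by (intro mult_mono) auto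
  finally show ?thesis by (simp add: q_def u_def)
qed

text \<open>The truncation at a large multiple \<open>b\<close> of \<open>k n\<close> changes the drift by little, so the type II errors of
  \<open>f n\<close> and its truncation are close; the remainder has a small drift, so it is hardly distinguished
  from the hypothesis. How large \<open>b\<close> must be depends on \<open>\<epsilon>\<close> only through the modulus of continuity of
  the limit distribution function, and neither on \<open>\<alpha>\<close> nor on the thresholds.\<close>

lemma consistent_approximation:
  assumes det: detectable and B: "condition_B r \<theta>" and \<epsilon>: "\<epsilon> > 0"
  shows "\<exists>P0>0. \<exists>c1 D1 g. 0 < c1 \<and> c1 < D1 \<and>
     (\<forall>n\<ge>1. g n \<in> besov_ball s P0 \<and> c1 * rt n \<le> l2norm (g n) \<and> l2norm (g n) \<le> D1 * rt n \<and>
        l2inner (g n) (\<lambda>x. f n x - g n x) = 0 \<and> alternative (g n) \<and> alternative (\<lambda>x. f n x - g n x)) \<and>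
     (\<forall>\<alpha>\<in>{0<..<1}. \<forall>t::nat \<Rightarrow> real. (\<lambda>n. type_I n (cvm_test n (t n))) \<longlonglongrightarrow> \<alpha> \<longrightarrow>
        (\<exists>n0. \<forall>n>n0. \<bar>type_II n (cvm_test n (t n)) (f n) - type_II n (cvm_test n (t n)) (g n)\<bar> \<le> \<epsilon> \<and>
           type_II n (cvm_test n (t n)) (\<lambda>x. f n x - g n x) \<ge> 1 - \<alpha> - \<epsilon>))"
proof -
  obtain A0 where A0: "\<forall>\<^sub>F n in sequentially. drift n (f n) \<le> A0" by (rule drift_bounded)
  define A where "A = max A0 0"
  have A: "A \<ge> 0" "\<forall>\<^sub>F n in sequentially. drift n (f n) \<le> A"
    using A0 by (auto simp: A_def elim: eventually_mono)
  have "\<epsilon> / 4 > 0" using \<epsilon> by simp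
  from limit_cdf_uniformly_continuous[OF this] obtain \<delta> where \<delta>: "\<delta> > 0"
    and uc: "\<forall>x y. \<bar>x - y\<bar> \<le> \<delta> \<longrightarrow> \<bar>limit_cdf x - limit_cdf y\<bar> \<le> \<epsilon> / 4" by metis
  \<comment> \<open>the admissible norm of the shift of the remainder\<close>
  define q where "q = min 1 (\<delta> / (2 * sqrt A + 1))"
  have sA: "2 * sqrt A + 1 > 0" using A(1) by (simp add: add_nonneg_pos)
  have q: "q > 0" using \<delta> sA by (simp add: q_def)
  have q1: "q * (2 * sqrt A + q) \<le> \<delta>"
  proof -
    have "q * (2 * sqrt A + q) \<le> q * (2 * sqrt A + 1)" using q by (intro mult_left_mono) (auto simp: q_def)
    also have "\<dots> \<le> \<delta> / (2 * sqrt A + 1) * (2 * sqrt A + 1)" using sA by (intro mult_right_mono) (auto simp: q_def)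
    also have "\<dots> = \<delta>" using sA by simp
    finally show ?thesis .
  qed
  have q2: "q\<^sup>2 \<le> \<delta>"
  proof -
    have "q\<^sup>2 \<le> q * (2 * sqrt A + q)" using q A(1) by (simp add: power2_eq_square distrib_left)
    then show ?thesis using q1 by linarith
  qed
  from choose_large[OF q, of C] obtain L where L: "L > 0" "\<forall>b\<ge>L. 2 * C / (pi * b) \<le> q" by metis
  obtain c0 where c0: "\<forall>c>c0. \<forall>n\<ge>1. series_density (\<lambda>j. if real j > c * real (kn r n) then \<theta> n j else 0) \<and>
     series_density (\<lambda>j. if real j < c * real (kn r n) then \<theta> n j else 0)"
    using B unfolding condition_B_def by blast
  obtain a b0 where ab: "a > 0" "b0 > 0" "\<forall>b'\<ge>b0. \<forall>n\<ge>1. low b' n \<ge> a * (rt n)\<^sup>2"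
    by (rule detectable_uniform[OF det])
  define m where "m = max c0 (max L b0)"
  obtain b where b: "m < b" "b < m + 1" "b \<notin> \<rat>" by (rule irrational_between[of m "m + 1"]) auto
  have bb: "b > c0" "b \<ge> L" "b \<ge> b0" "b > 0" using b(1) L(1) by (auto simp: m_def)
  define g where "g = trunc b"
  have rest_eq: "(\<lambda>x. f n x - g n x) = rest b n" for n by (simp add: rest_def g_def)
  have alt_g: "alternative (g n)" "alternative (rest b n)" if "n \<ge> 1" for n
    unfolding g_def using trunc_alternative[OF c0 bb(1) that] b(3) by auto
  have lo: "sqrt a * rt n \<le> l2norm (g n)" if "n \<ge> 1" for n
  proof (rule power2_le_imp_le)
    have "a * (rt n)\<^sup>2 \<le> low b n" using ab(3) that bb(3) by blast
    then show "(sqrt a * rt n)\<^sup>2 \<le> (l2norm (g n))\<^sup>2"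
      using ab(1) by (simp add: g_def trunc_norm power_mult_distrib)
  qed simp
  have vanish: "vanishing_alternatives (\<lambda>n. n) h"
    if "\<And>n. n \<ge> 1 \<Longrightarrow> alternative (h n)" "\<And>n. n \<ge> 1 \<Longrightarrow> l2norm (h n) \<le> C * rt n" for h
  proof
    show "filterlim (\<lambda>n::nat. n) at_top sequentially" by (rule filterlim_ident)
    show "\<forall>\<^sub>F n in sequentially. alternative (h n)"
      using eventually_ge_at_top[of 1] by eventually_elim (rule that(1))
    show "(\<lambda>n. l2norm (h n)) \<longlonglongrightarrow> 0"
    proof (rule Lim_null_comparison)
      show "\<forall>\<^sub>F n in sequentially. norm (l2norm (h n)) \<le> C * rt n"
        using eventually_ge_at_top[of 1] by eventually_elim (use that(2) in auto)
      show "(\<lambda>n. C * rt n) \<longlonglongrightarrow> 0" using tendsto_mult_left[OF rt_tendsto, of C] by simp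
    qed
  qed
  interpret vg: vanishing_alternatives "\<lambda>n. n" g
    by (rule vanish) (auto simp: alt_g, simp add: g_def trunc_norm_bounds)
  interpret vr: vanishing_alternatives "\<lambda>n. n" "rest b"
    by (rule vanish) (auto simp: alt_g, simp add: rest_def trunc_norm_bounds)
  have weak_dominated: "(\<lambda>n. real n * (l2inner (h n) (\<phi> j))\<^sup>2) \<longlonglongrightarrow> 0"
    if "j \<ge> 1" and h: "\<And>n. n \<ge> 1 \<Longrightarrow> l2inner (h n) (\<phi> j) = \<theta> n j \<or> l2inner (h n) (\<phi> j) = 0" for j h
  proof (rule Lim_null_comparison[OF _ coeff_weak[OF that(1)]])
    show "\<forall>\<^sub>F n in sequentially. norm (real n * (l2inner (h n) (\<phi> j))\<^sup>2) \<le> real n * (\<theta> n j)\<^sup>2"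
      using eventually_ge_at_top[of 1]
    proof eventually_elim
      case (elim n)
      show ?case using h[OF elim] by auto
    qed
  qed
  have close: "\<forall>\<^sub>F n in sequentially. \<bar>drift n (f n) - drift n (g n)\<bar> \<le> \<delta> \<and> drift n (rest b n) \<le> \<delta>"
    using A(2) eventually_ge_at_top[of 1]
  proof eventually_elim
    case (elim n)
    have Lb: "2 * C / (pi * b) \<le> q" "0 \<le> 2 * C / (pi * b)" using L(2) bb C_pos by auto
    have "\<bar>drift n (f n) - drift n (g n)\<bar> \<le> 2 * C / (pi * b) * (2 * sqrt (drift n (f n)) + 2 * C / (pi * b))"
      unfolding g_def by (rule trunc_drift_close[OF elim(2) bb(4)])
    also have "\<dots> \<le> q * (2 * sqrt A + q)"
      using Lb elim(1) A(1) q by (intro mult_mono add_mono) auto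
    finally have "\<bar>drift n (f n) - drift n (g n)\<bar> \<le> \<delta>" using q1 by linarith
    moreover have "drift n (rest b n) \<le> (2 * C / (pi * b))\<^sup>2" by (rule drift_rest[OF elim(2) bb(4)])
    moreover have "(2 * C / (pi * b))\<^sup>2 \<le> q\<^sup>2" using Lb by (intro power_mono) auto
    ultimately show ?case using q2 by linarith
  qed
  have errors: "\<exists>n0. \<forall>n>n0. \<bar>type_II n (cvm_test n (t n)) (f n) - type_II n (cvm_test n (t n)) (g n)\<bar> \<le> \<epsilon> \<and>
           type_II n (cvm_test n (t n)) (rest b n) \<ge> 1 - \<alpha> - \<epsilon>"
    if \<alpha>: "\<alpha> \<in> {0<..<1}" and t: "(\<lambda>n. type_I n (cvm_test n (t n))) \<longlonglongrightarrow> \<alpha>" for \<alpha> t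
  proof -
    have bg: "\<forall>\<^sub>F n in sequentially. drift n (g n) \<le> A + \<delta>"
      using close A(2) by eventually_elim linarith
    have br: "\<forall>\<^sub>F n in sequentially. drift n (rest b n) \<le> \<delta>"
      using close by eventually_elim simp
    have T1: "(\<lambda>n. type_II n (cvm_test n (t n)) (f n) - limit_cdf (real n * t n - drift n (f n))) \<longlonglongrightarrow> 0"
      by (rule van.type_II_asymptotic[OF A(2)]) (rule weak_f)
    have T2: "(\<lambda>n. type_II n (cvm_test n (t n)) (g n) - limit_cdf (real n * t n - drift n (g n))) \<longlonglongrightarrow> 0"
      by (rule vg.type_II_asymptotic[OF bg], rule weak_dominated) (auto simp: g_def trunc_coeff)
    have T3: "(\<lambda>n. type_II n (cvm_test n (t n)) (rest b n) - limit_cdf (real n * t n - drift n (rest b n))) \<longlonglongrightarrow> 0"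
      by (rule vr.type_II_asymptotic[OF br], rule weak_dominated) (auto simp: rest_coeff)
    have T4: "(\<lambda>n. limit_cdf (real n * t n)) \<longlonglongrightarrow> 1 - \<alpha>" by (rule van.limit_cdf_threshold[OF \<alpha> t])
    have e4: "\<epsilon> / 4 > 0" using \<epsilon> by simp
    have "\<forall>\<^sub>F n in sequentially. \<bar>type_II n (cvm_test n (t n)) (f n) - type_II n (cvm_test n (t n)) (g n)\<bar> \<le> \<epsilon> \<and>
           type_II n (cvm_test n (t n)) (rest b n) \<ge> 1 - \<alpha> - \<epsilon>"
      using close tendstoD[OF T1 e4] tendstoD[OF T2 e4] tendstoD[OF T3 e4] tendstoD[OF T4 e4]
    proof eventually_elim
      case (elim n)
      have "\<bar>limit_cdf (real n * t n - drift n (f n)) - limit_cdf (real n * t n - drift n (g n))\<bar> \<le> \<epsilon> / 4"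
        using uc[rule_format, of "real n * t n - drift n (f n)" "real n * t n - drift n (g n)"] elim(1) by linarith
      moreover have "\<bar>limit_cdf (real n * t n) - limit_cdf (real n * t n - drift n (rest b n))\<bar> \<le> \<epsilon> / 4"
        using uc[rule_format, of "real n * t n" "real n * t n - drift n (rest b n)"] elim(1) by simp
      ultimately show ?case using elim(2-5) unfolding dist_real_def by linarith
    qed
    then show ?thesis unfolding eventually_sequentially by (meson less_imp_le)
  qed
  have part1: "\<forall>n\<ge>1. g n \<in> besov_ball s (b powr (2 * s) * C\<^sup>2) \<and> sqrt a * rt n \<le> l2norm (g n) \<and>
      l2norm (g n) \<le> max C (sqrt a + 1) * rt n \<and> l2inner (g n) (\<lambda>x. f n x - g n x) = 0 \<and>
      alternative (g n) \<and> alternative (\<lambda>x. f n x - g n x)"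
  proof (intro allI impI conjI)
    fix n :: nat assume n: "n \<ge> 1"
    show "g n \<in> besov_ball s (b powr (2 * s) * C\<^sup>2)" unfolding g_def by (rule trunc_besov[OF n bb(4)])
    show "sqrt a * rt n \<le> l2norm (g n)" by (rule lo[OF n])
    have "C * rt n \<le> max C (sqrt a + 1) * rt n" by (intro mult_right_mono) auto
    then show "l2norm (g n) \<le> max C (sqrt a + 1) * rt n"
      using trunc_norm_bounds(1)[OF n, of b] unfolding g_def by linarith
    show "l2inner (g n) (\<lambda>x. f n x - g n x) = 0" unfolding g_def by (rule trunc_orthogonal[OF n])
    show "alternative (g n)" "alternative (\<lambda>x. f n x - g n x)" using alt_g[OF n] by (simp_all add: rest_eq)
  qed
  have part2: "\<forall>\<alpha>\<in>{0<..<1}. \<forall>t::nat \<Rightarrow> real. (\<lambda>n. type_I n (cvm_test n (t n))) \<longlonglongrightarrow> \<alpha> \<longrightarrow>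
      (\<exists>n0. \<forall>n>n0. \<bar>type_II n (cvm_test n (t n)) (f n) - type_II n (cvm_test n (t n)) (g n)\<bar> \<le> \<epsilon> \<and>
           type_II n (cvm_test n (t n)) (\<lambda>x. f n x - g n x) \<ge> 1 - \<alpha> - \<epsilon>)"
    unfolding rest_eq using errors by blast
  have pos: "b powr (2 * s) * C\<^sup>2 > 0" "0 < sqrt a" "sqrt a < max C (sqrt a + 1)"
    using bb C_pos ab by auto
  show ?thesis
    by (rule exI[of _ "b powr (2 * s) * C\<^sup>2"], rule conjI[OF pos(1)], rule exI[of _ "sqrt a"],
        rule exI[of _ "max C (sqrt a + 1)"], rule exI[of _ g]) (intro conjI pos part1 part2)
qed

subsection \<open>Negligible tails\<close>

text \<open>The condition in (e), with the frequencies at the cutoff counted to the tail.\<close>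

definition tight :: bool where
  "tight \<longleftrightarrow> (\<forall>e>0. \<exists>b>0. \<forall>\<^sub>F n in sequentially. (l2norm (rest b n))\<^sup>2 \<le> e * (rt n)\<^sup>2)"

lemma tight_iff_tail:
  "tight \<longleftrightarrow> (\<forall>e>0. \<exists>b n0. \<forall>n>n0. (\<Sum>\<^sub>\<infinity>j\<in>{j. 1 \<le> j \<and> real j > b * k n}. (\<theta> n j)\<^sup>2) \<le> e * (rt n)\<^sup>2)"
proof -
  have tail: "(\<Sum>\<^sub>\<infinity>j\<in>{j. 1 \<le> j \<and> real j > b * k n}. (\<theta> n j)\<^sup>2) = (l2norm (f n))\<^sup>2 - (\<Sum>j\<in>{j. 1 \<le> j \<and> real j \<le> b * k n}. (\<theta> n j)\<^sup>2)"
    if "n \<ge> 1" for b n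
  proof (rule cos_expansion_tail[OF expansion[OF that]])
    show "finite {j. 1 \<le> j \<and> real j \<le> b * k n}"
      by (rule finite_subset[OF _ finite_band[of "b * k n + 1"]]) auto
  qed auto
  have le1: "(\<Sum>\<^sub>\<infinity>j\<in>{j. 1 \<le> j \<and> real j > b * k n}. (\<theta> n j)\<^sup>2) \<le> (l2norm (rest b n))\<^sup>2" if "n \<ge> 1" for b n
    unfolding tail[OF that] rest_norm'[OF that] low_def
    by (intro diff_left_mono sum_mono2 finite_subset[OF _ finite_band[of "b * k n + 1"]]) auto
  have le2: "(l2norm (rest b' n))\<^sup>2 \<le> (\<Sum>\<^sub>\<infinity>j\<in>{j. 1 \<le> j \<and> real j > b * k n}. (\<theta> n j)\<^sup>2)" if "n \<ge> 1" "b < b'" for b b' n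
  proof -
    have "b * k n < b' * k n" using that k_ge_1[OF that(1)] by simp
    then have "(\<Sum>j\<in>{j. 1 \<le> j \<and> real j \<le> b * k n}. (\<theta> n j)\<^sup>2) \<le> low b' n"
      unfolding low_def by (intro sum_mono2) auto
    then show ?thesis unfolding tail[OF that(1)] rest_norm'[OF that(1)] by simp
  qed
  show ?thesis
    unfolding tight_def
  proof (intro iffI allI impI)
    fix e :: real assume "\<forall>e>0. \<exists>b>0. \<forall>\<^sub>F n in sequentially. (l2norm (rest b n))\<^sup>2 \<le> e * (rt n)\<^sup>2" "e > 0"
    then obtain b where "\<forall>\<^sub>F n in sequentially. (l2norm (rest b n))\<^sup>2 \<le> e * (rt n)\<^sup>2" by blast
    then obtain N where N: "\<And>n. n \<ge> N \<Longrightarrow> (l2norm (rest b n))\<^sup>2 \<le> e * (rt n)\<^sup>2" by (auto simp: eventually_sequentially)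
    have "(\<Sum>\<^sub>\<infinity>j\<in>{j. 1 \<le> j \<and> real j > b * k n}. (\<theta> n j)\<^sup>2) \<le> e * (rt n)\<^sup>2" if "n > N" for n
      using le1[of n b] N[of n] that by linarith
    then show "\<exists>b n0. \<forall>n>n0. (\<Sum>\<^sub>\<infinity>j\<in>{j. 1 \<le> j \<and> real j > b * k n}. (\<theta> n j)\<^sup>2) \<le> e * (rt n)\<^sup>2" by blast
  next
    fix e :: real assume "\<forall>e>0. \<exists>b n0. \<forall>n>n0. (\<Sum>\<^sub>\<infinity>j\<in>{j. 1 \<le> j \<and> real j > b * k n}. (\<theta> n j)\<^sup>2) \<le> e * (rt n)\<^sup>2" "e > 0"
    then obtain b n0 where N: "\<And>n. n > n0 \<Longrightarrow> (\<Sum>\<^sub>\<infinity>j\<in>{j. 1 \<le> j \<and> real j > b * k n}. (\<theta> n j)\<^sup>2) \<le> e * (rt n)\<^sup>2" by blast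
    have "\<forall>\<^sub>F n in sequentially. (l2norm (rest (max b 0 + 1) n))\<^sup>2 \<le> e * (rt n)\<^sup>2"
      using eventually_gt_at_top[of n0]
    proof eventually_elim
      case (elim n)
      show ?case using le2[of n b "max b 0 + 1"] N[OF elim] elim by linarith
    qed
    then show "\<exists>b>0. \<forall>\<^sub>F n in sequentially. (l2norm (rest b n))\<^sup>2 \<le> e * (rt n)\<^sup>2"
      by (intro exI[of _ "max b 0 + 1"]) auto
  qed
qed

lemma tight_imp_detectable:
  assumes tight
  shows detectable
proof -
  obtain b where b: "b > 0" "\<forall>\<^sub>F n in sequentially. (l2norm (rest b n))\<^sup>2 \<le> c\<^sup>2 / 2 * (rt n)\<^sup>2"
    using assms[unfolded tight_def, rule_format, of "c\<^sup>2 / 2"] cC by auto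
  have "\<forall>\<^sub>F n in sequentially. c\<^sup>2 / 4 * (rt n)\<^sup>2 < low b n"
    using b(2) eventually_ge_at_top[of 1]
  proof eventually_elim
    case (elim n)
    have "c\<^sup>2 / 4 * (rt n)\<^sup>2 > 0" using cC rt_pos[OF elim(2)] by simp
    then show ?case using elim(1) norm_square_ge[OF elim(2)] rest_norm'[OF elim(2), of b] by linarith
  qed
  then obtain N where "\<And>n. n \<ge> N \<Longrightarrow> c\<^sup>2 / 4 * (rt n)\<^sup>2 < low b n" by (auto simp: eventually_sequentially)
  then have "\<forall>n>N. c\<^sup>2 / 4 * (rt n)\<^sup>2 < low b n" by simp
  moreover have "c\<^sup>2 / 4 > 0" using cC by simp
  ultimately show ?thesis unfolding detectable_def using b(1) by blast
qed

text \<open>An inconsistent sequence has vanishing drift, hence little energy on frequencies of order \<open>k n\<close>, where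
  \<open>f\<close> has almost all of its energy.\<close>

lemma tight_cross_term:
  assumes tight and \<nu>: "filterlim \<nu> at_top sequentially" "\<And>i. \<nu> i \<ge> 1"
    and g: "\<And>i. alternative (g i)" "\<And>i. l2norm (g i) \<le> D * rt (\<nu> i)" and D: "D > 0"
    and inc: "cvm_inconsistent \<nu> g"
  shows "(\<lambda>i. l2inner (f (\<nu> i)) (g i) / (rt (\<nu> i))\<^sup>2) \<longlonglongrightarrow> 0"
proof (rule tendstoI)
  fix e :: real assume e: "e > 0"
  have dr: "(\<lambda>i. drift (\<nu> i) (g i)) \<longlonglongrightarrow> 0"
    by (rule inconsistent_imp_drift[OF inc \<nu>(2) _ norm_bound_tendsto[OF g(2) \<nu>(1)]]) (simp add: g(1))
  \<comment> \<open>leaves at most half of the error for the tail of \<open>f\<close>\<close>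
  define e' where "e' = (e / (2 * D))\<^sup>2"
  have e': "e' > 0" "sqrt e' = e / (2 * D)" using e D by (simp_all add: e'_def)
  obtain b where b: "b > 0" "\<forall>\<^sub>F n in sequentially. (l2norm (rest b n))\<^sup>2 \<le> e' * (rt n)\<^sup>2"
    using assms(1) e'(1) unfolding tight_def by blast
  have "(\<lambda>i. C * (pi * b) * sqrt (drift (\<nu> i) (g i))) \<longlonglongrightarrow> C * (pi * b) * sqrt 0"
    by (intro tendsto_intros dr)
  from order_tendstoD(2)[OF this, of "e / 2"] e
  have ev: "\<forall>\<^sub>F i in sequentially. C * (pi * b) * sqrt (drift (\<nu> i) (g i)) < e / 2" by simp
  from eventually_compose_filterlim[OF b(2) \<nu>(1)] ev
  show "\<forall>\<^sub>F i in sequentially. dist (l2inner (f (\<nu> i)) (g i) / (rt (\<nu> i))\<^sup>2) 0 < e"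
  proof eventually_elim
    case (elim i)
    let ?n = "\<nu> i"
    have n: "?n \<ge> 1" by (rule \<nu>(2))
    have rp: "rt ?n > 0" by (rule rt_pos[OF n])
    have gL: "g i \<in> L2" by (rule alternative_L2[OF g(1)])
    have "l2inner (f ?n) (g i) = l2inner (trunc b ?n) (g i) + l2inner (rest b ?n) (g i)"
      unfolding rest_def l2inner_diff_left[OF L2_f[OF n] L2_trunc gL] by simp
    moreover have "\<bar>l2inner (rest b ?n) (g i)\<bar> \<le> e / 2 * (rt ?n)\<^sup>2"
    proof -
      have "l2norm (rest b ?n) \<le> sqrt e' * rt ?n"
        by (rule power2_le_imp_le) (use elim(1) e'(1) in \<open>simp_all add: power_mult_distrib\<close>)
      then have "l2norm (rest b ?n) * l2norm (g i) \<le> (sqrt e' * rt ?n) * (D * rt ?n)"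
        using g(2)[of i] D e'(1) by (intro mult_mono) auto
      also have "\<dots> = e / 2 * (rt ?n)\<^sup>2" using D by (simp add: e'(2) power2_eq_square)
      finally show ?thesis using l2inner_le[OF L2_rest[OF n, of b] gL] by linarith
    qed
    moreover have "\<bar>l2inner (trunc b ?n) (g i)\<bar> \<le> C * (pi * b) * sqrt (drift ?n (g i)) * (rt ?n)\<^sup>2"
    proof -
      let ?J = "band (b * k ?n)"
      have "(l2inner (trunc b ?n) (g i))\<^sup>2 = (\<Sum>j\<in>?J. \<theta> ?n j * l2inner (\<phi> j) (g i))\<^sup>2"
        unfolding trunc_def l2inner_psum[OF gL] ..
      also have "\<dots> \<le> (\<Sum>j\<in>?J. (\<theta> ?n j)\<^sup>2) * (\<Sum>j\<in>?J. (l2inner (\<phi> j) (g i))\<^sup>2)"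
        by (rule Cauchy_Schwarz_ineq_sum)
      also have "\<dots> \<le> (C\<^sup>2 * (rt ?n)\<^sup>2) * ((pi * b)\<^sup>2 * drift ?n (g i) * (rt ?n)\<^sup>2)"
      proof (intro mult_mono)
        show "(\<Sum>j\<in>?J. (\<theta> ?n j)\<^sup>2) \<le> C\<^sup>2 * (rt ?n)\<^sup>2"
          using low_le_norm[OF n, of b] norm_square_le[OF n] by (simp add: low_def)
        show "(\<Sum>j\<in>?J. (l2inner (\<phi> j) (g i))\<^sup>2) \<le> (pi * b)\<^sup>2 * drift ?n (g i) * (rt ?n)\<^sup>2"
          unfolding l2inner_commute[of "\<phi> _"] by (rule band_coefficients_le[OF g(1) n b(1)]) auto
      qed (auto intro: sum_nonneg)
      also have "\<dots> = (C * (pi * b) * sqrt (drift ?n (g i)) * (rt ?n)\<^sup>2)\<^sup>2"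
        by (simp add: power_mult_distrib power2_eq_square[of "(rt ?n)\<^sup>2"] mult_ac)
      finally show ?thesis
        using C_pos b(1) by (intro abs_le_square_iff[THEN iffD2, THEN order_trans[OF _ eq_refl[OF abs_of_nonneg]]]) auto
    qed
    ultimately have "\<bar>l2inner (f ?n) (g i)\<bar> \<le> (e / 2 + C * (pi * b) * sqrt (drift ?n (g i))) * (rt ?n)\<^sup>2"
      unfolding distrib_right by linarith
    also have "\<dots> < e * (rt ?n)\<^sup>2" using elim(2) rp by (intro mult_strict_right_mono) auto
    finally show ?case using rp by (simp add: pos_divide_less_eq)
  qed
qed

text \<open>If the tails are not negligible, there are cutoffs \<open>\<beta> i\<close> tending to infinity and sample sizes at which
  the tail beyond \<open>\<beta> i * k (\<nu> i)\<close> keeps a fixed share of the energy.\<close>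

lemma heavy_tail_sequence:
  assumes "\<not> tight"
  obtains e \<nu> \<beta> where "e > 0" "strict_mono \<nu>" "\<forall>i. \<nu> i > (n1::nat)"
    "\<forall>i. \<beta> i > b0 \<and> \<beta> i \<ge> real (Suc i) \<and> \<beta> i \<notin> \<rat>"
    "\<forall>i. (l2norm (rest (\<beta> i) (\<nu> i)))\<^sup>2 > e * (rt (\<nu> i))\<^sup>2"
proof -
  obtain e where e: "e > 0" and bad: "\<And>b. b > 0 \<Longrightarrow> \<exists>\<^sub>F n in sequentially. (l2norm (rest b n))\<^sup>2 > e * (rt n)\<^sup>2"
    using assms unfolding tight_def frequently_def not_less by blast
  have "\<forall>i. \<exists>x. x > b0 \<and> x \<ge> real (Suc i) \<and> x \<notin> \<rat>"
  proof
    fix i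
    obtain x where "max b0 (real (Suc i)) < x" "x < max b0 (real (Suc i)) + 1" "x \<notin> \<rat>"
      by (rule irrational_between[of "max b0 (real (Suc i))" "max b0 (real (Suc i)) + 1"]) auto
    then show "\<exists>x. x > b0 \<and> x \<ge> real (Suc i) \<and> x \<notin> \<rat>" by (intro exI[of _ x]) auto
  qed
  from choice[OF this] obtain \<beta> where \<beta>: "\<forall>i. \<beta> i > b0 \<and> \<beta> i \<ge> real (Suc i) \<and> \<beta> i \<notin> \<rat>" by blast
  have ex: "\<exists>n>N. (l2norm (rest (\<beta> i) n))\<^sup>2 > e * (rt n)\<^sup>2" for N i
  proof -
    have "real (Suc i) > 0" by simp
    then have "\<beta> i > 0" using \<beta> less_le_trans by blast
    from frequently_eventually_conj[OF bad[OF this] eventually_gt_at_top[of N]]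
    show ?thesis by (auto dest!: frequently_ex)
  qed
  have "\<exists>\<nu>. \<forall>i. (\<nu> i > n1 \<and> (l2norm (rest (\<beta> i) (\<nu> i)))\<^sup>2 > e * (rt (\<nu> i))\<^sup>2) \<and> \<nu> i < \<nu> (Suc i)"
  proof (rule dependent_nat_choice)
    show "\<exists>n. n > n1 \<and> (l2norm (rest (\<beta> 0) n))\<^sup>2 > e * (rt n)\<^sup>2" using ex by blast
    show "\<exists>y. (y > n1 \<and> (l2norm (rest (\<beta> (Suc i)) y))\<^sup>2 > e * (rt y)\<^sup>2) \<and> x < y" for x i
      using ex[of "max n1 x" "Suc i"] by auto
  qed
  then obtain \<nu> where \<nu>: "\<forall>i. (\<nu> i > n1 \<and> (l2norm (rest (\<beta> i) (\<nu> i)))\<^sup>2 > e * (rt (\<nu> i))\<^sup>2) \<and> \<nu> i < \<nu> (Suc i)" by blast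
  show ?thesis
    by (rule that[of e \<nu> \<beta>]) (use e \<nu> \<beta> in \<open>auto simp: strict_mono_Suc_iff\<close>)
qed

lemma heavy_tail_drift:
  assumes "\<And>i. \<beta> i \<ge> real (Suc i)" "\<And>i. \<nu> i \<ge> 1"
  shows "(\<lambda>i. drift (\<nu> i) (rest (\<beta> i) (\<nu> i))) \<longlonglongrightarrow> 0"
proof (rule Lim_null_comparison)
  show "\<forall>\<^sub>F i in sequentially. norm (drift (\<nu> i) (rest (\<beta> i) (\<nu> i))) \<le> (2 * C / pi * (1 / real (Suc i)))\<^sup>2"
  proof (intro always_eventually allI)
    fix i
    have p: "real (Suc i) > 0" by simp
    then have bp: "\<beta> i > 0" using assms(1)[of i] by linarith
    have "drift (\<nu> i) (rest (\<beta> i) (\<nu> i)) \<le> (2 * C / (pi * \<beta> i))\<^sup>2" by (rule drift_rest[OF assms(2) bp])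
    also have "\<dots> \<le> (2 * C / (pi * real (Suc i)))\<^sup>2"
      using assms(1)[of i] p bp C_pos by (intro power_mono divide_left_mono mult_left_mono) auto
    finally show "norm (drift (\<nu> i) (rest (\<beta> i) (\<nu> i))) \<le> (2 * C / pi * (1 / real (Suc i)))\<^sup>2" by simp
  qed
  have "(\<lambda>i. (2 * C / pi * (1 / real (Suc i)))\<^sup>2) \<longlonglongrightarrow> (2 * C / pi * 0)\<^sup>2"
    by (intro tendsto_intros LIMSEQ_inverse_real_of_nat[unfolded inverse_eq_divide])
  then show "(\<lambda>i. (2 * C / pi * (1 / real (Suc i)))\<^sup>2) \<longlonglongrightarrow> 0" by simp
qed


subsection \<open>Pure consistency\<close>

text \<open>The last clause in the definition of pure consistency.\<close>

definition pure :: bool where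
  "pure \<longleftrightarrow> \<not> (\<exists>\<nu> f1 f2. sample_sizes \<nu> \<and>
          (\<forall>i. f1 i \<in> L2 \<and> alternative (f2 i) \<and>
               l2eq (f (\<nu> i)) (\<lambda>x. f1 i x + f2 i x) \<and> l2inner (f2 i) (f1 i) = 0) \<and>
          (\<exists>c1>0. \<forall>i. l2norm (f2 i) > c1 * rt (\<nu> i)) \<and>
          cvm_inconsistent \<nu> f2)"

lemma sample_sizes_at_top: "sample_sizes \<nu> \<Longrightarrow> filterlim \<nu> at_top sequentially"
  unfolding sample_sizes_def by (simp add: filterlim_subseq)

text \<open>An orthogonal component has its squared norm as inner product with \<open>f\<close>, which vanishes relative to
  the rate if the component is inconsistent.\<close>

lemma tight_imp_pure:
  assumes tight
  shows pure
  unfolding pure_def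
proof (intro notI, elim exE conjE)
  fix \<nu> f1 f2 c1
  assume \<nu>: "sample_sizes \<nu>" and dec: "\<forall>i. f1 i \<in> L2 \<and> alternative (f2 i) \<and>
      l2eq (f (\<nu> i)) (\<lambda>x. f1 i x + f2 i x) \<and> l2inner (f2 i) (f1 i) = 0"
    and c1: "c1 > 0" and big: "\<forall>i. l2norm (f2 i) > c1 * rt (\<nu> i)" and inc: "cvm_inconsistent \<nu> f2"
  have n1: "\<nu> i \<ge> 1" for i using \<nu> by (simp add: sample_sizes_def)
  have L: "f1 i \<in> L2" "f2 i \<in> L2" for i using dec alternative_L2 by auto
  have inner: "l2inner (f (\<nu> i)) (f2 i) = (l2norm (f2 i))\<^sup>2" for i
  proof -
    have "l2inner (f (\<nu> i)) (f2 i) = l2inner (\<lambda>x. f1 i x + f2 i x) (f2 i)"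
      using dec by (intro l2inner_cong_AE) (auto simp: l2eq_iff intro!: L2_measurable L2_f n1 L2_add L)
    also have "\<dots> = l2inner (f2 i) (f1 i) + l2inner (f2 i) (f2 i)"
      by (simp add: l2inner_add_left L l2inner_commute[of "f1 i"])
    finally show ?thesis using dec by (simp add: l2norm_square)
  qed
  have up: "l2norm (f2 i) \<le> C * rt (\<nu> i)" for i
  proof -
    have p: "l2norm (f2 i) > 0" using big c1 by (metis less_trans mult_pos_pos n1 rt_pos)
    have "l2norm (f2 i) * l2norm (f2 i) \<le> l2norm (f (\<nu> i)) * l2norm (f2 i)"
      using l2inner_le[OF L2_f[OF n1[of i]] L(2)[of i]] inner[of i] by (simp add: power2_eq_square)
    then have "l2norm (f2 i) \<le> l2norm (f (\<nu> i))" using p by simp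
    then show ?thesis using norm_f[OF n1[of i]] by linarith
  qed
  have "(\<lambda>i. l2inner (f (\<nu> i)) (f2 i) / (rt (\<nu> i))\<^sup>2) \<longlonglongrightarrow> 0"
    by (rule tight_cross_term[OF assms sample_sizes_at_top[OF \<nu>] n1 _ up C_pos inc]) (use dec in blast)
  from order_tendstoD(2)[OF this, of "c1\<^sup>2"] c1
  have "\<forall>\<^sub>F i in sequentially. l2inner (f (\<nu> i)) (f2 i) / (rt (\<nu> i))\<^sup>2 < c1\<^sup>2" by simp
  then obtain i where i: "l2inner (f (\<nu> i)) (f2 i) / (rt (\<nu> i))\<^sup>2 < c1\<^sup>2"
    using eventually_happens[of _ sequentially] by auto
  have rp: "rt (\<nu> i) > 0" by (rule rt_pos[OF n1])
  have "(c1 * rt (\<nu> i))\<^sup>2 \<le> (l2norm (f2 i))\<^sup>2" using big c1 rp by (intro power_mono) (auto intro: less_imp_le)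
  then show False using i rp inner[of i] by (simp add: pos_divide_less_eq power_mult_distrib)
qed

lemma heavy_tail_vanishing:
  assumes \<nu>: "filterlim \<nu> at_top sequentially" "\<And>i. \<nu> i \<ge> 1" and alt': "\<And>i. alternative (h i)"
    and bd: "\<And>i. l2norm (h i) \<le> D * rt (\<nu> i)"
  shows "vanishing_alternatives \<nu> h"
  by unfold_locales (use \<nu> alt' norm_bound_tendsto[OF bd \<nu>(1)] in auto)

text \<open>A heavy tail is an inconsistent component orthogonal to the rest.\<close>

lemma pure_imp_tight:
  assumes pure and B: "condition_B r \<theta>"
  shows tight
proof (rule ccontr)
  assume nt: "\<not> tight"
  obtain c0 where c0: "\<forall>c>c0. \<forall>n\<ge>1. series_density (\<lambda>j. if real j > c * real (kn r n) then \<theta> n j else 0) \<and>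
     series_density (\<lambda>j. if real j < c * real (kn r n) then \<theta> n j else 0)"
    using B unfolding condition_B_def by blast
  obtain e \<nu> \<beta> where e: "e > 0" and \<nu>: "strict_mono \<nu>" "\<forall>i. \<nu> i > (0::nat)"
    and \<beta>: "\<forall>i. \<beta> i > c0 \<and> \<beta> i \<ge> real (Suc i) \<and> \<beta> i \<notin> \<rat>"
    and heavy: "\<forall>i. (l2norm (rest (\<beta> i) (\<nu> i)))\<^sup>2 > e * (rt (\<nu> i))\<^sup>2"
    by (rule heavy_tail_sequence[OF nt, of 0 c0])
  have n1: "\<nu> i \<ge> 1" for i using \<nu>(2) by (simp add: Suc_le_eq)
  have sizes: "sample_sizes \<nu>" using \<nu>(1) n1 by (simp add: sample_sizes_def)
  have alt_r: "alternative (rest (\<beta> i) (\<nu> i))" for i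
    using trunc_alternative(2)[OF c0 _ n1[of i], of "\<beta> i"] \<beta> by blast
  have bd: "l2norm (rest (\<beta> i) (\<nu> i)) \<le> C * rt (\<nu> i)" for i
    unfolding rest_def by (rule trunc_norm_bounds(2)[OF n1])
  interpret v: vanishing_alternatives \<nu> "\<lambda>i. rest (\<beta> i) (\<nu> i)"
    by (rule heavy_tail_vanishing[OF sample_sizes_at_top[OF sizes] n1 alt_r bd])
  have inc: "cvm_inconsistent \<nu> (\<lambda>i. rest (\<beta> i) (\<nu> i))"
    by (rule v.inconsistent_of_drift, rule heavy_tail_drift) (use \<beta> n1 in auto)
  have big: "l2norm (rest (\<beta> i) (\<nu> i)) > sqrt e * rt (\<nu> i)" for i
  proof (rule power2_less_imp_less)
    show "(sqrt e * rt (\<nu> i))\<^sup>2 < (l2norm (rest (\<beta> i) (\<nu> i)))\<^sup>2"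
      using heavy e by (simp add: power_mult_distrib)
  qed simp
  have dec: "trunc (\<beta> i) (\<nu> i) \<in> L2 \<and> alternative (rest (\<beta> i) (\<nu> i)) \<and>
      l2eq (f (\<nu> i)) (\<lambda>x. trunc (\<beta> i) (\<nu> i) x + rest (\<beta> i) (\<nu> i) x) \<and> l2inner (rest (\<beta> i) (\<nu> i)) (trunc (\<beta> i) (\<nu> i)) = 0" for i
    using alt_r[of i] trunc_orthogonal[OF n1[of i], of "\<beta> i"]
    by (auto simp: L2_trunc l2eq_def rest_def l2inner_commute)
  have "sqrt e > 0" using e by simp
  have "sample_sizes \<nu> \<and>
      (\<forall>i. trunc (\<beta> i) (\<nu> i) \<in> L2 \<and> alternative (rest (\<beta> i) (\<nu> i)) \<and>
         l2eq (f (\<nu> i)) (\<lambda>x. trunc (\<beta> i) (\<nu> i) x + rest (\<beta> i) (\<nu> i) x) \<and>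
         l2inner (rest (\<beta> i) (\<nu> i)) (trunc (\<beta> i) (\<nu> i)) = 0) \<and>
      (\<exists>c1>0. \<forall>i. l2norm (rest (\<beta> i) (\<nu> i)) > c1 * rt (\<nu> i)) \<and>
      cvm_inconsistent \<nu> (\<lambda>i. rest (\<beta> i) (\<nu> i))"
    using \<open>sqrt e > 0\<close> sizes dec big inc by blast
  then have "\<not> pure"
    unfolding pure_def not_not
    by (intro exI[of _ \<nu>] exI[of _ "\<lambda>i. trunc (\<beta> i) (\<nu> i)"] exI[of _ "\<lambda>i. rest (\<beta> i) (\<nu> i)"])
  then show False using assms(1) by simp
qed

text \<open>The condition in (f), normalized by the rate.\<close>

definition insensitive :: bool where
  "insensitive \<longleftrightarrow> (\<forall>\<nu> f1. sample_sizes \<nu> \<and>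
     (\<forall>i. alternative (f1 i) \<and> c * rt (\<nu> i) < l2norm (f1 i) \<and> l2norm (f1 i) < C * rt (\<nu> i)) \<and>
     cvm_inconsistent \<nu> f1 \<longrightarrow>
     (\<lambda>i. ((l2norm (\<lambda>x. f (\<nu> i) x + f1 i x))\<^sup>2 - (l2norm (f (\<nu> i)))\<^sup>2 - (l2norm (f1 i))\<^sup>2) / (rt (\<nu> i))\<^sup>2) \<longlonglongrightarrow> 0)"

lemma tight_imp_insensitive:
  assumes tight
  shows insensitive
  unfolding insensitive_def
proof (intro allI impI, elim conjE)
  fix \<nu> f1
  assume \<nu>: "sample_sizes \<nu>" and a: "\<forall>i. alternative (f1 i) \<and> c * rt (\<nu> i) < l2norm (f1 i) \<and> l2norm (f1 i) < C * rt (\<nu> i)"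
    and inc: "cvm_inconsistent \<nu> f1"
  have n1: "\<nu> i \<ge> 1" for i using \<nu> by (simp add: sample_sizes_def)
  have "(\<lambda>i. l2inner (f (\<nu> i)) (f1 i) / (rt (\<nu> i))\<^sup>2) \<longlonglongrightarrow> 0"
    by (rule tight_cross_term[OF assms sample_sizes_at_top[OF \<nu>] n1 _ _ C_pos inc]) (use a in \<open>auto intro: less_imp_le\<close>)
  from tendsto_mult_left[OF this, of 2]
  have "(\<lambda>i. 2 * (l2inner (f (\<nu> i)) (f1 i) / (rt (\<nu> i))\<^sup>2)) \<longlonglongrightarrow> 0" by simp
  moreover have "((l2norm (\<lambda>x. f (\<nu> i) x + f1 i x))\<^sup>2 - (l2norm (f (\<nu> i)))\<^sup>2 - (l2norm (f1 i))\<^sup>2) / (rt (\<nu> i))\<^sup>2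
      = 2 * (l2inner (f (\<nu> i)) (f1 i) / (rt (\<nu> i))\<^sup>2)" for i
    using l2norm_add_square[OF L2_f[OF n1[of i]] alternative_L2[of "f1 i"]] a by simp
  ultimately show "(\<lambda>i. ((l2norm (\<lambda>x. f (\<nu> i) x + f1 i x))\<^sup>2 - (l2norm (f (\<nu> i)))\<^sup>2 - (l2norm (f1 i))\<^sup>2) / (rt (\<nu> i))\<^sup>2) \<longlonglongrightarrow> 0"
    by (simp only:)
qed

end

context cvm_alternatives
begin

text \<open>A cosine of high frequency adds norm to an alternative but hardly any drift.\<close>

lemma drift_mixture_le:
  assumes "g \<in> L2" "n \<ge> 1" "J \<ge> 1"
  shows "drift n (\<lambda>x. 1 / 2 * g x + a * \<phi> J x) \<le> drift n g + 2 * a\<^sup>2 * real n / (real J)\<^sup>2"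
proof -
  have L: "(\<lambda>x. 1 / 2 * g x) \<in> L2" "(\<lambda>x. a * \<phi> J x) \<in> L2" by (intro L2_scale assms(1) L2_phi)+
  have pr: "prim (\<lambda>x. 1 / 2 * g x + a * \<phi> J x) x = 1 / 2 * prim g x + a / (pi * real J) * sine J x" if "x \<in> {0<..<1}" for x
    using prim_add[OF L, of x] prim_scale[of "1 / 2" g x] prim_scale[of a "\<phi> J" x] prim_phi[OF assms(3) that] by simp
  have sn1: "l2norm (sine J) = 1" using assms(3) by (simp add: l2norm_def l2inner_trig)
  have "l2norm (prim (\<lambda>x. 1 / 2 * g x + a * \<phi> J x)) = l2norm (\<lambda>x. 1 / 2 * prim g x + a / (pi * real J) * sine J x)"
    by (rule l2norm_cong[OF pr])
  also have "\<dots> \<le> l2norm (\<lambda>x. 1 / 2 * prim g x) + l2norm (\<lambda>x. a / (pi * real J) * sine J x)"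
    by (intro l2norm_triangle L2_scale L2_prim assms(1) L2_sine)
  also have "\<dots> = 1 / 2 * l2norm (prim g) + \<bar>a\<bar> / (pi * real J)"
    unfolding l2norm_scale sn1 by (simp add: abs_mult)
  also have "\<bar>a\<bar> / (pi * real J) \<le> \<bar>a\<bar> / (1 * real J)"
    using pi_gt3 assms(3) by (intro divide_left_mono mult_right_mono) auto
  finally have le: "l2norm (prim (\<lambda>x. 1 / 2 * g x + a * \<phi> J x)) \<le> 1 / 2 * l2norm (prim g) + \<bar>a\<bar> / real J" by simp
  have "(l2norm (prim (\<lambda>x. 1 / 2 * g x + a * \<phi> J x)))\<^sup>2 \<le> (1 / 2 * l2norm (prim g) + \<bar>a\<bar> / real J)\<^sup>2"
    by (rule power_mono[OF le]) simp
  also have "\<dots> \<le> (l2norm (prim g))\<^sup>2 + 2 * (\<bar>a\<bar> / real J)\<^sup>2"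
  proof -
    have "(1 / 2 * u + v)\<^sup>2 \<le> u\<^sup>2 + 2 * v\<^sup>2" for u v :: real
    proof -
      have "u\<^sup>2 + 2 * v\<^sup>2 - (1 / 2 * u + v)\<^sup>2 = (u / 2 - v)\<^sup>2 + u\<^sup>2 / 2"
        by (simp add: power2_eq_square algebra_simps)
      moreover have "0 \<le> (u / 2 - v)\<^sup>2 + u\<^sup>2 / 2" by simp
      ultimately show ?thesis by linarith
    qed
    then show ?thesis .
  qed
  finally have "real n * (l2norm (prim (\<lambda>x. 1 / 2 * g x + a * \<phi> J x)))\<^sup>2 \<le> real n * ((l2norm (prim g))\<^sup>2 + 2 * (\<bar>a\<bar> / real J)\<^sup>2)"
    by (rule mult_left_mono) simp
  then show ?thesis by (simp add: drift_def distrib_left power_divide mult_ac)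
qed

text \<open>A heavy tail \<open>h i\<close> is inconsistent and correlated with \<open>f (\<nu> i)\<close>, but its norm may be too small to
  serve as a test sequence. Its average with a cosine of very high frequency is again a density, is
  still inconsistent and correlated, and the amplitude of the cosine is free to bring the norm
  between the prescribed bounds.\<close>

lemma insensitive_imp_tight:
  assumes insensitive and B: "condition_B r \<theta>"
  shows tight
proof (rule ccontr)
  assume nt: "\<not> tight"
  obtain c0 where c0: "\<forall>c>c0. \<forall>n\<ge>1. series_density (\<lambda>j. if real j > c * real (kn r n) then \<theta> n j else 0) \<and>
     series_density (\<lambda>j. if real j < c * real (kn r n) then \<theta> n j else 0)"
    using B unfolding condition_B_def by blast
  \<comment> \<open>from this size on, a cosine of amplitude \<open>2 * C * rt n\<close> stays above \<open>-1\<close>\<close>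
  have "(\<lambda>n. 2 * C * sqrt 2 * rt n) \<longlonglongrightarrow> 0" using tendsto_mult_left[OF rt_tendsto, of "2 * C * sqrt 2"] by simp
  from order_tendstoD(2)[OF this, of 1] obtain n1 where amp: "\<And>n. n \<ge> n1 \<Longrightarrow> 2 * C * sqrt 2 * rt n < 1"
    by (auto simp: eventually_sequentially)
  obtain e \<nu> \<beta> where e: "e > 0" and \<nu>: "strict_mono \<nu>" "\<forall>i. \<nu> i > n1"
    and \<beta>: "\<forall>i. \<beta> i > c0 \<and> \<beta> i \<ge> real (Suc i) \<and> \<beta> i \<notin> \<rat>"
    and heavy: "\<forall>i. (l2norm (rest (\<beta> i) (\<nu> i)))\<^sup>2 > e * (rt (\<nu> i))\<^sup>2"
    by (rule heavy_tail_sequence[OF nt, of n1 c0])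
  have n1: "\<nu> i \<ge> 1" for i using \<nu>(2)[rule_format, of i] by linarith
  have sizes: "sample_sizes \<nu>" using \<nu>(1) n1 by (simp add: sample_sizes_def)
  note top = sample_sizes_at_top[OF sizes]
  define h where "h i = rest (\<beta> i) (\<nu> i)" for i
  have alt_h: "alternative (h i)" for i
    unfolding h_def using trunc_alternative(2)[OF c0 _ n1[of i], of "\<beta> i"] \<beta> by blast
  have hL: "h i \<in> L2" for i by (rule alternative_L2[OF alt_h])
  have h_bd: "l2norm (h i) \<le> C * rt (\<nu> i)" for i
    unfolding h_def rest_def by (rule trunc_norm_bounds(2)[OF n1])
  define m where "m = (c + C) / 2"
  have m: "c < m" "m < C" "C \<le> 2 * m" "m > 0" using cC by (auto simp: m_def)
  define \<tau> where "\<tau> = min (e / (4 * C)) (min ((m\<^sup>2 - c\<^sup>2) / (2 * C)) ((C\<^sup>2 - m\<^sup>2) / (2 * C)))"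
  have mc: "c\<^sup>2 < m\<^sup>2" "m\<^sup>2 < C\<^sup>2" using m cC by (auto intro!: power_strict_mono)
  have \<tau>: "\<tau> > 0" unfolding \<tau>_def using e mc C_pos by simp
  have \<tau>_le: "C * \<tau> \<le> e / 4" "2 * C * \<tau> \<le> m\<^sup>2 - c\<^sup>2" "2 * C * \<tau> \<le> C\<^sup>2 - m\<^sup>2"
  proof -
    have "\<tau> \<le> e / (4 * C)" "\<tau> \<le> (m\<^sup>2 - c\<^sup>2) / (2 * C)" "\<tau> \<le> (C\<^sup>2 - m\<^sup>2) / (2 * C)" by (auto simp: \<tau>_def)
    then show "C * \<tau> \<le> e / 4" "2 * C * \<tau> \<le> m\<^sup>2 - c\<^sup>2" "2 * C * \<tau> \<le> C\<^sup>2 - m\<^sup>2"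
      using C_pos by (simp_all add: pos_le_divide_eq mult_ac)
  qed
  \<comment> \<open>a frequency so high that \<open>f (\<nu> i)\<close> has almost no energy there\<close>
  have "\<forall>i. \<exists>J. J \<ge> \<nu> i \<and> J \<ge> 1 \<and> \<bar>\<theta> (\<nu> i) J\<bar> \<le> \<tau> * rt (\<nu> i) \<and> J \<notin> band (\<beta> i * k (\<nu> i))"
  proof
    fix i
    let ?n = "\<nu> i"
    have conv: "(\<lambda>N. (\<Sum>j=1..Suc N. (\<theta> ?n j)\<^sup>2) - (\<Sum>j=1..N. (\<theta> ?n j)\<^sup>2)) \<longlonglongrightarrow> (l2norm (f ?n))\<^sup>2 - (l2norm (f ?n))\<^sup>2"
      by (intro tendsto_diff cos_expansion_norm[OF expansion[OF n1]] LIMSEQ_Suc[OF cos_expansion_norm[OF expansion[OF n1]]])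
    then have "(\<lambda>N. (\<theta> ?n (Suc N))\<^sup>2) \<longlonglongrightarrow> 0" by simp
    moreover have tp: "(\<tau> * rt ?n)\<^sup>2 > 0" using \<tau> rt_pos[OF n1] by simp
    ultimately have "\<forall>\<^sub>F N in sequentially. (\<theta> ?n (Suc N))\<^sup>2 < (\<tau> * rt ?n)\<^sup>2"
      by (rule order_tendstoD(2))
    with eventually_ge_at_top[of "max ?n (nat \<lceil>\<beta> i * k ?n\<rceil>)"]
    have "\<forall>\<^sub>F N in sequentially. Suc N \<ge> ?n \<and> \<bar>\<theta> ?n (Suc N)\<bar> \<le> \<tau> * rt ?n \<and> Suc N \<notin> band (\<beta> i * k ?n)"
    proof eventually_elim
      case (elim N)
      have "\<bar>\<theta> ?n (Suc N)\<bar> \<le> \<tau> * rt ?n"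
        using elim(2) \<tau> by (intro power2_le_imp_le[of "\<bar>\<theta> ?n (Suc N)\<bar>"]) (auto intro: less_imp_le)
      moreover have "\<beta> i * k ?n \<le> real (Suc N)" using elim(1) by linarith
      ultimately show ?case using elim(1) by auto
    qed
    then obtain N where "Suc N \<ge> ?n \<and> \<bar>\<theta> ?n (Suc N)\<bar> \<le> \<tau> * rt ?n \<and> Suc N \<notin> band (\<beta> i * k ?n)"
      using eventually_happens[of _ sequentially] by auto
    then show "\<exists>J. J \<ge> ?n \<and> J \<ge> 1 \<and> \<bar>\<theta> ?n J\<bar> \<le> \<tau> * rt ?n \<and> J \<notin> band (\<beta> i * k ?n)"
      by (intro exI[of _ "Suc N"]) simp
  qed
  from choice[OF this] obtain J where J: "\<forall>i. J i \<ge> \<nu> i \<and> J i \<ge> 1 \<and> \<bar>\<theta> (\<nu> i) (J i)\<bar> \<le> \<tau> * rt (\<nu> i) \<and> J i \<notin> band (\<beta> i * k (\<nu> i))"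
    by blast
  \<comment> \<open>the amplitude that gives the mixture the norm \<open>m * rt n\<close> up to the cross term\<close>
  define b where "b i = sqrt (4 * m\<^sup>2 * (rt (\<nu> i))\<^sup>2 - (l2norm (h i))\<^sup>2)" for i
  define g where "g i = (\<lambda>x. 1 / 2 * h i x + b i / 2 * \<phi> (J i) x)" for i
  have hsq: "(l2norm (h i))\<^sup>2 \<le> 4 * m\<^sup>2 * (rt (\<nu> i))\<^sup>2" for i
  proof -
    have "l2norm (h i) \<le> 2 * m * rt (\<nu> i)"
      using h_bd[of i] mult_right_mono[OF m(3), of "rt (\<nu> i)"] by simp
    then have "(l2norm (h i))\<^sup>2 \<le> (2 * m * rt (\<nu> i))\<^sup>2" by (intro power_mono) auto
    then show ?thesis by (simp add: power_mult_distrib)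
  qed
  have b: "(b i)\<^sup>2 = 4 * m\<^sup>2 * (rt (\<nu> i))\<^sup>2 - (l2norm (h i))\<^sup>2" "0 \<le> b i" for i
    using hsq[of i] by (simp_all add: b_def)
  have b_le: "b i \<le> 2 * C * rt (\<nu> i)" for i
  proof (rule power2_le_imp_le)
    have "(b i)\<^sup>2 \<le> 4 * m\<^sup>2 * (rt (\<nu> i))\<^sup>2" unfolding b(1) by simp
    also have "\<dots> \<le> 4 * C\<^sup>2 * (rt (\<nu> i))\<^sup>2" using mc by (intro mult_right_mono) auto
    finally show "(b i)\<^sup>2 \<le> (2 * C * rt (\<nu> i))\<^sup>2" by (simp add: power_mult_distrib)
  qed (use C_pos in simp)
  have coefh: "l2inner (h i) (\<phi> (J i)) = \<theta> (\<nu> i) (J i)" for i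
    unfolding h_def using rest_coeff[OF n1[of i], of "J i" "\<beta> i"] J by auto
  have cross: "\<bar>b i * \<theta> (\<nu> i) (J i)\<bar> \<le> 2 * (C * \<tau>) * (rt (\<nu> i))\<^sup>2" for i
  proof -
    have "b i * \<bar>\<theta> (\<nu> i) (J i)\<bar> \<le> (2 * C * rt (\<nu> i)) * (\<tau> * rt (\<nu> i))"
      using b_le[of i] b(2)[of i] J by (intro mult_mono) (auto intro: order_trans)
    also have "\<dots> = 2 * (C * \<tau>) * (rt (\<nu> i))\<^sup>2" by (simp add: power2_eq_square)
    finally show ?thesis using b(2)[of i] by (simp add: abs_mult)
  qed
  have gL: "g i \<in> L2" for i unfolding g_def by (intro L2_add L2_scale hL L2_phi)
  have alt_g: "alternative (g i)" for i
    unfolding alternative_iff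
  proof (intro conjI gL)
    have "0 \<le> 1 + g i x" if "0 \<le> 1 + h i x" for x
    proof -
      have "\<bar>b i * \<phi> (J i) x\<bar> \<le> (2 * C * rt (\<nu> i)) * sqrt 2"
        unfolding abs_mult using b(2)[of i] b_le[of i] abs_phi_le C_pos by (intro mult_mono) auto
      also have "\<dots> \<le> 1" using amp[of "\<nu> i"] \<nu>(2) by (simp add: less_imp_le mult_ac)
      finally show ?thesis using that unfolding g_def by linarith
    qed
    then show "AE x in U01. 0 \<le> 1 + g i x"
      using alt_h[of i] unfolding alternative_iff by (auto elim: eventually_mono)
    have "(LINT x|U01. g i x) = 1 / 2 * (LINT x|U01. h i x) + b i / 2 * (LINT x|U01. \<phi> (J i) x)"
      unfolding g_def using L2_integrable[OF hL[of i]] L2_integrable[OF L2_phi[of "J i"]] by simp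
    then show "(LINT x|U01. g i x) = 0" using alternative_mean[OF alt_h[of i]] J by simp
  qed
  have g_norm: "(l2norm (g i))\<^sup>2 = m\<^sup>2 * (rt (\<nu> i))\<^sup>2 + b i * \<theta> (\<nu> i) (J i) / 2" for i
  proof -
    have p1: "(l2norm (\<phi> (J i)))\<^sup>2 = 1" using J by (simp add: l2norm_square l2inner_trig)
    have "(l2norm (g i))\<^sup>2 = (l2norm (\<lambda>x. 1 / 2 * h i x))\<^sup>2 + 2 * l2inner (\<lambda>x. 1 / 2 * h i x) (\<lambda>x. b i / 2 * \<phi> (J i) x) + (l2norm (\<lambda>x. b i / 2 * \<phi> (J i) x))\<^sup>2"
      unfolding g_def by (intro l2norm_add_square L2_scale hL L2_phi)
    also have "\<dots> = (l2norm (h i))\<^sup>2 / 4 + b i * \<theta> (\<nu> i) (J i) / 2 + (b i)\<^sup>2 / 4"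
      unfolding l2norm_scale l2inner_scale_left l2inner_scale_right coefh power_mult_distrib p1
      by (simp add: power_divide)
    finally show ?thesis unfolding b(1) by (simp add: diff_divide_distrib)
  qed
  have g_bounds: "c * rt (\<nu> i) < l2norm (g i)" "l2norm (g i) < C * rt (\<nu> i)" for i
  proof -
    have r2: "(rt (\<nu> i))\<^sup>2 > 0" using rt_pos[OF n1[of i]] by simp
    have x: "\<bar>b i * \<theta> (\<nu> i) (J i) / 2\<bar> \<le> C * \<tau> * (rt (\<nu> i))\<^sup>2" using cross[of i] by simp
    have half: "C * \<tau> * (rt (\<nu> i))\<^sup>2 < (m\<^sup>2 - c\<^sup>2) * (rt (\<nu> i))\<^sup>2" "C * \<tau> * (rt (\<nu> i))\<^sup>2 < (C\<^sup>2 - m\<^sup>2) * (rt (\<nu> i))\<^sup>2"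
    proof -
      have "C * \<tau> > 0" using C_pos \<tau> by simp
      then have "C * \<tau> < m\<^sup>2 - c\<^sup>2" "C * \<tau> < C\<^sup>2 - m\<^sup>2" using \<tau>_le by linarith+
      then show "C * \<tau> * (rt (\<nu> i))\<^sup>2 < (m\<^sup>2 - c\<^sup>2) * (rt (\<nu> i))\<^sup>2" "C * \<tau> * (rt (\<nu> i))\<^sup>2 < (C\<^sup>2 - m\<^sup>2) * (rt (\<nu> i))\<^sup>2"
        using r2 by (auto intro!: mult_strict_right_mono)
    qed
    have "(c * rt (\<nu> i))\<^sup>2 < (l2norm (g i))\<^sup>2" "(l2norm (g i))\<^sup>2 < (C * rt (\<nu> i))\<^sup>2"
      unfolding g_norm power_mult_distrib using x half by (simp_all add: left_diff_distrib abs_le_iff)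
    then show "c * rt (\<nu> i) < l2norm (g i)" "l2norm (g i) < C * rt (\<nu> i)"
      using C_pos by (auto intro: power2_less_imp_less)
  qed
  interpret v: vanishing_alternatives \<nu> g
    by (rule heavy_tail_vanishing[OF top n1 alt_g less_imp_le[OF g_bounds(2)]])
  have dr: "(\<lambda>i. drift (\<nu> i) (g i)) \<longlonglongrightarrow> 0"
  proof (rule Lim_null_comparison)
    show "\<forall>\<^sub>F i in sequentially. norm (drift (\<nu> i) (g i)) \<le> drift (\<nu> i) (h i) + 2 * C\<^sup>2 * (rt (\<nu> i))\<^sup>2"
    proof (intro always_eventually allI)
      fix i
      have Jp: "real (J i) > 0" "real (\<nu> i) \<le> (real (J i))\<^sup>2"
      proof -
        have "1 \<le> real (J i)" "real (\<nu> i) \<le> real (J i)" using J by auto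
        then show "real (J i) > 0" "real (\<nu> i) \<le> (real (J i))\<^sup>2"
          using mult_mono[of 1 "real (J i)" "real (\<nu> i)" "real (J i)"] by (auto simp: power2_eq_square)
      qed
      have "(b i / 2)\<^sup>2 \<le> C\<^sup>2 * (rt (\<nu> i))\<^sup>2"
        using power_mono[OF b_le b(2), of i 2] by (simp add: power_divide power_mult_distrib)
      then have "2 * (b i / 2)\<^sup>2 * (real (\<nu> i) / (real (J i))\<^sup>2) \<le> 2 * (C\<^sup>2 * (rt (\<nu> i))\<^sup>2) * 1"
        using Jp by (intro mult_mono) auto
      moreover have "drift (\<nu> i) (g i) \<le> drift (\<nu> i) (h i) + 2 * (b i / 2)\<^sup>2 * real (\<nu> i) / (real (J i))\<^sup>2"
        unfolding g_def using J by (intro drift_mixture_le hL n1) auto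
      ultimately show "norm (drift (\<nu> i) (g i)) \<le> drift (\<nu> i) (h i) + 2 * C\<^sup>2 * (rt (\<nu> i))\<^sup>2" by simp
    qed
    have "(\<lambda>i. drift (\<nu> i) (h i)) \<longlonglongrightarrow> 0"
      unfolding h_def by (rule heavy_tail_drift) (use \<beta> n1 in auto)
    moreover have "(\<lambda>i. 2 * C\<^sup>2 * (rt (\<nu> i))\<^sup>2) \<longlonglongrightarrow> 2 * C\<^sup>2 * 0\<^sup>2"
      by (intro tendsto_intros filterlim_compose[OF rt_tendsto top])
    ultimately have "(\<lambda>i. drift (\<nu> i) (h i) + 2 * C\<^sup>2 * (rt (\<nu> i))\<^sup>2) \<longlonglongrightarrow> 0 + 2 * C\<^sup>2 * 0\<^sup>2"
      by (rule tendsto_add)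
    then show "(\<lambda>i. drift (\<nu> i) (h i) + 2 * C\<^sup>2 * (rt (\<nu> i))\<^sup>2) \<longlonglongrightarrow> 0" by simp
  qed
  have lim: "(\<lambda>i. ((l2norm (\<lambda>x. f (\<nu> i) x + g i x))\<^sup>2 - (l2norm (f (\<nu> i)))\<^sup>2 - (l2norm (g i))\<^sup>2) / (rt (\<nu> i))\<^sup>2) \<longlonglongrightarrow> 0"
    using assms(1)[unfolded insensitive_def, rule_format, of \<nu> g] sizes alt_g g_bounds v.inconsistent_of_drift[OF dr] by blast
  have big: "((l2norm (\<lambda>x. f (\<nu> i) x + g i x))\<^sup>2 - (l2norm (f (\<nu> i)))\<^sup>2 - (l2norm (g i))\<^sup>2) / (rt (\<nu> i))\<^sup>2 \<ge> e / 2" for i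
  proof -
    have r2: "(rt (\<nu> i))\<^sup>2 > 0" using rt_pos[OF n1[of i]] by simp
    have fh: "l2inner (f (\<nu> i)) (h i) = (l2norm (h i))\<^sup>2"
    proof -
      have "l2inner (f (\<nu> i)) (h i) - l2inner (trunc (\<beta> i) (\<nu> i)) (h i) = l2inner (h i) (h i)"
        using l2inner_diff_left[OF L2_f[OF n1[of i]] L2_trunc hL[of i], of "\<beta> i" "\<nu> i"] by (simp add: h_def rest_def)
      then show ?thesis using trunc_orthogonal[OF n1[of i], of "\<beta> i"] by (simp add: h_def rest_def l2norm_square)
    qed
    have "2 * l2inner (f (\<nu> i)) (g i) = 2 * (1 / 2 * l2inner (f (\<nu> i)) (h i) + b i / 2 * l2inner (f (\<nu> i)) (\<phi> (J i)))"
      unfolding g_def l2inner_add_right[OF L2_scale[OF hL] L2_scale[OF L2_phi] L2_f[OF n1]] l2inner_scale_right ..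
    also have "\<dots> = (l2norm (h i))\<^sup>2 + b i * \<theta> (\<nu> i) (J i)"
      unfolding fh using cos_expansion_coeff[OF expansion[OF n1[of i]], of "J i"] J by simp
    also have "\<dots> \<ge> e * (rt (\<nu> i))\<^sup>2 - 2 * (C * \<tau>) * (rt (\<nu> i))\<^sup>2"
      using heavy[rule_format, of i] cross[of i] unfolding h_def abs_le_iff by linarith
    finally have "2 * l2inner (f (\<nu> i)) (g i) \<ge> e * (rt (\<nu> i))\<^sup>2 - 2 * (C * \<tau>) * (rt (\<nu> i))\<^sup>2" .
    moreover have "2 * (C * \<tau>) * (rt (\<nu> i))\<^sup>2 \<le> e / 2 * (rt (\<nu> i))\<^sup>2"
      using \<tau>_le(1) r2 by (intro mult_right_mono) auto
    ultimately have "e / 2 * (rt (\<nu> i))\<^sup>2 \<le> 2 * l2inner (f (\<nu> i)) (g i)" by simp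
    then show ?thesis
      unfolding l2norm_add_square[OF L2_f[OF n1[of i]] gL[of i]] using r2 by (simp add: pos_le_divide_eq)
  qed
  have "\<forall>\<^sub>F i in sequentially. ((l2norm (\<lambda>x. f (\<nu> i) x + g i x))\<^sup>2 - (l2norm (f (\<nu> i)))\<^sup>2 - (l2norm (g i))\<^sup>2) / (rt (\<nu> i))\<^sup>2 < e / 2"
    using order_tendstoD(2)[OF lim, of "e / 2"] e by simp
  then obtain i where "((l2norm (\<lambda>x. f (\<nu> i) x + g i x))\<^sup>2 - (l2norm (f (\<nu> i)))\<^sup>2 - (l2norm (g i))\<^sup>2) / (rt (\<nu> i))\<^sup>2 < e / 2"
    using eventually_happens[of _ sequentially] by auto
  with big[of i] show False by linarith
qed

lemma smallo_rate_iff: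
  assumes "\<forall>\<^sub>F i in sequentially. \<nu> i \<ge> 1"
  shows "F \<in> o(\<lambda>i. real (\<nu> i) powr (- 2 * r)) \<longleftrightarrow> (\<lambda>i. F i / (rt (\<nu> i))\<^sup>2) \<longlonglongrightarrow> 0"
  unfolding rt_square
proof
  assume "F \<in> o(\<lambda>i. real (\<nu> i) powr (- 2 * r))"
  then show "(\<lambda>i. F i / real (\<nu> i) powr (- 2 * r)) \<longlonglongrightarrow> 0" by (rule smalloD_tendsto)
next
  assume "(\<lambda>i. F i / real (\<nu> i) powr (- 2 * r)) \<longlonglongrightarrow> 0"
  then show "F \<in> o(\<lambda>i. real (\<nu> i) powr (- 2 * r))"
    by (rule smalloI_tendsto) (use assms in eventually_elim, simp)
qed

end

section \<open>Consistency of the Cramer--von Mises tests\<close>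

theorem theorem7p3:
  fixes r s c C :: real
    and \<theta> :: "nat \<Rightarrow> nat \<Rightarrow> real"
    and f :: "nat \<Rightarrow> real \<Rightarrow> real"
  assumes r: "0 < r" "r < 1/2"
    and s: "s = 2 * r / (1 - 2 * r)"
    and cC: "0 < c" "c < C"
    and expansion: "\<And>n. n \<ge> 1 \<Longrightarrow> cos_expansion (\<theta> n) (f n)"
    and alt: "\<And>n. n \<ge> 1 \<Longrightarrow> alternative (f n)"
    and norm_f: "\<And>n. n \<ge> 1 \<Longrightarrow> c * real n powr (-r) \<le> l2norm (f n) \<and>
                                l2norm (f n) \<le> C * real n powr (-r)"
    and G1: "condition_G1 r \<theta>"
  shows
    \<comment> \<open>(a)\<close>
    "(cvm_consistent (\<lambda>n. n) f \<longleftrightarrow>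
       (\<exists>c1>0. \<exists>c2>0. \<exists>n0. \<forall>n>n0.
          (\<Sum>j | 1 \<le> j \<and> real j < c2 * real (kn r n). (\<theta> n j)\<^sup>2) > c1 * real n powr (-2 * r)))
     \<and>
    \<comment> \<open>(b)\<close>
     (cvm_inconsistent (\<lambda>n. n) f \<longleftrightarrow>
       (\<forall>c2>0. (\<lambda>n. \<Sum>j | 1 \<le> j \<and> real j < c2 * real (kn r n). (\<theta> n j)\<^sup>2)
                 \<in> o(\<lambda>n. real n powr (-2 * r))))
     \<and>
    \<comment> \<open>(c)\<close>
     (cvm_consistent (\<lambda>n. n) f \<longleftrightarrow>
       (\<exists>P0>0. \<exists>c1 C1 f1. 0 < c1 \<and> c1 < C1 \<and>
          (\<forall>n\<ge>1. f1 n \<in> besov_ball s P0 \<and>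
             c1 * real n powr (-r) \<le> l2norm (f1 n) \<and> l2norm (f1 n) \<le> C1 * real n powr (-r) \<and>
             (l2norm (f n))\<^sup>2 = (l2norm (f1 n))\<^sup>2 + (l2norm (\<lambda>x. f n x - f1 n x))\<^sup>2)))
     \<and>
     (\<forall>P0>0. \<forall>c1 C1 f1 f2. 0 < c1 \<and> c1 < C1 \<and>
        (\<forall>n\<ge>1. l2eq (f n) (\<lambda>x. f1 n x + f2 n x) \<and>
           f1 n \<in> besov_ball s P0 \<and> f2 n \<in> L2 \<and> l2inner (f2 n) (f1 n) = 0 \<and>
           c1 * real n powr (-r) \<le> l2norm (f1 n) \<and> l2norm (f1 n) \<le> C1 * real n powr (-r) \<and>
           c1 * real n powr (-r) \<le> l2norm (f2 n) \<and> l2norm (f2 n) \<le> C1 * real n powr (-r))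
        \<longrightarrow> cvm_consistent (\<lambda>n. n) f)
     \<and>
    \<comment> \<open>(d)\<close>
     (cvm_consistent (\<lambda>n. n) f \<and> condition_B r \<theta> \<longrightarrow>
       (\<forall>\<epsilon>>0. \<exists>P0>0. \<exists>c1 C1 f1. 0 < c1 \<and> c1 < C1 \<and>
          (\<forall>n\<ge>1. f1 n \<in> besov_ball s P0 \<and>
             c1 * real n powr (-r) \<le> l2norm (f1 n) \<and> l2norm (f1 n) \<le> C1 * real n powr (-r) \<and>
             l2inner (f1 n) (\<lambda>x. f n x - f1 n x) = 0 \<and>
             alternative (f1 n) \<and> alternative (\<lambda>x. f n x - f1 n x)) \<and>
          (\<forall>\<alpha>\<in>{0<..<1}. \<forall>t::nat \<Rightarrow> real.
             (\<lambda>n. type_I n (cvm_test n (t n))) \<longlonglongrightarrow> \<alpha> \<longrightarrow>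
             (\<exists>n\<^sub>\<epsilon>. \<forall>n>n\<^sub>\<epsilon>.
                \<bar>type_II n (cvm_test n (t n)) (f n) - type_II n (cvm_test n (t n)) (f1 n)\<bar> \<le> \<epsilon> \<and>
                type_II n (cvm_test n (t n)) (\<lambda>x. f n x - f1 n x) \<ge> 1 - \<alpha> - \<epsilon>))))
     \<and>
    \<comment> \<open>(e)\<close>
     (condition_B r \<theta> \<longrightarrow>
       (purely_consistent r \<theta> f \<longleftrightarrow>
         (\<forall>\<epsilon>>0. \<exists>C1 n0. \<forall>n>n0.
            (\<Sum>\<^sub>\<infinity>j\<in>{j. 1 \<le> j \<and> real j > C1 * real (kn r n)}. (\<theta> n j)\<^sup>2)
              \<le> \<epsilon> * real n powr (-2 * r))))
     \<and>
    \<comment> \<open>(f)\<close>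
     (condition_B r \<theta> \<longrightarrow>
       (purely_consistent r \<theta> f \<longleftrightarrow>
         (\<forall>\<nu> f1. sample_sizes \<nu> \<and>
            (\<forall>i. alternative (f1 i) \<and>
               c * real (\<nu> i) powr (-r) < l2norm (f1 i) \<and>
               l2norm (f1 i) < C * real (\<nu> i) powr (-r)) \<and>
            cvm_inconsistent \<nu> f1 \<longrightarrow>
            (\<lambda>i. (l2norm (\<lambda>x. f (\<nu> i) x + f1 i x))\<^sup>2
                  - (l2norm (f (\<nu> i)))\<^sup>2 - (l2norm (f1 i))\<^sup>2)
              \<in> o(\<lambda>i. real (\<nu> i) powr (-2 * r)))))"
proof -
  interpret cvm_alternatives r s c C \<theta> f
    by unfold_locales (use assms in auto)
  have A: "detectable \<longleftrightarrow> (\<exists>c1>0. \<exists>c2>0. \<exists>n0. \<forall>n>n0.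
          (\<Sum>j | 1 \<le> j \<and> real j < c2 * real (kn r n). (\<theta> n j)\<^sup>2) > c1 * real n powr (-2 * r))"
    unfolding detectable_def low_def rt_square ..
  have part_a: "cvm_consistent (\<lambda>n. n) f \<longleftrightarrow> (\<exists>c1>0. \<exists>c2>0. \<exists>n0. \<forall>n>n0.
          (\<Sum>j | 1 \<le> j \<and> real j < c2 * real (kn r n). (\<theta> n j)\<^sup>2) > c1 * real n powr (-2 * r))"
    unfolding consistent_iff_detectable A ..
  have part_b: "cvm_inconsistent (\<lambda>n. n) f \<longleftrightarrow>
       (\<forall>c2>0. (\<lambda>n. \<Sum>j | 1 \<le> j \<and> real j < c2 * real (kn r n). (\<theta> n j)\<^sup>2) \<in> o(\<lambda>n. real n powr (-2 * r)))"
    unfolding inconsistent_iff_low smallo_rate_iff[OF eventually_ge_at_top] low_def ..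
  have part_c1: "(\<exists>P0>0. \<exists>c1 C1 f1. 0 < c1 \<and> c1 < C1 \<and>
          (\<forall>n\<ge>1. f1 n \<in> besov_ball s P0 \<and>
             c1 * real n powr (-r) \<le> l2norm (f1 n) \<and> l2norm (f1 n) \<le> C1 * real n powr (-r) \<and>
             (l2norm (f n))\<^sup>2 = (l2norm (f1 n))\<^sup>2 + (l2norm (\<lambda>x. f n x - f1 n x))\<^sup>2)) \<Longrightarrow> detectable"
  proof (elim exE conjE)
    fix P0 c1 C1 f1
    assume P0: "P0 > 0" "0 < c1" "c1 < C1" and *: "\<forall>n\<ge>1. f1 n \<in> besov_ball s P0 \<and>
             c1 * real n powr (-r) \<le> l2norm (f1 n) \<and> l2norm (f1 n) \<le> C1 * real n powr (-r) \<and>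
             (l2norm (f n))\<^sup>2 = (l2norm (f1 n))\<^sup>2 + (l2norm (\<lambda>x. f n x - f1 n x))\<^sup>2"
    show detectable
    proof (rule besov_part_detectable[OF P0, of f1])
      fix n :: nat assume n: "n \<ge> 1"
      then have L: "f1 n \<in> L2" using * unfolding besov_ball_def by (blast intro: cos_expansion_L2)
      have "l2inner (f n) (f1 n) = (l2norm (f1 n))\<^sup>2"
        using l2norm_diff_square[OF L2_f[OF n] L] *[rule_format, OF n] by simp
      then show "f1 n \<in> besov_ball s P0 \<and> c1 * rt n \<le> l2norm (f1 n) \<and> l2norm (f1 n) \<le> C1 * rt n
        \<and> l2inner (f n) (f1 n) = (l2norm (f1 n))\<^sup>2" using *[rule_format, OF n] by blast
    qed
  qed
  have part_c: "cvm_consistent (\<lambda>n. n) f \<longleftrightarrow>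
       (\<exists>P0>0. \<exists>c1 C1 f1. 0 < c1 \<and> c1 < C1 \<and>
          (\<forall>n\<ge>1. f1 n \<in> besov_ball s P0 \<and>
             c1 * real n powr (-r) \<le> l2norm (f1 n) \<and> l2norm (f1 n) \<le> C1 * real n powr (-r) \<and>
             (l2norm (f n))\<^sup>2 = (l2norm (f1 n))\<^sup>2 + (l2norm (\<lambda>x. f n x - f1 n x))\<^sup>2))"
    unfolding consistent_iff_detectable using part_c1 detectable_imp_besov_part by blast
  have part_c': "\<forall>P0>0. \<forall>c1 C1 f1 f2. 0 < c1 \<and> c1 < C1 \<and>
        (\<forall>n\<ge>1. l2eq (f n) (\<lambda>x. f1 n x + f2 n x) \<and>
           f1 n \<in> besov_ball s P0 \<and> f2 n \<in> L2 \<and> l2inner (f2 n) (f1 n) = 0 \<and>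
           c1 * real n powr (-r) \<le> l2norm (f1 n) \<and> l2norm (f1 n) \<le> C1 * real n powr (-r) \<and>
           c1 * real n powr (-r) \<le> l2norm (f2 n) \<and> l2norm (f2 n) \<le> C1 * real n powr (-r))
        \<longrightarrow> cvm_consistent (\<lambda>n. n) f"
  proof (intro allI impI, elim conjE)
    fix P0 c1 C1 :: real and f1 f2
    assume P0: "P0 > 0" "0 < c1" "c1 < C1" and *: "\<forall>n\<ge>1. l2eq (f n) (\<lambda>x. f1 n x + f2 n x) \<and>
           f1 n \<in> besov_ball s P0 \<and> f2 n \<in> L2 \<and> l2inner (f2 n) (f1 n) = 0 \<and>
           c1 * real n powr (-r) \<le> l2norm (f1 n) \<and> l2norm (f1 n) \<le> C1 * real n powr (-r) \<and>
           c1 * real n powr (-r) \<le> l2norm (f2 n) \<and> l2norm (f2 n) \<le> C1 * real n powr (-r)"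
    have detectable
    proof (rule besov_part_detectable[OF P0, of f1])
      fix n :: nat assume n: "n \<ge> 1"
      note * = *[rule_format, OF n]
      have L: "f1 n \<in> L2" "f2 n \<in> L2" using * unfolding besov_ball_def by (blast intro: cos_expansion_L2)+
      have "l2inner (f n) (f1 n) = l2inner (\<lambda>x. f1 n x + f2 n x) (f1 n)"
        using * L2_measurable[OF L2_f[OF n]] L2_measurable[OF L(1)] L2_measurable[OF L2_add[OF L]]
        by (intro l2inner_cong_AE) (auto simp: l2eq_iff)
      also have "\<dots> = (l2norm (f1 n))\<^sup>2" using * by (simp add: l2inner_add_left L l2norm_square)
      finally show "f1 n \<in> besov_ball s P0 \<and> c1 * rt n \<le> l2norm (f1 n) \<and> l2norm (f1 n) \<le> C1 * rt n
        \<and> l2inner (f n) (f1 n) = (l2norm (f1 n))\<^sup>2" using * by blast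
    qed
    then show "cvm_consistent (\<lambda>n. n) f" unfolding consistent_iff_detectable .
  qed
  have tail: "tight \<longleftrightarrow> (\<forall>\<epsilon>>0. \<exists>C1 n0. \<forall>n>n0.
            (\<Sum>\<^sub>\<infinity>j\<in>{j. 1 \<le> j \<and> real j > C1 * real (kn r n)}. (\<theta> n j)\<^sup>2) \<le> \<epsilon> * real n powr (-2 * r))"
    unfolding tight_iff_tail rt_square ..
  have pure: "purely_consistent r \<theta> f \<longleftrightarrow> tight" if B: "condition_B r \<theta>"
  proof
    assume "purely_consistent r \<theta> f"
    then have pure unfolding purely_consistent_def pure_def by blast
    then show tight using B by (rule pure_imp_tight)
  next
    assume t: tight
    have "cvm_consistent (\<lambda>n. n) f" unfolding consistent_iff_detectable by (rule tight_imp_detectable[OF t])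
    then show "purely_consistent r \<theta> f"
      using tight_imp_pure[OF t] B cC norm_f unfolding purely_consistent_def pure_def by blast
  qed
  have ins: "insensitive \<longleftrightarrow> (\<forall>\<nu> f1. sample_sizes \<nu> \<and>
            (\<forall>i. alternative (f1 i) \<and>
               c * real (\<nu> i) powr (-r) < l2norm (f1 i) \<and>
               l2norm (f1 i) < C * real (\<nu> i) powr (-r)) \<and>
            cvm_inconsistent \<nu> f1 \<longrightarrow>
            (\<lambda>i. (l2norm (\<lambda>x. f (\<nu> i) x + f1 i x))\<^sup>2
                  - (l2norm (f (\<nu> i)))\<^sup>2 - (l2norm (f1 i))\<^sup>2)
              \<in> o(\<lambda>i. real (\<nu> i) powr (-2 * r)))"
  proof -
    have key: "(F \<in> o(\<lambda>i. real (\<nu> i) powr (-2 * r))) = ((\<lambda>i. F i / (rt (\<nu> i))\<^sup>2) \<longlonglongrightarrow> 0)" if "sample_sizes \<nu>" for F \<nu>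
      using that by (intro smallo_rate_iff always_eventually) (simp add: sample_sizes_def)
    show ?thesis
      unfolding insensitive_def
      by (intro all_cong1 imp_cong refl key[symmetric]) (elim conjE, assumption)
  qed
  have part_d: "cvm_consistent (\<lambda>n. n) f \<and> condition_B r \<theta> \<longrightarrow>
       (\<forall>\<epsilon>>0. \<exists>P0>0. \<exists>c1 C1 f1. 0 < c1 \<and> c1 < C1 \<and>
          (\<forall>n\<ge>1. f1 n \<in> besov_ball s P0 \<and>
             c1 * real n powr (-r) \<le> l2norm (f1 n) \<and> l2norm (f1 n) \<le> C1 * real n powr (-r) \<and>
             l2inner (f1 n) (\<lambda>x. f n x - f1 n x) = 0 \<and>
             alternative (f1 n) \<and> alternative (\<lambda>x. f n x - f1 n x)) \<and>
          (\<forall>\<alpha>\<in>{0<..<1}. \<forall>t::nat \<Rightarrow> real.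
             (\<lambda>n. type_I n (cvm_test n (t n))) \<longlonglongrightarrow> \<alpha> \<longrightarrow>
             (\<exists>n\<^sub>\<epsilon>. \<forall>n>n\<^sub>\<epsilon>.
                \<bar>type_II n (cvm_test n (t n)) (f n) - type_II n (cvm_test n (t n)) (f1 n)\<bar> \<le> \<epsilon> \<and>
                type_II n (cvm_test n (t n)) (\<lambda>x. f n x - f1 n x) \<ge> 1 - \<alpha> - \<epsilon>)))"
    unfolding consistent_iff_detectable using consistent_approximation by blast
  have part_f: "purely_consistent r \<theta> f \<longleftrightarrow> insensitive" if B: "condition_B r \<theta>"
    using pure[OF B] tight_imp_insensitive insensitive_imp_tight[OF _ B] by blast
  show ?thesis
    by (intro conjI part_a part_b part_c part_c' part_d impI)
      (rule trans[OF pure tail], assumption, rule trans[OF part_f ins], assumption)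
qed

end
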